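(* Let $\mathcal{H}$ be an invariant multiplicity-one subspace of $L^2(N)$ with reducing isomorphism $V:\mathcal{H}\to L^2(\Lambda\times\mathbb{R})$ and associated multiplier $\chi$, and let $\alpha,\beta>0$. Suppose that $I\subseteq\Lambda$ satisfies $I\subset[-1/\alpha\beta,1/\alpha\beta]$, and that $I$ is both translation congruent with a subset of the unit interval $[0,1]$ and dilation congruent with the Shannon set $[-1,-1/2)\cup[1/2,1)$. Set $g=\beta^{1/2}\mathbf{1}_{I\times[0,\alpha]}$ and put $\psi=V^{-1}g$. Then the systems $$\mathcal U(\psi,\alpha,\beta)=\{D_jT_{(k,l,m)}\psi: j\in\mathbb{Z},k\in\alpha\mathbb{Z},l\in\beta\mathbb{Z},m\in\mathbb{Z}\}$$ and $$\widehat{\mathcal U}(g,\alpha,\beta,\chi)=\{\hat D^\chi_j\hat T_{k,l,m}g: j\in\mathbb{Z},k\in\alpha\mathbb{Z},l\in\beta\mathbb{Z},m\in\mathbb{Z}\}$$ are Parseval frames for $\mathcal{H}$ and $L^2(\Lambda\times\mathbb{R})$, respectively.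
   Context: All sets and functions are Lebesgue measurable, and sets whose symmetric difference is Lebesgue null are identified. A system $\{\psi_j\}$ in a separable Hilbert space $\mathcal{K}$ is a Parseval frame for $\mathcal{K}$ if $\|f\|^2=\sum_j|\langle f,\psi_j\rangle|^2$ for all $f\in\mathcal{K}$. Subsets $I,J$ of $\mathbb{R}$ are translation congruent if there is a bijection $\tau:I\to J$ and an integer-valued function $k$ on $I$ with $\tau(\lambda)=\lambda+k(\lambda)$; they are dilation congruent if there is a bijection $\delta:I\to J$ and an integer-valued function $j$ on $I$ with $\delta(\lambda)=2^{j(\lambda)}\lambda$. Heisenberg group: $N=\mathbb{R}^3$ with $(x_1,x_2,x_3)(y_1,y_2,y_3)=(x_1+y_1,x_2+y_2,x_3+y_3+x_1y_2)$, Haar measure = Lebesgue measure, and dilations $a\cdot x=(a^{1/2}x_1,a^{1/2}x_2,ax_3)$, $a>0$. On $L^2(N)$: $T_x\phi=\phi(x^{-1}\,\cdot)$, $D_a\phi=a^{-1}\phi(a^{-1}\cdot)$, $D_j:=D_{2^j}$ for $j\in\mathbb{Z}$. $\Lambda=\mathbb{R}\setminus\{0\}$. For $\lambda\in\Lambda$, $\pi_\lambda(x)f(t)=e^{2\pi i\lambda x_3}e^{-2\pi i\lambda x_2t}f(t-x_1)$ on $L^2(\mathbb{R})$. The Fourier transform $\hat\phi(\lambda)=\int_N\phi(x)\pi_\lambda(x)\,dx$ extends to a unitary isomorphism from $L^2(N)$ onto the space of Hilbert–Schmidt operator fields $L^2(\Lambda,\mathcal{HS}(L^2(\mathbb{R})),|\lambda|d\lambda)$.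 A closed subspace $\mathcal{H}\subseteq L^2(N)$ is translation invariant if $T_x\mathcal{H}\subseteq\mathcal{H}$ for all $x\in N$; then there is an a.e. unique measurable field of orthogonal projections $\hat P_\lambda$ on $L^2(\mathbb{R})$ such that the projection $P$ onto $\mathcal{H}$ satisfies $\widehat{P\phi}(\lambda)=\hat\phi(\lambda)\hat P_\lambda$. It is multiplicity-one if $\operatorname{rank}\hat P_\lambda=1$ for a.e. $\lambda$, and an invariant multiplicity-one subspace if in addition $D_a\mathcal{H}\subseteq\mathcal{H}$ for all $a>0$. In that case choose a measurable field of unit vectors $e=\{e_\lambda\}_{\lambda\in\Lambda}$ with $\hat P_\lambda L^2(\mathbb{R})=\mathbb{C}e_\lambda$ a.e.; the associated reducing isomorphism $V:\mathcal{H}\to L^2(\Lambda\times\mathbb{R})$ is $(V\eta)(\lambda,\cdot)=\hat\eta(\lambda)(e_\lambda)$, a unitary map, where $L^2(\Lambda\times\mathbb{R})$ carries the measure $|\lambda|\,d\lambda\,dt$. Its associated multiplier is the family $\chi=\{\chi_a\}_{a>0}$ of measurable unimodular functions on $\Lambda$ with $C_ae_\lambda=\chi_a(\lambda)e_{a\lambda}$ for a.e. $\lambda$, where $C_af(t)=a^{1/4}f(a^{1/2}t)$. On $L^2(\Lambda\times\mathbb{R})$: $\hat T_{k,l,m}f(\lambda,t)=e^{2\pi i\lambda m}e^{-2\pi i\lambda lt}f(\lambda,t-k)$, $\hat D^\chi_af(\lambda,t)=\chi_a(\lambda)\,a^{3/4}f(a\lambda,a^{-1/2}t)$, and $\hat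 D^\chi_j:=\hat D^\chi_{2^j}$ for $j\in\mathbb{Z}$. *)

theory Defs
  imports "HOL-Analysis.Analysis"
begin

section \<open>Square-integrable functions\<close>

text \<open>Elements of \<open>L\<^sup>2(M)\<close> are represented by functions; equality in \<open>L\<^sup>2(M)\<close> is equality almost
  everywhere, and subsets of \<open>L\<^sup>2(M)\<close> are represented by sets of functions that are closed under
  almost everywhere equality.\<close>

definition L2 :: "'a measure \<Rightarrow> ('a \<Rightarrow> complex) set" where
  "L2 M = {f \<in> borel_measurable M. integrable M (\<lambda>x. (cmod (f x))\<^sup>2)}"

definition L2_inner :: "'a measure \<Rightarrow> ('a \<Rightarrow> complex) \<Rightarrow> ('a \<Rightarrow> complex) \<Rightarrow> complex" where
  "L2_inner M f g = (\<integral>x. f x * cnj (g x) \<partial>M)"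

definition L2_norm :: "'a measure \<Rightarrow> ('a \<Rightarrow> complex) \<Rightarrow> real" where
  "L2_norm M f = sqrt (\<integral>x. (cmod (f x))\<^sup>2 \<partial>M)"

text \<open>Closure under limits includes closure under almost everywhere equality (take constant
  sequences).\<close>

definition closed_L2_subspace :: "'a measure \<Rightarrow> ('a \<Rightarrow> complex) set \<Rightarrow> bool" where
  "closed_L2_subspace M H \<longleftrightarrow>
     H \<subseteq> L2 M \<and> (\<lambda>_. 0) \<in> H \<and>
     (\<forall>f\<in>H. \<forall>g\<in>H. (\<lambda>x. f x + g x) \<in> H) \<and>
     (\<forall>c. \<forall>f\<in>H. (\<lambda>x. c * f x) \<in> H) \<and>
     (\<forall>F f. (\<forall>n::nat. F n \<in> H) \<and> f \<in> L2 M \<and>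
        (\<lambda>n. L2_norm M (\<lambda>x. F n x - f x)) \<longlonglongrightarrow> 0 \<longrightarrow> f \<in> H)"

definition orthogonal_projection_of ::
  "'a measure \<Rightarrow> ('a \<Rightarrow> complex) set \<Rightarrow> ('a \<Rightarrow> complex) \<Rightarrow> ('a \<Rightarrow> complex) \<Rightarrow> bool" where
  "orthogonal_projection_of M H f p \<longleftrightarrow>
     p \<in> H \<and> (\<forall>h\<in>H. L2_inner M (\<lambda>x. f x - p x) h = 0)"

definition parseval_frame ::
  "'a measure \<Rightarrow> ('a \<Rightarrow> complex) set \<Rightarrow> 'i set \<Rightarrow> ('i \<Rightarrow> 'a \<Rightarrow> complex) \<Rightarrow> bool" where
  "parseval_frame M K S u \<longleftrightarrow>
     (\<forall>i\<in>S. u i \<in> K) \<and>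
     (\<forall>f\<in>K. ((\<lambda>i. (cmod (L2_inner M f (u i)))\<^sup>2) has_sum (L2_norm M f)\<^sup>2) S)"

section \<open>Operators on \<open>L\<^sup>2(\<real>)\<close>\<close>

abbreviation L2R :: "(real \<Rightarrow> complex) set" where
  "L2R \<equiv> L2 lebesgue"

type_synonym L2_op = "(real \<Rightarrow> complex) \<Rightarrow> (real \<Rightarrow> complex)"

text \<open>Linearity and boundedness together imply that the operator respects almost everywhere
  equality on \<open>L\<^sup>2(\<real>)\<close>.\<close>

definition bounded_operator :: "L2_op \<Rightarrow> bool" where
  "bounded_operator A \<longleftrightarrow>
     (\<forall>f\<in>L2R. A f \<in> L2R) \<and>
     (\<forall>f\<in>L2R. \<forall>g\<in>L2R. AE t in lebesgue. A (\<lambda>s. f s + g s) t = A f t + A g t) \<and>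
     (\<forall>c. \<forall>f\<in>L2R. AE t in lebesgue. A (\<lambda>s. c * f s) t = c * A f t) \<and>
     (\<exists>B. \<forall>f\<in>L2R. L2_norm lebesgue (A f) \<le> B * L2_norm lebesgue f)"

definition orthogonal_projection :: "L2_op \<Rightarrow> bool" where
  "orthogonal_projection Q \<longleftrightarrow>
     bounded_operator Q \<and>
     (\<forall>f\<in>L2R. AE t in lebesgue. Q (Q f) t = Q f t) \<and>
     (\<forall>f\<in>L2R. \<forall>g\<in>L2R. L2_inner lebesgue (Q f) g = L2_inner lebesgue f (Q g))"

text \<open>The range of \<open>Q\<close> is the line (or zero space) of all complex multiples of \<open>v\<close>.\<close>

definition range_is_span :: "L2_op \<Rightarrow> (real \<Rightarrow> complex) \<Rightarrow> bool" where
  "range_is_span Q v \<longleftrightarrow>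
     (\<forall>f\<in>L2R. \<exists>c. AE t in lebesgue. Q f t = c * v t) \<and>
     (\<forall>c. \<exists>f\<in>L2R. AE t in lebesgue. Q f t = c * v t)"

definition rank_one :: "L2_op \<Rightarrow> bool" where
  "rank_one Q \<longleftrightarrow> (\<exists>v\<in>L2R. L2_norm lebesgue v \<noteq> 0 \<and> range_is_span Q v)"

definition orthonormal_basis :: "(nat \<Rightarrow> real \<Rightarrow> complex) \<Rightarrow> bool" where
  "orthonormal_basis u \<longleftrightarrow>
     (\<forall>n. u n \<in> L2R) \<and>
     (\<forall>m n. L2_inner lebesgue (u m) (u n) = (if m = n then 1 else 0)) \<and>
     (\<forall>f\<in>L2R. (\<forall>n. L2_inner lebesgue f (u n) = 0) \<longrightarrow> (AE t in lebesgue. f t = 0))"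

text \<open>The squared Hilbert--Schmidt norm.  For a bounded operator the sum does not depend on the
  orthonormal basis, so the supremum is over a single value.\<close>

definition HS_norm_sq :: "L2_op \<Rightarrow> ennreal" where
  "HS_norm_sq A =
     (SUP u \<in> {u. orthonormal_basis u}. \<Sum>n. ennreal ((L2_norm lebesgue (A (u n)))\<^sup>2))"

definition hilbert_schmidt :: "L2_op \<Rightarrow> bool" where
  "hilbert_schmidt A \<longleftrightarrow> bounded_operator A \<and> HS_norm_sq A < \<infinity>"

section \<open>The Heisenberg group\<close>

type_synonym heis = "real \<times> real \<times> real"

fun heis_mult :: "heis \<Rightarrow> heis \<Rightarrow> heis" where
  "heis_mult (x1, x2, x3) (y1, y2, y3) = (x1 + y1, x2 + y2, x3 + y3 + x1 * y2)"

fun heis_inv :: "heis \<Rightarrow> heis" where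
  "heis_inv (x1, x2, x3) = (- x1, - x2, - x3 + x1 * x2)"

lemma heis_inv:
  "heis_mult (heis_inv x) x = (0, 0, 0)" "heis_mult x (heis_inv x) = (0, 0, 0)"
  by (cases x; simp)+

fun heis_dil :: "real \<Rightarrow> heis \<Rightarrow> heis" where
  "heis_dil a (x1, x2, x3) = (a powr (1/2) * x1, a powr (1/2) * x2, a * x3)"

definition transl :: "heis \<Rightarrow> (heis \<Rightarrow> complex) \<Rightarrow> heis \<Rightarrow> complex" where
  "transl x \<phi> = (\<lambda>y. \<phi> (heis_mult (heis_inv x) y))"

definition dilat :: "real \<Rightarrow> (heis \<Rightarrow> complex) \<Rightarrow> heis \<Rightarrow> complex" where
  "dilat a \<phi> = (\<lambda>y. complex_of_real (1 / a) * \<phi> (heis_dil (1 / a) y))"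

section \<open>The Fourier transform\<close>

definition Lam :: "real set" where
  "Lam = UNIV - {0}"

definition plancherel :: "real measure" where
  "plancherel = density (lebesgue_on Lam) (\<lambda>l. ennreal \<bar>l\<bar>)"

fun schroedinger :: "real \<Rightarrow> heis \<Rightarrow> L2_op" where
  "schroedinger l (x1, x2, x3) f =
     (\<lambda>t. cis (2 * pi * l * x3) * cis (- 2 * pi * l * x2 * t) * f (t - x1))"

definition measurable_operator_field :: "(real \<Rightarrow> L2_op) \<Rightarrow> bool" where
  "measurable_operator_field A \<longleftrightarrow>
     (\<forall>f\<in>L2R. \<forall>g\<in>L2R. (\<lambda>l. L2_inner lebesgue (A l f) g) \<in> borel_measurable (lebesgue_on Lam))"

definition L2_HS_field :: "(real \<Rightarrow> L2_op) \<Rightarrow> bool" where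
  "L2_HS_field A \<longleftrightarrow>
     measurable_operator_field A \<and>
     (AE l in plancherel. hilbert_schmidt (A l)) \<and>
     (\<integral>\<^sup>+l. HS_norm_sq (A l) \<partial>plancherel) < \<infinity>"

text \<open>The operator-valued integral of \<open>\<phi>(x) \<pi>\<^sub>\<lambda>(x)\<close> over the group, for integrable \<open>\<phi>\<close>.  For
  \<open>f\<close> in \<open>L\<^sup>2(\<real>)\<close> the scalar integral below converges absolutely for almost every \<open>t\<close>.\<close>

definition fourier_L1 :: "(heis \<Rightarrow> complex) \<Rightarrow> real \<Rightarrow> L2_op" where
  "fourier_L1 \<phi> l f = (\<lambda>t. \<integral>x. \<phi> x * schroedinger l x f t \<partial>lebesgue)"

text \<open>The extension of the Fourier transform by continuity from \<open>L\<^sup>1(N) \<inter> L\<^sup>2(N)\<close> to \<open>L\<^sup>2(N)\<close>: the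
  field \<open>A\<close> (determined up to almost everywhere equality) is the Fourier transform of \<open>\<phi>\<close>.\<close>

definition has_fourier_transform :: "(heis \<Rightarrow> complex) \<Rightarrow> (real \<Rightarrow> L2_op) \<Rightarrow> bool" where
  "has_fourier_transform \<phi> A \<longleftrightarrow>
     \<phi> \<in> L2 lebesgue \<and> L2_HS_field A \<and>
     (\<exists>\<Phi> :: nat \<Rightarrow> heis \<Rightarrow> complex.
        (\<forall>n. \<Phi> n \<in> L2 lebesgue \<and> integrable lebesgue (\<Phi> n)) \<and>
        (\<lambda>n. L2_norm lebesgue (\<lambda>x. \<Phi> n x - \<phi> x)) \<longlonglongrightarrow> 0 \<and>
        (\<lambda>n. \<integral>\<^sup>+l. HS_norm_sq (\<lambda>f t. fourier_L1 (\<Phi> n) l f t - A l f t) \<partial>plancherel) \<longlonglongrightarrow> 0)"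

section \<open>Invariant multiplicity-one subspaces\<close>

definition translation_invariant_subspace :: "(heis \<Rightarrow> complex) set \<Rightarrow> bool" where
  "translation_invariant_subspace H \<longleftrightarrow>
     closed_L2_subspace lebesgue H \<and> (\<forall>x. \<forall>\<phi>\<in>H. transl x \<phi> \<in> H)"

definition fibre_projections :: "(heis \<Rightarrow> complex) set \<Rightarrow> (real \<Rightarrow> L2_op) \<Rightarrow> bool" where
  "fibre_projections H Phat \<longleftrightarrow>
     measurable_operator_field Phat \<and>
     (\<forall>l\<in>Lam. orthogonal_projection (Phat l)) \<and>
     (\<forall>\<phi>\<in>L2 lebesgue. \<forall>p A. orthogonal_projection_of lebesgue H \<phi> p \<and> has_fourier_transform \<phi> A \<longrightarrow>
        has_fourier_transform p (\<lambda>l f. A l (Phat l f)))"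

definition multiplicity_one :: "(heis \<Rightarrow> complex) set \<Rightarrow> bool" where
  "multiplicity_one H \<longleftrightarrow>
     translation_invariant_subspace H \<and>
     (\<exists>Phat. fibre_projections H Phat \<and> (AE l in lebesgue_on Lam. rank_one (Phat l)))"

definition invariant_multiplicity_one :: "(heis \<Rightarrow> complex) set \<Rightarrow> bool" where
  "invariant_multiplicity_one H \<longleftrightarrow>
     multiplicity_one H \<and> (\<forall>a>0. \<forall>\<phi>\<in>H. dilat a \<phi> \<in> H)"

definition unit_vector_field :: "(real \<Rightarrow> real \<Rightarrow> complex) \<Rightarrow> bool" where
  "unit_vector_field e \<longleftrightarrow>
     (\<forall>l\<in>Lam. e l \<in> L2R \<and> L2_norm lebesgue (e l) = 1) \<and>
     (\<forall>f\<in>L2R. (\<lambda>l. L2_inner lebesgue (e l) f) \<in> borel_measurable (lebesgue_on Lam))"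

definition spanning_unit_field ::
  "(heis \<Rightarrow> complex) set \<Rightarrow> (real \<Rightarrow> real \<Rightarrow> complex) \<Rightarrow> bool" where
  "spanning_unit_field H e \<longleftrightarrow>
     unit_vector_field e \<and>
     (\<exists>Phat. fibre_projections H Phat \<and> (AE l in lebesgue_on Lam. range_is_span (Phat l) (e l)))"

definition measure_LamR :: "(real \<times> real) measure" where
  "measure_LamR = density (lebesgue_on (Lam \<times> UNIV)) (\<lambda>(l, t). ennreal \<bar>l\<bar>)"

definition reducing_isomorphism ::
  "(heis \<Rightarrow> complex) set \<Rightarrow> (real \<Rightarrow> real \<Rightarrow> complex) \<Rightarrow>
   ((heis \<Rightarrow> complex) \<Rightarrow> (real \<times> real \<Rightarrow> complex)) \<Rightarrow> bool" where
  "reducing_isomorphism H e V \<longleftrightarrow>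
     (\<forall>\<eta>\<in>H. V \<eta> \<in> L2 measure_LamR \<and>
        (\<exists>A. has_fourier_transform \<eta> A \<and>
           (AE l in lebesgue_on Lam. AE t in lebesgue. V \<eta> (l, t) = A l (e l) t)))"

definition C_op :: "real \<Rightarrow> L2_op" where
  "C_op a f = (\<lambda>t. complex_of_real (a powr (1/4)) * f (a powr (1/2) * t))"

definition associated_multiplier ::
  "(real \<Rightarrow> real \<Rightarrow> complex) \<Rightarrow> (real \<Rightarrow> real \<Rightarrow> complex) \<Rightarrow> bool" where
  "associated_multiplier e chi \<longleftrightarrow>
     (\<forall>a>0. chi a \<in> borel_measurable (lebesgue_on Lam) \<and>
        (\<forall>l\<in>Lam. cmod (chi a l) = 1) \<and>
        (AE l in lebesgue_on Lam. AE t in lebesgue. C_op a (e l) t = chi a l * e (a * l) t))"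

definition transl_hat :: "heis \<Rightarrow> (real \<times> real \<Rightarrow> complex) \<Rightarrow> real \<times> real \<Rightarrow> complex" where
  "transl_hat = (\<lambda>(k, l, m) f (w, t).
     cis (2 * pi * w * m) * cis (- 2 * pi * w * l * t) * f (w, t - k))"

definition dilat_hat ::
  "(real \<Rightarrow> real \<Rightarrow> complex) \<Rightarrow> real \<Rightarrow> (real \<times> real \<Rightarrow> complex) \<Rightarrow> real \<times> real \<Rightarrow> complex" where
  "dilat_hat chi a f = (\<lambda>(l, t).
     chi a l * complex_of_real (a powr (3/4)) * f (a * l, a powr (- 1/2) * t))"

section \<open>Congruence of subsets of the line\<close>

text \<open>Sets are considered modulo Lebesgue null sets.\<close>

definition eq_mod_null :: "real set \<Rightarrow> real set \<Rightarrow> bool" where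
  "eq_mod_null A B \<longleftrightarrow> (A - B) \<union> (B - A) \<in> null_sets lebesgue"

definition subset_mod_null :: "real set \<Rightarrow> real set \<Rightarrow> bool" where
  "subset_mod_null A B \<longleftrightarrow> A - B \<in> null_sets lebesgue"

definition translation_congruent :: "real set \<Rightarrow> real set \<Rightarrow> bool" where
  "translation_congruent I J \<longleftrightarrow>
     (\<exists>I'\<in>sets lebesgue. \<exists>J'\<in>sets lebesgue. eq_mod_null I I' \<and> eq_mod_null J J' \<and>
        (\<exists>\<tau>. \<exists>k :: real \<Rightarrow> int. bij_betw \<tau> I' J' \<and>
           k \<in> measurable (lebesgue_on I') (count_space UNIV) \<and>
           (\<forall>l\<in>I'. \<tau> l = l + of_int (k l))))"

definition dilation_congruent :: "real set \<Rightarrow> real set \<Rightarrow> bool" where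
  "dilation_congruent I J \<longleftrightarrow>
     (\<exists>I'\<in>sets lebesgue. \<exists>J'\<in>sets lebesgue. eq_mod_null I I' \<and> eq_mod_null J J' \<and>
        (\<exists>\<delta>. \<exists>j :: real \<Rightarrow> int. bij_betw \<delta> I' J' \<and>
           j \<in> measurable (lebesgue_on I') (count_space UNIV) \<and>
           (\<forall>l\<in>I'. \<delta> l = 2 powi (j l) * l)))"

definition shannon_set :: "real set" where
  "shannon_set = {-1..<-1/2} \<union> {1/2..<1}"

section \<open>The wavelet systems\<close>

text \<open>Both systems are indexed families, with \<open>(j, k, l, m)\<close> ranging over
  \<open>\<int> \<times> \<alpha>\<int> \<times> \<beta>\<int> \<times> \<int>\<close>.\<close>

definition wavelet_index :: "real \<Rightarrow> real \<Rightarrow> (int \<times> heis) set" where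
  "wavelet_index \<alpha> \<beta> = UNIV \<times> ((*) \<alpha> ` \<int>) \<times> ((*) \<beta> ` \<int>) \<times> \<int>"

definition wavelet_system :: "(heis \<Rightarrow> complex) \<Rightarrow> int \<times> heis \<Rightarrow> heis \<Rightarrow> complex" where
  "wavelet_system \<psi> = (\<lambda>(j, x). dilat (2 powi j) (transl x \<psi>))"

definition wavelet_system_hat ::
  "(real \<Rightarrow> real \<Rightarrow> complex) \<Rightarrow> (real \<times> real \<Rightarrow> complex) \<Rightarrow> int \<times> heis \<Rightarrow> real \<times> real \<Rightarrow> complex" where
  "wavelet_system_hat chi g = (\<lambda>(j, x). dilat_hat chi (2 powi j) (transl_hat x g))"

end

theory Submission
  imports Defs "HOL-Library.Nat_Bijection"
begin

text \<open>
  The reducing isomorphism \<open>V\<close> turns the statement about the subspace \<open>H\<close> into a statement about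
  the space \<open>L\<^sup>2(\<Lambda> \<times> \<real>)\<close>, where everything is explicit, so there are two halves:
  \<open>V\<close> preserves inner products and carries one wavelet system to the other, and the explicit system
  is a Parseval frame.

  \<^bold>\<open>The explicit system.\<close>  Fix a scale \<open>j\<close>.  After the substitution undoing the dilation, the
  coefficients of \<open>f\<close> are
  \<open>\<integral>\<integral> \<surd>\<beta> |\<lambda>| 1\<^sub>I(\<lambda>) F(\<lambda>,t) 1\<^sub>[\<^sub>\<alpha>\<^sub>p\<^sub>,\<^sub>\<alpha>\<^sub>p\<^sub>+\<^sub>\<alpha>\<^sub>)(t) e(\<beta>\<lambda>nt) e(-m\<lambda>) dt d\<lambda>\<close> with \<open>F\<close> a rescaled copy of \<open>f\<close>
  (\<open>wavelet_coefficient\<close>).  Three Parseval identities recover the norm, one for each index.  For the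
  sum over \<open>m\<close>: the integer translates of \<open>I\<close> are essentially disjoint by translation congruence, so a
  function supported in \<open>I\<close> is determined isometrically by its coefficients against the integer
  frequencies (\<open>parseval_packing\<close>).  For the sum over \<open>n\<close> at a fixed \<open>\<lambda>\<close>: the frequencies
  \<open>\<beta>\<lambda>n\<close> have spacing \<open>\<beta>|\<lambda>| \<le> 1/\<alpha>\<close>, so they form a tight frame on an interval of length \<open>\<alpha>\<close>, with
  frame bound \<open>1/(\<beta>|\<lambda>|)\<close> (\<open>parseval_scaled_interval\<close>); this bound is what the factors \<open>\<surd>\<beta>\<close> and
  \<open>|\<lambda>|\<close> compensate.  For the sum over \<open>p\<close>: these intervals tile the line.  At scale \<open>j\<close> this gives
  the norm of \<open>f\<close> restricted to \<open>2\<^sup>-\<^sup>jI \<times> \<real>\<close> (\<open>gabor_coeff_parseval\<close>, \<open>dilated_slice_norm\<close>), and dilation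
  congruence with the Shannon set says that the sets \<open>2\<^sup>-\<^sup>jI\<close> tile the line
  (\<open>dilation_congruent_tiling\<close>).  The multiplier is unimodular and disappears in absolute values.

  \<^bold>\<open>The isometry.\<close>  An element \<open>\<eta>\<close> of \<open>H\<close> is its own projection, so if \<open>A\<close> is a Fourier transform
  of \<open>\<eta>\<close> then so is the field \<open>A(\<lambda>)P(\<lambda>)\<close>.  As \<open>P(\<lambda>)\<close> is the rank-one projection onto \<open>e(\<lambda>)\<close>, the
  Hilbert--Schmidt norm of \<open>A(\<lambda>)P(\<lambda>)\<close> is \<open>\<parallel>A(\<lambda>)e(\<lambda>)\<parallel> = \<parallel>V\<eta>(\<lambda>,\<cdot>)\<parallel>\<close>, and the Plancherel formula for the Heisenberg
  group (\<open>fourier_hs_norm\<close>) gives \<open>\<parallel>V\<eta>\<parallel> = \<parallel>\<eta>\<parallel>\<close> (\<open>reducing_isomorphism_isometry\<close>).  Inner products follow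
  by polarization once \<open>V\<close> is known to be linear almost everywhere.

  \<^bold>\<open>Plancherel and intertwining.\<close>  For integrable \<open>\<Phi>\<close> the operator \<open>\<Phi>\<close>-hat at \<open>\<lambda>\<close> is an integral operator
  whose kernel is the partial Fourier transform of \<open>\<Phi>\<close> in its last two variables, so the Plancherel
  formula reduces to the one in the plane, hence on the line, hence (by summing over integer
  translates) to Parseval's identity for Fourier series.  The formula passes to \<open>L\<^sup>2\<close> by approximation.
  Translations, dilations and linear combinations are also computed for integrable functions first.
  The passage to the limit needs that any sequence of functions in \<open>L\<^sup>1 \<inter> L\<^sup>2\<close> approximating \<open>\<phi>\<close>, and
  not just the one that witnesses the transform, has a subsequence whose transforms converge strongly
  for almost every \<open>\<lambda>\<close> (\<open>fourier_strong_limit\<close>); the two sides of an intertwining relation are then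
  limits of the same sequence.
\<close>

section \<open>Square-integrable functions\<close>

abbreviation csq :: "complex \<Rightarrow> ennreal" where
  "csq z \<equiv> ennreal ((cmod z)\<^sup>2)"

text \<open>Sums of extended nonnegative reals are integrals with respect to counting measure, so exchanging them
  with each other and with integrals is Tonelli's theorem and never requires a summability proof.\<close>

abbreviation nn_sum :: "('i \<Rightarrow> ennreal) \<Rightarrow> ennreal" (binder "\<Sum>\<^sup>+" 10) where
  "(\<Sum>\<^sup>+i. a i) \<equiv> (\<integral>\<^sup>+i. a i \<partial>count_space UNIV)"

text \<open>For measurable functions the squared norm takes the value \<open>\<infinity>\<close> exactly outside \<open>L\<^sup>2\<close>.  Most identities below are first
  equalities of such extended numbers, from which finiteness is read off afterwards.\<close>

definition nsq :: "'a measure \<Rightarrow> ('a \<Rightarrow> complex) \<Rightarrow> ennreal" where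
  "nsq M f = (\<integral>\<^sup>+x. csq (f x) \<partial>M)"

lemma borel_measurable_cnj [measurable]: "f \<in> borel_measurable M \<Longrightarrow> (\<lambda>x. cnj (f x)) \<in> borel_measurable M"
  by (rule borel_measurable_continuous_on[OF continuous_on_cnj]) (auto intro: continuous_on_id)

lemma L2_iff_nsq: "f \<in> L2 M \<longleftrightarrow> f \<in> borel_measurable M \<and> nsq M f < \<infinity>"
  unfolding L2_def nsq_def by (auto simp: integrable_iff_bounded)

lemma L2_measurable: "f \<in> L2 M \<Longrightarrow> f \<in> borel_measurable M"
  by (simp add: L2_def)

lemma L2_norm_nonneg [simp]: "L2_norm M f \<ge> 0"
  unfolding L2_norm_def by (intro real_sqrt_ge_zero integral_nonneg_AE) auto

lemma L2_norm_power2: "(L2_norm M f)\<^sup>2 = (\<integral>x. (cmod (f x))\<^sup>2 \<partial>M)"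
  unfolding L2_norm_def by (intro real_sqrt_pow2 integral_nonneg_AE) auto

lemma nsq_eq_L2_norm: "f \<in> L2 M \<Longrightarrow> nsq M f = ennreal ((L2_norm M f)\<^sup>2)"
  unfolding nsq_def L2_norm_power2 by (rule nn_integral_eq_integral) (auto simp: L2_def)

lemma nsq_cong_AE: "(AE x in M. f x = g x) \<Longrightarrow> nsq M f = nsq M g"
  unfolding nsq_def by (rule nn_integral_cong_AE) auto

lemma nsq_scale: "f \<in> borel_measurable M \<Longrightarrow> nsq M (\<lambda>x. c * f x) = csq c * nsq M f"
  unfolding nsq_def by (subst nn_integral_cmult[symmetric]) (auto simp: norm_mult power_mult_distrib ennreal_mult)

lemma nsq_minus_commute: "nsq M (\<lambda>x. f x - g x) = nsq M (\<lambda>x. g x - f x)"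
  unfolding nsq_def by (simp add: norm_minus_commute)

text \<open>The elementary substitute for the triangle inequality when one works with squared norms: the
  factor of \<open>a\<close> can be brought as close to 1 as desired, at the price of a large factor of \<open>b\<close>.\<close>

lemma cmod_add_sq_le: "(cmod (a + b))\<^sup>2 \<le> (1 + r) * (cmod a)\<^sup>2 + (1 + 1 / r) * (cmod b)\<^sup>2" if "r > 0"
proof -
  have "(cmod (a + b))\<^sup>2 \<le> (cmod a + cmod b)\<^sup>2"
    by (intro power_mono norm_triangle_ineq) auto
  also have "\<dots> \<le> (1 + r) * (cmod a)\<^sup>2 + (1 + 1 / r) * (cmod b)\<^sup>2"
  proof -
    have "0 \<le> (r * cmod a - cmod b)\<^sup>2 / r" using that by simp
    also have "\<dots> = r * (cmod a)\<^sup>2 + (cmod b)\<^sup>2 / r - 2 * cmod a * cmod b"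
      using that by (simp add: power2_eq_square field_simps)
    finally show ?thesis by (simp add: power2_eq_square algebra_simps)
  qed
  finally show ?thesis .
qed

lemma nsq_add_le:
  assumes [measurable]: "f \<in> borel_measurable M" "g \<in> borel_measurable M" and "r > 0"
  shows "nsq M (\<lambda>x. f x + g x) \<le> ennreal (1 + r) * nsq M f + ennreal (1 + 1 / r) * nsq M g"
proof -
  have "nsq M (\<lambda>x. f x + g x)
      \<le> (\<integral>\<^sup>+x. ennreal (1 + r) * csq (f x) + ennreal (1 + 1 / r) * csq (g x) \<partial>M)"
    unfolding nsq_def using cmod_add_sq_le[OF \<open>r > 0\<close>] \<open>r > 0\<close>
    by (intro nn_integral_mono)
       (auto simp flip: ennreal_mult ennreal_plus simp del: ennreal_plus intro!: ennreal_leI)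
  also have "\<dots> = ennreal (1 + r) * nsq M f + ennreal (1 + 1 / r) * nsq M g"
    unfolding nsq_def by (subst nn_integral_add) (auto simp: nn_integral_cmult)
  finally show ?thesis .
qed

lemma nsq_add_le2:
  assumes "f \<in> borel_measurable M" "g \<in> borel_measurable M"
  shows "nsq M (\<lambda>x. f x + g x) \<le> 2 * nsq M f + 2 * nsq M g"
  using nsq_add_le[OF assms, of 1] by simp

lemma nsq_diff_triangle:
  assumes [measurable]: "f \<in> borel_measurable M" "g \<in> borel_measurable M" "h \<in> borel_measurable M"
  shows "nsq M (\<lambda>x. f x - h x) \<le> 2 * nsq M (\<lambda>x. f x - g x) + 2 * nsq M (\<lambda>x. g x - h x)"
  using nsq_add_le2[of "\<lambda>x. f x - g x" M "\<lambda>x. g x - h x"] by simp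

lemma L2_zero [simp, intro]: "(\<lambda>_. 0) \<in> L2 M"
  by (simp add: L2_def)

lemma L2_add [intro]: "f \<in> L2 M \<Longrightarrow> g \<in> L2 M \<Longrightarrow> (\<lambda>x. f x + g x) \<in> L2 M"
  unfolding L2_iff_nsq
  by (auto intro!: le_less_trans[OF nsq_add_le2] simp: ennreal_mult_less_top)

lemma L2_scale [intro]: "f \<in> L2 M \<Longrightarrow> (\<lambda>x. c * f x) \<in> L2 M"
  unfolding L2_iff_nsq by (auto simp: nsq_scale ennreal_mult_less_top)

lemma L2_diff [intro]: "f \<in> L2 M \<Longrightarrow> g \<in> L2 M \<Longrightarrow> (\<lambda>x. f x - g x) \<in> L2 M"
  using L2_add[of f M "\<lambda>x. (-1) * g x"] L2_scale[of g M "-1"] by simp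

lemma L2_sum: "(\<And>i. i \<in> S \<Longrightarrow> f i \<in> L2 M) \<Longrightarrow> (\<lambda>x. \<Sum>i\<in>S. f i x) \<in> L2 M"
  by (induction S rule: infinite_finite_induct) auto

lemma L2_norm_cong_AE:
  "f \<in> borel_measurable M \<Longrightarrow> g \<in> borel_measurable M \<Longrightarrow> (AE x in M. f x = g x) \<Longrightarrow> L2_norm M f = L2_norm M g"
  unfolding L2_norm_def by (intro arg_cong[where f=sqrt] integral_cong_AE) auto

lemma L2_inner_cong_AE:
  "f \<in> borel_measurable M \<Longrightarrow> g \<in> borel_measurable M \<Longrightarrow> f' \<in> borel_measurable M \<Longrightarrow> g' \<in> borel_measurable M
   \<Longrightarrow> (AE x in M. f x = f' x) \<Longrightarrow> (AE x in M. g x = g' x) \<Longrightarrow> L2_inner M f g = L2_inner M f' g'"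
  unfolding L2_inner_def by (intro integral_cong_AE) auto

lemma L2_mult_integrable: "f \<in> L2 M \<Longrightarrow> g \<in> L2 M \<Longrightarrow> integrable M (\<lambda>x. f x * g x)"
proof -
  assume *: "f \<in> L2 M" "g \<in> L2 M"
  have "integrable M (\<lambda>x. (cmod (f x))\<^sup>2 + (cmod (g x))\<^sup>2)" using * by (auto simp: L2_def)
  then show ?thesis
  proof (rule Bochner_Integration.integrable_bound)
    show "(\<lambda>x. f x * g x) \<in> borel_measurable M" using * by (auto simp: L2_def)
    show "AE x in M. norm (f x * g x) \<le> norm ((cmod (f x))\<^sup>2 + (cmod (g x))\<^sup>2)"
    proof (intro AE_I2)
      fix x
      have "0 \<le> (cmod (f x) - cmod (g x))\<^sup>2" "0 \<le> (cmod (f x))\<^sup>2" "0 \<le> (cmod (g x))\<^sup>2" by auto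
      moreover have "0 \<le> cmod (f x) * cmod (g x)" by simp
      ultimately have "cmod (f x) * cmod (g x) \<le> (cmod (f x))\<^sup>2 + (cmod (g x))\<^sup>2"
        unfolding power2_diff by linarith
      then show "norm (f x * g x) \<le> norm ((cmod (f x))\<^sup>2 + (cmod (g x))\<^sup>2)"
        by (simp add: norm_mult)
    qed
  qed
qed

lemma L2_cnj: "f \<in> L2 M \<Longrightarrow> (\<lambda>x. cnj (f x)) \<in> L2 M"
  by (auto simp: L2_def)

lemma L2_inner_integrable: "f \<in> L2 M \<Longrightarrow> g \<in> L2 M \<Longrightarrow> integrable M (\<lambda>x. f x * cnj (g x))"
  by (intro L2_mult_integrable L2_cnj)

lemma L2_inner_add_left: "f \<in> L2 M \<Longrightarrow> g \<in> L2 M \<Longrightarrow> h \<in> L2 M \<Longrightarrow>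
    L2_inner M (\<lambda>x. f x + g x) h = L2_inner M f h + L2_inner M g h"
  unfolding L2_inner_def by (simp add: distrib_right L2_inner_integrable)

lemma L2_inner_diff_left: "f \<in> L2 M \<Longrightarrow> g \<in> L2 M \<Longrightarrow> h \<in> L2 M \<Longrightarrow>
    L2_inner M (\<lambda>x. f x - g x) h = L2_inner M f h - L2_inner M g h"
  unfolding L2_inner_def by (simp add: left_diff_distrib L2_inner_integrable)

lemma L2_inner_scale_left: "L2_inner M (\<lambda>x. c * f x) h = c * L2_inner M f h"
  unfolding L2_inner_def by (simp add: mult.assoc)

lemma L2_inner_commute: "L2_inner M f g = cnj (L2_inner M g f)"
  unfolding L2_inner_def Bochner_Integration.integral_cnj[symmetric] by (simp add: mult.commute)

lemma L2_inner_add_right: "f \<in> L2 M \<Longrightarrow> g \<in> L2 M \<Longrightarrow> h \<in> L2 M \<Longrightarrow>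
    L2_inner M h (\<lambda>x. f x + g x) = L2_inner M h f + L2_inner M h g"
  unfolding L2_inner_def by (simp add: distrib_left L2_inner_integrable)

lemma L2_inner_scale_right: "L2_inner M h (\<lambda>x. c * f x) = cnj c * L2_inner M h f"
  by (subst (1 2) L2_inner_commute) (simp add: L2_inner_scale_left)

lemma L2_inner_sum_left: "(\<And>i. i \<in> S \<Longrightarrow> f i \<in> L2 M) \<Longrightarrow> h \<in> L2 M \<Longrightarrow>
    L2_inner M (\<lambda>x. \<Sum>i\<in>S. f i x) h = (\<Sum>i\<in>S. L2_inner M (f i) h)"
  by (induction S rule: infinite_finite_induct)
     (auto simp: L2_inner_add_left L2_sum L2_inner_def[of _ "\<lambda>_. 0"])

lemma L2_inner_self: "L2_inner M f f = complex_of_real ((L2_norm M f)\<^sup>2)"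
  unfolding L2_inner_def L2_norm_power2
  by (simp add: complex_norm_square[symmetric] flip: integral_complex_of_real)

lemma L2_norm_scale: "L2_norm M (\<lambda>x. c * f x) = cmod c * L2_norm M f"
  unfolding L2_norm_def by (simp add: norm_mult power_mult_distrib real_sqrt_mult)

lemma L2_norm_add_sq: "f \<in> L2 M \<Longrightarrow> g \<in> L2 M \<Longrightarrow>
   (L2_norm M (\<lambda>x. f x + g x))\<^sup>2 = (L2_norm M f)\<^sup>2 + (L2_norm M g)\<^sup>2 + 2 * Re (L2_inner M f g)"
proof -
  assume *: "f \<in> L2 M" "g \<in> L2 M"
  have "complex_of_real ((L2_norm M (\<lambda>x. f x + g x))\<^sup>2) =
      L2_inner M f f + L2_inner M g g + (L2_inner M f g + cnj (L2_inner M f g))"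
    unfolding L2_inner_self[symmetric]
    using * by (simp add: L2_inner_add_left L2_inner_add_right L2_add L2_inner_commute[of M g f])
  also have "\<dots> = complex_of_real ((L2_norm M f)\<^sup>2 + (L2_norm M g)\<^sup>2 + 2 * Re (L2_inner M f g))"
    unfolding L2_inner_self complex_add_cnj by simp
  finally show ?thesis using of_real_eq_iff by blast
qed

text \<open>Two pairs of vectors, possibly in different spaces, have the same inner product as soon as
  all combinations \<open>f + c g\<close> have the same norm.  This is how an isometry that is linear only up to
  null sets is seen to preserve inner products.\<close>

lemma L2_polarization:
  assumes "f \<in> L2 M" "g \<in> L2 M" "f' \<in> L2 M'" "g' \<in> L2 M'"
    and eq: "\<And>c. L2_norm M (\<lambda>x. f x + c * g x) = L2_norm M' (\<lambda>x. f' x + c * g' x)"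
    and eq0: "L2_norm M f = L2_norm M' f'" "L2_norm M g = L2_norm M' g'"
  shows "L2_inner M f g = L2_inner M' f' g'"
proof -
  have R: "Re (cnj c * L2_inner M f g) = Re (cnj c * L2_inner M' f' g')" for c
  proof -
    have "(L2_norm M (\<lambda>x. f x + c * g x))\<^sup>2 = (L2_norm M' (\<lambda>x. f' x + c * g' x))\<^sup>2"
      by (simp add: eq)
    then show ?thesis
      using assms(1-4) by (simp add: L2_norm_add_sq L2_scale L2_norm_scale L2_inner_scale_right eq0 del: complex_mult_cnj)
  qed
  show ?thesis using R[of 1] R[of \<i>] by (auto simp: complex_eq_iff)
qed

lemma L2_Cauchy_Schwarz_nsq:
  assumes "f \<in> borel_measurable M" "g \<in> borel_measurable M"
  shows "(\<integral>\<^sup>+x. ennreal (cmod (f x * g x)) \<partial>M)\<^sup>2 \<le> nsq M f * nsq M g"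
  using Cauchy_Schwarz_nn_integral[of "\<lambda>x. ennreal (cmod (f x))" M "\<lambda>x. ennreal (cmod (g x))"] assms
  unfolding nsq_def by (simp add: norm_mult ennreal_mult ennreal_power)

lemma integral_mult_sq_le_nsq:
  assumes "f \<in> borel_measurable M" "g \<in> borel_measurable M"
  shows "csq (\<integral>x. f x * g x \<partial>M) \<le> nsq M f * nsq M g"
proof (cases "integrable M (\<lambda>x. f x * g x)")
  case True
  have "csq (\<integral>x. f x * g x \<partial>M) = (ennreal (cmod (\<integral>x. f x * g x \<partial>M)))\<^sup>2"
    by (simp add: ennreal_power)
  also have "\<dots> \<le> (\<integral>\<^sup>+x. ennreal (cmod (f x * g x)) \<partial>M)\<^sup>2"
    by (intro power_mono integral_norm_bound_ennreal True) auto
  also have "\<dots> \<le> nsq M f * nsq M g" by (rule L2_Cauchy_Schwarz_nsq[OF assms])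
  finally show ?thesis .
qed (simp add: not_integrable_integral_eq)

lemma nsq_cnj: "nsq M (\<lambda>x. cnj (f x)) = nsq M f"
  by (simp add: nsq_def)

lemma L2_Cauchy_Schwarz:
  assumes "f \<in> L2 M" "g \<in> L2 M"
  shows "cmod (L2_inner M f g) \<le> L2_norm M f * L2_norm M g"
proof -
  have "csq (L2_inner M f g) \<le> nsq M f * nsq M g"
    using integral_mult_sq_le_nsq[of f M "\<lambda>x. cnj (g x)"] assms
    by (simp add: L2_inner_def nsq_cnj L2_measurable borel_measurable_cnj)
  also have "\<dots> = ennreal ((L2_norm M f * L2_norm M g)\<^sup>2)"
    using assms by (simp add: nsq_eq_L2_norm ennreal_mult power_mult_distrib)
  finally have "(cmod (L2_inner M f g))\<^sup>2 \<le> (L2_norm M f * L2_norm M g)\<^sup>2"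
    by (simp add: ennreal_le_iff)
  then show ?thesis by (rule power2_le_imp_le) simp
qed

lemma L2_norm_triangle:
  assumes "f \<in> L2 M" "g \<in> L2 M"
  shows "L2_norm M (\<lambda>x. f x + g x) \<le> L2_norm M f + L2_norm M g"
proof (rule power2_le_imp_le)
  have "Re (L2_inner M f g) \<le> L2_norm M f * L2_norm M g"
    using L2_Cauchy_Schwarz[OF assms] complex_Re_le_cmod order_trans by blast
  then show "(L2_norm M (\<lambda>x. f x + g x))\<^sup>2 \<le> (L2_norm M f + L2_norm M g)\<^sup>2"
    by (simp add: L2_norm_add_sq[OF assms] power2_sum)
qed simp

lemma L2_norm_diff_triangle:
  assumes "f \<in> L2 M" "g \<in> L2 M" "h \<in> L2 M"
  shows "L2_norm M (\<lambda>x. f x - h x) \<le> L2_norm M (\<lambda>x. f x - g x) + L2_norm M (\<lambda>x. g x - h x)"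
  using L2_norm_triangle[of "\<lambda>x. f x - g x" M "\<lambda>x. g x - h x"] assms by (simp add: L2_diff)

lemma L2_norm_eq_0_AE: "f \<in> L2 M \<Longrightarrow> L2_norm M f = 0 \<Longrightarrow> AE x in M. f x = 0"
  unfolding L2_norm_def
  by (simp add: integral_nonneg_eq_0_iff_AE L2_def)

lemma nsq_eq_0_AE: "f \<in> borel_measurable M \<Longrightarrow> nsq M f = 0 \<Longrightarrow> AE x in M. f x = 0"
  unfolding nsq_def by (subst (asm) nn_integral_0_iff_AE) auto

section \<open>Orthonormal families\<close>

definition orthonormal_family :: "'a measure \<Rightarrow> ('i \<Rightarrow> 'a \<Rightarrow> complex) \<Rightarrow> bool" where
  "orthonormal_family M u \<longleftrightarrow> (\<forall>i. u i \<in> L2 M) \<and> (\<forall>i j. L2_inner M (u i) (u j) = (if i = j then 1 else 0))"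

text \<open>One identity carries Bessel's inequality (\<open>p\<close> the Fourier coefficients), the best
  approximation property, and the convergence of the expansion.\<close>

lemma orthonormal_family_dist_sq:
  assumes u: "orthonormal_family M u" and f: "f \<in> L2 M" and S: "finite S"
  shows "(L2_norm M (\<lambda>x. f x - (\<Sum>i\<in>S. p i * u i x)))\<^sup>2 =
    (L2_norm M f)\<^sup>2 - (\<Sum>i\<in>S. (cmod (L2_inner M f (u i)))\<^sup>2) + (\<Sum>i\<in>S. (cmod (L2_inner M f (u i) - p i))\<^sup>2)"
  using S
proof (induction S)
  case empty
  then show ?case by simp
next
  case (insert j S)
  let ?F = "\<lambda>x. f x - (\<Sum>i\<in>S. p i * u i x)"
  have uL: "u i \<in> L2 M" for i using u by (simp add: orthonormal_family_def)
  have SL: "(\<lambda>x. \<Sum>i\<in>S. p i * u i x) \<in> L2 M" by (intro L2_sum L2_scale uL)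
  have FL: "?F \<in> L2 M" using f SL by auto
  have "L2_inner M ?F (u j) = L2_inner M f (u j) - (\<Sum>i\<in>S. p i * L2_inner M (u i) (u j))"
    using f SL uL by (simp add: L2_inner_diff_left L2_inner_sum_left L2_scale L2_inner_scale_left)
  also have "(\<Sum>i\<in>S. p i * L2_inner M (u i) (u j)) = 0"
    using u insert.hyps by (intro sum.neutral) (auto simp: orthonormal_family_def)
  finally have in1: "L2_inner M ?F (u j) = L2_inner M f (u j)" by simp
  have "L2_norm M (u j) = 1"
  proof -
    have "complex_of_real ((L2_norm M (u j))\<^sup>2) = 1"
      using u unfolding L2_inner_self[symmetric] by (simp add: orthonormal_family_def)
    then have "(L2_norm M (u j))\<^sup>2 = 1" using of_real_eq_1_iff by blast
    then show ?thesis by (simp add: power2_eq_1_iff) (smt (verit) L2_norm_nonneg)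
  qed
  then have "(L2_norm M (\<lambda>x. ?F x + (- p j) * u j x))\<^sup>2 =
     (L2_norm M ?F)\<^sup>2 + (cmod (p j))\<^sup>2 + 2 * Re (cnj (- p j) * L2_inner M f (u j))"
    unfolding L2_norm_add_sq[OF FL L2_scale[OF uL]] L2_norm_scale L2_inner_scale_right in1 by simp
  also have "(\<lambda>x. ?F x + (- p j) * u j x) = (\<lambda>x. f x - (\<Sum>i\<in>insert j S. p i * u i x))"
    using insert.hyps by (auto simp: fun_eq_iff)
  finally have "(L2_norm M (\<lambda>x. f x - (\<Sum>i\<in>insert j S. p i * u i x)))\<^sup>2 =
     (L2_norm M ?F)\<^sup>2 + ((cmod (p j))\<^sup>2 + 2 * Re (cnj (- p j) * L2_inner M f (u j)))" by simp
  also have "(cmod (p j))\<^sup>2 + 2 * Re (cnj (- p j) * L2_inner M f (u j)) =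
     - (cmod (L2_inner M f (u j)))\<^sup>2 + (cmod (L2_inner M f (u j) - p j))\<^sup>2"
    unfolding cmod_power2 by (simp add: power2_eq_square algebra_simps)
  finally show ?case using insert by simp
qed

text \<open>The partial sums of squared coefficients are bounded by Bessel's inequality.  Replacing the weights
  of an approximating combination by the Fourier coefficients only improves the approximation, so
  density makes the partial sums come arbitrarily close to the squared norm.\<close>

lemma has_sum_of_dense:
  assumes u: "orthonormal_family M u" and f: "f \<in> L2 M"
    and dense: "\<And>r. r > 0 \<Longrightarrow> \<exists>S p. finite S \<and> L2_norm M (\<lambda>x. f x - (\<Sum>i\<in>S. p i * u i x)) < r"
  shows "((\<lambda>i. (cmod (L2_inner M f (u i)))\<^sup>2) has_sum (L2_norm M f)\<^sup>2) UNIV"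
proof -
  let ?a = "\<lambda>i. (cmod (L2_inner M f (u i)))\<^sup>2"
  have bessel: "(\<Sum>i\<in>S. ?a i) \<le> (L2_norm M f)\<^sup>2" if "finite S" for S
    using orthonormal_family_dist_sq[OF u f that, of "\<lambda>i. L2_inner M f (u i)"]
    by simp (smt (verit) zero_le_power2)
  have approx: "\<exists>S. finite S \<and> (L2_norm M f)\<^sup>2 - (\<Sum>i\<in>S. ?a i) < r" if "r > 0" for r
  proof -
    obtain S p where S: "finite S" and "L2_norm M (\<lambda>x. f x - (\<Sum>i\<in>S. p i * u i x)) < sqrt r"
      using dense[of "sqrt r"] \<open>r > 0\<close> real_sqrt_gt_zero by blast
    then have "(L2_norm M (\<lambda>x. f x - (\<Sum>i\<in>S. p i * u i x)))\<^sup>2 < r"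
      by (metis L2_norm_nonneg less_eq_real_def power_strict_mono real_sqrt_pow2 that zero_less_numeral)
    then have "(L2_norm M f)\<^sup>2 - (\<Sum>i\<in>S. ?a i) < r"
      unfolding orthonormal_family_dist_sq[OF u f S]
      by (smt (verit) sum_nonneg zero_le_power2)
    then show ?thesis using S by blast
  qed
  show ?thesis
    unfolding has_sum_def tendsto_iff eventually_finite_subsets_at_top
  proof (intro allI impI)
    fix r :: real assume "r > 0"
    then obtain S where S: "finite S" "(L2_norm M f)\<^sup>2 - (\<Sum>i\<in>S. ?a i) < r" using approx by blast
    have "dist (sum ?a Y) ((L2_norm M f)\<^sup>2) < r" if Y: "finite Y" "S \<subseteq> Y" for Y
    proof -
      have "(\<Sum>i\<in>S. ?a i) \<le> (\<Sum>i\<in>Y. ?a i)" using Y by (intro sum_mono2) auto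
      then show ?thesis using bessel[OF Y(1)] S(2) by (simp add: dist_real_def)
    qed
    then show "\<exists>X. finite X \<and> X \<subseteq> UNIV \<and> (\<forall>Y. finite Y \<and> X \<subseteq> Y \<and> Y \<subseteq> UNIV \<longrightarrow> dist (sum ?a Y) ((L2_norm M f)\<^sup>2) < r)"
      using S(1) by blast
  qed
qed

text \<open>Links sums in the sense of \<open>has_sum\<close>, which define Parseval frames, to the
  extended sums in which all computations are carried out.\<close>

lemma nn_integral_count_space_has_sum:
  assumes nn: "\<And>i. i \<in> A \<Longrightarrow> a i \<ge> 0" and r: "r \<ge> 0"
  shows "(a has_sum r) A \<longleftrightarrow> (\<integral>\<^sup>+i. ennreal (a i) \<partial>count_space A) = ennreal r"
proof
  assume a: "(a has_sum r) A"
  have "a summable_on A" using a summable_on_def by blast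
  then have "(\<lambda>i. norm (a i)) summable_on A" using nn by (simp cong: summable_on_cong)
  then have int: "integrable (count_space A) a"
    using abs_summable_equivalent unfolding abs_summable_on_def by blast
  then have "(\<integral>\<^sup>+i. ennreal (a i) \<partial>count_space A) = ennreal (\<integral>i. a i \<partial>count_space A)"
    using nn by (intro nn_integral_eq_integral) (auto simp: AE_count_space)
  also have "(\<integral>i. a i \<partial>count_space A) = infsum a A"
    using int infsetsum_infsum[of a A] unfolding infsetsum_def abs_summable_on_def by simp
  also have "\<dots> = r" using a by (rule infsumI)
  finally show "(\<integral>\<^sup>+i. ennreal (a i) \<partial>count_space A) = ennreal r" .
next
  assume eq: "(\<integral>\<^sup>+i. ennreal (a i) \<partial>count_space A) = ennreal r"
  have int: "integrable (count_space A) a"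
    using eq nn by (intro integrableI_nonneg) (auto simp: AE_count_space)
  have eq2: "(\<integral>\<^sup>+i. ennreal (a i) \<partial>count_space A) = ennreal (\<integral>i. a i \<partial>count_space A)"
    using nn int by (intro nn_integral_eq_integral) (auto simp: AE_count_space)
  have "(\<integral>i. a i \<partial>count_space A) \<ge> 0" using nn by (intro integral_nonneg_AE) (auto simp: AE_count_space)
  then have "(\<integral>i. a i \<partial>count_space A) = r" using eq eq2 r by simp
  moreover have "(\<integral>i. a i \<partial>count_space A) = infsum a A"
    using int infsetsum_infsum[of a A] unfolding infsetsum_def abs_summable_on_def by simp
  moreover have "a summable_on A"
    using int abs_summable_equivalent[of a A] unfolding abs_summable_on_def by (metis abs_summable_summable)
  ultimately show "(a has_sum r) A" by auto
qed

section \<open>Fourier series\<close>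

definition ef :: "real \<Rightarrow> complex" where
  "ef x = cis (2 * pi * x)"

lemma ef_add: "ef (x + y) = ef x * ef y"
  by (simp add: ef_def cis_mult distrib_left)

lemma ef_of_int [simp]: "ef (of_int n) = 1"
  unfolding ef_def by (rule cis_multiple_2pi) auto

lemma ef_0 [simp]: "ef 0 = 1"
  by (simp add: ef_def)

lemma cnj_ef: "cnj (ef x) = ef (- x)"
  by (simp add: ef_def cis_cnj)

lemma norm_ef [simp]: "cmod (ef x) = 1"
  by (simp add: ef_def)

lemma continuous_ef: "continuous_on UNIV ef"
  unfolding ef_def cis_conv_exp by (intro continuous_intros)

lemma continuous_on_ef [continuous_intros]: "continuous_on S f \<Longrightarrow> continuous_on S (\<lambda>x. ef (f x))"
  using continuous_on_compose2[OF continuous_ef] by blast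

lemma borel_measurable_ef [measurable]: "ef \<in> borel_measurable borel"
  by (intro borel_measurable_continuous_onI continuous_ef)

lemma ef_has_vector_derivative:
  "((\<lambda>x. ef (c * x)) has_vector_derivative (2 * pi * \<i> * c) * ef (c * x)) (at x within S)"
proof -
  have "((\<lambda>z. exp (2 * pi * \<i> * c * z)) has_field_derivative (2 * pi * \<i> * c) * exp (2 * pi * \<i> * c * of_real x)) (at (of_real x))"
    by (auto intro!: derivative_eq_intros)
  then have "((\<lambda>x. exp (2 * pi * \<i> * c * of_real x)) has_vector_derivative (2 * pi * \<i> * c) * exp (2 * pi * \<i> * c * of_real x)) (at x within S)"
    by (rule has_vector_derivative_real_field)
  moreover have "ef (c * x) = exp (2 * pi * \<i> * c * of_real x)" for x
    by (simp add: ef_def cis_conv_exp mult_ac)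
  ultimately show ?thesis by simp
qed

text \<open>A measure on the whole line rather than on a subspace, so that functions of a real variable need no
  restriction.  Being half open, the interval tiles the line exactly.\<close>

definition unit_interval :: "real measure" where
  "unit_interval = density lborel (indicator {0..<1})"

lemma sets_unit_interval [simp, measurable_cong]: "sets unit_interval = sets borel"
  by (simp add: unit_interval_def)

lemma space_unit_interval [simp]: "space unit_interval = UNIV"
  by (simp add: unit_interval_def)

lemma nn_integral_unit_interval:
  "f \<in> borel_measurable borel \<Longrightarrow> (\<integral>\<^sup>+x. f x \<partial>unit_interval) = (\<integral>\<^sup>+x. indicator {0..<1} x * f x \<partial>lborel)"
  unfolding unit_interval_def by (rule nn_integral_density) auto

lemma AE_unit_interval: "(AE x in unit_interval. P x) \<longleftrightarrow> (AE x in lborel. x \<in> {0..<1} \<longrightarrow> P x)"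
  unfolding unit_interval_def by (subst AE_density) (auto simp: indicator_def split: if_splits)

lemma integral_unit_interval:
  fixes f :: "real \<Rightarrow> complex"
  assumes "f \<in> borel_measurable borel"
  shows "(\<integral>x. f x \<partial>unit_interval) = (\<integral>x. indicator {0..<1} x *\<^sub>R f x \<partial>lborel)"
  unfolding unit_interval_def ennreal_indicator[symmetric]
  by (rule integral_density) (use assms in auto)

lemma emeasure_unit_interval [simp]: "emeasure unit_interval UNIV = 1"
  by (simp add: unit_interval_def emeasure_density)

lemma sigma_finite_unit_interval: "sigma_finite_measure unit_interval"
  by (rule finite_measure.axioms(1)[OF finite_measureI]) simp

lemma bounded_L2_unit_interval:
  assumes "f \<in> borel_measurable borel" "\<And>x. cmod (f x) \<le> B"
  shows "f \<in> L2 unit_interval"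
proof -
  have "nsq unit_interval f \<le> (\<integral>\<^sup>+x. ennreal (B\<^sup>2) \<partial>unit_interval)"
    unfolding nsq_def using assms(2)
    by (intro nn_integral_mono ennreal_leI power_mono) auto
  also have "\<dots> < \<infinity>" by simp
  finally show ?thesis using assms(1) by (simp add: L2_iff_nsq)
qed

lemma integral_ef_unit_interval:
  "(\<integral>x. ef (of_int k * x) \<partial>unit_interval) = (if k = 0 then 1 else 0)"
proof (cases "k = 0")
  case True
  then show ?thesis by (simp add: measure_def)
next
  case False
  let ?F = "\<lambda>x. ef (of_int k * x) / (2 * pi * \<i> * of_int k)"
  have "(\<integral>x. ef (of_int k * x) \<partial>unit_interval) = (\<integral>x. indicator {0..<1} x *\<^sub>R ef (of_int k * x) \<partial>lborel)"
    by (subst integral_unit_interval) auto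
  also have "\<dots> = (\<integral>x. indicator {0..1} x *\<^sub>R ef (of_int k * x) \<partial>lborel)"
    using AE_lborel_singleton[of "1::real"]
    by (intro integral_cong_AE) (auto elim!: eventually_mono split: split_indicator)
  also have "\<dots> = ?F 1 - ?F 0"
  proof (rule integral_FTC_Icc)
    show "(?F has_vector_derivative ef (of_int k * x)) (at x within {0..1})" for x
      using has_vector_derivative_mult_left[OF ef_has_vector_derivative[of "of_int k" x], of "1 / (2 * pi * \<i> * of_int k)"] False
      by simp
  qed (auto intro!: continuous_intros)
  also have "\<dots> = 0" using ef_of_int[of k] by simp
  finally show ?thesis using False by simp
qed

lemma orthonormal_ef: "orthonormal_family unit_interval (\<lambda>n::int. \<lambda>x. ef (of_int n * x))"
  unfolding orthonormal_family_def
proof (intro conjI allI)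
  show "(\<lambda>x. ef (of_int n * x)) \<in> L2 unit_interval" for n :: int
    by (rule bounded_L2_unit_interval[where B=1]) auto
  fix i j :: int
  have "L2_inner unit_interval (\<lambda>x. ef (of_int i * x)) (\<lambda>x. ef (of_int j * x)) = (\<integral>x. ef (of_int (i - j) * x) \<partial>unit_interval)"
    unfolding L2_inner_def by (simp add: cnj_ef ef_add[symmetric] algebra_simps)
  then show "L2_inner unit_interval (\<lambda>x. ef (of_int i * x)) (\<lambda>x. ef (of_int j * x)) = (if i = j then 1 else 0)"
    unfolding integral_ef_unit_interval by simp
qed

subsection \<open>Trigonometric polynomials\<close>

inductive trig_poly :: "(real \<Rightarrow> complex) \<Rightarrow> bool" where
  monom: "trig_poly (\<lambda>x. c * ef (of_int n * x))"
| add: "trig_poly f \<Longrightarrow> trig_poly g \<Longrightarrow> trig_poly (\<lambda>x. f x + g x)"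

lemma trig_poly_mult_monom: "trig_poly f \<Longrightarrow> trig_poly (\<lambda>x. c * ef (of_int n * x) * f x)"
proof (induction rule: trig_poly.induct)
  case (monom d m)
  have "(\<lambda>x. c * ef (of_int n * x) * (d * ef (of_int m * x))) = (\<lambda>x. (c * d) * ef (of_int (n + m) * x))"
    by (auto simp: fun_eq_iff ef_add algebra_simps)
  then show ?case using trig_poly.monom by metis
qed (simp add: distrib_left trig_poly.add)

lemma trig_poly_mult: "trig_poly f \<Longrightarrow> trig_poly g \<Longrightarrow> trig_poly (\<lambda>x. f x * g x)"
  by (induction rule: trig_poly.induct) (simp_all add: trig_poly_mult_monom distrib_right trig_poly.add)

lemma trig_poly_const: "trig_poly (\<lambda>_. c)"
  using trig_poly.monom[of c 0] by simp

text \<open>Restricted to the circle, the real and imaginary part are combinations of the characters 1 and -1;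
  products and sums stay within trigonometric polynomials.  This identifies the algebra to which the
  Stone--Weierstrass theorem applies.\<close>

lemma trig_poly_real_polynomial:
  "real_polynomial_function p \<Longrightarrow> trig_poly (\<lambda>x. complex_of_real (p (ef x)))"
proof (induction rule: real_polynomial_function.induct)
  case (linear f)
  interpret bounded_linear f by fact
  have "complex_of_real (f (ef x)) = (of_real (f 1) / 2 + of_real (f \<i>) / (2 * \<i>)) * ef (of_int 1 * x) +
      (of_real (f 1) / 2 - of_real (f \<i>) / (2 * \<i>)) * ef (of_int (-1) * x)" for x
  proof -
    have "ef x = Re (ef x) *\<^sub>R 1 + Im (ef x) *\<^sub>R \<i>" by (simp add: complex_eq_iff)
    then have "f (ef x) = Re (ef x) * f 1 + Im (ef x) * f \<i>" using add scaleR by (metis real_scaleR_def)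
    moreover have "complex_of_real (Re (ef x)) = (ef x + ef (- x)) / 2" "complex_of_real (Im (ef x)) = (ef x - ef (- x)) / (2 * \<i>)"
      by (simp_all add: ef_def complex_eq_iff)
    ultimately have "complex_of_real (f (ef x)) = (ef x + ef (- x)) / 2 * of_real (f 1) + (ef x - ef (- x)) / (2 * \<i>) * of_real (f \<i>)"
      by (simp only: of_real_add of_real_mult)
    then show ?thesis
      by (simp only:) (simp add: algebra_simps add_divide_distrib diff_divide_distrib)
  qed
  then show ?case by (simp only: trig_poly.intros)
qed (auto simp: trig_poly_const trig_poly_mult trig_poly.add)

lemma trig_poly_polynomial:
  assumes "polynomial_function (p :: complex \<Rightarrow> complex)"
  shows "trig_poly (\<lambda>x. p (ef x))"
proof -
  have "trig_poly (\<lambda>x. complex_of_real (Re (p (ef x))))" "trig_poly (\<lambda>x. complex_of_real (Im (p (ef x))))"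
    using assms trig_poly_real_polynomial[of "Re \<circ> p"] trig_poly_real_polynomial[of "Im \<circ> p"] bounded_linear_Re bounded_linear_Im
    unfolding polynomial_function_def by (auto simp: o_def)
  then have "trig_poly (\<lambda>x. complex_of_real (Re (p (ef x))) + \<i> * complex_of_real (Im (p (ef x))))"
    by (intro trig_poly.add trig_poly_mult trig_poly_const)
  then show ?thesis by (simp add: complex_eq[symmetric])
qed

lemma trig_poly_sum_rep: "trig_poly f \<Longrightarrow> \<exists>S c. finite S \<and> f = (\<lambda>x. \<Sum>n\<in>S. c n * ef (of_int n * x))"
proof (induction rule: trig_poly.induct)
  case (monom c n)
  show ?case by (intro exI[of _ "{n}"] exI[of _ "\<lambda>_. c"]) auto
next
  case (add f g)
  then obtain S c T d where S: "finite S" "finite T" and f: "f = (\<lambda>x. \<Sum>n\<in>S. c n * ef (of_int n * x))"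
    and g: "g = (\<lambda>x. \<Sum>n\<in>T. d n * ef (of_int n * x))" by auto
  have 1: "f x = (\<Sum>n\<in>S\<union>T. (if n \<in> S then c n else 0) * ef (of_int n * x))" for x
    unfolding f using S by (intro sum.mono_neutral_cong_left) auto
  have 2: "g x = (\<Sum>n\<in>S\<union>T. (if n \<in> T then d n else 0) * ef (of_int n * x))" for x
    unfolding g using S by (intro sum.mono_neutral_cong_left) auto
  have "(\<lambda>x. f x + g x) = (\<lambda>x. \<Sum>n\<in>S\<union>T. ((if n \<in> S then c n else 0) + (if n \<in> T then d n else 0)) * ef (of_int n * x))"
    unfolding 1 2 distrib_right sum.distrib by simp
  with S show ?case by (intro exI conjI) (rule finite_UnI)
qed

lemma ef_eq_iff_unit: "x \<in> {0..1} \<Longrightarrow> y \<in> {0..1} \<Longrightarrow> ef x = ef y \<Longrightarrow> x = y \<or> {x, y} = {0, 1}"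
proof -
  assume *: "x \<in> {0..1}" "y \<in> {0..1}" "ef x = ef y"
  then have "cis (2 * pi * x) = cis (2 * pi * y)" by (simp add: ef_def)
  then have "sin (2 * pi * x) = sin (2 * pi * y) \<and> cos (2 * pi * x) = cos (2 * pi * y)"
    by (auto simp: complex_eq_iff)
  then obtain n :: int where "2 * pi * x = 2 * pi * y + 2 * pi * n"
    using sin_cos_eq_iff[of "2 * pi * x" "2 * pi * y"] by (auto simp: algebra_simps)
  then have "2 * pi * x = 2 * pi * (y + n)" by (simp add: algebra_simps)
  then have n: "x = y + n" by simp
  then have "\<bar>real_of_int n\<bar> \<le> 1" using * by auto
  then have "n = -1 \<or> n = 0 \<or> n = 1" by linarith
  then show ?thesis using n * by auto
qed

lemma ef_surj_sphere: "z \<in> sphere 0 1 \<Longrightarrow> \<exists>x\<in>{0..1}. ef x = z"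
proof -
  assume "z \<in> sphere 0 1"
  then have "cmod z = 1" by simp
  then obtain t where t: "0 \<le> t" "t < 2 * pi" "z = exp (\<i> * of_real t)"
    using Arg2pi[of z] by (metis is_Arg_def mult.left_neutral of_real_1)
  have "ef (t / (2 * pi)) = z" using t by (simp add: ef_def cis_conv_exp)
  moreover have "t / (2 * pi) \<in> {0..1}" using t by simp
  ultimately show ?thesis by blast
qed

text \<open>A continuous function with equal values at the end points descends to the circle, a compact
  subset of the complex plane on which polynomials in the real and imaginary part are dense.\<close>

lemma periodic_continuous_approx:
  assumes g: "continuous_on {0..1::real} g" and g01: "g 0 = g 1" and r: "r > 0"
  shows "\<exists>p. trig_poly p \<and> (\<forall>x\<in>{0..1}. cmod (g x - p x) < r)"
proof -
  define h where "h z = g (SOME x. x \<in> {0..1} \<and> ef x = z)" for z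
  have h: "h (ef x) = g x" if x: "x \<in> {0..1}" for x
  proof -
    define y where "y = (SOME y. y \<in> {0..1} \<and> ef y = ef x)"
    have "y \<in> {0..1} \<and> ef y = ef x" unfolding y_def by (rule someI[of _ x]) (use x in auto)
    then have "y = x \<or> {y, x} = {0, 1}" using ef_eq_iff_unit x by blast
    then have "g y = g x" using g01 by (auto simp: doubleton_eq_iff)
    then show ?thesis by (simp add: h_def y_def)
  qed
  \<comment> \<open>The map from the interval to the circle is closed by compactness, so the descended function is continuous.\<close>
  have "continuous_on (sphere 0 1) h"
  proof (subst continuous_on_closed_vimage, simp, intro allI impI)
    fix C :: "complex set" assume C: "closed C"
    have "h -` C \<inter> sphere 0 1 = ef ` (g -` C \<inter> {0..1})"
    proof safe
      fix z assume z: "h z \<in> C" "z \<in> sphere 0 1"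
      then obtain x where "x \<in> {0..1}" "ef x = z" using ef_surj_sphere by blast
      then show "z \<in> ef ` (g -` C \<inter> {0..1})" using z h by auto
    qed (auto simp: h)
    moreover have "compact (g -` C \<inter> {0..1})"
    proof -
      have "closed (g -` C \<inter> {0..1})" using continuous_on_closed_vimage[of "{0..1}" g] g C by blast
      then have "compact ({0..1} \<inter> (g -` C \<inter> {0..1}))" by (rule compact_Int_closed[OF compact_Icc])
      moreover have "{0..1} \<inter> (g -` C \<inter> {0..1}) = g -` C \<inter> {0..1}" by auto
      ultimately show ?thesis by simp
    qed
    then have "closed (ef ` (g -` C \<inter> {0..1}))"
      by (intro compact_imp_closed compact_continuous_image continuous_on_subset[OF continuous_ef]) auto
    ultimately show "closed (h -` C \<inter> sphere 0 1)" by simp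
  qed
  then obtain q where q: "polynomial_function q" "\<forall>z\<in>sphere 0 1. cmod (h z - q z) < r"
    using Stone_Weierstrass_polynomial_function[of "sphere 0 1" h r] r compact_sphere by blast
  have "\<forall>x\<in>{0..1}. cmod (g x - q (ef x)) < r"
  proof
    fix x :: real assume x: "x \<in> {0..1}"
    have "ef x \<in> sphere 0 1" by simp
    with q(2) have "cmod (h (ef x) - q (ef x)) < r" by blast
    then show "cmod (g x - q (ef x)) < r" by (simp only: h[OF x])
  qed
  then show ?thesis using trig_poly_polynomial[OF q(1)] by blast
qed

subsection \<open>Density in the square-integrable functions on the unit interval\<close>

lemma nsq_dominated_convergence:
  assumes [measurable]: "\<And>n. F n \<in> borel_measurable M" "f \<in> borel_measurable M" "w \<in> borel_measurable M"
    and w: "(\<integral>\<^sup>+x. ennreal ((w x)\<^sup>2) \<partial>M) < \<infinity>" and bd: "\<And>n. AE x in M. cmod (F n x - f x) \<le> w x"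
    and lim: "AE x in M. (\<lambda>n. F n x) \<longlonglongrightarrow> f x"
  shows "(\<lambda>n. nsq M (\<lambda>x. F n x - f x)) \<longlonglongrightarrow> 0"
proof -
  have "(\<lambda>n. \<integral>\<^sup>+x. csq (F n x - f x) \<partial>M) \<longlonglongrightarrow> (\<integral>\<^sup>+x. 0 \<partial>M)"
  proof (rule nn_integral_dominated_convergence[where w = "\<lambda>x. ennreal ((w x)\<^sup>2)"])
    show "AE x in M. csq (F j x - f x) \<le> ennreal ((w x)\<^sup>2)" for j
      using bd[of j] by eventually_elim (intro ennreal_leI power_mono, auto)
    show "AE x in M. (\<lambda>n. csq (F n x - f x)) \<longlonglongrightarrow> 0"
      using lim
    proof eventually_elim
      case (elim x)
      have "(\<lambda>n. (cmod (F n x - f x))\<^sup>2) \<longlonglongrightarrow> (cmod (f x - f x))\<^sup>2"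
        by (intro tendsto_intros elim)
      then show ?case using tendsto_ennrealI by fastforce
    qed
  qed (use w in auto)
  then show ?thesis by (simp add: nsq_def)
qed

text \<open>Lebesgue measurable functions are almost everywhere limits of continuous ones.  To be able to use
  dominated convergence, these are truncated to the ball of radius \<open>B\<close>; to make them periodic, they are
  multiplied by cut-off functions vanishing at the end points of the unit interval.\<close>

lemma continuous_approx_bounded:
  fixes f :: "real \<Rightarrow> complex"
  assumes f: "f \<in> borel_measurable borel" and B: "\<And>x. cmod (f x) \<le> B"
  shows "\<exists>G. (\<forall>n. continuous_on UNIV (G n) \<and> G n 0 = 0 \<and> G n 1 = 0) \<and>
    (\<lambda>n. nsq unit_interval (\<lambda>x. G n x - f x)) \<longlonglongrightarrow> 0"
proof -
  have "f \<in> borel_measurable lebesgue" using f by (simp add: measurable_completion)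
  then have "f measurable_on UNIV" by (rule lebesgue_measurable_imp_measurable_on) auto
  then obtain N g where N: "negligible N" and cg: "\<And>n. continuous_on UNIV (g n)"
    and lim: "\<And>x. x \<notin> N \<Longrightarrow> (\<lambda>n. g n x) \<longlonglongrightarrow> f x"
    unfolding measurable_on_def by auto
  have B0: "B \<ge> 0" using B[of 0] norm_ge_zero order_trans by blast
  \<comment> \<open>Truncation is composition with the nearest point projection onto the ball, a continuous map.\<close>
  define cl where "cl = closest_point (cball (0::complex) B)"
  have ne: "cball (0::complex) B \<noteq> {}" using B0 by simp
  have ccl: "continuous_on UNIV cl" unfolding cl_def by (rule continuous_on_closest_point) (use ne in auto)
  have clB: "cmod (cl z) \<le> B" for z
    using closest_point_in_set[of "cball (0::complex) B" z] ne unfolding cl_def by simp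
  have clf: "cl (f x) = f x" for x unfolding cl_def using B by (simp add: closest_point_self)
  \<comment> \<open>The cut-off is 0 at both end points and increases to 1 at every interior point.\<close>
  define c where "c n x = min 1 (real n * max 0 (x * (1 - x)))" for n :: nat and x :: real
  have cc: "continuous_on UNIV (c n)" for n unfolding c_def by (intro continuous_intros)
  have c01: "0 \<le> c n x" "c n x \<le> 1" for n x unfolding c_def by auto
  have clim: "(\<lambda>n. c n x) \<longlonglongrightarrow> 1" if x: "0 < x" "x < 1" for x
  proof (rule tendsto_eventually)
    have p: "x * (1 - x) > 0" using x by simp
    obtain n0 :: nat where n0: "1 / (x * (1 - x)) \<le> real n0" using real_arch_simple by blast
    show "\<forall>\<^sub>F n in sequentially. c n x = 1"
      using eventually_ge_at_top[of n0]
    proof eventually_elim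
      case (elim n)
      then have "1 / (x * (1 - x)) \<le> real n" using n0 by linarith
      then have "1 \<le> real n * (x * (1 - x))" using p by (simp add: field_simps)
      then show ?case using p by (simp add: c_def)
    qed
  qed
  define G where "G n x = of_real (c n x) * cl (g n x)" for n x
  have cG: "continuous_on UNIV (G n)" for n
    unfolding G_def by (intro continuous_intros cc continuous_on_compose2[OF ccl] cg) auto
  have GB: "cmod (G n x) \<le> B" for n x
  proof -
    have "cmod (G n x) \<le> 1 * B" unfolding G_def norm_mult
      by (intro mult_mono clB) (use c01 in auto)
    then show ?thesis by simp
  qed
  note [measurable] = f borel_measurable_continuous_onI[OF cG]
  have "(\<lambda>n. nsq unit_interval (\<lambda>x. G n x - f x)) \<longlonglongrightarrow> 0"
  proof (rule nsq_dominated_convergence[where w = "\<lambda>_. 2 * B"])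
    show "AE x in unit_interval. cmod (G n x - f x) \<le> 2 * B" for n
    proof (intro AE_I2)
      fix x show "cmod (G n x - f x) \<le> 2 * B" using norm_triangle_ineq4[of "G n x" "f x"] GB[of n x] B[of x] by linarith
    qed
    have "N \<in> null_sets lebesgue" using N by (simp add: negligible_iff_null_sets)
    then have "AE x in lebesgue. x \<notin> N" by (rule AE_not_in)
    then have "AE x in lborel. x \<notin> N" by (simp add: AE_completion_iff)
    moreover have "AE x in lborel. x \<noteq> (0::real)" by (rule AE_lborel_singleton)
    ultimately have "AE x in lborel. x \<in> {0..<1} \<longrightarrow> (\<lambda>n. G n x) \<longlonglongrightarrow> f x"
    proof eventually_elim
      case (elim x)
      show ?case
      proof
        assume x: "x \<in> {0..<1}"
        have "(\<lambda>n. cl (g n x)) \<longlonglongrightarrow> cl (f x)"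
          by (rule continuous_on_tendsto_compose[OF ccl lim]) (use elim in auto)
        then have "(\<lambda>n. G n x) \<longlonglongrightarrow> of_real 1 * cl (f x)"
          unfolding G_def using x elim by (intro tendsto_intros clim) auto
        then show "(\<lambda>n. G n x) \<longlonglongrightarrow> f x" by (simp add: clf)
      qed
    qed
    then show "AE x in unit_interval. (\<lambda>n. G n x) \<longlonglongrightarrow> f x"
      by (simp add: AE_unit_interval)
  qed (auto simp: emeasure_unit_interval)
  moreover have "G n 0 = 0" "G n 1 = 0" for n by (auto simp: G_def c_def)
  ultimately show ?thesis using cG by blast
qed

lemma nsq_unit_interval_le: "(\<And>x. x \<in> {0..1} \<Longrightarrow> cmod (f x) \<le> r) \<Longrightarrow> nsq unit_interval f \<le> ennreal (r\<^sup>2)"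
proof -
  assume *: "\<And>x. x \<in> {0..1} \<Longrightarrow> cmod (f x) \<le> r"
  have "nsq unit_interval f \<le> (\<integral>\<^sup>+x. ennreal (r\<^sup>2) \<partial>unit_interval)"
    unfolding nsq_def using *
    by (intro nn_integral_mono_AE) (auto simp: AE_unit_interval intro!: ennreal_leI power_mono)
  also have "\<dots> = ennreal (r\<^sup>2)" by simp
  finally show ?thesis .
qed

lemma trig_poly_measurable: "trig_poly p \<Longrightarrow> p \<in> borel_measurable borel"
  by (induction rule: trig_poly.induct) auto

lemma two_ennreal_add: "a \<ge> 0 \<Longrightarrow> b \<ge> 0 \<Longrightarrow> 2 * ennreal a + 2 * ennreal b = ennreal (2 * a + 2 * b)"
  by (simp add: ennreal_mult')

text \<open>Three approximations: by bounded functions (truncation), then by continuous functions that vanish at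
  the end points, then uniformly by trigonometric polynomials.\<close>

lemma trig_poly_dense:
  assumes f: "f \<in> L2 unit_interval" and s: "s > 0"
  shows "\<exists>p. trig_poly p \<and> nsq unit_interval (\<lambda>x. f x - p x) < ennreal s"
proof -
  have [measurable]: "f \<in> borel_measurable borel" using L2_measurable[OF f] by simp
  define F where "F n x = (if cmod (f x) \<le> real n then f x else 0)" for n :: nat and x
  have [measurable]: "F n \<in> borel_measurable borel" for n unfolding F_def by measurable
  have "(\<lambda>n. nsq unit_interval (\<lambda>x. F n x - f x)) \<longlonglongrightarrow> 0"
  proof (rule nsq_dominated_convergence[where w = "\<lambda>x. cmod (f x)"])
    show "AE x in unit_interval. (\<lambda>n. F n x) \<longlonglongrightarrow> f x"
    proof (intro AE_I2 tendsto_eventually)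
      fix x
      obtain n0 :: nat where n0: "cmod (f x) \<le> n0" using real_arch_simple by blast
      show "\<forall>\<^sub>F n in sequentially. F n x = f x"
        using eventually_ge_at_top[of n0] by eventually_elim (use n0 in \<open>auto simp: F_def\<close>)
    qed
  qed (use f in \<open>auto simp: F_def L2_iff_nsq nsq_def\<close>)
  then have "\<forall>\<^sub>F n in sequentially. nsq unit_interval (\<lambda>x. F n x - f x) < ennreal (s / 8)"
    by (rule order_tendstoD(2)) (use s in simp)
  then obtain n where n: "nsq unit_interval (\<lambda>x. F n x - f x) < ennreal (s / 8)"
    using eventually_happens'[OF sequentially_bot] by blast
  have "cmod (F n x) \<le> real n" for x by (auto simp: F_def)
  then obtain G where cG: "\<And>k. continuous_on UNIV (G k)" and G01: "\<And>k. G k 0 = 0" "\<And>k. G k 1 = 0"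
    and limG: "(\<lambda>k. nsq unit_interval (\<lambda>x. G k x - F n x)) \<longlonglongrightarrow> 0"
    using continuous_approx_bounded[of "F n" "real n"] by auto
  from limG have "\<forall>\<^sub>F k in sequentially. nsq unit_interval (\<lambda>x. G k x - F n x) < ennreal (s / 16)"
    by (rule order_tendstoD(2)) (use s in simp)
  then obtain k where k: "nsq unit_interval (\<lambda>x. G k x - F n x) < ennreal (s / 16)"
    using eventually_happens'[OF sequentially_bot] by blast
  obtain p where p: "trig_poly p" "\<And>x. x \<in> {0..1} \<Longrightarrow> cmod (G k x - p x) < sqrt (s / 16)"
    using periodic_continuous_approx[of "G k" "sqrt (s / 16)"] s continuous_on_subset[OF cG[of k] subset_UNIV] G01[of k]
    by auto
  note [measurable] = trig_poly_measurable[OF p(1)] borel_measurable_continuous_onI[OF cG]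
  have "nsq unit_interval (\<lambda>x. G k x - p x) \<le> ennreal ((sqrt (s / 16))\<^sup>2)"
    by (intro nsq_unit_interval_le less_imp_le p)
  \<comment> \<open>The three errors are combined with the inequality \<open>\<parallel>a + b\<parallel>\<^sup>2 \<le> 2\<parallel>a\<parallel>\<^sup>2 + 2\<parallel>b\<parallel>\<^sup>2\<close>, applied twice.\<close>
  then have 1: "nsq unit_interval (\<lambda>x. G k x - p x) \<le> ennreal (s / 16)" using s by simp
  have "nsq unit_interval (\<lambda>x. F n x - p x) \<le> 2 * nsq unit_interval (\<lambda>x. F n x - G k x) + 2 * nsq unit_interval (\<lambda>x. G k x - p x)"
    by (rule nsq_diff_triangle) auto
  also have "\<dots> \<le> 2 * ennreal (s / 16) + 2 * ennreal (s / 16)"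
    using k 1 unfolding nsq_minus_commute[of _ "F n"] by (intro add_mono mult_left_mono) auto
  also have "\<dots> = ennreal (s / 4)" using s by (subst two_ennreal_add) auto
  finally have 2: "nsq unit_interval (\<lambda>x. F n x - p x) \<le> ennreal (s / 4)" .
  have "nsq unit_interval (\<lambda>x. f x - p x) \<le> 2 * nsq unit_interval (\<lambda>x. f x - F n x) + 2 * nsq unit_interval (\<lambda>x. F n x - p x)"
    by (rule nsq_diff_triangle) auto
  also have "\<dots> \<le> 2 * ennreal (s / 8) + 2 * ennreal (s / 4)"
    using n 2 unfolding nsq_minus_commute[of _ f] by (intro add_mono mult_left_mono) auto
  also have "\<dots> = ennreal (3 * s / 4)" using s by (subst two_ennreal_add) auto
  also have "\<dots> < ennreal s" using s by (intro ennreal_lessI) auto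
  finally show ?thesis using p(1) by blast
qed

lemma nn_sum_int_uminus: "(\<Sum>\<^sup>+n. \<phi> (- n)) = (\<Sum>\<^sup>+n. \<phi> (n::int))"
  by (rule nn_integral_bij_count_space[where g = uminus]) (rule bij_uminus)

theorem fourier_series_parseval:
  assumes f: "f \<in> L2 unit_interval"
  shows "(\<Sum>\<^sup>+n. csq (\<integral>x. f x * ef (of_int n * x) \<partial>unit_interval)) = nsq unit_interval f"
proof -
  let ?u = "\<lambda>n::int. \<lambda>x. ef (of_int n * x)"
  have "((\<lambda>n. (cmod (L2_inner unit_interval f (?u n)))\<^sup>2) has_sum (L2_norm unit_interval f)\<^sup>2) UNIV"
  proof (rule has_sum_of_dense[OF orthonormal_ef f])
    fix r :: real assume r: "r > 0"
    obtain p where p: "trig_poly p" "nsq unit_interval (\<lambda>x. f x - p x) < ennreal (r\<^sup>2)"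
      using trig_poly_dense[OF f, of "r\<^sup>2"] r by auto
    obtain S c where S: "finite S" "p = (\<lambda>x. \<Sum>n\<in>S. c n * ef (of_int n * x))" using trig_poly_sum_rep[OF p(1)] by blast
    have "(\<lambda>x. f x - p x) \<in> L2 unit_interval"
      using L2_measurable[OF f] p(2) trig_poly_measurable[OF p(1)] unfolding L2_iff_nsq
      by (auto simp: less_top[symmetric])
    then have "(L2_norm unit_interval (\<lambda>x. f x - p x))\<^sup>2 < r\<^sup>2"
      using p(2) by (simp add: nsq_eq_L2_norm ennreal_less_iff)
    then have "L2_norm unit_interval (\<lambda>x. f x - p x) < r" using r by (simp add: power_less_imp_less_base)
    then show "\<exists>S p. finite S \<and> L2_norm unit_interval (\<lambda>x. f x - (\<Sum>n\<in>S. p n * ef (of_int n * x))) < r"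
      using S by blast
  qed
  then have "(\<Sum>\<^sup>+n. csq (L2_inner unit_interval f (?u n))) = nsq unit_interval f"
    by (subst (asm) nn_integral_count_space_has_sum) (auto simp: nsq_eq_L2_norm[OF f])
  also have "(\<Sum>\<^sup>+n. csq (L2_inner unit_interval f (?u n))) =
     (\<Sum>\<^sup>+n. csq (\<integral>x. f x * ef (of_int (- n) * x) \<partial>unit_interval))"
    by (simp add: L2_inner_def cnj_ef)
  also have "\<dots> = (\<Sum>\<^sup>+n. csq (\<integral>x. f x * ef (of_int n * x) \<partial>unit_interval))"
    by (rule nn_sum_int_uminus)
  finally show ?thesis .
qed

section \<open>Tiling the line by integer translates of the unit interval\<close>

lemma nn_integral_tile:
  assumes [measurable]: "f \<in> borel_measurable borel"
  shows "(\<integral>\<^sup>+x. f x \<partial>lborel) = (\<integral>\<^sup>+x. (\<Sum>\<^sup>+n. f (x + of_int n)) \<partial>unit_interval)"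
proof -
  have "(\<integral>\<^sup>+x. f x \<partial>lborel) = (\<integral>\<^sup>+x. (\<Sum>\<^sup>+n. f x * indicator {of_int n..<of_int n + 1} x) \<partial>lborel)"
  proof (rule nn_integral_cong)
    fix x :: real
    have "indicator {of_int n..<of_int n + 1} x = (indicator {\<lfloor>x\<rfloor>} n :: ennreal)" for n :: int
      using floor_eq_iff[of x n] by (auto simp: indicator_def)
    then show "f x = (\<Sum>\<^sup>+n. f x * indicator {of_int n..<of_int n + 1} x)"
      by (simp add: nn_integral_cmult)
  qed
  also have "\<dots> = (\<Sum>\<^sup>+n. (\<integral>\<^sup>+x. f x * indicator {of_int n..<of_int n + 1} x \<partial>lborel))"
    by (rule nn_integral_count_space_nn_integral) auto
  also have "\<dots> = (\<Sum>\<^sup>+n. (\<integral>\<^sup>+x. indicator {0..<1} x * f (x + of_int n) \<partial>lborel))"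
  proof (rule nn_integral_cong)
    fix n :: int
    have "(\<integral>\<^sup>+x. f x * indicator {of_int n..<of_int n + 1} x \<partial>lborel) =
       (\<integral>\<^sup>+x. f (of_int n + x) * indicator {of_int n..<of_int n + 1} (of_int n + x) \<partial>lborel)"
      by (subst nn_integral_real_affine[where c=1 and t="of_int n"]) auto
    also have "\<dots> = (\<integral>\<^sup>+x. indicator {0..<1} x * f (x + of_int n) \<partial>lborel)"
      by (intro nn_integral_cong) (auto simp: indicator_def add.commute)
    finally show "(\<integral>\<^sup>+x. f x * indicator {of_int n..<of_int n + 1} x \<partial>lborel) = (\<integral>\<^sup>+x. indicator {0..<1} x * f (x + of_int n) \<partial>lborel)" .
  qed
  also have "\<dots> = (\<Sum>\<^sup>+n. (\<integral>\<^sup>+x. f (x + of_int n) \<partial>unit_interval))"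
    by (simp add: nn_integral_unit_interval)
  also have "\<dots> = (\<integral>\<^sup>+x. (\<Sum>\<^sup>+n. f (x + of_int n)) \<partial>unit_interval)"
    by (rule nn_integral_count_space_nn_integral[symmetric]) auto
  finally show ?thesis .
qed

lemma pair_sigma_finite_unit_interval_int: "pair_sigma_finite unit_interval (count_space (UNIV :: int set))"
  by (intro pair_sigma_finite.intro sigma_finite_unit_interval sigma_finite_measure_count_space)

text \<open>The Bochner integral analogue of the tiling formula, in the form of an equality of measures from which
  it follows with its integrability statement by Fubini's theorem.\<close>

lemma distr_tile:
  "distr (unit_interval \<Otimes>\<^sub>M count_space (UNIV :: int set)) borel (\<lambda>p. fst p + of_int (snd p)) = lborel"
proof (rule measure_eqI)
  interpret pair_sigma_finite unit_interval "count_space (UNIV :: int set)"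
    by (rule pair_sigma_finite_unit_interval_int)
  fix A :: "real set" assume "A \<in> sets (distr (unit_interval \<Otimes>\<^sub>M count_space (UNIV :: int set)) borel (\<lambda>p. fst p + of_int (snd p)))"
  then have [measurable]: "A \<in> sets borel" by simp
  have "emeasure (distr (unit_interval \<Otimes>\<^sub>M count_space (UNIV :: int set)) borel (\<lambda>p. fst p + of_int (snd p))) A =
     (\<integral>\<^sup>+p. indicator A (fst p + of_int (snd p)) \<partial>(unit_interval \<Otimes>\<^sub>M count_space (UNIV :: int set)))"
    (is "emeasure ?D A = _")
  proof -
    have "emeasure ?D A = (\<integral>\<^sup>+x. indicator A x \<partial>?D)" by (rule nn_integral_indicator[symmetric]) simp
    also have "\<dots> = (\<integral>\<^sup>+p. indicator A (fst p + of_int (snd p)) \<partial>(unit_interval \<Otimes>\<^sub>M count_space (UNIV :: int set)))"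
      by (rule nn_integral_distr) auto
    finally show ?thesis .
  qed
  also have "\<dots> = (\<integral>\<^sup>+x. (\<Sum>\<^sup>+n. indicator A (x + of_int n)) \<partial>unit_interval)"
    by (subst M2.nn_integral_fst[symmetric]) auto
  also have "\<dots> = emeasure lborel A"
    by (subst nn_integral_tile[symmetric]) auto
  finally show "emeasure (distr (unit_interval \<Otimes>\<^sub>M count_space (UNIV :: int set)) borel (\<lambda>p. fst p + of_int (snd p))) A = emeasure lborel A" .
qed simp

lemma integral_tile:
  fixes f :: "real \<Rightarrow> complex"
  assumes f: "integrable lborel f"
  shows "AE x in unit_interval. integrable (count_space UNIV) (\<lambda>n::int. f (x + of_int n))"
    and "(\<integral>x. f x \<partial>lborel) = (\<integral>x. (\<integral>n. f (x + of_int n) \<partial>count_space (UNIV :: int set)) \<partial>unit_interval)"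
proof -
  interpret pair_sigma_finite unit_interval "count_space (UNIV :: int set)"
    by (rule pair_sigma_finite_unit_interval_int)
  have [measurable]: "f \<in> borel_measurable borel" using f by auto
  have "integrable (distr (unit_interval \<Otimes>\<^sub>M count_space (UNIV :: int set)) borel (\<lambda>p. fst p + of_int (snd p))) f"
    using f by (simp add: distr_tile)
  then have int: "integrable (unit_interval \<Otimes>\<^sub>M count_space (UNIV :: int set)) (\<lambda>p. f (fst p + of_int (snd p)))"
    by (subst (asm) integrable_distr_eq) auto
  show "AE x in unit_interval. integrable (count_space UNIV) (\<lambda>n::int. f (x + of_int n))"
    using AE_integrable_fst'[OF int] by simp
  have "(\<integral>x. f x \<partial>lborel) = (\<integral>p. f (fst p + of_int (snd p)) \<partial>(unit_interval \<Otimes>\<^sub>M count_space (UNIV :: int set)))"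
    by (subst distr_tile[symmetric], subst integral_distr) auto
  also have "\<dots> = (\<integral>x. (\<integral>n. f (x + of_int n) \<partial>count_space (UNIV :: int set)) \<partial>unit_interval)"
    by (subst integral_fst'[symmetric]) (use int in auto)
  finally show "(\<integral>x. f x \<partial>lborel) = (\<integral>x. (\<integral>n. f (x + of_int n) \<partial>count_space (UNIV :: int set)) \<partial>unit_interval)" .
qed

lemma AE_unit_interval_of_lborel: "(AE x in lborel. P x) \<Longrightarrow> (AE x in unit_interval. P x)"
  by (auto simp: AE_unit_interval)

text \<open>The sum \<open>H\<close> of the integer translates of \<open>h\<close> has the same coefficients at the integer frequencies as
  \<open>h\<close>.  By the disjointness assumption at most one term of the sum is nonzero at almost every point,
  so \<open>H\<close> also has the same norm, and Parseval's identity on the unit interval applies to it.\<close>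

lemma parseval_packing:
  fixes h :: "real \<Rightarrow> complex"
  assumes [measurable]: "h \<in> borel_measurable borel" and fin: "nsq lborel h < \<infinity>"
    and pack: "AE x in lborel. \<forall>m n::int. h (x + of_int m) \<noteq> 0 \<longrightarrow> h (x + of_int n) \<noteq> 0 \<longrightarrow> m = n"
  shows "integrable lborel h"
    and "(\<Sum>\<^sup>+n. csq (\<integral>x. h x * ef (of_int n * x) \<partial>lborel)) = nsq lborel h"
proof -
  interpret C: sigma_finite_measure "count_space (UNIV :: int set)" by (rule sigma_finite_measure_count_space)
  define H where "H x = (\<integral>n. h (x + of_int n) \<partial>count_space (UNIV :: int set))" for x
  have [measurable]: "H \<in> borel_measurable borel" unfolding H_def by measurable
  have single: "\<exists>k. \<forall>n. n \<noteq> k \<longrightarrow> h (x + of_int n) = 0"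
    if "\<forall>m n::int. h (x + of_int m) \<noteq> 0 \<longrightarrow> h (x + of_int n) \<noteq> 0 \<longrightarrow> m = n" for x
    using that by metis
  have Hx: "H x = h (x + of_int k)" and nnx: "\<And>\<phi>. \<phi> 0 = 0 \<Longrightarrow> (\<Sum>\<^sup>+n. ennreal (\<phi> (h (x + of_int n)))) = ennreal (\<phi> (h (x + of_int k)))"
    if k: "\<forall>n. n \<noteq> k \<longrightarrow> h (x + of_int n) = 0" for x and k :: int
  proof -
    have eq: "{a \<in> UNIV. h (x + real_of_int a) \<noteq> 0} \<subseteq> {k}" using k by auto
    then have "finite {a \<in> UNIV. h (x + real_of_int a) \<noteq> 0}" using finite_subset by blast
    then have "H x = (\<Sum>a | a \<in> UNIV \<and> h (x + real_of_int a) \<noteq> 0. h (x + of_int a))"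
      unfolding H_def by (rule lebesgue_integral_count_space_finite_support)
    also have "\<dots> = (\<Sum>a\<in>{k}. h (x + of_int a))"
      by (intro sum.mono_neutral_left) (use eq in auto)
    finally show "H x = h (x + of_int k)" by simp
    fix \<phi> :: "complex \<Rightarrow> real" assume "\<phi> 0 = 0"
    then have eq: "ennreal (\<phi> (h (x + of_int n))) = ennreal (\<phi> (h (x + of_int k))) * indicator {k} n" for n
      using k by (auto simp: indicator_def)
    have "(\<Sum>\<^sup>+n. ennreal (\<phi> (h (x + of_int n)))) = (\<Sum>\<^sup>+n. ennreal (\<phi> (h (x + of_int k))) * indicator {k} n)"
      by (rule nn_integral_cong) (rule eq)
    then show "(\<Sum>\<^sup>+n. ennreal (\<phi> (h (x + of_int n)))) = ennreal (\<phi> (h (x + of_int k)))"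
      by (simp add: nn_integral_cmult)
  qed
  have AE\<phi>: "AE x in unit_interval. (\<Sum>\<^sup>+n. ennreal (\<phi> (h (x + of_int n)))) = ennreal (\<phi> (H x))"
    if "\<phi> 0 = 0" for \<phi> :: "complex \<Rightarrow> real"
    using AE_unit_interval_of_lborel[OF pack]
  proof eventually_elim
    case (elim x)
    then obtain k where k: "\<forall>n. n \<noteq> k \<longrightarrow> h (x + of_int n) = 0" using single by blast
    show ?case using Hx[OF k] nnx[OF k, of \<phi>] that by simp
  qed
  \<comment> \<open>Applied to the squared modulus for the norms, and to the modulus for integrability.\<close>
  have tile\<phi>: "(\<integral>\<^sup>+x. ennreal (\<phi> (h x)) \<partial>lborel) = (\<integral>\<^sup>+x. ennreal (\<phi> (H x)) \<partial>unit_interval)"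
    if "\<phi> 0 = 0" and [measurable]: "\<phi> \<in> borel_measurable borel" for \<phi> :: "complex \<Rightarrow> real"
  proof -
    have "(\<integral>\<^sup>+x. ennreal (\<phi> (h x)) \<partial>lborel) = (\<integral>\<^sup>+x. (\<Sum>\<^sup>+n. ennreal (\<phi> (h (x + of_int n)))) \<partial>unit_interval)"
      by (rule nn_integral_tile) measurable
    also have "\<dots> = (\<integral>\<^sup>+x. ennreal (\<phi> (H x)) \<partial>unit_interval)"
      by (rule nn_integral_cong_AE) (rule AE\<phi>, fact)
    finally show ?thesis .
  qed
  have nsqH: "nsq unit_interval H = nsq lborel h"
    unfolding nsq_def by (rule tile\<phi>[symmetric]) auto
  have HL2: "H \<in> L2 unit_interval" using fin by (simp add: L2_iff_nsq nsqH)
  have "(\<integral>\<^sup>+x. ennreal (cmod (H x * 1)) \<partial>unit_interval)\<^sup>2 \<le> nsq unit_interval H * nsq unit_interval (\<lambda>_. 1)"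
    by (rule L2_Cauchy_Schwarz_nsq) auto
  also have "nsq unit_interval (\<lambda>_. 1) = 1" by (simp add: nsq_def)
  also have "nsq unit_interval H * 1 < \<infinity>" using fin by (simp add: nsqH)
  finally have "(\<integral>\<^sup>+x. ennreal (cmod (H x)) \<partial>unit_interval) < \<infinity>"
    by (simp add: power_less_top_ennreal)
  moreover have "(\<integral>\<^sup>+x. ennreal (cmod (h x)) \<partial>lborel) = (\<integral>\<^sup>+x. ennreal (cmod (H x)) \<partial>unit_interval)"
    by (rule tile\<phi>) auto
  ultimately show int: "integrable lborel h"
    by (intro integrableI_bounded) auto
  have "(\<integral>x. h x * ef (of_int n * x) \<partial>lborel) = (\<integral>x. H x * ef (of_int n * x) \<partial>unit_interval)" for n :: int
  proof -
    have "integrable lborel (\<lambda>x. h x * ef (of_int n * x))"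
      by (rule Bochner_Integration.integrable_bound[OF int]) (auto simp: norm_mult)
    then have "(\<integral>x. h x * ef (of_int n * x) \<partial>lborel) =
        (\<integral>x. (\<integral>k. h (x + of_int k) * ef (of_int n * (x + of_int k)) \<partial>count_space (UNIV :: int set)) \<partial>unit_interval)"
      by (rule integral_tile)
    also have "\<dots> = (\<integral>x. H x * ef (of_int n * x) \<partial>unit_interval)"
    proof (rule Bochner_Integration.integral_cong[OF refl])
      fix x
      have "ef (of_int n * (x + of_int k)) = ef (of_int n * x)" for k :: int
        using ef_of_int[of "n * k"] by (simp add: distrib_left ef_add)
      then show "(\<integral>k. h (x + of_int k) * ef (of_int n * (x + of_int k)) \<partial>count_space (UNIV :: int set)) = H x * ef (of_int n * x)"
        by (simp add: H_def)
    qed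
    finally show ?thesis .
  qed
  then show "(\<Sum>\<^sup>+n. csq (\<integral>x. h x * ef (of_int n * x) \<partial>lborel)) = nsq lborel h"
    using fourier_series_parseval[OF HL2] by (simp add: nsqH)
qed

section \<open>The Plancherel theorem on the line\<close>

text \<open>The sign of the exponent is the one with which the central variable enters the representations
  \<open>\<pi>\<^sub>\<lambda>\<close>.\<close>

definition ft :: "(real \<Rightarrow> complex) \<Rightarrow> real \<Rightarrow> complex" where
  "ft f w = (\<integral>x. f x * ef (w * x) \<partial>lborel)"

text \<open>Parseval's identity read backwards: the sum of an absolutely convergent Fourier series is bounded,
  hence square-integrable, and its coefficients are the given ones up to the sign of the index.\<close>

lemma nsq_fourier_series_summable:
  fixes a :: "int \<Rightarrow> complex"
  assumes a: "integrable (count_space UNIV) a"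
  shows "nsq unit_interval (\<lambda>t. \<integral>k. a k * ef (t * of_int k) \<partial>count_space UNIV) = (\<Sum>\<^sup>+k. csq (a k))"
proof -
  interpret pair_sigma_finite unit_interval "count_space (UNIV :: int set)"
    by (rule pair_sigma_finite_unit_interval_int)
  define g where "g t = (\<integral>k. a k * ef (t * of_int k) \<partial>count_space UNIV)" for t
  have [measurable]: "g \<in> borel_measurable borel" unfolding g_def by measurable
  have "cmod (g t) \<le> (\<integral>k. cmod (a k) \<partial>count_space UNIV)" for t
    unfolding g_def using integral_norm_bound[of "count_space UNIV" "\<lambda>k. a k * ef (t * of_int k)"]
    by (simp add: norm_mult)
  then have "g \<in> L2 unit_interval" by (intro bounded_L2_unit_interval) auto
  then have "nsq unit_interval g = (\<Sum>\<^sup>+n. csq (\<integral>t. g t * ef (of_int n * t) \<partial>unit_interval))"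
    by (rule fourier_series_parseval[symmetric])
  also have "\<dots> = (\<Sum>\<^sup>+n. csq (a (- n)))"
  proof (rule nn_integral_cong)
    fix n :: int
    have "integrable (unit_interval \<Otimes>\<^sub>M count_space UNIV) (\<lambda>p. a (snd p) * ef (fst p * of_int (snd p)) * ef (of_int n * fst p))"
    proof (rule integrableI_bounded)
      have "(\<integral>\<^sup>+p. ennreal (norm (a (snd p) * ef (fst p * of_int (snd p)) * ef (of_int n * fst p))) \<partial>(unit_interval \<Otimes>\<^sub>M count_space UNIV))
         = (\<integral>\<^sup>+x. (\<Sum>\<^sup>+k. ennreal (norm (a k))) \<partial>unit_interval)"
        by (subst M2.nn_integral_fst[symmetric]) (auto simp: norm_mult)
      also have "\<dots> < \<infinity>" using a by (simp add: integrable_iff_bounded)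
      finally show "(\<integral>\<^sup>+p. ennreal (norm (a (snd p) * ef (fst p * of_int (snd p)) * ef (of_int n * fst p))) \<partial>(unit_interval \<Otimes>\<^sub>M count_space UNIV)) < \<infinity>" .
    qed measurable
    then have int: "integrable (unit_interval \<Otimes>\<^sub>M count_space UNIV) (\<lambda>(t, k). a k * ef (t * of_int k) * ef (of_int n * t))"
      by (simp add: case_prod_beta')
    have "(\<integral>t. g t * ef (of_int n * t) \<partial>unit_interval) = (\<integral>t. (\<integral>k. a k * ef (t * of_int k) * ef (of_int n * t) \<partial>count_space UNIV) \<partial>unit_interval)"
      by (simp add: g_def)
    also have "\<dots> = (\<integral>k. (\<integral>t. a k * ef (t * of_int k) * ef (of_int n * t) \<partial>unit_interval) \<partial>count_space UNIV)"
      by (rule Fubini_integral[OF int, symmetric])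
    also have "\<dots> = (\<integral>k. (if k = - n then a k else 0) \<partial>count_space UNIV)"
    proof (rule Bochner_Integration.integral_cong[OF refl])
      fix k :: int
      have "(\<integral>t. a k * ef (t * of_int k) * ef (of_int n * t) \<partial>unit_interval) = a k * (\<integral>t. ef (of_int (k + n) * t) \<partial>unit_interval)"
        by (simp add: mult.assoc ef_add[symmetric] algebra_simps)
      also have "\<dots> = (if k = - n then a k else 0)"
        unfolding integral_ef_unit_interval by auto
      finally show "(\<integral>t. a k * ef (t * of_int k) * ef (of_int n * t) \<partial>unit_interval) = (if k = - n then a k else 0)" .
    qed
    also have "\<dots> = a (- n)"
    proof -
      have *: "{k \<in> UNIV. (if k = - n then a k else 0) \<noteq> 0} \<subseteq> {- n}" by auto
      have "(\<integral>k. (if k = - n then a k else 0) \<partial>count_space UNIV) = (\<Sum>k | k \<in> UNIV \<and> (if k = - n then a k else 0) \<noteq> 0. if k = - n then a k else 0)"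
        by (rule lebesgue_integral_count_space_finite_support) (use * finite_subset in blast)
      also have "\<dots> = (\<Sum>k\<in>{- n}. if k = - n then a k else 0)"
        by (rule sum.mono_neutral_left) (use * in auto)
      finally show ?thesis by simp
    qed
    finally show "csq (\<integral>t. g t * ef (of_int n * t) \<partial>unit_interval) = csq (a (- n))" by simp
  qed
  also have "\<dots> = (\<Sum>\<^sup>+k. csq (a k))"
    by (rule nn_sum_int_uminus)
  finally show ?thesis by (simp add: g_def[abs_def])
qed

text \<open>The values of the transform along \<open>t + \<int>\<close> are the Fourier coefficients of
  \<open>F t x = \<Sum>\<^sub>k f(x+k) e(t(x+k))\<close> as a function of \<open>x\<close>, so the squared norm of the transform is
  the integral of \<open>|F t x|\<^sup>2\<close> over \<open>x\<close> and \<open>t\<close> in the unit interval.  For fixed \<open>x\<close>, up to the unimodular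
  factor \<open>e(tx)\<close>, the function \<open>F\<close> is the Fourier series in \<open>t\<close> with coefficients \<open>f(x+k)\<close>; integrating
  in the other order gives \<open>\<Sum>\<^sub>k |f(x+k)|\<^sup>2\<close> integrated over the unit interval, which is the squared norm
  of \<open>f\<close>.\<close>

theorem plancherel_line:
  assumes f: "integrable lborel f" and fin: "nsq lborel f < \<infinity>"
  shows "nsq lborel (ft f) = nsq lborel f"
proof -
  interpret pair_sigma_finite unit_interval "count_space (UNIV :: int set)"
    by (rule pair_sigma_finite_unit_interval_int)
  interpret U: pair_sigma_finite unit_interval unit_interval
    by (intro pair_sigma_finite.intro sigma_finite_unit_interval)
  have [measurable]: "f \<in> borel_measurable borel" using f by auto
  define F where "F t x = (\<integral>k. f (x + of_int k) * ef (t * (x + of_int k)) \<partial>count_space (UNIV :: int set))" for t x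
  have Fm [measurable]: "(\<lambda>p. F (fst p) (snd p)) \<in> borel_measurable (borel \<Otimes>\<^sub>M borel)"
    unfolding F_def by measurable
  have [measurable]: "F t \<in> borel_measurable borel" for t unfolding F_def by measurable
  have [measurable]: "(\<lambda>t. F t x) \<in> borel_measurable borel" for x unfolding F_def by measurable
  have [measurable]: "ft f \<in> borel_measurable borel" unfolding ft_def by measurable
  have "(\<integral>\<^sup>+t. nsq unit_interval (F t) \<partial>unit_interval) = (\<integral>\<^sup>+x. nsq unit_interval (\<lambda>t. F t x) \<partial>unit_interval)"
    unfolding nsq_def by (subst U.Fubini') (auto simp: case_prod_beta')
  also have "\<dots> = (\<integral>\<^sup>+x. (\<Sum>\<^sup>+k. csq (f (x + of_int k))) \<partial>unit_interval)"
  proof (rule nn_integral_cong_AE)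
    show "AE x in unit_interval. nsq unit_interval (\<lambda>t. F t x) = (\<Sum>\<^sup>+k. csq (f (x + of_int k)))"
      using integral_tile(1)[OF f]
    proof eventually_elim
      case (elim x)
      have "F t x = ef (t * x) * (\<integral>k. f (x + of_int k) * ef (t * of_int k) \<partial>count_space (UNIV :: int set))" for t
        unfolding F_def by (subst Bochner_Integration.integral_mult_right_zero[symmetric]) (simp add: distrib_left ef_add mult_ac)
      then have "nsq unit_interval (\<lambda>t. F t x) = nsq unit_interval (\<lambda>t. \<integral>k. f (x + of_int k) * ef (t * of_int k) \<partial>count_space (UNIV :: int set))"
        by (simp add: nsq_def norm_mult)
      also have "\<dots> = (\<Sum>\<^sup>+k. csq (f (x + of_int k)))"
        by (rule nsq_fourier_series_summable[OF elim])
      finally show ?case .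
    qed
  qed
  also have "\<dots> = nsq lborel f"
    unfolding nsq_def by (rule nn_integral_tile[symmetric]) auto
  finally have nsqF: "(\<integral>\<^sup>+t. nsq unit_interval (F t) \<partial>unit_interval) = nsq lborel f" .
  have "(\<lambda>t. nsq unit_interval (F t)) \<in> borel_measurable unit_interval"
    unfolding nsq_def by measurable
  then have "AE t in unit_interval. nsq unit_interval (F t) \<noteq> \<infinity>"
    by (rule nn_integral_PInf_AE) (use fin nsqF in auto)
  then have AEF: "AE t in unit_interval. F t \<in> L2 unit_interval"
    by eventually_elim (auto simp: L2_iff_nsq less_top)
  have ftn: "ft f (t + of_int n) = (\<integral>x. F t x * ef (of_int n * x) \<partial>unit_interval)" for t and n :: int
  proof -
    have "integrable lborel (\<lambda>x. f x * ef ((t + of_int n) * x))"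
      by (rule Bochner_Integration.integrable_bound[OF f]) (auto simp: norm_mult)
    then have "ft f (t + of_int n) =
        (\<integral>x. (\<integral>k. f (x + of_int k) * ef ((t + of_int n) * (x + of_int k)) \<partial>count_space (UNIV :: int set)) \<partial>unit_interval)"
      unfolding ft_def by (rule integral_tile)
    also have "\<dots> = (\<integral>x. F t x * ef (of_int n * x) \<partial>unit_interval)"
    proof (rule Bochner_Integration.integral_cong[OF refl])
      fix x
      have "ef ((t + of_int n) * (x + of_int k)) = ef (t * (x + of_int k)) * ef (of_int n * x)" for k :: int
        using ef_of_int[of "n * k"] by (simp add: distrib_left distrib_right ef_add)
      then show "(\<integral>k. f (x + of_int k) * ef ((t + of_int n) * (x + of_int k)) \<partial>count_space (UNIV :: int set)) = F t x * ef (of_int n * x)"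
        by (simp add: F_def mult.assoc flip: Bochner_Integration.integral_mult_left_zero)
    qed
    finally show ?thesis .
  qed
  have "nsq lborel (ft f) = (\<integral>\<^sup>+t. (\<Sum>\<^sup>+n. csq (ft f (t + of_int n))) \<partial>unit_interval)"
    unfolding nsq_def by (rule nn_integral_tile) auto
  also have "\<dots> = (\<integral>\<^sup>+t. nsq unit_interval (F t) \<partial>unit_interval)"
  proof (rule nn_integral_cong_AE)
    show "AE t in unit_interval. (\<Sum>\<^sup>+n. csq (ft f (t + of_int n))) = nsq unit_interval (F t)"
      using AEF by eventually_elim (simp add: ftn fourier_series_parseval)
  qed
  finally show ?thesis using nsqF by simp
qed

section \<open>An orthonormal basis of the square-integrable functions on the line\<close>

lemma interval_tiling_nsq:
  fixes \<phi> :: "real \<Rightarrow> complex" and \<alpha> :: real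
  assumes \<phi>: "\<phi> \<in> borel_measurable borel" and \<alpha>: "\<alpha> > 0"
  shows "(\<Sum>\<^sup>+p. nsq lborel (\<lambda>t. \<phi> t * indicator {\<alpha> * of_int p..<\<alpha> * of_int p + \<alpha>} t)) = nsq lborel \<phi>"
proof -
  note [measurable] = \<phi>
  have [measurable]: "(\<lambda>t. \<phi> t * indicator {\<alpha> * of_int p..<\<alpha> * of_int p + \<alpha>} t) \<in> borel_measurable borel" for p :: int
    by measurable
  have "(\<Sum>\<^sup>+p. nsq lborel (\<lambda>t. \<phi> t * indicator {\<alpha> * of_int p..<\<alpha> * of_int p + \<alpha>} t)) =
    (\<integral>\<^sup>+t. (\<Sum>\<^sup>+p. csq (\<phi> t * indicator {\<alpha> * of_int p..<\<alpha> * of_int p + \<alpha>} t)) \<partial>lborel)"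
    unfolding nsq_def by (rule nn_integral_count_space_nn_integral[symmetric]) auto
  also have "\<dots> = nsq lborel \<phi>"
    unfolding nsq_def
  proof (rule nn_integral_cong)
    fix t
    have "csq (\<phi> t * indicator {\<alpha> * of_int p..<\<alpha> * of_int p + \<alpha>} t) = csq (\<phi> t) * indicator {\<lfloor>t / \<alpha>\<rfloor>} p" for p
    proof -
      have "p = \<lfloor>t / \<alpha>\<rfloor> \<longleftrightarrow> of_int p \<le> t / \<alpha> \<and> t / \<alpha> < of_int p + 1" by linarith
      also have "\<dots> \<longleftrightarrow> t \<in> {\<alpha> * of_int p..<\<alpha> * of_int p + \<alpha>}" using \<alpha> by (simp add: field_simps)
      finally show ?thesis by (simp add: indicator_def)
    qed
    then show "(\<Sum>\<^sup>+p. csq (\<phi> t * indicator {\<alpha> * of_int p..<\<alpha> * of_int p + \<alpha>} t)) = csq (\<phi> t)"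
      by (simp add: nn_integral_cmult)
  qed
  finally show ?thesis .
qed

text \<open>The orthonormal basis of all integer frequencies on all unit intervals.  A concrete basis is needed
  because the squared Hilbert--Schmidt norms computed in it are to be measurable in \<open>\<lambda>\<close>.\<close>

definition gabor :: "int \<Rightarrow> int \<Rightarrow> real \<Rightarrow> complex" where
  "gabor p n t = indicator {of_int p..<of_int p + 1} t * ef (of_int n * t)"

lemma cnj_indicator: "cnj (indicator A x) = indicator A x"
  by (simp add: indicator_def)

lemma gabor_measurable [measurable]: "gabor p n \<in> borel_measurable borel"
  unfolding gabor_def by measurable

lemma gabor_nn_parseval:
  assumes [measurable]: "f \<in> borel_measurable borel" and fin: "nsq lborel f < \<infinity>"
  shows "(\<Sum>\<^sup>+p. (\<Sum>\<^sup>+n. csq (\<integral>t. f t * cnj (gabor p n t) \<partial>lborel))) = nsq lborel f"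
proof -
  define h where "h p t = f t * indicator {of_int p..<of_int p + 1} t" for p :: int and t
  have [measurable]: "h p \<in> borel_measurable borel" for p unfolding h_def by measurable
  have "(\<Sum>\<^sup>+n. csq (\<integral>t. f t * cnj (gabor p n t) \<partial>lborel)) = nsq lborel (h p)" for p
  proof -
    have "(\<Sum>\<^sup>+n. csq (\<integral>t. f t * cnj (gabor p n t) \<partial>lborel)) =
       (\<Sum>\<^sup>+n. csq (\<integral>t. h p t * ef (of_int (- n) * t) \<partial>lborel))"
      by (simp add: gabor_def h_def cnj_ef cnj_indicator mult.assoc)
    also have "\<dots> = (\<Sum>\<^sup>+n. csq (\<integral>t. h p t * ef (of_int n * t) \<partial>lborel))"
      by (rule nn_sum_int_uminus)
    also have "\<dots> = nsq lborel (h p)"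
    proof (rule parseval_packing(2))
      have "nsq lborel (h p) \<le> nsq lborel f"
        unfolding nsq_def h_def by (intro nn_integral_mono) (auto simp: indicator_def)
      then show "nsq lborel (h p) < \<infinity>" using fin le_less_trans by blast
      show "AE x in lborel. \<forall>m n::int. h p (x + of_int m) \<noteq> 0 \<longrightarrow> h p (x + of_int n) \<noteq> 0 \<longrightarrow> m = n"
        by (intro AE_I2) (auto simp: h_def indicator_def split: if_splits)
    qed auto
    finally show ?thesis .
  qed
  then have "(\<Sum>\<^sup>+p. (\<Sum>\<^sup>+n. csq (\<integral>t. f t * cnj (gabor p n t) \<partial>lborel))) = (\<Sum>\<^sup>+p. nsq lborel (h p))"
    by simp
  also have "\<dots> = nsq lborel f"
    unfolding h_def using interval_tiling_nsq[of f 1] by simp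
  finally show ?thesis .
qed

lemma gabor_inner: "(\<integral>t. gabor p n t * cnj (gabor q m t) \<partial>lborel) = (if p = q \<and> n = m then 1 else 0)"
proof (cases "p = q")
  case True
  have "(\<integral>t. gabor p n t * cnj (gabor q m t) \<partial>lborel) = (\<integral>t. indicator {of_int p..<of_int p + 1} t *\<^sub>R ef (of_int (n - m) * t) \<partial>lborel)"
    using True by (intro Bochner_Integration.integral_cong) (auto simp: gabor_def cnj_ef ef_add[symmetric] indicator_def algebra_simps)
  also have "\<dots> = (\<integral>t. indicator {of_int p..<of_int p + 1} (of_int p + t) *\<^sub>R ef (of_int (n - m) * (of_int p + t)) \<partial>lborel)"
    by (subst lborel_integral_real_affine[where c=1 and t="of_int p"]) auto
  also have "\<dots> = (\<integral>t. indicator {0..<1} t *\<^sub>R ef (of_int (n - m) * t) \<partial>lborel)"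
  proof (intro Bochner_Integration.integral_cong refl)
    fix t :: real
    have "ef (of_int (n - m) * (of_int p + t)) = ef (of_int (n - m) * t)"
      using ef_of_int[of "(n - m) * p"] by (simp only: distrib_left ef_add of_int_mult mult_1_left)
    then show "indicator {of_int p..<of_int p + 1} (of_int p + t) *\<^sub>R ef (of_int (n - m) * (of_int p + t)) = indicator {0..<1} t *\<^sub>R ef (of_int (n - m) * t)"
      by (auto simp: indicator_def)
  qed
  also have "\<dots> = (\<integral>t. ef (of_int (n - m) * t) \<partial>unit_interval)"
    by (subst integral_unit_interval) auto
  finally show ?thesis unfolding integral_ef_unit_interval using True by auto
next
  case False
  have "gabor p n t * cnj (gabor q m t) = 0" for t
    using False by (auto simp: gabor_def indicator_def)
  then show ?thesis unfolding \<open>\<And>t. gabor p n t * cnj (gabor q m t) = 0\<close> using False by simp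
qed

definition onb :: "nat \<Rightarrow> real \<Rightarrow> complex" where
  "onb k = gabor (int_decode (fst (prod_decode k))) (int_decode (snd (prod_decode k)))"

lemma onb_measurable [measurable]: "onb k \<in> borel_measurable borel"
  by (simp add: onb_def)

lemma inj_onb_index: "int_decode (fst (prod_decode j)) = int_decode (fst (prod_decode k)) \<and>
   int_decode (snd (prod_decode j)) = int_decode (snd (prod_decode k)) \<longleftrightarrow> j = k"
  by (metis int_decode_inverse prod.collapse prod_decode_inverse)

lemma onb_inner: "(\<integral>t. onb j t * cnj (onb k t) \<partial>lborel) = (if j = k then 1 else 0)"
  unfolding onb_def gabor_inner inj_onb_index ..

lemma nn_integral_count_space_int_pair:
  fixes \<phi> :: "int \<Rightarrow> int \<Rightarrow> ennreal"
  shows "(\<Sum>\<^sup>+k. \<phi> (int_decode (fst (prod_decode k))) (int_decode (snd (prod_decode k)))) =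
    (\<Sum>\<^sup>+p. (\<Sum>\<^sup>+n. \<phi> p n))"
proof -
  have "(\<Sum>\<^sup>+p. (\<Sum>\<^sup>+n. \<phi> p n)) = (\<Sum>\<^sup>+a. (\<Sum>\<^sup>+b. \<phi> (int_decode a) (int_decode b)))"
    unfolding nn_integral_bij_count_space[OF bij_int_decode, of "\<phi> _"]
    by (rule nn_integral_bij_count_space[OF bij_int_decode, symmetric])
  also have "\<dots> = (\<Sum>\<^sup>+z. \<phi> (int_decode (fst z)) (int_decode (snd z)))"
    by (subst nn_integral_fst_count_space[symmetric]) simp
  also have "\<dots> = (\<Sum>\<^sup>+k. \<phi> (int_decode (fst (prod_decode k))) (int_decode (snd (prod_decode k))))"
    by (rule nn_integral_bij_count_space[OF bij_prod_decode, symmetric])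
  finally show ?thesis by simp
qed

theorem onb_nn_parseval:
  assumes "f \<in> borel_measurable borel" "nsq lborel f < \<infinity>"
  shows "(\<Sum>\<^sup>+k. csq (\<integral>t. f t * cnj (onb k t) \<partial>lborel)) = nsq lborel f"
  unfolding onb_def
  using nn_integral_count_space_int_pair[of "\<lambda>p n. csq (\<integral>t. f t * cnj (gabor p n t) \<partial>lborel)"]
    gabor_nn_parseval[OF assms] by simp

section \<open>Borel representatives\<close>

text \<open>Elements of \<open>L\<^sup>2\<close> are Lebesgue measurable, while Tonelli's theorem and substitutions are available
  for Borel functions on products.  The lemmas of this section replace one by the other outside a null
  set.\<close>

lemma lebesgue_measurable_AE_cong:
  assumes f: "f \<in> borel_measurable lebesgue" and eq: "AE x in lborel. f x = g x"
  shows "g \<in> borel_measurable lebesgue"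
proof (rule measurableI)
  fix A :: "'b set" assume A: "A \<in> sets borel"
  have sA: "f -` A \<inter> space lebesgue \<in> sets lebesgue" using f A by (rule measurable_sets)
  have "AE x in lebesgue. (x \<in> f -` A \<inter> space lebesgue) = (x \<in> g -` A \<inter> space lebesgue)"
    unfolding AE_completion_iff using eq by eventually_elim auto
  then show "g -` A \<inter> space lebesgue \<in> sets lebesgue"
    by (rule completion.in_sets_AE[OF _ sA]) simp
qed simp

lemma lebesgue_measurableI_AE:
  "g \<in> borel_measurable borel \<Longrightarrow> AE x in lborel. f x = g x \<Longrightarrow> f \<in> borel_measurable lebesgue"
proof (rule lebesgue_measurable_AE_cong[of g])
  assume "AE x in lborel. f x = g x"
  then show "AE x in lborel. g x = f x" by eventually_elim simp
qed (simp add: measurable_completion)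

lemma borel_representative:
  fixes f :: "'a::euclidean_space \<Rightarrow> complex"
  assumes "f \<in> borel_measurable lebesgue"
  shows "\<exists>g\<in>borel_measurable borel. AE x in lborel. f x = g x"
proof -
  have "(\<lambda>x. Re (f x)) \<in> borel_measurable lebesgue" "(\<lambda>x. Im (f x)) \<in> borel_measurable lebesgue"
    using assms by auto
  then obtain a b where a: "a \<in> borel_measurable lborel" "AE x in lborel. Re (f x) = a x"
    and b: "b \<in> borel_measurable lborel" "AE x in lborel. Im (f x) = b x"
    by (auto dest!: completion_ex_borel_measurable_real)
  have [measurable]: "a \<in> borel_measurable borel" "b \<in> borel_measurable borel" using a b by auto
  have "(\<lambda>x. complex_of_real (a x) + \<i> * complex_of_real (b x)) \<in> borel_measurable borel" by measurable
  moreover have "AE x in lborel. f x = complex_of_real (a x) + \<i> * complex_of_real (b x)"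
    using a(2) b(2) by eventually_elim (simp add: complex_eq_iff)
  ultimately show ?thesis by (intro bexI[of _ "\<lambda>x. complex_of_real (a x) + \<i> * complex_of_real (b x)"])
qed

lemma nsq_lebesgue: "nsq lebesgue f = nsq lborel f"
  unfolding nsq_def by (rule nn_integral_completion)

lemma L2_borel_representative:
  fixes f :: "'a::euclidean_space \<Rightarrow> complex"
  assumes "f \<in> L2 lebesgue"
  obtains g where "g \<in> borel_measurable borel" "AE x in lborel. f x = g x" "nsq lborel g = nsq lebesgue f" "nsq lborel g < \<infinity>"
proof -
  obtain g where g: "g \<in> borel_measurable borel" "AE x in lborel. f x = g x"
    using borel_representative[of f] assms by (auto simp: L2_def)
  have "nsq lborel g = nsq lebesgue f" unfolding nsq_lebesgue by (rule nsq_cong_AE[symmetric]) (rule g)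
  moreover have "nsq lebesgue f < \<infinity>" using assms by (simp add: L2_iff_nsq)
  ultimately show ?thesis using that g by metis
qed

lemma L2_lebesgueI:
  assumes "g \<in> borel_measurable borel" "nsq lborel g < \<infinity>" "AE x in lborel. f x = g x"
  shows "f \<in> L2 lebesgue"
proof -
  have "nsq lebesgue f = nsq lborel g" unfolding nsq_lebesgue by (rule nsq_cong_AE) (rule assms)
  then show ?thesis using assms lebesgue_measurableI_AE by (auto simp: L2_iff_nsq)
qed

lemma L2_inner_lebesgue_borel:
  fixes f g :: "'a::euclidean_space \<Rightarrow> complex"
  assumes "f' \<in> borel_measurable borel" "g' \<in> borel_measurable borel" "AE x in lborel. f x = f' x" "AE x in lborel. g x = g' x"
  shows "L2_inner lebesgue f g = (\<integral>x. f' x * cnj (g' x) \<partial>lborel)"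
proof -
  have "L2_inner lebesgue f g = L2_inner lebesgue f' g'"
    using assms by (intro L2_inner_cong_AE) (auto intro: lebesgue_measurableI_AE measurable_completion simp: AE_completion_iff)
  also have "\<dots> = (\<integral>x. f' x * cnj (g' x) \<partial>lborel)"
    unfolding L2_inner_def using assms(1,2) by (intro integral_completion) auto
  finally show ?thesis .
qed

lemma onb_nsq: "nsq lborel (onb k) = 1"
proof -
  have "integrable lborel (\<lambda>t. onb k t * cnj (onb k t))"
    using onb_inner[of k k] not_integrable_integral_eq by fastforce
  from integrable_Re[OF this] have int: "integrable lborel (\<lambda>t. (cmod (onb k t))\<^sup>2)"
    by (simp flip: complex_norm_square)
  have "complex_of_real (\<integral>t. (cmod (onb k t))\<^sup>2 \<partial>lborel) = 1"
    using onb_inner[of k k] by (simp only: complex_norm_square[symmetric] integral_complex_of_real refl if_True)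
  then have "(\<integral>t. (cmod (onb k t))\<^sup>2 \<partial>lborel) = 1" using of_real_eq_1_iff by blast
  then show ?thesis unfolding nsq_def using int by (subst nn_integral_eq_integral) auto
qed

lemma onb_L2: "onb k \<in> L2 lebesgue"
  by (rule L2_lebesgueI[of "onb k"]) (auto simp: onb_nsq)

lemma onb_L2_inner: "L2_inner lebesgue (onb j) (onb k) = (if j = k then 1 else 0)"
  by (subst L2_inner_lebesgue_borel[of "onb j" "onb k"]) (auto simp: onb_inner)

lemma onb_parseval:
  assumes "f \<in> L2R"
  shows "(\<Sum>\<^sup>+k. csq (L2_inner lebesgue f (onb k))) = nsq lebesgue f"
proof -
  obtain g where g: "g \<in> borel_measurable borel" "AE x in lborel. f x = g x" "nsq lborel g = nsq lebesgue f" "nsq lborel g < \<infinity>"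
    using L2_borel_representative[OF assms] by metis
  have "L2_inner lebesgue f (onb k) = (\<integral>t. g t * cnj (onb k t) \<partial>lborel)" for k
    using g by (intro L2_inner_lebesgue_borel) auto
  then show ?thesis using onb_nn_parseval[OF g(1,4)] g(3) by simp
qed

lemma orthonormal_basis_onb: "orthonormal_basis onb"
  unfolding orthonormal_basis_def
proof (intro conjI allI ballI impI)
  fix f :: "real \<Rightarrow> complex" assume f: "f \<in> L2R" "\<forall>n. L2_inner lebesgue f (onb n) = 0"
  then have "nsq lebesgue f = 0" using onb_parseval[OF f(1)] by simp
  then show "AE t in lebesgue. f t = 0" using f(1) by (intro nsq_eq_0_AE) (auto simp: L2_def)
qed (auto simp: onb_L2 onb_L2_inner)

section \<open>The Plancherel theorem in the plane\<close>

lemma ft_measurable [measurable (raw)]: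
  assumes [measurable]: "(\<lambda>p. f (fst p) (snd p)) \<in> borel_measurable (M \<Otimes>\<^sub>M lborel)" "g \<in> borel_measurable M"
  shows "(\<lambda>x. ft (f x) (g x)) \<in> borel_measurable M"
  unfolding ft_def by measurable

lemma norm_ft_le: "ennreal (cmod (ft f w)) \<le> (\<integral>\<^sup>+x. ennreal (cmod (f x)) \<partial>lborel)"
proof (cases "integrable lborel (\<lambda>x. f x * ef (w * x))")
  case True
  then have "ennreal (cmod (ft f w)) \<le> (\<integral>\<^sup>+x. ennreal (cmod (f x * ef (w * x))) \<partial>lborel)"
    unfolding ft_def by (rule integral_norm_bound_ennreal)
  then show ?thesis by (simp add: norm_mult)
qed (simp add: ft_def not_integrable_integral_eq)

text \<open>Plancherel on the line, once in each variable.  The second application is legitimate for almost every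
  \<open>l\<close>: the partial transform is square-integrable by the first application and integrable because it is
  dominated by the integrals of \<open>|h(x, \<cdot>)|\<close>.\<close>

theorem plancherel_plane:
  fixes h :: "real \<times> real \<Rightarrow> complex"
  assumes h: "integrable lborel h" and fin: "nsq lborel h < \<infinity>"
  shows "(\<integral>\<^sup>+l. nsq lborel (ft (\<lambda>x. ft (\<lambda>y. h (x, y)) l)) \<partial>lborel) = nsq lborel h"
proof -
  have hm [measurable]: "h \<in> borel_measurable (borel \<Otimes>\<^sub>M borel)" using h by (simp add: borel_prod)
  have h': "integrable (lborel \<Otimes>\<^sub>M lborel) h" using h by (simp add: lborel_prod)
  have nsqh: "nsq lborel h = (\<integral>\<^sup>+x. nsq lborel (\<lambda>y. h (x, y)) \<partial>lborel)"
    unfolding nsq_def lborel_prod[symmetric] by (subst lborel.nn_integral_fst[symmetric]) auto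
  have nn1: "(\<integral>\<^sup>+x. (\<integral>\<^sup>+y. ennreal (cmod (h (x, y))) \<partial>lborel) \<partial>lborel) < \<infinity>"
    using h' by (subst lborel.nn_integral_fst) (auto simp: integrable_iff_bounded)
  have "AE x in lborel. nsq lborel (\<lambda>y. h (x, y)) \<noteq> \<infinity>"
    by (rule nn_integral_PInf_AE) (use fin nsqh in \<open>auto simp: nsq_def\<close>)
  moreover have "AE x in lborel. integrable lborel (\<lambda>y. h (x, y))"
    using lborel_pair.AE_integrable_fst'[OF h'] by simp
  ultimately have pl: "AE x in lborel. nsq lborel (ft (\<lambda>y. h (x, y))) = nsq lborel (\<lambda>y. h (x, y))"
    by eventually_elim (rule plancherel_line, auto simp: less_top)
  have eq1: "(\<integral>\<^sup>+l. nsq lborel (\<lambda>x. ft (\<lambda>y. h (x, y)) l) \<partial>lborel) = nsq lborel h"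
  proof -
    have "(\<integral>\<^sup>+l. nsq lborel (\<lambda>x. ft (\<lambda>y. h (x, y)) l) \<partial>lborel) = (\<integral>\<^sup>+x. nsq lborel (ft (\<lambda>y. h (x, y))) \<partial>lborel)"
      unfolding nsq_def by (subst lborel_pair.Fubini') (auto simp: case_prod_beta')
    also have "\<dots> = nsq lborel h" unfolding nsqh by (rule nn_integral_cong_AE) (rule pl)
    finally show ?thesis .
  qed
  have "AE l in lborel. nsq lborel (\<lambda>x. ft (\<lambda>y. h (x, y)) l) \<noteq> \<infinity>"
    by (rule nn_integral_PInf_AE) (use fin eq1 in \<open>auto simp: nsq_def\<close>)
  then have "AE l in lborel. nsq lborel (ft (\<lambda>x. ft (\<lambda>y. h (x, y)) l)) = nsq lborel (\<lambda>x. ft (\<lambda>y. h (x, y)) l)"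
  proof eventually_elim
    case (elim l)
    have "integrable lborel (\<lambda>x. ft (\<lambda>y. h (x, y)) l)"
    proof (rule integrableI_bounded)
      have "(\<integral>\<^sup>+x. ennreal (norm (ft (\<lambda>y. h (x, y)) l)) \<partial>lborel) \<le> (\<integral>\<^sup>+x. (\<integral>\<^sup>+y. ennreal (cmod (h (x, y))) \<partial>lborel) \<partial>lborel)"
        by (intro nn_integral_mono norm_ft_le)
      then show "(\<integral>\<^sup>+x. ennreal (norm (ft (\<lambda>y. h (x, y)) l)) \<partial>lborel) < \<infinity>" using nn1 by (rule le_less_trans)
    qed measurable
    then show ?case using elim by (intro plancherel_line) (auto simp: less_top)
  qed
  then have "(\<integral>\<^sup>+l. nsq lborel (ft (\<lambda>x. ft (\<lambda>y. h (x, y)) l)) \<partial>lborel) = (\<integral>\<^sup>+l. nsq lborel (\<lambda>x. ft (\<lambda>y. h (x, y)) l) \<partial>lborel)"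
    by (rule nn_integral_cong_AE)
  then show ?thesis using eq1 by simp
qed

section \<open>The kernel of the Fourier transform of an integrable function\<close>

text \<open>The Fourier transform of \<open>\<Phi>(x\<^sub>1, \<cdot>, \<cdot>)\<close> in the second and third variable, the third at frequency
  \<open>l\<close>.\<close>

definition heis_ker :: "(heis \<Rightarrow> complex) \<Rightarrow> real \<Rightarrow> real \<Rightarrow> real \<Rightarrow> complex" where
  "heis_ker \<Phi> l x1 = ft (\<lambda>x2. ft (\<lambda>x3. \<Phi> (x1, x2, x3)) l)"

text \<open>The Fourier transform of an integrable \<open>\<Phi>\<close> at \<open>l\<close>: in the group integral, the third variable carries
  the character of frequency \<open>l\<close> and the second that of frequency \<open>-lt\<close>
  (see \<open>fourier_borel_eq_ker_op\<close>).\<close>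

definition ker_op :: "(heis \<Rightarrow> complex) \<Rightarrow> real \<Rightarrow> L2_op" where
  "ker_op \<Phi> l f t = (\<integral>x. f (t - x) * heis_ker \<Phi> l x (- (l * t)) \<partial>lborel)"

text \<open>Up to the factor \<open>|l|\<close> the squared Hilbert--Schmidt norm of the operator at \<open>l\<close>, since
  \<open>t \<mapsto> -lt\<close> scales the line by \<open>|l|\<close>.\<close>

definition ker_nsq :: "(heis \<Rightarrow> complex) \<Rightarrow> real \<Rightarrow> ennreal" where
  "ker_nsq \<Phi> l = (\<integral>\<^sup>+x. nsq lborel (heis_ker \<Phi> l x) \<partial>lborel)"

lemma borel_heis: "\<Phi> \<in> borel_measurable borel \<Longrightarrow> (\<Phi> :: heis \<Rightarrow> complex) \<in> borel_measurable (borel \<Otimes>\<^sub>M (borel \<Otimes>\<^sub>M borel))"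
  by (simp add: borel_prod)

lemma heis_ker_measurable [measurable (raw)]:
  assumes [measurable]: "\<Phi> \<in> borel_measurable (borel \<Otimes>\<^sub>M (borel \<Otimes>\<^sub>M borel))"
    "a \<in> borel_measurable M" "b \<in> borel_measurable M" "c \<in> borel_measurable M"
  shows "(\<lambda>x. heis_ker \<Phi> (a x) (b x) (c x)) \<in> borel_measurable M"
  unfolding heis_ker_def by measurable

lemma ker_op_measurable [measurable (raw)]:
  assumes [measurable]: "\<Phi> \<in> borel_measurable (borel \<Otimes>\<^sub>M (borel \<Otimes>\<^sub>M borel))" "f \<in> borel_measurable borel"
    "a \<in> borel_measurable M" "b \<in> borel_measurable M"
  shows "(\<lambda>x. ker_op \<Phi> (a x) f (b x)) \<in> borel_measurable M"
  unfolding ker_op_def by measurable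

lemma ker_nsq_measurable [measurable]:
  assumes [measurable]: "\<Phi> \<in> borel_measurable (borel \<Otimes>\<^sub>M (borel \<Otimes>\<^sub>M borel))"
  shows "ker_nsq \<Phi> \<in> borel_measurable borel"
  unfolding ker_nsq_def nsq_def by measurable

lemma lborel_heis: "(lborel :: heis measure) = lborel \<Otimes>\<^sub>M lborel"
  by (simp add: lborel_prod)

text \<open>Plancherel in the plane for almost every value of the first variable.\<close>

lemma integral_ker_nsq:
  assumes \<Phi>: "integrable lborel \<Phi>" and fin: "nsq lborel \<Phi> < \<infinity>"
  shows "(\<integral>\<^sup>+l. ker_nsq \<Phi> l \<partial>lborel) = nsq lborel \<Phi>"
proof -
  have [measurable]: "\<Phi> \<in> borel_measurable (borel \<Otimes>\<^sub>M (borel \<Otimes>\<^sub>M borel))" using \<Phi> by (intro borel_heis) auto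
  have [measurable]: "\<Phi> \<in> borel_measurable (lborel \<Otimes>\<^sub>M lborel)"
    using \<Phi> by (simp add: lborel_prod)
  have [measurable]: "(\<lambda>y. \<Phi> (x, y)) \<in> borel_measurable borel" for x
    unfolding borel_prod[symmetric] by measurable
  have nsq\<Phi>: "nsq lborel \<Phi> = (\<integral>\<^sup>+x. nsq lborel (\<lambda>y. \<Phi> (x, y)) \<partial>lborel)"
    unfolding nsq_def by (subst lborel_heis, subst lborel.nn_integral_fst[symmetric]) auto
  have "integrable (lborel \<Otimes>\<^sub>M lborel) \<Phi>" using \<Phi> by (simp add: lborel_prod)
  from lborel_pair.AE_integrable_fst'[OF this]
  have i: "AE x in lborel. integrable lborel (\<lambda>y. \<Phi> (x, y))" by simp
  have "(\<lambda>x. nsq lborel (\<lambda>y. \<Phi> (x, y))) \<in> borel_measurable lborel"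
    unfolding nsq_def by (rule lborel.borel_measurable_nn_integral_fst) (auto simp: borel_prod)
  then have n: "AE x in lborel. nsq lborel (\<lambda>y. \<Phi> (x, y)) \<noteq> \<infinity>"
    by (rule nn_integral_PInf_AE) (use fin nsq\<Phi> in auto)
  have "(\<integral>\<^sup>+l. ker_nsq \<Phi> l \<partial>lborel) = (\<integral>\<^sup>+x. (\<integral>\<^sup>+l. nsq lborel (heis_ker \<Phi> l x) \<partial>lborel) \<partial>lborel)"
    unfolding ker_nsq_def nsq_def by (rule lborel_pair.Fubini') (auto simp: case_prod_beta')
  also have "\<dots> = nsq lborel \<Phi>"
    unfolding nsq\<Phi>
  proof (rule nn_integral_cong_AE)
    show "AE x in lborel. (\<integral>\<^sup>+l. nsq lborel (heis_ker \<Phi> l x) \<partial>lborel) = nsq lborel (\<lambda>y. \<Phi> (x, y))"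
      using i n
    proof eventually_elim
      case (elim x)
      then show ?case using plancherel_plane[of "\<lambda>y. \<Phi> (x, y)"] by (simp add: heis_ker_def less_top)
    qed
  qed
  finally show ?thesis .
qed

lemma nn_integral_reflect:
  "f \<in> borel_measurable borel \<Longrightarrow> (\<integral>\<^sup>+x. f (t - x) \<partial>lborel) = (\<integral>\<^sup>+x. f x \<partial>(lborel :: real measure))"
  by (subst (2) nn_integral_real_affine[where c="-1" and t=t]) auto

lemma ker_nsq_scale:
  assumes \<Phi>: "\<Phi> \<in> borel_measurable (borel \<Otimes>\<^sub>M (borel \<Otimes>\<^sub>M borel))" and l: "l \<noteq> 0"
  shows "ennreal \<bar>l\<bar> * (\<integral>\<^sup>+t. nsq lborel (\<lambda>x. heis_ker \<Phi> l x (- (l * t))) \<partial>lborel) = ker_nsq \<Phi> l"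
proof -
  note [measurable] = \<Phi>
  have "ker_nsq \<Phi> l = (\<integral>\<^sup>+w. nsq lborel (\<lambda>x. heis_ker \<Phi> l x w) \<partial>lborel)"
    unfolding ker_nsq_def nsq_def by (rule lborel_pair.Fubini'[symmetric]) (auto simp: case_prod_beta')
  also have "\<dots> = ennreal \<bar>- l\<bar> * (\<integral>\<^sup>+t. nsq lborel (\<lambda>x. heis_ker \<Phi> l x (0 + (- l) * t)) \<partial>lborel)"
    by (rule nn_integral_real_affine) (use l in \<open>auto simp: nsq_def\<close>)
  finally show ?thesis by simp
qed

text \<open>Cauchy--Schwarz in the integral defining the operator; the kernel stays inside the norm.\<close>

lemma ker_op_bound:
  assumes \<Phi>: "\<Phi> \<in> borel_measurable (borel \<Otimes>\<^sub>M (borel \<Otimes>\<^sub>M borel))" and l: "l \<noteq> 0" and f: "f \<in> borel_measurable borel"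
  shows "ennreal \<bar>l\<bar> * nsq lborel (ker_op \<Phi> l f) \<le> ker_nsq \<Phi> l * nsq lborel f"
proof -
  note [measurable] = \<Phi> f
  have "nsq lborel (ker_op \<Phi> l f) \<le> (\<integral>\<^sup>+t. nsq lborel f * nsq lborel (\<lambda>x. heis_ker \<Phi> l x (- (l * t))) \<partial>lborel)"
    unfolding nsq_def[of lborel "ker_op \<Phi> l f"]
  proof (rule nn_integral_mono)
    fix t
    have "csq (ker_op \<Phi> l f t) \<le> nsq lborel (\<lambda>x. f (t - x)) * nsq lborel (\<lambda>x. heis_ker \<Phi> l x (- (l * t)))"
      unfolding ker_op_def by (rule integral_mult_sq_le_nsq) auto
    also have "nsq lborel (\<lambda>x. f (t - x)) = nsq lborel f"
      unfolding nsq_def by (rule nn_integral_reflect) auto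
    finally show "csq (ker_op \<Phi> l f t) \<le> nsq lborel f * nsq lborel (\<lambda>x. heis_ker \<Phi> l x (- (l * t)))" .
  qed
  also have "\<dots> = nsq lborel f * (\<integral>\<^sup>+t. nsq lborel (\<lambda>x. heis_ker \<Phi> l x (- (l * t))) \<partial>lborel)"
    by (rule nn_integral_cmult) (auto simp: nsq_def)
  finally have "ennreal \<bar>l\<bar> * nsq lborel (ker_op \<Phi> l f) \<le> ennreal \<bar>l\<bar> * (nsq lborel f * (\<integral>\<^sup>+t. nsq lborel (\<lambda>x. heis_ker \<Phi> l x (- (l * t))) \<partial>lborel))"
    by (rule mult_left_mono) auto
  also have "\<dots> = ker_nsq \<Phi> l * nsq lborel f"
    by (subst ker_nsq_scale[OF \<Phi> l, symmetric]) (simp add: mult_ac)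
  finally show ?thesis .
qed

text \<open>For fixed \<open>t\<close> the numbers \<open>ker_op \<Phi> l (onb k) t\<close> are conjugates of the coefficients of a
  function whose norm is that of the row of the kernel at \<open>t\<close>.  Parseval for the basis sums their
  squares, and integration over \<open>t\<close> finishes the computation.\<close>

lemma ker_op_hilbert_schmidt:
  assumes \<Phi>: "\<Phi> \<in> borel_measurable (borel \<Otimes>\<^sub>M (borel \<Otimes>\<^sub>M borel))" and l: "l \<noteq> 0" and fin: "ker_nsq \<Phi> l < \<infinity>"
  shows "ennreal \<bar>l\<bar> * (\<Sum>\<^sup>+k. nsq lborel (ker_op \<Phi> l (onb k))) = ker_nsq \<Phi> l"
proof -
  note [measurable] = \<Phi>
  have "(\<Sum>\<^sup>+k. nsq lborel (ker_op \<Phi> l (onb k))) =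
     (\<integral>\<^sup>+t. (\<Sum>\<^sup>+k. csq (ker_op \<Phi> l (onb k) t)) \<partial>lborel)"
    unfolding nsq_def by (rule nn_integral_count_space_nn_integral[symmetric]) auto
  also have "\<dots> = (\<integral>\<^sup>+t. nsq lborel (\<lambda>x. heis_ker \<Phi> l x (- (l * t))) \<partial>lborel)"
  proof (rule nn_integral_cong_AE)
    have "ennreal \<bar>l\<bar> * (\<integral>\<^sup>+t. nsq lborel (\<lambda>x. heis_ker \<Phi> l x (- (l * t))) \<partial>lborel) \<noteq> \<infinity>"
      using ker_nsq_scale[OF \<Phi> l] fin by simp
    then have "(\<integral>\<^sup>+t. nsq lborel (\<lambda>x. heis_ker \<Phi> l x (- (l * t))) \<partial>lborel) \<noteq> \<infinity>"
      using l by (auto simp: ennreal_mult_eq_top_iff)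
    then have "AE t in lborel. nsq lborel (\<lambda>x. heis_ker \<Phi> l x (- (l * t))) \<noteq> \<infinity>"
      by (intro nn_integral_PInf_AE) (auto simp: nsq_def)
    then show "AE t in lborel. (\<Sum>\<^sup>+k. csq (ker_op \<Phi> l (onb k) t)) = nsq lborel (\<lambda>x. heis_ker \<Phi> l x (- (l * t)))"
    proof eventually_elim
      case (elim t)
      define \<kappa> where "\<kappa> s = cnj (heis_ker \<Phi> l (t - s) (- (l * t)))" for s
      have [measurable]: "\<kappa> \<in> borel_measurable borel" unfolding \<kappa>_def by measurable
      have nsq\<kappa>: "nsq lborel \<kappa> = nsq lborel (\<lambda>x. heis_ker \<Phi> l x (- (l * t)))"
        unfolding nsq_def \<kappa>_def complex_mod_cnj by (rule nn_integral_reflect) auto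
      have "ker_op \<Phi> l (onb k) t = cnj (\<integral>s. \<kappa> s * cnj (onb k s) \<partial>lborel)" for k
      proof -
        have "ker_op \<Phi> l (onb k) t = (\<integral>s. onb k s * heis_ker \<Phi> l (t - s) (- (l * t)) \<partial>lborel)"
          unfolding ker_op_def by (subst lborel_integral_real_affine[where c="-1" and t=t]) auto
        also have "\<dots> = cnj (\<integral>s. \<kappa> s * cnj (onb k s) \<partial>lborel)"
          unfolding Bochner_Integration.integral_cnj[symmetric] by (simp add: \<kappa>_def mult.commute)
        finally show ?thesis .
      qed
      then show ?case using onb_nn_parseval[of \<kappa>] elim by (simp add: nsq\<kappa> less_top)
    qed
  qed
  finally show ?thesis using ker_nsq_scale[OF \<Phi> l] by simp
qed

lemma schroedinger_ef: "schroedinger l (x1, x2, x3) f t = ef (l * x3) * ef (- (l * t) * x2) * f (t - x1)"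
  by (simp add: ef_def mult_ac)

lemma borel_measurable_fst_heis: "(fst :: heis \<Rightarrow> real) \<in> borel_measurable borel"
  by (intro borel_measurable_continuous_onI continuous_intros)

text \<open>Integrating \<open>|\<Phi>(x)| |f(t-x\<^sub>1)|\<^sup>2\<close> over \<open>t\<close> as well gives \<open>\<parallel>\<Phi>\<parallel>\<^sub>1\<parallel>f\<parallel>\<^sup>2\<close>, so it is finite for almost every
  \<open>t\<close>; the integrand itself is dominated by \<open>|\<Phi>(x)| (1 + |f(t-x\<^sub>1)|\<^sup>2)\<close>.  The bound does not involve \<open>l\<close>,
  so one null set serves all \<open>l\<close>.\<close>

lemma AE_fourier_integrable_borel:
  assumes \<Phi>: "integrable lborel \<Phi>" and f: "f \<in> borel_measurable borel" "nsq lborel f < \<infinity>"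
  shows "AE t in lborel. \<forall>l. integrable lborel (\<lambda>x. \<Phi> x * schroedinger l x f t)"
proof -
  note [measurable] = f(1)
  have [measurable]: "\<Phi> \<in> borel_measurable borel" using \<Phi> by auto
  note [measurable] = borel_heis[OF this] borel_measurable_fst_heis
  have "(\<integral>\<^sup>+t. (\<integral>\<^sup>+x. ennreal (cmod (\<Phi> x)) * csq (f (t - fst x)) \<partial>lborel) \<partial>lborel) =
    (\<integral>\<^sup>+x. (\<integral>\<^sup>+t. ennreal (cmod (\<Phi> x)) * csq (f (t - fst x)) \<partial>lborel) \<partial>lborel)"
    by (rule lborel_pair.Fubini') (auto simp: case_prod_beta')
  also have "\<dots> = (\<integral>\<^sup>+x. ennreal (cmod (\<Phi> x)) * nsq lborel f \<partial>lborel)"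
  proof (rule nn_integral_cong)
    fix x :: heis
    have "(\<integral>\<^sup>+t. csq (f (t - fst x)) \<partial>lborel) = nsq lborel f"
      unfolding nsq_def by (subst (2) nn_integral_real_affine[where c=1 and t="- fst x"]) auto
    then show "(\<integral>\<^sup>+t. ennreal (cmod (\<Phi> x)) * csq (f (t - fst x)) \<partial>lborel) = ennreal (cmod (\<Phi> x)) * nsq lborel f"
      by (simp add: nn_integral_cmult)
  qed
  also have "\<dots> = (\<integral>\<^sup>+x. ennreal (cmod (\<Phi> x)) \<partial>lborel) * nsq lborel f"
    by (rule nn_integral_multc) auto
  also have "\<dots> < \<infinity>" using \<Phi> f by (auto simp: integrable_iff_bounded ennreal_mult_less_top)
  finally have "AE t in lborel. (\<integral>\<^sup>+x. ennreal (cmod (\<Phi> x)) * csq (f (t - fst x)) \<partial>lborel) \<noteq> \<infinity>"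
    by (intro nn_integral_PInf_AE) auto
  then show ?thesis
  proof eventually_elim
    case (elim t)
    show ?case
    proof
      fix l
      have eq: "schroedinger l x f t = ef (l * snd (snd x)) * ef (- (l * t) * fst (snd x)) * f (t - fst x)" for x
        by (cases x) (simp add: schroedinger_ef del: schroedinger.simps)
      show "integrable lborel (\<lambda>x. \<Phi> x * schroedinger l x f t)"
      proof (rule integrableI_bounded)
        have "(\<lambda>x::heis. \<Phi> x * schroedinger l x f t) \<in> borel_measurable (borel \<Otimes>\<^sub>M (borel \<Otimes>\<^sub>M borel))"
          unfolding eq by measurable
        then show "(\<lambda>x. \<Phi> x * schroedinger l x f t) \<in> borel_measurable lborel" by (simp add: borel_prod)
        have "(\<integral>\<^sup>+x. ennreal (norm (\<Phi> x * schroedinger l x f t)) \<partial>lborel) \<le>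
          (\<integral>\<^sup>+x. ennreal (cmod (\<Phi> x)) + ennreal (cmod (\<Phi> x)) * csq (f (t - fst x)) \<partial>lborel)"
        proof (rule nn_integral_mono)
          fix x :: heis
          have "cmod (f (t - fst x)) \<le> 1 + (cmod (f (t - fst x)))\<^sup>2"
            using sum_squares_bound[of 1 "cmod (f (t - fst x))"] norm_ge_zero[of "f (t - fst x)"]
            by (simp add: power2_eq_square) (smt (verit) norm_ge_zero)
          then have "norm (\<Phi> x * schroedinger l x f t) \<le> cmod (\<Phi> x) * (1 + (cmod (f (t - fst x)))\<^sup>2)"
            unfolding eq by (simp add: norm_mult mult_left_mono del: distrib_left)
          then have "ennreal (norm (\<Phi> x * schroedinger l x f t)) \<le> ennreal (cmod (\<Phi> x) * (1 + (cmod (f (t - fst x)))\<^sup>2))"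
            by (rule ennreal_leI)
          also have "\<dots> = ennreal (cmod (\<Phi> x)) + ennreal (cmod (\<Phi> x)) * csq (f (t - fst x))"
            by (simp add: distrib_left ennreal_mult)
          finally show "ennreal (norm (\<Phi> x * schroedinger l x f t)) \<le> ennreal (cmod (\<Phi> x)) + ennreal (cmod (\<Phi> x)) * csq (f (t - fst x))" .
        qed
        also have "\<dots> = (\<integral>\<^sup>+x. ennreal (cmod (\<Phi> x)) \<partial>lborel) + (\<integral>\<^sup>+x. ennreal (cmod (\<Phi> x)) * csq (f (t - fst x)) \<partial>lborel)"
          by (rule nn_integral_add) auto
        also have "\<dots> < \<infinity>" using \<Phi> elim by (auto simp: integrable_iff_bounded less_top)
        finally show "(\<integral>\<^sup>+x. ennreal (norm (\<Phi> x * schroedinger l x f t)) \<partial>lborel) < \<infinity>" .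
      qed
    qed
  qed
qed

lemma fourier_borel_eq_ker_op:
  assumes \<Phi>: "integrable lborel \<Phi>" and int: "integrable lborel (\<lambda>x. \<Phi> x * schroedinger l x f t)"
    and f [measurable]: "f \<in> borel_measurable borel"
  shows "(\<integral>x. \<Phi> x * schroedinger l x f t \<partial>lborel) = ker_op \<Phi> l f t"
proof -
  have i: "AE x in lborel. integrable lborel (\<lambda>y. \<Phi> (x, y))"
    using \<Phi> lborel_pair.AE_integrable_fst'[of \<Phi>] by (simp add: lborel_prod)
  have int': "integrable (lborel \<Otimes>\<^sub>M lborel) (\<lambda>x. \<Phi> x * schroedinger l x f t)"
    using int by (simp add: lborel_prod)
  have m [measurable]: "\<Phi> \<in> borel_measurable (borel \<Otimes>\<^sub>M (borel \<Otimes>\<^sub>M borel))" using \<Phi> by (intro borel_heis) auto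
  have "(\<integral>x. \<Phi> x * schroedinger l x f t \<partial>lborel) = (\<integral>x. (\<integral>y. \<Phi> (x, y) * schroedinger l (x, y) f t \<partial>lborel) \<partial>lborel)"
    using lborel_pair.integral_fst'[OF int'] by (simp add: lborel_prod)
  also have "\<dots> = ker_op \<Phi> l f t"
    unfolding ker_op_def
  proof (rule integral_cong_AE)
    have "(\<lambda>x. (\<integral>y. \<Phi> (x, y) * schroedinger l (x, y) f t \<partial>lborel)) \<in> borel_measurable lborel"
      using lborel_pair.integrable_fst'[OF int'] by auto
    then show "(\<lambda>x. (\<integral>y. \<Phi> (x, y) * schroedinger l (x, y) f t \<partial>lborel)) \<in> borel_measurable lborel" .
    show eq: "AE x in lborel. (\<integral>y. \<Phi> (x, y) * schroedinger l (x, y) f t \<partial>lborel) = f (t - x) * heis_ker \<Phi> l x (- (l * t))"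
      using i
    proof eventually_elim
      case (elim x)
      have int1: "integrable lborel (\<lambda>y. \<Phi> (x, y) * ef (l * snd y) * ef (- (l * t) * fst y))"
        by (rule Bochner_Integration.integrable_bound[OF elim]) (auto simp: norm_mult borel_prod[symmetric])
      have int2: "integrable (lborel \<Otimes>\<^sub>M lborel) (\<lambda>y. \<Phi> (x, y) * ef (l * snd y) * ef (- (l * t) * fst y))"
        using int1 by (simp add: lborel_prod)
      have "(\<integral>y. \<Phi> (x, y) * schroedinger l (x, y) f t \<partial>lborel) = (\<integral>y. f (t - x) * (\<Phi> (x, y) * ef (l * snd y) * ef (- (l * t) * fst y)) \<partial>lborel)"
      proof (rule Bochner_Integration.integral_cong[OF refl])
        fix y :: "real \<times> real"
        show "\<Phi> (x, y) * schroedinger l (x, y) f t = f (t - x) * (\<Phi> (x, y) * ef (l * snd y) * ef (- (l * t) * fst y))"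
          by (cases y) (simp add: schroedinger_ef del: schroedinger.simps)
      qed
      also have "\<dots> = f (t - x) * (\<integral>y. \<Phi> (x, y) * ef (l * snd y) * ef (- (l * t) * fst y) \<partial>lborel)"
        by (rule Bochner_Integration.integral_mult_right_zero)
      also have "(\<integral>y. \<Phi> (x, y) * ef (l * snd y) * ef (- (l * t) * fst y) \<partial>lborel) = (\<integral>a. (\<integral>b. \<Phi> (x, a, b) * ef (l * b) * ef (- (l * t) * a) \<partial>lborel) \<partial>lborel)"
        using lborel_pair.integral_fst'[OF int2] by (simp add: lborel_prod)
      also have "\<dots> = heis_ker \<Phi> l x (- (l * t))"
        by (simp add: heis_ker_def ft_def)
      finally show ?case .
    qed
    show "(\<lambda>x. f (t - x) * heis_ker \<Phi> l x (- (l * t))) \<in> borel_measurable lborel"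
      by measurable
  qed
  finally show ?thesis .
qed

section \<open>Change of variables for maps that scale Lebesgue measure\<close>

text \<open>Left translations and dilations of the group, and the affine maps behind translations and dilations on
  the dual side, all multiply Lebesgue measure by a constant.  Everything that is needed about
  composition with such a map (null sets, measurability, norms, integrals) follows from this one
  substitution rule for Borel functions.\<close>

definition scales_measure :: "('a::euclidean_space \<Rightarrow> 'a) \<Rightarrow> real \<Rightarrow> bool" where
  "scales_measure T c \<longleftrightarrow> T \<in> borel_measurable borel \<and> c > 0 \<and>
     (\<forall>F::'a \<Rightarrow> ennreal. F \<in> borel_measurable borel \<longrightarrow> (\<integral>\<^sup>+x. F (T x) \<partial>lborel) = ennreal c * (\<integral>\<^sup>+x. F x \<partial>lborel))"

lemma scales_measure_measurable: "scales_measure T c \<Longrightarrow> T \<in> borel_measurable borel"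
  by (simp add: scales_measure_def)

lemma scales_measure_nn_integral:
  "scales_measure T c \<Longrightarrow> F \<in> borel_measurable borel \<Longrightarrow> (\<integral>\<^sup>+x. F (T x) \<partial>lborel) = ennreal c * (\<integral>\<^sup>+x. F x \<partial>lborel)"
  by (simp add: scales_measure_def)

lemma scales_measure_distr:
  assumes T: "scales_measure T c"
  shows "distr lborel borel T = density lborel (\<lambda>_. ennreal c)"
proof (rule measure_eqI)
  note [measurable] = scales_measure_measurable[OF T]
  fix A assume "A \<in> sets (distr lborel borel T)"
  then have [measurable]: "A \<in> sets borel" by simp
  have "emeasure (distr lborel borel T) A = (\<integral>\<^sup>+x. indicator A x \<partial>distr lborel borel T)"
    by (rule nn_integral_indicator[symmetric]) simp
  also have "\<dots> = (\<integral>\<^sup>+x. indicator A (T x) \<partial>lborel)"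
    by (rule nn_integral_distr) auto
  also have "\<dots> = ennreal c * (\<integral>\<^sup>+x. indicator A x \<partial>lborel)"
    by (rule scales_measure_nn_integral[OF T]) auto
  also have "\<dots> = emeasure (density lborel (\<lambda>_. ennreal c)) A"
    by (subst emeasure_density) (auto simp: nn_integral_cmult)
  finally show "emeasure (distr lborel borel T) A = emeasure (density lborel (\<lambda>_. ennreal c)) A" .
qed simp

lemma AE_lborel_borel_superset:
  assumes "AE x in lborel. P x"
  obtains N where "N \<in> sets borel" "emeasure lborel N = 0" "\<And>x. x \<notin> N \<Longrightarrow> P x"
proof -
  obtain N where "{x \<in> space lborel. \<not> P x} \<subseteq> N" "emeasure lborel N = 0" "N \<in> sets lborel"
    by (rule AE_E[OF assms]) auto
  then show ?thesis by (intro that[of N]) auto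
qed

lemma scales_measure_AE:
  assumes T: "scales_measure T c" and P: "AE x in lborel. P x"
  shows "AE x in lborel. P (T x)"
proof -
  note [measurable] = scales_measure_measurable[OF T]
  obtain N where N: "N \<in> sets borel" "emeasure lborel N = 0" "\<And>x. x \<notin> N \<Longrightarrow> P x"
    by (rule AE_lborel_borel_superset[OF P]) auto
  note [measurable] = N(1)
  have "(\<integral>\<^sup>+x. indicator N (T x) \<partial>lborel) = ennreal c * (\<integral>\<^sup>+x. indicator N x \<partial>lborel)"
    by (rule scales_measure_nn_integral[OF T]) auto
  also have "\<dots> = 0" using N by simp
  finally have "AE x in lborel. (indicator N (T x) :: ennreal) = 0"
    by (subst (asm) nn_integral_0_iff_AE) auto
  then show ?thesis by eventually_elim (use N(3) in \<open>auto simp: indicator_def split: if_splits\<close>)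
qed

lemma scales_measure_borel_measurable:
  fixes f :: "'a::euclidean_space \<Rightarrow> complex"
  assumes T: "scales_measure T c" and f: "f \<in> borel_measurable lebesgue"
  shows "(\<lambda>x. f (T x)) \<in> borel_measurable lebesgue"
proof -
  note [measurable] = scales_measure_measurable[OF T]
  obtain g where g [measurable]: "g \<in> borel_measurable borel" and eq: "AE x in lborel. f x = g x"
    using borel_representative[OF f] by blast
  show ?thesis
    by (rule lebesgue_measurableI_AE[of "\<lambda>x. g (T x)"]) (use scales_measure_AE[OF T eq] in auto)
qed

lemma scales_measure_nsq:
  fixes f :: "'a::euclidean_space \<Rightarrow> complex"
  assumes T: "scales_measure T c" and f: "f \<in> borel_measurable lebesgue"
  shows "nsq lebesgue (\<lambda>x. f (T x)) = ennreal c * nsq lebesgue f"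
proof -
  obtain g where g [measurable]: "g \<in> borel_measurable borel" and eq: "AE x in lborel. f x = g x"
    using borel_representative[OF f] by blast
  have "nsq lborel (\<lambda>x. f (T x)) = nsq lborel (\<lambda>x. g (T x))"
    by (rule nsq_cong_AE) (rule scales_measure_AE[OF T eq])
  also have "\<dots> = ennreal c * nsq lborel g"
    unfolding nsq_def by (rule scales_measure_nn_integral[OF T]) auto
  also have "nsq lborel g = nsq lborel f"
    by (rule nsq_cong_AE) (use eq in eventually_elim, simp)
  finally show ?thesis by (simp add: nsq_lebesgue)
qed

lemma integral_lebesgue_borel_representative:
  fixes f :: "'a::euclidean_space \<Rightarrow> complex"
  assumes g: "g \<in> borel_measurable borel" and eq: "AE x in lborel. f x = g x"
  shows "integrable lebesgue f \<longleftrightarrow> integrable lborel g" and "integral\<^sup>L lebesgue f = integral\<^sup>L lborel g"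
proof -
  have f: "f \<in> borel_measurable lebesgue" by (rule lebesgue_measurableI_AE[OF g eq])
  have g': "g \<in> borel_measurable lebesgue" using g by (simp add: measurable_completion)
  have eq': "AE x in lebesgue. f x = g x" using eq by (simp add: AE_completion_iff)
  have "integrable lebesgue f \<longleftrightarrow> integrable lebesgue g" by (rule integrable_cong_AE[OF f g' eq'])
  then show "integrable lebesgue f \<longleftrightarrow> integrable lborel g" using g by (simp add: integrable_completion)
  have "integral\<^sup>L lebesgue f = integral\<^sup>L lebesgue g" by (rule integral_cong_AE[OF f g' eq'])
  then show "integral\<^sup>L lebesgue f = integral\<^sup>L lborel g" using g by (simp add: integral_completion)
qed

lemma scales_measure_integral:
  fixes f :: "'a::euclidean_space \<Rightarrow> complex"
  assumes T: "scales_measure T c" and f: "f \<in> borel_measurable lebesgue"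
  shows "integrable lebesgue f \<Longrightarrow> integrable lebesgue (\<lambda>x. f (T x))"
    and "(\<integral>x. f (T x) \<partial>lebesgue) = of_real c * (\<integral>x. f x \<partial>lebesgue)"
proof -
  note [measurable] = scales_measure_measurable[OF T]
  have c: "c > 0" using T by (simp add: scales_measure_def)
  obtain g where g [measurable]: "g \<in> borel_measurable borel" and eq: "AE x in lborel. f x = g x"
    using borel_representative[OF f] by blast
  have gT: "(\<lambda>x. g (T x)) \<in> borel_measurable borel" by measurable
  note rep = integral_lebesgue_borel_representative[OF g eq] integral_lebesgue_borel_representative[OF gT scales_measure_AE[OF T eq]]
  have "integrable lborel (\<lambda>x. g (T x))" if "integrable lborel g"
  proof -
    have "integrable (density lborel (\<lambda>_. ennreal c)) g"
      using that c by (subst integrable_density) auto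
    then show ?thesis
      unfolding scales_measure_distr[OF T, symmetric] by (subst (asm) integrable_distr_eq) auto
  qed
  then show "integrable lebesgue f \<Longrightarrow> integrable lebesgue (\<lambda>x. f (T x))" using rep by simp
  have "(\<integral>x. g (T x) \<partial>lborel) = integral\<^sup>L (distr lborel borel T) g"
    by (rule integral_distr[symmetric]) auto
  also have "\<dots> = of_real c * integral\<^sup>L lborel g"
    unfolding scales_measure_distr[OF T] using c by (subst integral_density) (auto simp: scaleR_conv_of_real)
  finally show "(\<integral>x. f (T x) \<partial>lebesgue) = of_real c * (\<integral>x. f x \<partial>lebesgue)" using rep by simp
qed

lemma scales_measure_real_affine:
  assumes c: "c \<noteq> 0"
  shows "scales_measure (\<lambda>x::real. t + c * x) (1 / \<bar>c\<bar>)"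
  unfolding scales_measure_def
proof (intro conjI allI impI)
  fix F :: "real \<Rightarrow> ennreal" assume F: "F \<in> borel_measurable borel"
  have "(\<integral>\<^sup>+x. F x \<partial>lborel) = ennreal \<bar>c\<bar> * (\<integral>\<^sup>+x. F (t + c * x) \<partial>lborel)"
    by (rule nn_integral_real_affine[OF F c])
  then have "ennreal (1 / \<bar>c\<bar>) * (\<integral>\<^sup>+x. F x \<partial>lborel) = (ennreal (1 / \<bar>c\<bar>) * ennreal \<bar>c\<bar>) * (\<integral>\<^sup>+x. F (t + c * x) \<partial>lborel)"
    by (simp add: mult.assoc)
  also have "ennreal (1 / \<bar>c\<bar>) * ennreal \<bar>c\<bar> = 1"
    using c by (simp add: ennreal_mult[symmetric])
  finally show "(\<integral>\<^sup>+x. F (t + c * x) \<partial>lborel) = ennreal (1 / \<bar>c\<bar>) * (\<integral>\<^sup>+x. F x \<partial>lborel)" by simp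
qed (use c in auto)

lemma AE_lborel_fst:
  assumes P: "AE x in lborel. P (x::'a::euclidean_space)"
  shows "AE z in (lborel :: ('a \<times> 'b::euclidean_space) measure). P (fst z)"
proof -
  obtain N where N: "N \<in> sets borel" "emeasure lborel N = 0" "\<And>x. x \<notin> N \<Longrightarrow> P x"
    by (rule AE_lborel_borel_superset[OF P]) auto
  have "AE x in lborel. x \<notin> N" using N by (intro AE_not_in) (simp add: null_sets_def)
  then have "AE x in lborel. AE y in (lborel::'b measure). fst (x, y) \<notin> N" by eventually_elim simp
  then have "AE z in ((lborel :: 'a measure) \<Otimes>\<^sub>M (lborel :: 'b measure)). fst z \<notin> N"
    by (intro lborel_pair.AE_pair_measure) (use N(1) in \<open>measurable\<close>)
  then have "AE z in (lborel :: ('a \<times> 'b) measure). fst z \<notin> N" by (simp only: lborel_prod)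
  then show ?thesis by eventually_elim (rule N(3))
qed

section \<open>The Fourier transform of integrable functions\<close>

definition L1_L2 :: "(heis \<Rightarrow> complex) \<Rightarrow> bool" where
  "L1_L2 \<Phi> \<longleftrightarrow> \<Phi> \<in> L2 lebesgue \<and> integrable lebesgue \<Phi>"

lemma schroedinger_measurable_borel:
  assumes [measurable]: "f \<in> borel_measurable borel"
  shows "(\<lambda>x. schroedinger l x f t) \<in> borel_measurable borel"
proof -
  have eq: "schroedinger l x f t = ef (l * snd (snd x)) * ef (- (l * t) * fst (snd x)) * f (t - fst x)" for x
    by (cases x) (simp add: schroedinger_ef del: schroedinger.simps)
  have "(\<lambda>x. schroedinger l x f t) \<in> borel_measurable (borel \<Otimes>\<^sub>M (borel \<Otimes>\<^sub>M borel))"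
    unfolding eq by measurable
  then show ?thesis by (simp add: borel_prod)
qed

lemma AE_schroedinger_eq:
  assumes "AE t in lborel. f t = g t"
  shows "AE x in lborel. schroedinger l x f t = schroedinger l x g t"
proof -
  have "AE x in lborel. f (t + (-1) * x) = g (t + (-1) * x)"
    by (rule scales_measure_AE[OF scales_measure_real_affine assms]) simp
  from AE_lborel_fst[OF this, where 'b="real \<times> real"] show ?thesis
    by eventually_elim (auto simp: schroedinger_ef simp del: schroedinger.simps)
qed

lemma fourier_integrand_representative:
  assumes "AE x in lborel. \<Phi> x = \<Phi>' x" "AE t in lborel. f t = f' t"
  shows "AE x in lborel. \<Phi> x * schroedinger l x f t = \<Phi>' x * schroedinger l x f' t"
  using assms(1) AE_schroedinger_eq[OF assms(2), of l t] by eventually_elim simp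

lemma fourier_integrand_measurable:
  assumes \<Phi>: "\<Phi> \<in> borel_measurable lebesgue" and f: "f \<in> borel_measurable lebesgue"
  shows "(\<lambda>x. \<Phi> x * schroedinger l x f t) \<in> borel_measurable lebesgue"
proof -
  obtain \<Phi>' where \<Phi>' [measurable]: "\<Phi>' \<in> borel_measurable borel" and e1: "AE x in lborel. \<Phi> x = \<Phi>' x"
    using borel_representative[OF \<Phi>] by blast
  obtain f' where f' [measurable]: "f' \<in> borel_measurable borel" and e2: "AE x in lborel. f x = f' x"
    using borel_representative[OF f] by blast
  note [measurable] = schroedinger_measurable_borel[OF f']
  show ?thesis
    by (rule lebesgue_measurableI_AE[OF _ fourier_integrand_representative[OF e1 e2]]) measurable
qed

lemma L1_L2_representative:
  assumes "L1_L2 \<Phi>"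
  obtains \<Phi>' where "\<Phi>' \<in> borel_measurable borel" "integrable lborel \<Phi>'" "AE x in lborel. \<Phi> x = \<Phi>' x"
    "nsq lborel \<Phi>' = nsq lebesgue \<Phi>" "nsq lborel \<Phi>' < \<infinity>"
proof -
  have L: "\<Phi> \<in> L2 lebesgue" and int: "integrable lebesgue \<Phi>" using assms by (simp_all add: L1_L2_def)
  obtain \<Phi>' where \<Phi>': "\<Phi>' \<in> borel_measurable borel" "AE x in lborel. \<Phi> x = \<Phi>' x"
    "nsq lborel \<Phi>' = nsq lebesgue \<Phi>" "nsq lborel \<Phi>' < \<infinity>"
    by (rule L2_borel_representative[OF L])
  moreover have "integrable lborel \<Phi>'"
    using integral_lebesgue_borel_representative(1)[OF \<Phi>'(1,2)] int by simp
  ultimately show ?thesis by (intro that)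
qed

lemma fourier_L1_representative:
  assumes \<Phi>: "\<Phi>' \<in> borel_measurable borel" "integrable lborel \<Phi>'" "AE x in lborel. \<Phi> x = \<Phi>' x"
    and f: "f' \<in> borel_measurable borel" "nsq lborel f' < \<infinity>" "AE x in lborel. f x = f' x"
  shows "AE t in lborel. \<forall>l. integrable lebesgue (\<lambda>x. \<Phi> x * schroedinger l x f t) \<and> fourier_L1 \<Phi> l f t = ker_op \<Phi>' l f' t"
  using AE_fourier_integrable_borel[OF \<Phi>(2) f(1,2)]
proof eventually_elim
  case (elim t)
  note [measurable] = \<Phi>(1) schroedinger_measurable_borel[OF f(1)]
  show ?case
  proof
    fix l
    have m: "(\<lambda>x. \<Phi>' x * schroedinger l x f' t) \<in> borel_measurable borel" by measurable
    note rep = integral_lebesgue_borel_representative[OF m fourier_integrand_representative[OF \<Phi>(3) f(3)]]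
    show "integrable lebesgue (\<lambda>x. \<Phi> x * schroedinger l x f t) \<and> fourier_L1 \<Phi> l f t = ker_op \<Phi>' l f' t"
      using rep elim fourier_borel_eq_ker_op[OF \<Phi>(2) _ f(1), of l t] by (simp add: fourier_L1_def)
  qed
qed

lemma AE_fourier_integrable:
  assumes "L1_L2 \<Phi>" "f \<in> L2R"
  shows "AE t in lborel. \<forall>l. integrable lebesgue (\<lambda>x. \<Phi> x * schroedinger l x f t)"
proof -
  obtain \<Phi>' where \<Phi>': "\<Phi>' \<in> borel_measurable borel" "integrable lborel \<Phi>'" "AE x in lborel. \<Phi> x = \<Phi>' x"
    by (rule L1_L2_representative[OF assms(1)])
  obtain f' where f': "f' \<in> borel_measurable borel" "AE x in lborel. f x = f' x" "nsq lborel f' < \<infinity>"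
    by (rule L2_borel_representative[OF assms(2)])
  show ?thesis using fourier_L1_representative[OF \<Phi>' f'(1,3,2)] by eventually_elim blast
qed

text \<open>Summary of the analysis of integrable functions, with the Borel representative and its kernel hidden
  in the function \<open>k\<close>, which plays the part of \<open>l \<mapsto> |l| \<parallel>\<Phi>-hat(l)\<parallel>\<^sup>2\<close>.\<close>

lemma fourier_kernel_norm:
  assumes "L1_L2 \<Phi>"
  obtains k where "k \<in> borel_measurable borel" "(\<integral>\<^sup>+l. k l \<partial>lborel) = nsq lebesgue \<Phi>"
    "\<And>l f. l \<noteq> 0 \<Longrightarrow> f \<in> L2R \<Longrightarrow> fourier_L1 \<Phi> l f \<in> borel_measurable lebesgue"
    "\<And>l f. l \<noteq> 0 \<Longrightarrow> f \<in> L2R \<Longrightarrow> ennreal \<bar>l\<bar> * nsq lebesgue (fourier_L1 \<Phi> l f) \<le> k l * nsq lebesgue f"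
    "\<And>l. l \<noteq> 0 \<Longrightarrow> k l < \<infinity> \<Longrightarrow> ennreal \<bar>l\<bar> * (\<Sum>\<^sup>+j. nsq lebesgue (fourier_L1 \<Phi> l (onb j))) = k l"
    "\<And>f g. f \<in> L2R \<Longrightarrow> g \<in> L2R \<Longrightarrow> (\<lambda>l. L2_inner lebesgue (fourier_L1 \<Phi> l f) g) \<in> borel_measurable borel"
proof -
  obtain \<Phi>' where \<Phi>': "\<Phi>' \<in> borel_measurable borel" "integrable lborel \<Phi>'" "AE x in lborel. \<Phi> x = \<Phi>' x"
    "nsq lborel \<Phi>' = nsq lebesgue \<Phi>" "nsq lborel \<Phi>' < \<infinity>"
    by (rule L1_L2_representative[OF assms])
  note m [measurable] = borel_heis[OF \<Phi>'(1)]
  have rep: "AE t in lborel. fourier_L1 \<Phi> l f t = ker_op \<Phi>' l f' t"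
    if "f' \<in> borel_measurable borel" "nsq lborel f' < \<infinity>" "AE x in lborel. f x = f' x" for l f f'
    using fourier_L1_representative[OF \<Phi>'(1-3) that] by eventually_elim simp
  have repn: "nsq lebesgue (fourier_L1 \<Phi> l f) = nsq lborel (ker_op \<Phi>' l f')"
    if "f' \<in> borel_measurable borel" "nsq lborel f' < \<infinity>" "AE x in lborel. f x = f' x" for l f f'
    unfolding nsq_lebesgue by (rule nsq_cong_AE) (rule rep[OF that])
  show ?thesis
  proof (rule that[of "ker_nsq \<Phi>'"])
    show "ker_nsq \<Phi>' \<in> borel_measurable borel" by measurable
    show "(\<integral>\<^sup>+l. ker_nsq \<Phi>' l \<partial>lborel) = nsq lebesgue \<Phi>" using integral_ker_nsq[OF \<Phi>'(2,5)] \<Phi>'(4) by simp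
    fix l :: real assume l: "l \<noteq> 0"
    {
      fix f assume "f \<in> L2R"
      then obtain f' where f' [measurable]: "f' \<in> borel_measurable borel" and f'': "AE x in lborel. f x = f' x" "nsq lborel f' = nsq lebesgue f" "nsq lborel f' < \<infinity>"
        by (rule L2_borel_representative)
      show "fourier_L1 \<Phi> l f \<in> borel_measurable lebesgue"
        by (rule lebesgue_measurableI_AE[OF _ rep[OF f' f''(3,1)]]) measurable
      show "ennreal \<bar>l\<bar> * nsq lebesgue (fourier_L1 \<Phi> l f) \<le> ker_nsq \<Phi>' l * nsq lebesgue f"
        unfolding repn[OF f' f''(3,1)] f''(2)[symmetric] by (rule ker_op_bound[OF m l f'])
    }
    assume "ker_nsq \<Phi>' l < \<infinity>"
    then show "ennreal \<bar>l\<bar> * (\<Sum>\<^sup>+j. nsq lebesgue (fourier_L1 \<Phi> l (onb j))) = ker_nsq \<Phi>' l"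
      using ker_op_hilbert_schmidt[OF m l] repn[OF onb_measurable _ AE_I2[OF refl], of _ l] by (simp add: onb_nsq)
  next
    fix f g :: "real \<Rightarrow> complex" assume "f \<in> L2R" "g \<in> L2R"
    then obtain f' g' where f' [measurable]: "f' \<in> borel_measurable borel" and f'': "AE x in lborel. f x = f' x" "nsq lborel f' < \<infinity>"
      and g' [measurable]: "g' \<in> borel_measurable borel" and g'': "AE x in lborel. g x = g' x"
      by (metis L2_borel_representative)
    have "L2_inner lebesgue (fourier_L1 \<Phi> l f) g = (\<integral>t. ker_op \<Phi>' l f' t * cnj (g' t) \<partial>lborel)" for l
      by (rule L2_inner_lebesgue_borel[OF _ g' rep[OF f' f''(2,1)] g'']) measurable
    then show "(\<lambda>l. L2_inner lebesgue (fourier_L1 \<Phi> l f) g) \<in> borel_measurable borel" by simp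
  qed
qed

lemma L1_L2_add_scale: "L1_L2 \<Phi> \<Longrightarrow> L1_L2 \<Psi> \<Longrightarrow> L1_L2 (\<lambda>x. \<Phi> x + c * \<Psi> x)"
  unfolding L1_L2_def by (intro conjI L2_add L2_scale Bochner_Integration.integrable_add integrable_mult_right) auto

lemma fourier_L1_add_scale:
  assumes "L1_L2 \<Phi>" "L1_L2 \<Psi>" "f \<in> L2R"
  shows "AE t in lborel. \<forall>l. fourier_L1 (\<lambda>x. \<Phi> x + c * \<Psi> x) l f t = fourier_L1 \<Phi> l f t + c * fourier_L1 \<Psi> l f t"
  using AE_fourier_integrable[OF assms(1,3)] AE_fourier_integrable[OF assms(2,3)]
proof eventually_elim
  case (elim t)
  show ?case
  proof
    fix l
    have "fourier_L1 (\<lambda>x. \<Phi> x + c * \<Psi> x) l f t = (\<integral>x. \<Phi> x * schroedinger l x f t + c * (\<Psi> x * schroedinger l x f t) \<partial>lebesgue)"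
      unfolding fourier_L1_def by (simp add: algebra_simps)
    also have "\<dots> = fourier_L1 \<Phi> l f t + c * fourier_L1 \<Psi> l f t"
      unfolding fourier_L1_def using elim by (subst Bochner_Integration.integral_add) auto
    finally show "fourier_L1 (\<lambda>x. \<Phi> x + c * \<Psi> x) l f t = fourier_L1 \<Phi> l f t + c * fourier_L1 \<Psi> l f t" .
  qed
qed

lemma fourier_L1_linear:
  assumes "L1_L2 \<Phi>" "f \<in> L2R" "g \<in> L2R"
  shows "AE t in lborel. fourier_L1 \<Phi> l (\<lambda>s. f s + c * g s) t = fourier_L1 \<Phi> l f t + c * fourier_L1 \<Phi> l g t"
  using AE_fourier_integrable[OF assms(1,2)] AE_fourier_integrable[OF assms(1,3)]
proof eventually_elim
  case (elim t)
  have eq: "schroedinger l x (\<lambda>s. f s + c * g s) t = schroedinger l x f t + c * schroedinger l x g t" for x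
    by (cases x) (simp add: algebra_simps)
  have "fourier_L1 \<Phi> l (\<lambda>s. f s + c * g s) t = (\<integral>x. \<Phi> x * schroedinger l x f t + c * (\<Phi> x * schroedinger l x g t) \<partial>lebesgue)"
    unfolding fourier_L1_def eq by (simp add: algebra_simps)
  also have "\<dots> = fourier_L1 \<Phi> l f t + c * fourier_L1 \<Phi> l g t"
    unfolding fourier_L1_def using elim by (subst Bochner_Integration.integral_add) auto
  finally show ?case .
qed

section \<open>The Plancherel measure\<close>

lemma AE_lebesgue_on_Lam: "(AE l in lebesgue_on Lam. P l) \<longleftrightarrow> (AE l in lborel. P l)"
proof -
  have "Lam \<inter> space lebesgue \<in> sets lebesgue" by (auto simp: Lam_def)
  then have "(AE l in lebesgue_on Lam. P l) \<longleftrightarrow> (AE l in lborel. l \<in> Lam \<longrightarrow> P l)"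
    by (subst AE_restrict_space_iff) (auto simp: AE_completion_iff)
  also have "\<dots> \<longleftrightarrow> (AE l in lborel. P l)"
    using AE_lborel_singleton[of "0::real"] by (auto simp: Lam_def elim: eventually_elim2)
  finally show ?thesis .
qed

lemma measurable_lebesgue_on_Lam:
  fixes f :: "real \<Rightarrow> complex"
  shows "f \<in> borel_measurable (lebesgue_on Lam) \<Longrightarrow> f \<in> borel_measurable lebesgue"
proof -
  assume f: "f \<in> borel_measurable (lebesgue_on Lam)"
  have "Lam \<in> sets lebesgue" by (auto simp: Lam_def)
  then have "(\<lambda>x. if x \<in> Lam then f x else 0) \<in> borel_measurable lebesgue"
    using f by (subst borel_measurable_if)
  moreover have "AE x in lborel. (if x \<in> Lam then f x else 0) = f x"
    using AE_lborel_singleton[of "0::real"] by eventually_elim (simp add: Lam_def)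
  ultimately show ?thesis by (rule lebesgue_measurable_AE_cong)
qed

lemma abs_measurable_lebesgue_on: "(\<lambda>l::real. ennreal \<bar>l\<bar>) \<in> borel_measurable (lebesgue_on Lam)"
  by (intro measurable_restrict_space1 measurable_completion) auto

lemma AE_plancherel: "(AE l in plancherel. P l) \<longleftrightarrow> (AE l in lborel. P l)"
proof -
  have "(AE l in plancherel. P l) \<longleftrightarrow> (AE l in lebesgue_on Lam. 0 < ennreal \<bar>l\<bar> \<longrightarrow> P l)"
    unfolding plancherel_def by (rule AE_density[OF abs_measurable_lebesgue_on])
  also have "\<dots> \<longleftrightarrow> (AE l in lborel. 0 < ennreal \<bar>l\<bar> \<longrightarrow> P l)"
    by (rule AE_lebesgue_on_Lam)
  also have "\<dots> \<longleftrightarrow> (AE l in lborel. P l)"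
    using AE_lborel_singleton[of "0::real"] by (auto elim: eventually_elim2)
  finally show ?thesis .
qed

lemma nn_integral_plancherel:
  assumes f: "f \<in> borel_measurable lebesgue"
  shows "(\<integral>\<^sup>+l. f l \<partial>plancherel) = (\<integral>\<^sup>+l. ennreal \<bar>l\<bar> * f l \<partial>lborel)"
proof -
  have L: "Lam \<inter> space lebesgue \<in> sets lebesgue" by (auto simp: Lam_def)
  have "(\<integral>\<^sup>+l. f l \<partial>plancherel) = (\<integral>\<^sup>+l. ennreal \<bar>l\<bar> * f l \<partial>lebesgue_on Lam)"
    unfolding plancherel_def using f
    by (intro nn_integral_density abs_measurable_lebesgue_on measurable_restrict_space1)
  also have "\<dots> = (\<integral>\<^sup>+l. ennreal \<bar>l\<bar> * f l * indicator Lam l \<partial>lebesgue)"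
    by (rule nn_integral_restrict_space[OF L])
  also have "\<dots> = (\<integral>\<^sup>+l. ennreal \<bar>l\<bar> * f l \<partial>lebesgue)"
    by (intro nn_integral_cong) (auto simp: Lam_def indicator_def)
  finally show ?thesis by (simp add: nn_integral_completion)
qed

section \<open>Bounded operators and their Hilbert--Schmidt norms\<close>

lemma bounded_operator_L2: "bounded_operator B \<Longrightarrow> f \<in> L2R \<Longrightarrow> B f \<in> L2R"
  by (simp add: bounded_operator_def)

lemma bounded_operator_add:
  "bounded_operator B \<Longrightarrow> f \<in> L2R \<Longrightarrow> g \<in> L2R \<Longrightarrow> AE t in lborel. B (\<lambda>s. f s + g s) t = B f t + B g t"
  unfolding bounded_operator_def AE_completion_iff by auto

lemma bounded_operator_scale:
  "bounded_operator B \<Longrightarrow> f \<in> L2R \<Longrightarrow> AE t in lborel. B (\<lambda>s. c * f s) t = c * B f t"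
  unfolding bounded_operator_def AE_completion_iff by auto

lemma bounded_operator_linear:
  assumes B: "bounded_operator B" and f: "f \<in> L2R" and g: "g \<in> L2R"
  shows "AE t in lborel. B (\<lambda>s. f s + c * g s) t = B f t + c * B g t"
  using bounded_operator_add[OF B f L2_scale[OF g, of c]] bounded_operator_scale[OF B g, of c]
  by eventually_elim simp

lemma bounded_operator_zero:
  assumes "bounded_operator B"
  shows "AE t in lborel. B (\<lambda>_. 0) t = 0"
  using bounded_operator_scale[OF assms L2_zero, of 0] by simp

lemma bounded_operator_bound:
  assumes "bounded_operator B"
  obtains K where "K \<ge> 0" "\<And>f. f \<in> L2R \<Longrightarrow> L2_norm lebesgue (B f) \<le> K * L2_norm lebesgue f"
proof -
  obtain K where K: "\<And>f. f \<in> L2R \<Longrightarrow> L2_norm lebesgue (B f) \<le> K * L2_norm lebesgue f"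
    using assms unfolding bounded_operator_def by blast
  have "L2_norm lebesgue (B f) \<le> max 0 K * L2_norm lebesgue f" if "f \<in> L2R" for f
    using K[OF that] mult_right_mono[of K "max 0 K" "L2_norm lebesgue f"] by simp
  then show ?thesis using that[of "max 0 K"] by simp
qed

lemma bounded_operator_cong_AE:
  assumes B: "bounded_operator B" and "f \<in> L2R" "g \<in> L2R" and eq: "AE t in lborel. f t = g t"
  shows "AE t in lborel. B f t = B g t"
proof -
  obtain K where K: "\<And>f. f \<in> L2R \<Longrightarrow> L2_norm lebesgue (B f) \<le> K * L2_norm lebesgue f"
    by (rule bounded_operator_bound[OF B]) auto
  have d: "(\<lambda>s. f s + (-1) * g s) \<in> L2R" using assms by (intro L2_add L2_scale)
  have "L2_norm lebesgue (\<lambda>s. f s + (-1) * g s) = L2_norm lebesgue (\<lambda>_::real. 0)"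
  proof (rule L2_norm_cong_AE[OF L2_measurable[OF d]])
    show "AE s in lebesgue. f s + (-1) * g s = 0"
      unfolding AE_completion_iff using eq by eventually_elim simp
  qed simp
  then have "L2_norm lebesgue (\<lambda>s. f s + (-1) * g s) = 0" by (simp add: L2_norm_def)
  then have "L2_norm lebesgue (B (\<lambda>s. f s + (-1) * g s)) = 0" using K[OF d] by (simp add: order_antisym)
  then have "AE t in lebesgue. B (\<lambda>s. f s + (-1) * g s) t = 0"
    by (rule L2_norm_eq_0_AE[OF bounded_operator_L2[OF B d]])
  then have "AE t in lborel. B (\<lambda>s. f s + (-1) * g s) t = 0" by (simp add: AE_completion_iff)
  with bounded_operator_linear[OF B assms(2,3), of "-1"] show ?thesis by eventually_elim simp
qed

lemma bounded_operatorI: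
  assumes L2: "\<And>f. f \<in> L2R \<Longrightarrow> B f \<in> L2R"
    and lin: "\<And>f g c. f \<in> L2R \<Longrightarrow> g \<in> L2R \<Longrightarrow> AE t in lborel. B (\<lambda>s. f s + c * g s) t = B f t + c * B g t"
    and bd: "\<And>f. f \<in> L2R \<Longrightarrow> nsq lebesgue (B f) \<le> ennreal K * nsq lebesgue f"
  shows "bounded_operator B"
  unfolding bounded_operator_def AE_completion_iff
proof (intro conjI ballI allI)
  fix f g :: "real \<Rightarrow> complex" assume "f \<in> L2R" "g \<in> L2R"
  then show "AE t in lborel. B (\<lambda>s. f s + g s) t = B f t + B g t" using lin[of f g 1] by simp
next
  fix c and g :: "real \<Rightarrow> complex" assume g: "g \<in> L2R"
  have "nsq lebesgue (B (\<lambda>_. 0)) \<le> ennreal K * nsq lebesgue (\<lambda>_::real. 0)" by (rule bd[OF L2_zero])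
  then have "nsq lebesgue (B (\<lambda>_. 0)) = 0" by (simp add: nsq_def)
  then have "AE t in lebesgue. B (\<lambda>_. 0) t = 0" by (intro nsq_eq_0_AE) (use L2[OF L2_zero] in \<open>auto simp: L2_measurable\<close>)
  then have "AE t in lborel. B (\<lambda>_. 0) t = 0" by (simp add: AE_completion_iff)
  with lin[OF L2_zero g, of c] show "AE t in lborel. B (\<lambda>s. c * g s) t = c * B g t"
    by eventually_elim simp
next
  show "\<exists>K. \<forall>f\<in>L2R. L2_norm lebesgue (B f) \<le> K * L2_norm lebesgue f"
  proof (intro exI ballI)
    fix f :: "real \<Rightarrow> complex" assume f: "f \<in> L2R"
    have "ennreal ((L2_norm lebesgue (B f))\<^sup>2) \<le> ennreal (max 0 K) * ennreal ((L2_norm lebesgue f)\<^sup>2)"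
    proof -
      have "ennreal K = ennreal (max 0 K)" by (simp add: max_def ennreal_neg)
      then show ?thesis using bd[OF f] f L2[OF f] by (simp add: nsq_eq_L2_norm)
    qed
    also have "\<dots> = ennreal ((sqrt (max 0 K) * L2_norm lebesgue f)\<^sup>2)"
      by (simp add: power_mult_distrib ennreal_mult)
    finally have "(L2_norm lebesgue (B f))\<^sup>2 \<le> (sqrt (max 0 K) * L2_norm lebesgue f)\<^sup>2"
      by (simp add: ennreal_le_iff)
    then show "L2_norm lebesgue (B f) \<le> sqrt (max 0 K) * L2_norm lebesgue f"
      by (rule power2_le_imp_le) simp
  qed
qed (use L2 in auto)

lemma bounded_operator_diff:
  assumes B: "bounded_operator B" and C: "bounded_operator C"
  shows "bounded_operator (\<lambda>f t. B f t - C f t)"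
proof -
  obtain K where K: "K \<ge> 0" "\<And>f. f \<in> L2R \<Longrightarrow> L2_norm lebesgue (B f) \<le> K * L2_norm lebesgue f"
    by (rule bounded_operator_bound[OF B]) auto
  obtain K' where K': "K' \<ge> 0" "\<And>f. f \<in> L2R \<Longrightarrow> L2_norm lebesgue (C f) \<le> K' * L2_norm lebesgue f"
    by (rule bounded_operator_bound[OF C]) auto
  show ?thesis
  proof (rule bounded_operatorI[where K = "(K + K')\<^sup>2"])
    fix f :: "real \<Rightarrow> complex" assume f: "f \<in> L2R"
    note L = bounded_operator_L2[OF B f] bounded_operator_L2[OF C f]
    show L': "(\<lambda>t. B f t - C f t) \<in> L2R" using L by (rule L2_diff)
    have "L2_norm lebesgue (\<lambda>t. B f t - C f t) \<le> L2_norm lebesgue (\<lambda>t. B f t - 0) + L2_norm lebesgue (\<lambda>t. 0 - C f t)"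
      using L by (intro L2_norm_diff_triangle) auto
    also have "\<dots> = L2_norm lebesgue (B f) + L2_norm lebesgue (C f)" by (simp add: L2_norm_def)
    also have "\<dots> \<le> (K + K') * L2_norm lebesgue f" using K(2)[OF f] K'(2)[OF f] by (simp add: distrib_right)
    finally have "(L2_norm lebesgue (\<lambda>t. B f t - C f t))\<^sup>2 \<le> ((K + K') * L2_norm lebesgue f)\<^sup>2"
      by (intro power_mono) auto
    then show "nsq lebesgue (\<lambda>t. B f t - C f t) \<le> ennreal ((K + K')\<^sup>2) * nsq lebesgue f"
      using L' f by (simp add: nsq_eq_L2_norm ennreal_mult[symmetric] power_mult_distrib ennreal_leI)
  next
    fix f g :: "real \<Rightarrow> complex" and c assume "f \<in> L2R" "g \<in> L2R"
    with bounded_operator_linear[OF B] bounded_operator_linear[OF C]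
    have "AE t in lborel. B (\<lambda>s. f s + c * g s) t = B f t + c * B g t" "AE t in lborel. C (\<lambda>s. f s + c * g s) t = C f t + c * C g t"
      by blast+
    then show "AE t in lborel. B (\<lambda>s. f s + c * g s) t - C (\<lambda>s. f s + c * g s) t = B f t - C f t + c * (B g t - C g t)"
      by eventually_elim (simp add: algebra_simps)
  qed
qed

text \<open>The squared Hilbert--Schmidt norm as the sum of the squares of all matrix coefficients in a fixed
  basis.  Unlike the supremum over all bases, this is visibly measurable in a parameter on which the
  matrix coefficients depend measurably.\<close>

definition hs_sq :: "L2_op \<Rightarrow> ennreal" where
  "hs_sq B = (\<Sum>\<^sup>+j. (\<Sum>\<^sup>+k. csq (L2_inner lebesgue (B (onb j)) (onb k))))"

lemma hs_sq_eq:
  assumes "\<And>j. B (onb j) \<in> L2R"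
  shows "hs_sq B = (\<Sum>\<^sup>+j. nsq lebesgue (B (onb j)))"
  unfolding hs_sq_def using assms by (simp add: onb_parseval)

lemma hs_sq_le_HS_norm_sq:
  assumes "\<And>j. B (onb j) \<in> L2R"
  shows "hs_sq B \<le> HS_norm_sq B"
proof -
  have "hs_sq B = (\<Sum>j. ennreal ((L2_norm lebesgue (B (onb j)))\<^sup>2))"
    unfolding hs_sq_eq[of B, OF assms] nn_integral_count_space_nat using assms by (simp add: nsq_eq_L2_norm)
  also have "\<dots> \<le> HS_norm_sq B"
    unfolding HS_norm_sq_def using orthonormal_basis_onb by (intro SUP_upper) auto
  finally show ?thesis .
qed

lemma orthonormal_family_onb: "orthonormal_family lebesgue onb"
  unfolding orthonormal_family_def by (auto simp: onb_L2 onb_L2_inner)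

definition onb_partial :: "(real \<Rightarrow> complex) \<Rightarrow> nat \<Rightarrow> real \<Rightarrow> complex" where
  "onb_partial f N = (\<lambda>t. \<Sum>j<N. L2_inner lebesgue f (onb j) * onb j t)"

lemma onb_partial_L2: "onb_partial f N \<in> L2R"
  unfolding onb_partial_def by (intro L2_sum L2_scale onb_L2)

lemma onb_partial_tendsto:
  assumes f: "f \<in> L2R"
  shows "(\<lambda>N. L2_norm lebesgue (\<lambda>t. f t - onb_partial f N t)) \<longlonglongrightarrow> 0"
proof -
  let ?a = "\<lambda>j. (cmod (L2_inner lebesgue f (onb j)))\<^sup>2"
  have "(?a has_sum (L2_norm lebesgue f)\<^sup>2) UNIV"
    by (subst nn_integral_count_space_has_sum) (auto simp: onb_parseval[OF f] nsq_eq_L2_norm[OF f])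
  then have "?a sums (L2_norm lebesgue f)\<^sup>2" by (rule has_sum_imp_sums)
  then have "(\<lambda>N. \<Sum>j<N. ?a j) \<longlonglongrightarrow> (L2_norm lebesgue f)\<^sup>2" by (simp add: sums_def)
  then have "(\<lambda>N. sqrt ((L2_norm lebesgue f)\<^sup>2 - (\<Sum>j<N. ?a j))) \<longlonglongrightarrow> sqrt ((L2_norm lebesgue f)\<^sup>2 - (L2_norm lebesgue f)\<^sup>2)"
    by (intro tendsto_intros)
  moreover have "L2_norm lebesgue (\<lambda>t. f t - onb_partial f N t) = sqrt ((L2_norm lebesgue f)\<^sup>2 - (\<Sum>j<N. ?a j))" for N
  proof -
    have "(L2_norm lebesgue (\<lambda>t. f t - onb_partial f N t))\<^sup>2 = (L2_norm lebesgue f)\<^sup>2 - (\<Sum>j<N. ?a j)"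
      unfolding onb_partial_def
      using orthonormal_family_dist_sq[OF orthonormal_family_onb f, of "{..<N}" "\<lambda>j. L2_inner lebesgue f (onb j)"] by simp
    then show ?thesis by (metis L2_norm_nonneg real_sqrt_unique)
  qed
  ultimately show ?thesis by simp
qed

lemma bounded_operator_onb_partial:
  assumes B: "bounded_operator B"
  shows "AE t in lborel. B (onb_partial f N) t = (\<Sum>j<N. L2_inner lebesgue f (onb j) * B (onb j) t)"
proof (induction N)
  case 0
  then show ?case using bounded_operator_zero[OF B] by (simp add: onb_partial_def)
next
  case (Suc N)
  have eq: "onb_partial f (Suc N) = (\<lambda>t. onb_partial f N t + L2_inner lebesgue f (onb N) * onb N t)"
    by (simp add: onb_partial_def)
  show ?case
    using Suc bounded_operator_linear[OF B onb_partial_L2[of f N] onb_L2[of N], of "L2_inner lebesgue f (onb N)"]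
    unfolding eq by eventually_elim simp
qed

text \<open>On the span of finitely many basis vectors this is Cauchy--Schwarz for the matrix coefficients; the
  partial expansions of \<open>f\<close> converge to \<open>f\<close> and \<open>B\<close> is bounded, so the estimate passes to the limit.
  It turns Hilbert--Schmidt convergence into strong convergence.\<close>

lemma nsq_le_hs_sq:
  assumes B: "bounded_operator B" and f: "f \<in> L2R"
  shows "nsq lebesgue (B f) \<le> hs_sq B * nsq lebesgue f"
proof (cases "hs_sq B = \<infinity>")
  case True
  show ?thesis
  proof (cases "nsq lebesgue f = 0")
    case True
    then have "L2_norm lebesgue f = 0" using f by (simp add: nsq_eq_L2_norm)
    moreover obtain K where "\<And>f. f \<in> L2R \<Longrightarrow> L2_norm lebesgue (B f) \<le> K * L2_norm lebesgue f"
      by (rule bounded_operator_bound[OF B]) auto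
    ultimately have "L2_norm lebesgue (B f) = 0" using f by (metis L2_norm_nonneg mult_zero_right order_antisym)
    then have "nsq lebesgue (B f) = 0" using bounded_operator_L2[OF B f] by (simp add: nsq_eq_L2_norm)
    then show ?thesis by simp
  next
    case False
    then show ?thesis using \<open>hs_sq B = \<infinity>\<close> by (simp add: ennreal_top_mult)
  qed
next
  case False
  note BL = bounded_operator_L2[OF B]
  define W where "W = enn2real (hs_sq B)"
  have W: "hs_sq B = ennreal W" "W \<ge> 0" using False by (simp_all add: W_def less_top)
  have hs: "hs_sq B = (\<Sum>\<^sup>+j. nsq lebesgue (B (onb j)))"
    by (rule hs_sq_eq) (intro BL onb_L2)
  obtain K where K: "K \<ge> 0" "\<And>f. f \<in> L2R \<Longrightarrow> L2_norm lebesgue (B f) \<le> K * L2_norm lebesgue f"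
    by (rule bounded_operator_bound[OF B]) auto
  let ?a = "\<lambda>j. L2_inner lebesgue f (onb j)"
  have part: "L2_norm lebesgue (B (onb_partial f N)) \<le> L2_norm lebesgue f * sqrt W" for N
  proof -
    have "nsq lebesgue (B (onb_partial f N)) = nsq lebesgue (\<lambda>t. \<Sum>j<N. ?a j * B (onb j) t)"
      unfolding nsq_lebesgue by (rule nsq_cong_AE) (rule bounded_operator_onb_partial[OF B])
    also have "\<dots> \<le> (\<integral>\<^sup>+t. ennreal (\<Sum>j<N. (cmod (?a j))\<^sup>2) * (\<Sum>j<N. csq (B (onb j) t)) \<partial>lebesgue)"
      unfolding nsq_def
    proof (rule nn_integral_mono)
      fix t
      have "(cmod (\<Sum>j<N. ?a j * B (onb j) t))\<^sup>2 \<le> (\<Sum>j<N. cmod (?a j) * cmod (B (onb j) t))\<^sup>2"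
        by (intro power_mono order_trans[OF norm_sum]) (auto simp: norm_mult)
      also have "\<dots> \<le> (\<Sum>j<N. (cmod (?a j))\<^sup>2) * (\<Sum>j<N. (cmod (B (onb j) t))\<^sup>2)"
        by (rule Cauchy_Schwarz_ineq_sum)
      finally have "csq (\<Sum>j<N. ?a j * B (onb j) t) \<le> ennreal ((\<Sum>j<N. (cmod (?a j))\<^sup>2) * (\<Sum>j<N. (cmod (B (onb j) t))\<^sup>2))"
        by (rule ennreal_leI)
      also have "\<dots> = ennreal (\<Sum>j<N. (cmod (?a j))\<^sup>2) * (\<Sum>j<N. csq (B (onb j) t))"
        by (subst ennreal_mult) (auto simp: sum_nonneg sum_ennreal)
      finally show "csq (\<Sum>j<N. ?a j * B (onb j) t) \<le> ennreal (\<Sum>j<N. (cmod (?a j))\<^sup>2) * (\<Sum>j<N. csq (B (onb j) t))" .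
    qed
    also have "\<dots> = ennreal (\<Sum>j<N. (cmod (?a j))\<^sup>2) * (\<Sum>j<N. nsq lebesgue (B (onb j)))"
      using L2_measurable[OF BL[OF onb_L2]] by (simp add: nn_integral_cmult nn_integral_sum nsq_def del: sum_ennreal)
    also have "\<dots> \<le> nsq lebesgue f * hs_sq B"
    proof (rule mult_mono)
      have "(\<Sum>\<^sup>+j. csq (?a j)) = nsq lebesgue f" by (rule onb_parseval[OF f])
      then have "(\<Sum>j. csq (?a j)) = nsq lebesgue f" by (simp add: nn_integral_count_space_nat)
      then show "ennreal (\<Sum>j<N. (cmod (?a j))\<^sup>2) \<le> nsq lebesgue f"
        by (subst sum_ennreal[symmetric]) (use sum_le_suminf[of "\<lambda>j. csq (?a j)" "{..<N}"] in auto)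
      have "(\<Sum>j. nsq lebesgue (B (onb j))) = hs_sq B" unfolding hs by (simp add: nn_integral_count_space_nat)
      then show "(\<Sum>j<N. nsq lebesgue (B (onb j))) \<le> hs_sq B"
        using sum_le_suminf[of "\<lambda>j. nsq lebesgue (B (onb j))" "{..<N}"] by auto
    qed auto
    finally have "ennreal ((L2_norm lebesgue (B (onb_partial f N)))\<^sup>2) \<le> ennreal ((L2_norm lebesgue f * sqrt W)\<^sup>2)"
      using f W(2) BL[OF onb_partial_L2] by (simp add: nsq_eq_L2_norm W(1) ennreal_mult power_mult_distrib)
    then have "(L2_norm lebesgue (B (onb_partial f N)))\<^sup>2 \<le> (L2_norm lebesgue f * sqrt W)\<^sup>2"
      by (simp add: ennreal_le_iff)
    then show ?thesis by (rule power2_le_imp_le) (simp add: W)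
  qed
  have bd: "L2_norm lebesgue (B f) \<le> K * L2_norm lebesgue (\<lambda>t. f t - onb_partial f N t) + L2_norm lebesgue f * sqrt W" for N
  proof -
    let ?d = "\<lambda>t. f t - onb_partial f N t"
    have d: "?d \<in> L2R" using f onb_partial_L2 by (rule L2_diff)
    have "AE t in lborel. B (\<lambda>s. ?d s + 1 * onb_partial f N s) t = B ?d t + 1 * B (onb_partial f N) t"
      by (rule bounded_operator_linear[OF B d onb_partial_L2])
    then have "L2_norm lebesgue (B f) = L2_norm lebesgue (\<lambda>t. B ?d t + B (onb_partial f N) t)"
      using L2_measurable[OF BL[OF f]] L2_measurable[OF L2_add[OF BL[OF d] BL[OF onb_partial_L2[of f N]]]]
      by (intro L2_norm_cong_AE) (auto simp: AE_completion_iff)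
    also have "\<dots> \<le> L2_norm lebesgue (B ?d) + L2_norm lebesgue (B (onb_partial f N))"
      by (rule L2_norm_triangle[OF BL[OF d] BL[OF onb_partial_L2]])
    also have "\<dots> \<le> K * L2_norm lebesgue ?d + L2_norm lebesgue f * sqrt W"
      by (intro add_mono K part d)
    finally show ?thesis .
  qed
  have "(\<lambda>N. K * L2_norm lebesgue (\<lambda>t. f t - onb_partial f N t) + L2_norm lebesgue f * sqrt W) \<longlonglongrightarrow> K * 0 + L2_norm lebesgue f * sqrt W"
    by (intro tendsto_intros onb_partial_tendsto f)
  then have "L2_norm lebesgue (B f) \<le> K * 0 + L2_norm lebesgue f * sqrt W"
    by (rule LIMSEQ_le_const) (use bd in auto)
  then have "(L2_norm lebesgue (B f))\<^sup>2 \<le> (L2_norm lebesgue f * sqrt W)\<^sup>2" by (intro power_mono) auto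
  then have "ennreal ((L2_norm lebesgue (B f))\<^sup>2) \<le> ennreal (W * (L2_norm lebesgue f)\<^sup>2)"
    using W(2) by (intro ennreal_leI) (simp add: power_mult_distrib mult.commute)
  then show ?thesis
    using W BL[OF f] f by (simp add: nsq_eq_L2_norm ennreal_mult)
qed

section \<open>Almost everywhere convergent subsequences\<close>

lemma tendsto_nn_integral_AE_subseq:
  fixes g :: "nat \<Rightarrow> 'a \<Rightarrow> ennreal"
  assumes g [measurable]: "\<And>n. g n \<in> borel_measurable M" and lim: "(\<lambda>n. \<integral>\<^sup>+x. g n x \<partial>M) \<longlonglongrightarrow> 0"
  shows "\<exists>r::nat \<Rightarrow> nat. strict_mono r \<and> (AE x in M. (\<lambda>n. g (r n) x) \<longlonglongrightarrow> 0)"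
proof -
  have "\<forall>\<^sub>F n in sequentially. (\<integral>\<^sup>+x. g n x \<partial>M) < 1" using lim by (rule order_tendstoD(2)) simp
  then obtain N where N: "\<And>n. n \<ge> N \<Longrightarrow> (\<integral>\<^sup>+x. g n x \<partial>M) < 1" unfolding eventually_sequentially by blast
  define u where "u n x = enn2real (g (n + N) x)" for n x
  have fin: "AE x in M. g (n + N) x \<noteq> \<infinity>" for n
    by (rule nn_integral_PInf_AE) (use N[of "n + N"] in auto)
  have eq: "(\<integral>\<^sup>+x. ennreal (u n x) \<partial>M) = (\<integral>\<^sup>+x. g (n + N) x \<partial>M)" for n
    using fin[of n] by (intro nn_integral_cong_AE) (auto simp: u_def less_top elim: eventually_mono)
  have [measurable]: "u n \<in> borel_measurable M" for n unfolding u_def by measurable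
  have u0: "u n x \<ge> 0" for n x by (simp add: u_def)
  have int: "integrable M (u n)" for n
    using eq[of n] N[of "n + N"] by (intro integrableI_nonneg) (auto simp: u_def intro: less_trans)
  have "(\<integral>x. norm (u n x) \<partial>M) = enn2real (\<integral>\<^sup>+x. g (n + N) x \<partial>M)" for n
    unfolding eq[symmetric] using u0 int[of n] by (subst integral_eq_nn_integral) auto
  moreover have "(\<lambda>n. enn2real (\<integral>\<^sup>+x. g (n + N) x \<partial>M)) \<longlonglongrightarrow> 0"
    by (rule tendsto_enn2real) (use LIMSEQ_ignore_initial_segment[OF lim, of N] in auto)
  ultimately have "(\<lambda>n. (\<integral>x. norm (u n x) \<partial>M)) \<longlonglongrightarrow> 0" by simp
  with tendsto_L1_AE_subseq[of M u] int obtain r where r: "strict_mono r" "AE x in M. (\<lambda>n. u (r n) x) \<longlonglongrightarrow> 0" by blast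
  have "AE x in M. \<forall>n. g (n + N) x \<noteq> \<infinity>" using fin by (simp add: AE_all_countable)
  with r(2) have "AE x in M. (\<lambda>n. g (r n + N) x) \<longlonglongrightarrow> 0"
  proof eventually_elim
    case (elim x)
    then have "(\<lambda>n. ennreal (u (r n) x)) \<longlonglongrightarrow> ennreal 0" by (intro tendsto_ennrealI)
    moreover have "ennreal (u (r n) x) = g (r n + N) x" for n
      using elim(2) by (simp add: u_def less_top)
    ultimately show ?case by simp
  qed
  moreover have "strict_mono (\<lambda>n. r n + N)" using r(1) by (simp add: strict_mono_def)
  ultimately show ?thesis by blast
qed

lemma ennreal_div_mult: "l \<noteq> 0 \<Longrightarrow> ennreal (1 / \<bar>l\<bar>) * (ennreal \<bar>l\<bar> * x) = x"
proof -
  assume "l \<noteq> (0::real)"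
  then have "ennreal (1 / \<bar>l\<bar>) * ennreal \<bar>l\<bar> = 1" by (simp add: ennreal_mult[symmetric])
  then show ?thesis by (simp add: mult.assoc[symmetric])
qed

lemma nsq_tendsto_iff:
  assumes "\<And>n. F n \<in> L2 M"
  shows "(\<lambda>n. nsq M (F n)) \<longlonglongrightarrow> 0 \<longleftrightarrow> (\<lambda>n. L2_norm M (F n)) \<longlonglongrightarrow> 0"
proof
  assume "(\<lambda>n. nsq M (F n)) \<longlonglongrightarrow> 0"
  then have "(\<lambda>n. enn2real (ennreal ((L2_norm M (F n))\<^sup>2))) \<longlonglongrightarrow> 0"
    using assms by (intro tendsto_enn2real) (simp_all add: nsq_eq_L2_norm)
  then have "(\<lambda>n. sqrt ((L2_norm M (F n))\<^sup>2)) \<longlonglongrightarrow> sqrt 0"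
    by (intro tendsto_intros) simp
  then show "(\<lambda>n. L2_norm M (F n)) \<longlonglongrightarrow> 0" by simp
next
  assume "(\<lambda>n. L2_norm M (F n)) \<longlonglongrightarrow> 0"
  then have "(\<lambda>n. (L2_norm M (F n))\<^sup>2) \<longlonglongrightarrow> 0\<^sup>2" by (intro tendsto_intros)
  then have "(\<lambda>n. ennreal ((L2_norm M (F n))\<^sup>2)) \<longlonglongrightarrow> ennreal (0\<^sup>2)" by (rule tendsto_ennrealI)
  then show "(\<lambda>n. nsq M (F n)) \<longlonglongrightarrow> 0" using assms by (simp add: nsq_eq_L2_norm)
qed

section \<open>The operators of an integrable function\<close>

lemma L1_L2_diff: "L1_L2 \<Phi> \<Longrightarrow> L1_L2 \<Psi> \<Longrightarrow> L1_L2 (\<lambda>x. \<Phi> x - \<Psi> x)"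
  using L1_L2_add_scale[of \<Phi> \<Psi> "-1"] by simp

lemma AE_neq_0: "AE l in lborel. l \<noteq> (0::real)"
  by (rule AE_lborel_singleton)

lemma fourier_L1_bounded:
  assumes "L1_L2 \<Phi>"
  shows "AE l in lborel. bounded_operator (fourier_L1 \<Phi> l)"
proof -
  obtain k where k: "k \<in> borel_measurable borel" "(\<integral>\<^sup>+l. k l \<partial>lborel) = nsq lebesgue \<Phi>"
    and m: "\<And>l f. l \<noteq> 0 \<Longrightarrow> f \<in> L2R \<Longrightarrow> fourier_L1 \<Phi> l f \<in> borel_measurable lebesgue"
    and bd: "\<And>l f. l \<noteq> 0 \<Longrightarrow> f \<in> L2R \<Longrightarrow> ennreal \<bar>l\<bar> * nsq lebesgue (fourier_L1 \<Phi> l f) \<le> k l * nsq lebesgue f"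
    by (rule fourier_kernel_norm[OF assms]) auto
  have "nsq lebesgue \<Phi> < \<infinity>" using assms by (simp add: L1_L2_def L2_iff_nsq)
  then have "AE l in lborel. k l \<noteq> \<infinity>" using k by (intro nn_integral_PInf_AE) auto
  with AE_neq_0 show ?thesis
  proof eventually_elim
    case (elim l)
    define K where "K = enn2real (k l)"
    have K: "k l = ennreal K" "K \<ge> 0" using elim by (simp_all add: K_def less_top)
    have b: "nsq lebesgue (fourier_L1 \<Phi> l f) \<le> ennreal (1 / \<bar>l\<bar> * K) * nsq lebesgue f" if f: "f \<in> L2R" for f
    proof -
      have "nsq lebesgue (fourier_L1 \<Phi> l f) = ennreal (1 / \<bar>l\<bar>) * (ennreal \<bar>l\<bar> * nsq lebesgue (fourier_L1 \<Phi> l f))"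
        by (rule ennreal_div_mult[symmetric]) (rule elim(1))
      also have "\<dots> \<le> ennreal (1 / \<bar>l\<bar>) * (k l * nsq lebesgue f)"
        using elim by (intro mult_left_mono bd f) auto
      also have "\<dots> = ennreal (1 / \<bar>l\<bar> * K) * nsq lebesgue f"
        unfolding K(1) using K(2) by (subst ennreal_mult) (auto simp: mult.assoc)
      finally show ?thesis .
    qed
    show ?case
    proof (rule bounded_operatorI[where K = "1 / \<bar>l\<bar> * K"])
      fix f :: "real \<Rightarrow> complex" assume f: "f \<in> L2R"
      have "ennreal (1 / \<bar>l\<bar> * K) * nsq lebesgue f < \<infinity>" using f by (simp add: L2_iff_nsq ennreal_mult_less_top)
      then show "fourier_L1 \<Phi> l f \<in> L2R"
        using b[OF f] m[OF _ f] elim by (auto simp: L2_iff_nsq intro: le_less_trans)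
    next
      fix f :: "real \<Rightarrow> complex" assume f: "f \<in> L2R"
      then show "nsq lebesgue (fourier_L1 \<Phi> l f) \<le> ennreal (1 / \<bar>l\<bar> * K) * nsq lebesgue f" by (rule b)
    qed (rule fourier_L1_linear[OF assms])
  qed
qed

lemma fourier_L1_hs:
  assumes "L1_L2 \<Phi>"
  shows "(\<integral>\<^sup>+l. ennreal \<bar>l\<bar> * hs_sq (fourier_L1 \<Phi> l) \<partial>lborel) = nsq lebesgue \<Phi>"
proof -
  obtain k where k: "k \<in> borel_measurable borel" "(\<integral>\<^sup>+l. k l \<partial>lborel) = nsq lebesgue \<Phi>"
    and hs: "\<And>l. l \<noteq> 0 \<Longrightarrow> k l < \<infinity> \<Longrightarrow> ennreal \<bar>l\<bar> * (\<Sum>\<^sup>+j. nsq lebesgue (fourier_L1 \<Phi> l (onb j))) = k l"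
    by (rule fourier_kernel_norm[OF assms]) auto
  have "nsq lebesgue \<Phi> < \<infinity>" using assms by (simp add: L1_L2_def L2_iff_nsq)
  then have "AE l in lborel. k l \<noteq> \<infinity>" using k by (intro nn_integral_PInf_AE) auto
  with AE_neq_0 fourier_L1_bounded[OF assms]
  have "AE l in lborel. ennreal \<bar>l\<bar> * hs_sq (fourier_L1 \<Phi> l) = k l"
  proof eventually_elim
    case (elim l)
    have "hs_sq (fourier_L1 \<Phi> l) = (\<Sum>\<^sup>+j. nsq lebesgue (fourier_L1 \<Phi> l (onb j)))"
      by (rule hs_sq_eq) (intro bounded_operator_L2[OF elim(2)] onb_L2)
    then show ?case using hs elim by (simp add: less_top)
  qed
  then show ?thesis unfolding k(2)[symmetric] by (rule nn_integral_cong_AE)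
qed

lemma hs_sq_measurable:
  assumes "\<And>j k. (\<lambda>l. L2_inner lebesgue (B l (onb j)) (onb k)) \<in> borel_measurable lebesgue"
  shows "(\<lambda>l. hs_sq (B l)) \<in> borel_measurable lebesgue"
proof -
  note [measurable] = assms
  show ?thesis unfolding hs_sq_def nn_integral_count_space_nat by measurable
qed

lemma hs_sq_le_add:
  assumes B: "bounded_operator B" and C: "bounded_operator C" and r: "r > 0"
  shows "hs_sq B \<le> ennreal (1 + r) * hs_sq C + ennreal (1 + 1 / r) * hs_sq (\<lambda>f t. B f t - C f t)"
proof -
  note BL = bounded_operator_L2[OF B onb_L2] and CL = bounded_operator_L2[OF C onb_L2]
  have D: "hs_sq (\<lambda>f t. B f t - C f t) = (\<Sum>\<^sup>+j. nsq lebesgue (\<lambda>t. B (onb j) t - C (onb j) t))"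
    by (rule hs_sq_eq) (intro L2_diff BL CL)
  have "hs_sq B = (\<Sum>\<^sup>+j. nsq lebesgue (B (onb j)))" by (rule hs_sq_eq) (rule BL)
  also have "\<dots> \<le> (\<Sum>\<^sup>+j. ennreal (1 + r) * nsq lebesgue (C (onb j)) + ennreal (1 + 1 / r) * nsq lebesgue (\<lambda>t. B (onb j) t - C (onb j) t))"
  proof (rule nn_integral_mono)
    fix j
    show "nsq lebesgue (B (onb j)) \<le> ennreal (1 + r) * nsq lebesgue (C (onb j)) + ennreal (1 + 1 / r) * nsq lebesgue (\<lambda>t. B (onb j) t - C (onb j) t)"
      using nsq_add_le[of "C (onb j)" lebesgue "\<lambda>t. B (onb j) t - C (onb j) t" r] L2_measurable[OF BL[of j]] L2_measurable[OF CL[of j]] r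
      by simp
  qed
  also have "\<dots> = ennreal (1 + r) * hs_sq C + ennreal (1 + 1 / r) * hs_sq (\<lambda>f t. B f t - C f t)"
    unfolding D hs_sq_eq[of C, OF CL] by (simp add: nn_integral_add nn_integral_cmult)
  finally show ?thesis .
qed

section \<open>The Fourier transform of square-integrable functions\<close>

text \<open>Repackages the defining approximation in terms of Lebesgue measure and of \<open>hs_sq\<close>, whose measurability
  in \<open>l\<close> makes integrals of sums split.\<close>

lemma has_fourier_transform_approx:
  assumes FT: "has_fourier_transform \<phi> A"
  obtains \<Phi> where "\<And>n. L1_L2 (\<Phi> n)" "(\<lambda>n. nsq lebesgue (\<lambda>x. \<Phi> n x - \<phi> x)) \<longlonglongrightarrow> 0"
    "AE l in lborel. bounded_operator (A l)"
    "(\<lambda>l. hs_sq (A l)) \<in> borel_measurable lebesgue"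
    "\<And>n. (\<lambda>l. hs_sq (\<lambda>f t. fourier_L1 (\<Phi> n) l f t - A l f t)) \<in> borel_measurable lebesgue"
    "\<And>n. (\<lambda>l. hs_sq (fourier_L1 (\<Phi> n) l)) \<in> borel_measurable lebesgue"
    "(\<lambda>n. \<integral>\<^sup>+l. ennreal \<bar>l\<bar> * hs_sq (\<lambda>f t. fourier_L1 (\<Phi> n) l f t - A l f t) \<partial>lborel) \<longlonglongrightarrow> 0"
proof -
  obtain \<Phi> where \<Phi>0: "\<And>n. \<Phi> n \<in> L2 lebesgue \<and> integrable lebesgue (\<Phi> n)"
    and n0: "(\<lambda>n. L2_norm lebesgue (\<lambda>x. \<Phi> n x - \<phi> x)) \<longlonglongrightarrow> 0"
    and HS: "(\<lambda>n. \<integral>\<^sup>+l. HS_norm_sq (\<lambda>f t. fourier_L1 (\<Phi> n) l f t - A l f t) \<partial>plancherel) \<longlonglongrightarrow> 0"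
    using FT unfolding has_fourier_transform_def by auto
  have \<phi>: "\<phi> \<in> L2 lebesgue" and F: "L2_HS_field A" using FT by (simp_all add: has_fourier_transform_def)
  have \<Phi>: "L1_L2 (\<Phi> n)" for n using \<Phi>0 by (simp add: L1_L2_def)
  have conv: "(\<lambda>n. nsq lebesgue (\<lambda>x. \<Phi> n x - \<phi> x)) \<longlonglongrightarrow> 0"
    using n0 by (subst nsq_tendsto_iff) (use \<Phi>0 \<phi> L2_diff in auto)
  have Ab: "AE l in lborel. bounded_operator (A l)"
    using F unfolding L2_HS_field_def AE_plancherel by (auto simp: hilbert_schmidt_def elim: eventually_mono)
  have Am: "(\<lambda>l. L2_inner lebesgue (A l f) g) \<in> borel_measurable lebesgue" if "f \<in> L2R" "g \<in> L2R" for f g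
    using F that unfolding L2_HS_field_def measurable_operator_field_def by (intro measurable_lebesgue_on_Lam) auto
  have \<Phi>m: "(\<lambda>l. L2_inner lebesgue (fourier_L1 (\<Phi> n) l f) g) \<in> borel_measurable lebesgue" if "f \<in> L2R" "g \<in> L2R" for f g n
    by (rule fourier_kernel_norm[OF \<Phi>[of n]]) (use that in \<open>auto intro!: measurable_completion\<close>)
  have Dm: "(\<lambda>l. L2_inner lebesgue (\<lambda>t. fourier_L1 (\<Phi> n) l f t - A l f t) g) \<in> borel_measurable lebesgue"
    if f: "f \<in> L2R" and g: "g \<in> L2R" for f g n
  proof (rule lebesgue_measurable_AE_cong)
    show "(\<lambda>l. L2_inner lebesgue (fourier_L1 (\<Phi> n) l f) g - L2_inner lebesgue (A l f) g) \<in> borel_measurable lebesgue"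
      by (intro borel_measurable_diff Am \<Phi>m f g)
    show "AE l in lborel. L2_inner lebesgue (fourier_L1 (\<Phi> n) l f) g - L2_inner lebesgue (A l f) g = L2_inner lebesgue (\<lambda>t. fourier_L1 (\<Phi> n) l f t - A l f t) g"
      using Ab fourier_L1_bounded[OF \<Phi>[of n]]
      by eventually_elim (rule L2_inner_diff_left[symmetric], auto intro: bounded_operator_L2 f g)
  qed
  have hm: "(\<lambda>l. hs_sq (\<lambda>f t. fourier_L1 (\<Phi> n) l f t - A l f t)) \<in> borel_measurable lebesgue" for n
    by (intro hs_sq_measurable Dm onb_L2)
  have le: "(\<integral>\<^sup>+l. ennreal \<bar>l\<bar> * hs_sq (\<lambda>f t. fourier_L1 (\<Phi> n) l f t - A l f t) \<partial>lborel)
      \<le> (\<integral>\<^sup>+l. HS_norm_sq (\<lambda>f t. fourier_L1 (\<Phi> n) l f t - A l f t) \<partial>plancherel)" for n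
    unfolding nn_integral_plancherel[OF hm, symmetric]
  proof (rule nn_integral_mono_AE)
    show "AE l in plancherel. hs_sq (\<lambda>f t. fourier_L1 (\<Phi> n) l f t - A l f t) \<le> HS_norm_sq (\<lambda>f t. fourier_L1 (\<Phi> n) l f t - A l f t)"
      unfolding AE_plancherel using Ab fourier_L1_bounded[OF \<Phi>[of n]]
    proof eventually_elim
      case (elim l)
      show ?case by (rule hs_sq_le_HS_norm_sq) (intro L2_diff bounded_operator_L2[OF elim(1) onb_L2] bounded_operator_L2[OF elim(2) onb_L2])
    qed
  qed
  show ?thesis
  proof (rule that[of \<Phi>])
    show "(\<lambda>n. \<integral>\<^sup>+l. ennreal \<bar>l\<bar> * hs_sq (\<lambda>f t. fourier_L1 (\<Phi> n) l f t - A l f t) \<partial>lborel) \<longlonglongrightarrow> 0"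
      by (rule tendsto_sandwich[OF _ _ tendsto_const HS]) (auto simp: le)
  qed (fact \<Phi> conv Ab hm | intro hs_sq_measurable Am \<Phi>m onb_L2)+
qed

lemma ennreal_tendsto_cmult_0: "c < top \<Longrightarrow> (x \<longlonglongrightarrow> 0) \<Longrightarrow> (\<lambda>n. c * x n) \<longlonglongrightarrow> (0::ennreal)"
  using ennreal_tendsto_cmult[of c x 0 sequentially] by simp

text \<open>Let \<open>\<Phi>\<^sub>n\<close> be the sequence witnessing the transform.  The operators of \<open>\<Psi>\<^sub>n - \<Phi>\<^sub>n\<close> are controlled
  by a kernel norm whose integral is \<open>\<parallel>\<Psi>\<^sub>n - \<Phi>\<^sub>n\<parallel>\<^sup>2\<close>, and those of \<open>\<Phi>\<^sub>n - \<phi>\<close> by the Hilbert--Schmidt norm.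
  The sum \<open>g n\<close> of both controlling functions tends to 0 in \<open>L\<^sup>1\<close>, hence almost everywhere along a
  subsequence, with one null set for all \<open>f\<close>.\<close>

theorem fourier_strong_limit:
  assumes FT: "has_fourier_transform \<phi> A" and \<Psi>: "\<And>n. L1_L2 (\<Psi> n)"
    and lim: "(\<lambda>n. nsq lebesgue (\<lambda>x. \<Psi> n x - \<phi> x)) \<longlonglongrightarrow> 0"
  obtains r :: "nat \<Rightarrow> nat" where "strict_mono r"
    "AE l in lborel. \<forall>f\<in>L2R. (\<lambda>n. nsq lebesgue (\<lambda>t. fourier_L1 (\<Psi> (r n)) l f t - A l f t)) \<longlonglongrightarrow> 0"
proof -
  obtain \<Phi> where \<Phi>: "\<And>n. L1_L2 (\<Phi> n)" and conv: "(\<lambda>n. nsq lebesgue (\<lambda>x. \<Phi> n x - \<phi> x)) \<longlonglongrightarrow> 0"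
    and Ab: "AE l in lborel. bounded_operator (A l)"
    and hm: "\<And>n. (\<lambda>l. hs_sq (\<lambda>f t. fourier_L1 (\<Phi> n) l f t - A l f t)) \<in> borel_measurable lebesgue"
    and D0: "(\<lambda>n. \<integral>\<^sup>+l. ennreal \<bar>l\<bar> * hs_sq (\<lambda>f t. fourier_L1 (\<Phi> n) l f t - A l f t) \<partial>lborel) \<longlonglongrightarrow> 0"
    by (rule has_fourier_transform_approx[OF FT]) blast
  have \<phi>: "\<phi> \<in> borel_measurable lebesgue" using FT by (simp add: has_fourier_transform_def L2_measurable)
  have \<Phi>\<Psi>m: "\<Phi> n \<in> borel_measurable lebesgue" "\<Psi> n \<in> borel_measurable lebesgue" for n
    using \<Phi> \<Psi> by (auto simp: L1_L2_def L2_measurable)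
  have "\<exists>k. k \<in> borel_measurable borel \<and> (\<integral>\<^sup>+l. k l \<partial>lborel) = nsq lebesgue (\<lambda>x. \<Psi> n x - \<Phi> n x) \<and>
      (\<forall>l f. l \<noteq> 0 \<longrightarrow> f \<in> L2R \<longrightarrow> ennreal \<bar>l\<bar> * nsq lebesgue (fourier_L1 (\<lambda>x. \<Psi> n x - \<Phi> n x) l f) \<le> k l * nsq lebesgue f)" for n
    by (rule fourier_kernel_norm[OF L1_L2_diff[OF \<Psi>[of n] \<Phi>[of n]]]) blast
  then obtain k where km: "\<And>n. k n \<in> borel_measurable borel" and kint: "\<And>n. (\<integral>\<^sup>+l. k n l \<partial>lborel) = nsq lebesgue (\<lambda>x. \<Psi> n x - \<Phi> n x)"
    and kbd: "\<And>n l f. l \<noteq> 0 \<Longrightarrow> f \<in> L2R \<Longrightarrow> ennreal \<bar>l\<bar> * nsq lebesgue (fourier_L1 (\<lambda>x. \<Psi> n x - \<Phi> n x) l f) \<le> k n l * nsq lebesgue f"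
    by metis
  define g where "g n l = ennreal \<bar>l\<bar> * hs_sq (\<lambda>f t. fourier_L1 (\<Phi> n) l f t - A l f t) + k n l" for n l
  have km': "k n \<in> borel_measurable lebesgue" for n using km by (simp add: measurable_completion)
  have am: "(\<lambda>l::real. ennreal \<bar>l\<bar>) \<in> borel_measurable lebesgue" by (intro measurable_completion) auto
  note [measurable] = am km' hm
  have gm: "g n \<in> borel_measurable lebesgue" for n
    unfolding g_def by measurable
  have gint: "(\<integral>\<^sup>+l. g n l \<partial>lebesgue) = (\<integral>\<^sup>+l. ennreal \<bar>l\<bar> * hs_sq (\<lambda>f t. fourier_L1 (\<Phi> n) l f t - A l f t) \<partial>lborel) + nsq lebesgue (\<lambda>x. \<Psi> n x - \<Phi> n x)" for n
    unfolding g_def by (subst nn_integral_add) (auto simp: nn_integral_completion kint)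
  have "(\<lambda>n. nsq lebesgue (\<lambda>x. \<Psi> n x - \<Phi> n x)) \<longlonglongrightarrow> 0"
  proof (rule tendsto_sandwich[OF _ _ tendsto_const])
    have "(\<lambda>n. 2 * nsq lebesgue (\<lambda>x. \<Psi> n x - \<phi> x) + 2 * nsq lebesgue (\<lambda>x. \<Phi> n x - \<phi> x)) \<longlonglongrightarrow> 0 + 0"
      by (intro tendsto_add ennreal_tendsto_cmult_0 lim conv) auto
    then show "(\<lambda>n. 2 * nsq lebesgue (\<lambda>x. \<Psi> n x - \<phi> x) + 2 * nsq lebesgue (\<lambda>x. \<phi> x - \<Phi> n x)) \<longlonglongrightarrow> 0"
      by (simp add: nsq_minus_commute[of _ \<phi>])
  qed (auto intro!: always_eventually nsq_diff_triangle \<Phi>\<Psi>m \<phi>)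
  then have "(\<lambda>n. \<integral>\<^sup>+l. g n l \<partial>lebesgue) \<longlonglongrightarrow> 0 + 0"
    unfolding gint by (intro tendsto_add D0)
  then obtain r where r: "strict_mono r" and AEr: "AE l in lebesgue. (\<lambda>n. g (r n) l) \<longlonglongrightarrow> 0"
    using tendsto_nn_integral_AE_subseq[of g, OF gm] by auto
  have allb: "AE l in lborel. \<forall>n. bounded_operator (fourier_L1 (\<Phi> n) l) \<and> bounded_operator (fourier_L1 (\<Psi> n) l)"
    using fourier_L1_bounded[OF \<Phi>] fourier_L1_bounded[OF \<Psi>] by (simp add: AE_all_countable AE_conj_iff)
  have "AE l in lborel. \<forall>f\<in>L2R. (\<lambda>n. nsq lebesgue (\<lambda>t. fourier_L1 (\<Psi> (r n)) l f t - A l f t)) \<longlonglongrightarrow> 0"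
    using AEr[unfolded AE_completion_iff] allb AE_neq_0 Ab
  proof eventually_elim
    case (elim l)
    show ?case
    proof
      fix f :: "real \<Rightarrow> complex" assume f: "f \<in> L2R"
      have bound: "nsq lebesgue (\<lambda>t. fourier_L1 (\<Psi> n) l f t - A l f t) \<le> (ennreal (1 / \<bar>l\<bar>) * (2 * nsq lebesgue f)) * g n l" for n
      proof -
        let ?P = "fourier_L1 (\<Psi> n) l f" and ?Q = "fourier_L1 (\<Phi> n) l f" and ?R = "A l f"
        have L: "?P \<in> L2R" "?Q \<in> L2R" "?R \<in> L2R" using elim f by (auto intro: bounded_operator_L2)
        have "AE t in lborel. ?P t - ?Q t = fourier_L1 (\<lambda>x. \<Psi> n x - \<Phi> n x) l f t"
          using fourier_L1_add_scale[OF \<Psi>[of n] \<Phi>[of n] f, of "-1"] by eventually_elim simp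
        then have e: "nsq lebesgue (\<lambda>t. ?P t - ?Q t) = nsq lebesgue (fourier_L1 (\<lambda>x. \<Psi> n x - \<Phi> n x) l f)"
          unfolding nsq_lebesgue by (rule nsq_cong_AE)
        have h: "nsq lebesgue (\<lambda>t. ?Q t - ?R t) \<le> hs_sq (\<lambda>f t. fourier_L1 (\<Phi> n) l f t - A l f t) * nsq lebesgue f"
          using nsq_le_hs_sq[OF bounded_operator_diff f, of "fourier_L1 (\<Phi> n) l" "A l"] elim by simp
        have "ennreal \<bar>l\<bar> * nsq lebesgue (\<lambda>t. ?P t - ?R t) \<le> ennreal \<bar>l\<bar> * (2 * nsq lebesgue (\<lambda>t. ?P t - ?Q t) + 2 * nsq lebesgue (\<lambda>t. ?Q t - ?R t))"
          using L by (intro mult_left_mono nsq_diff_triangle) (auto simp: L2_measurable)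
        also have "\<dots> = 2 * (ennreal \<bar>l\<bar> * nsq lebesgue (\<lambda>t. ?P t - ?Q t)) + 2 * (ennreal \<bar>l\<bar> * nsq lebesgue (\<lambda>t. ?Q t - ?R t))"
          by (simp add: distrib_left mult_ac)
        also have "\<dots> \<le> 2 * (k n l * nsq lebesgue f) + 2 * (ennreal \<bar>l\<bar> * (hs_sq (\<lambda>f t. fourier_L1 (\<Phi> n) l f t - A l f t) * nsq lebesgue f))"
          unfolding e using elim f h by (intro add_mono mult_left_mono kbd) auto
        also have "\<dots> = (2 * nsq lebesgue f) * g n l"
          by (simp add: g_def distrib_left distrib_right mult_ac)
        finally have "ennreal (1 / \<bar>l\<bar>) * (ennreal \<bar>l\<bar> * nsq lebesgue (\<lambda>t. ?P t - ?R t)) \<le> ennreal (1 / \<bar>l\<bar>) * ((2 * nsq lebesgue f) * g n l)"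
          by (intro mult_left_mono) auto
        then show ?thesis using elim by (simp only: ennreal_div_mult mult.assoc not_False_eq_True)
      qed
      show "(\<lambda>n. nsq lebesgue (\<lambda>t. fourier_L1 (\<Psi> (r n)) l f t - A l f t)) \<longlonglongrightarrow> 0"
      proof (rule tendsto_sandwich[OF _ _ tendsto_const])
        show "(\<lambda>n. (ennreal (1 / \<bar>l\<bar>) * (2 * nsq lebesgue f)) * g (r n) l) \<longlonglongrightarrow> 0"
          using f by (intro ennreal_tendsto_cmult_0 elim(1)) (auto simp: L2_iff_nsq ennreal_mult_less_top)
      qed (auto intro!: always_eventually bound)
    qed
  qed
  with r show ?thesis by (rule that)
qed

text \<open>Both sides are limits of the corresponding quantities for integrable functions, where equality is
  known.  The comparison uses squared norms and the inequality with factors \<open>1 + r\<close> and \<open>1 + 1/r\<close>: for fixed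
  \<open>r\<close> the second term vanishes in the limit, and then \<open>r\<close> tends to 0.\<close>

theorem fourier_hs_norm:
  assumes FT: "has_fourier_transform \<phi> A"
  shows "(\<integral>\<^sup>+l. ennreal \<bar>l\<bar> * hs_sq (A l) \<partial>lborel) = nsq lebesgue \<phi>"
proof -
  obtain \<Phi> where \<Phi>: "\<And>n. L1_L2 (\<Phi> n)" and conv: "(\<lambda>n. nsq lebesgue (\<lambda>x. \<Phi> n x - \<phi> x)) \<longlonglongrightarrow> 0"
    and Ab: "AE l in lborel. bounded_operator (A l)"
    and Am: "(\<lambda>l. hs_sq (A l)) \<in> borel_measurable lebesgue"
    and hm: "\<And>n. (\<lambda>l. hs_sq (\<lambda>f t. fourier_L1 (\<Phi> n) l f t - A l f t)) \<in> borel_measurable lebesgue"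
    and \<Phi>m: "\<And>n. (\<lambda>l. hs_sq (fourier_L1 (\<Phi> n) l)) \<in> borel_measurable lebesgue"
    and D0: "(\<lambda>n. \<integral>\<^sup>+l. ennreal \<bar>l\<bar> * hs_sq (\<lambda>f t. fourier_L1 (\<Phi> n) l f t - A l f t) \<partial>lborel) \<longlonglongrightarrow> 0"
    by (rule has_fourier_transform_approx[OF FT]) blast
  have \<phi>: "\<phi> \<in> L2 lebesgue" using FT by (simp add: has_fourier_transform_def)
  have \<Phi>L: "\<Phi> n \<in> L2 lebesgue" for n using \<Phi> by (auto simp: L1_L2_def)
  define X where "X = (\<integral>\<^sup>+l. ennreal \<bar>l\<bar> * hs_sq (A l) \<partial>lborel)"
  define d where "d n = (\<integral>\<^sup>+l. ennreal \<bar>l\<bar> * hs_sq (\<lambda>f t. fourier_L1 (\<Phi> n) l f t - A l f t) \<partial>lborel)" for n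
  have am: "(\<lambda>l::real. ennreal \<bar>l\<bar>) \<in> borel_measurable lebesgue" by (intro measurable_completion) auto
  have int: "(\<integral>\<^sup>+l. ennreal \<bar>l\<bar> * (ennreal a * F l + ennreal b * G l) \<partial>lborel) =
      ennreal a * (\<integral>\<^sup>+l. ennreal \<bar>l\<bar> * F l \<partial>lborel) + ennreal b * (\<integral>\<^sup>+l. ennreal \<bar>l\<bar> * G l \<partial>lborel)"
    if [measurable]: "F \<in> borel_measurable lebesgue" "G \<in> borel_measurable lebesgue" for a b F G
  proof -
    have "(\<integral>\<^sup>+l. ennreal \<bar>l\<bar> * (ennreal a * F l + ennreal b * G l) \<partial>lebesgue) = (\<integral>\<^sup>+l. ennreal a * (ennreal \<bar>l\<bar> * F l) + ennreal b * (ennreal \<bar>l\<bar> * G l) \<partial>lebesgue)"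
      by (simp add: distrib_left mult_ac)
    also have "\<dots> = ennreal a * (\<integral>\<^sup>+l. ennreal \<bar>l\<bar> * F l \<partial>lebesgue) + ennreal b * (\<integral>\<^sup>+l. ennreal \<bar>l\<bar> * G l \<partial>lebesgue)"
      using am that by (subst nn_integral_add) (auto simp: nn_integral_cmult)
    finally show ?thesis by (simp add: nn_integral_completion)
  qed
  have up: "X \<le> ennreal (1 + r) * nsq lebesgue (\<Phi> n) + ennreal (1 + 1 / r) * d n" if r: "r > 0" for r n
  proof -
    have "X \<le> (\<integral>\<^sup>+l. ennreal \<bar>l\<bar> * (ennreal (1 + r) * hs_sq (fourier_L1 (\<Phi> n) l) + ennreal (1 + 1 / r) * hs_sq (\<lambda>f t. fourier_L1 (\<Phi> n) l f t - A l f t)) \<partial>lborel)"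
      unfolding X_def
    proof (rule nn_integral_mono_AE)
      show "AE l in lborel. ennreal \<bar>l\<bar> * hs_sq (A l) \<le> ennreal \<bar>l\<bar> * (ennreal (1 + r) * hs_sq (fourier_L1 (\<Phi> n) l) + ennreal (1 + 1 / r) * hs_sq (\<lambda>f t. fourier_L1 (\<Phi> n) l f t - A l f t))"
        using Ab fourier_L1_bounded[OF \<Phi>[of n]]
      proof eventually_elim
        case (elim l)
        have "hs_sq (\<lambda>f t. A l f t - fourier_L1 (\<Phi> n) l f t) = hs_sq (\<lambda>f t. fourier_L1 (\<Phi> n) l f t - A l f t)"
          using elim by (simp add: hs_sq_eq L2_diff bounded_operator_L2 onb_L2 nsq_minus_commute[of _ "A l _"])
        then show ?case using hs_sq_le_add[OF elim r] by (intro mult_left_mono) auto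
      qed
    qed
    also have "\<dots> = ennreal (1 + r) * nsq lebesgue (\<Phi> n) + ennreal (1 + 1 / r) * d n"
      unfolding int[OF \<Phi>m hm] fourier_L1_hs[OF \<Phi>] d_def ..
    finally show ?thesis .
  qed
  have lo: "nsq lebesgue (\<Phi> n) \<le> ennreal (1 + r) * X + ennreal (1 + 1 / r) * d n" if r: "r > 0" for r n
  proof -
    have "nsq lebesgue (\<Phi> n) \<le> (\<integral>\<^sup>+l. ennreal \<bar>l\<bar> * (ennreal (1 + r) * hs_sq (A l) + ennreal (1 + 1 / r) * hs_sq (\<lambda>f t. fourier_L1 (\<Phi> n) l f t - A l f t)) \<partial>lborel)"
      unfolding fourier_L1_hs[OF \<Phi>, symmetric]
    proof (rule nn_integral_mono_AE)
      show "AE l in lborel. ennreal \<bar>l\<bar> * hs_sq (fourier_L1 (\<Phi> n) l) \<le> ennreal \<bar>l\<bar> * (ennreal (1 + r) * hs_sq (A l) + ennreal (1 + 1 / r) * hs_sq (\<lambda>f t. fourier_L1 (\<Phi> n) l f t - A l f t))"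
        using Ab fourier_L1_bounded[OF \<Phi>[of n]]
        by eventually_elim (intro mult_left_mono hs_sq_le_add r, auto)
    qed
    also have "\<dots> = ennreal (1 + r) * X + ennreal (1 + 1 / r) * d n"
      unfolding int[OF Am hm] X_def d_def ..
    finally show ?thesis .
  qed
  have n1: "nsq lebesgue \<phi> \<le> ennreal (1 + r) * nsq lebesgue (\<Phi> n) + ennreal (1 + 1 / r) * nsq lebesgue (\<lambda>x. \<Phi> n x - \<phi> x)" if r: "r > 0" for r n
    using nsq_add_le[of "\<Phi> n" lebesgue "\<lambda>x. \<phi> x - \<Phi> n x" r] r L2_measurable[OF \<phi>] L2_measurable[OF \<Phi>L]
    by (simp add: nsq_minus_commute[of _ \<phi>])
  have n2: "nsq lebesgue (\<Phi> n) \<le> ennreal (1 + r) * nsq lebesgue \<phi> + ennreal (1 + 1 / r) * nsq lebesgue (\<lambda>x. \<Phi> n x - \<phi> x)" if r: "r > 0" for r n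
    using nsq_add_le[of \<phi> lebesgue "\<lambda>x. \<Phi> n x - \<phi> x" r] r L2_measurable[OF \<phi>] L2_measurable[OF \<Phi>L] by simp
  \<comment> \<open>Chaining two such inequalities and letting the index tend to infinity.\<close>
  have two: "U \<le> ennreal (1 + r) * (ennreal (1 + r) * V)"
    if r: "r > 0" and 1: "\<And>n. U \<le> ennreal (1 + r) * W n + ennreal (1 + 1 / r) * x n"
      and 2: "\<And>n. W n \<le> ennreal (1 + r) * V + ennreal (1 + 1 / r) * y n" and xy: "x \<longlonglongrightarrow> 0" "y \<longlonglongrightarrow> 0"
    for U V r and W x y :: "nat \<Rightarrow> ennreal"
  proof -
    have "(\<lambda>n. ennreal (1 + r) * (ennreal (1 + r) * V) + ((ennreal (1 + r) * ennreal (1 + 1 / r)) * y n + ennreal (1 + 1 / r) * x n)) \<longlonglongrightarrow> ennreal (1 + r) * (ennreal (1 + r) * V) + (0 + 0)"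
      by (intro tendsto_add tendsto_const ennreal_tendsto_cmult_0 xy) (auto simp: ennreal_mult_less_top)
    moreover have "U \<le> ennreal (1 + r) * (ennreal (1 + r) * V) + ((ennreal (1 + r) * ennreal (1 + 1 / r)) * y n + ennreal (1 + 1 / r) * x n)" for n
    proof -
      have "U \<le> ennreal (1 + r) * (ennreal (1 + r) * V + ennreal (1 + 1 / r) * y n) + ennreal (1 + 1 / r) * x n"
        by (rule order_trans[OF 1 add_mono[OF mult_left_mono[OF 2] order_refl]]) auto
      then show ?thesis by (simp add: distrib_left mult.assoc add.assoc)
    qed
    ultimately have "U \<le> ennreal (1 + r) * (ennreal (1 + r) * V) + (0 + 0)"
      by (intro LIMSEQ_le_const) auto
    then show ?thesis by simp
  qed
  have lim_r: "U \<le> V" if "\<And>r. r > 0 \<Longrightarrow> U \<le> ennreal (1 + r) * (ennreal (1 + r) * V)" for U V :: ennreal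
  proof -
    have "(\<lambda>n. ennreal ((1 + inverse (real (Suc n))) * (1 + inverse (real (Suc n)))) * V) \<longlonglongrightarrow> ennreal ((1 + 0) * (1 + 0)) * V"
      by (intro tendsto_mult_ennreal tendsto_ennrealI tendsto_intros LIMSEQ_inverse_real_of_nat) auto
    moreover have "U \<le> ennreal ((1 + inverse (real (Suc n))) * (1 + inverse (real (Suc n)))) * V" for n
      using that[of "inverse (real (Suc n))"] by (subst ennreal_mult) (auto simp: mult.assoc)
    ultimately have "U \<le> ennreal ((1 + 0) * (1 + 0)) * V" by (intro LIMSEQ_le_const) auto
    then show ?thesis by simp
  qed
  have d0: "d \<longlonglongrightarrow> 0" using D0 by (simp add: d_def[abs_def])
  have "X \<le> nsq lebesgue \<phi>"
    by (rule lim_r) (rule two[OF _ up n2 d0 conv], auto)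
  moreover have "nsq lebesgue \<phi> \<le> X"
    by (rule lim_r) (rule two[OF _ n1 lo conv d0], auto)
  ultimately show ?thesis unfolding X_def by (rule order_antisym)
qed

section \<open>The measure on the dual side\<close>

lemma Lam_UNIV_sets: "Lam \<times> (UNIV :: real set) \<in> sets lebesgue"
proof -
  have "open (Lam \<times> (UNIV :: real set))" by (intro open_Times) (auto simp: Lam_def)
  then show ?thesis by simp
qed

lemma AE_fst_neq_0: "AE z in (lborel :: (real \<times> real) measure). fst z \<noteq> 0"
  by (rule AE_lborel_fst[OF AE_neq_0])

lemma abs_fst_measurable: "(\<lambda>z::real \<times> real. ennreal \<bar>fst z\<bar>) \<in> borel_measurable borel"
  by (intro measurable_compose[OF _ measurable_ennreal] borel_measurable_continuous_onI continuous_intros)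

lemma measure_LamR_eq: "measure_LamR = density (lebesgue_on (Lam \<times> UNIV)) (\<lambda>z. ennreal \<bar>fst z\<bar>)"
  by (simp add: measure_LamR_def case_prod_beta')

lemma abs_fst_measurable_on: "(\<lambda>z::real \<times> real. ennreal \<bar>fst z\<bar>) \<in> borel_measurable (lebesgue_on (Lam \<times> UNIV))"
  by (intro measurable_restrict_space1 measurable_completion) (use abs_fst_measurable in simp)

text \<open>The density vanishes only on the line over 0, which is a null set.\<close>

lemma AE_measure_LamR: "(AE z in measure_LamR. P z) \<longleftrightarrow> (AE z in lborel. P z)"
proof -
  have "(AE z in measure_LamR. P z) \<longleftrightarrow> (AE z in lebesgue_on (Lam \<times> UNIV). 0 < ennreal \<bar>fst z\<bar> \<longrightarrow> P z)"
    unfolding measure_LamR_eq by (rule AE_density[OF abs_fst_measurable_on])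
  also have "\<dots> \<longleftrightarrow> (AE z in lborel. z \<in> Lam \<times> UNIV \<longrightarrow> 0 < ennreal \<bar>fst z\<bar> \<longrightarrow> P z)"
    by (subst AE_restrict_space_iff) (use Lam_UNIV_sets in \<open>auto simp: AE_completion_iff\<close>)
  also have "\<dots> \<longleftrightarrow> (AE z in lborel. P z)"
    using AE_fst_neq_0 by (auto simp: Lam_def elim: eventually_elim2)
  finally show ?thesis .
qed

lemma measurable_measure_LamR: "(f \<in> borel_measurable measure_LamR) \<longleftrightarrow> f \<in> borel_measurable (lebesgue_on (Lam \<times> UNIV))"
  by (simp add: measure_LamR_def)

lemma measure_LamR_borel: "f \<in> borel_measurable lebesgue \<Longrightarrow> f \<in> borel_measurable measure_LamR"
  unfolding measurable_measure_LamR by (rule measurable_restrict_space1)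

lemma measure_LamR_lebesgue:
  fixes f :: "real \<times> real \<Rightarrow> complex"
  assumes f: "f \<in> borel_measurable measure_LamR"
  shows "f \<in> borel_measurable lebesgue"
proof -
  have "(\<lambda>x. if x \<in> Lam \<times> UNIV then f x else 0) \<in> borel_measurable lebesgue"
    using f unfolding measurable_measure_LamR by (subst borel_measurable_if) (use Lam_UNIV_sets in auto)
  moreover have "AE x in lborel. (if x \<in> Lam \<times> UNIV then f x else 0) = f x"
    using AE_fst_neq_0 by eventually_elim (auto simp: Lam_def)
  ultimately show ?thesis by (rule lebesgue_measurable_AE_cong)
qed

lemma nn_integral_measure_LamR:
  assumes G: "G \<in> borel_measurable borel"
  shows "(\<integral>\<^sup>+z. G z \<partial>measure_LamR) = (\<integral>\<^sup>+l. ennreal \<bar>l\<bar> * (\<integral>\<^sup>+t. G (l, t) \<partial>lborel) \<partial>lborel)"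
proof -
  have [measurable]: "G \<in> borel_measurable (borel \<Otimes>\<^sub>M borel)" using G by (simp add: borel_prod)
  have G': "G \<in> borel_measurable (lebesgue_on (Lam \<times> UNIV))"
    using G by (intro measurable_restrict_space1 measurable_completion) simp
  have "(\<integral>\<^sup>+z. G z \<partial>measure_LamR) = (\<integral>\<^sup>+z. ennreal \<bar>fst z\<bar> * G z \<partial>lebesgue_on (Lam \<times> UNIV))"
    unfolding measure_LamR_eq by (rule nn_integral_density[OF abs_fst_measurable_on G'])
  also have "\<dots> = (\<integral>\<^sup>+z. ennreal \<bar>fst z\<bar> * G z * indicator (Lam \<times> UNIV) z \<partial>lebesgue)"
    by (rule nn_integral_restrict_space) (use Lam_UNIV_sets in auto)
  also have "\<dots> = (\<integral>\<^sup>+z. ennreal \<bar>fst z\<bar> * G z \<partial>lebesgue)"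
    by (intro nn_integral_cong) (auto simp: Lam_def indicator_def)
  also have "\<dots> = (\<integral>\<^sup>+z. ennreal \<bar>fst z\<bar> * G z \<partial>(lborel \<Otimes>\<^sub>M lborel))"
    by (simp add: nn_integral_completion lborel_prod)
  also have "\<dots> = (\<integral>\<^sup>+l. (\<integral>\<^sup>+t. ennreal \<bar>l\<bar> * G (l, t) \<partial>lborel) \<partial>lborel)"
    by (subst lborel.nn_integral_fst[symmetric]) auto
  also have "\<dots> = (\<integral>\<^sup>+l. ennreal \<bar>l\<bar> * (\<integral>\<^sup>+t. G (l, t) \<partial>lborel) \<partial>lborel)"
    by (intro nn_integral_cong nn_integral_cmult) auto
  finally show ?thesis .
qed

lemma AE_lborel_pair:
  "AE z in lborel. P z \<Longrightarrow> AE x in (lborel :: real measure). AE y in (lborel :: real measure). P (x, y)"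
proof -
  assume "AE z in lborel. P z"
  then have "AE z in (lborel :: real measure) \<Otimes>\<^sub>M (lborel :: real measure). P z" by (simp only: lborel_prod)
  then show ?thesis by (rule lborel_pair.AE_pair)
qed

lemma nsq_measure_LamR:
  assumes f: "f \<in> borel_measurable measure_LamR"
  shows "nsq measure_LamR f = (\<integral>\<^sup>+l. ennreal \<bar>l\<bar> * nsq lborel (\<lambda>t. f (l, t)) \<partial>lborel)"
proof -
  obtain g where g: "g \<in> borel_measurable borel" and eq: "AE z in lborel. f z = g z"
    using borel_representative[OF measure_LamR_lebesgue[OF f]] by blast
  have "nsq measure_LamR f = nsq measure_LamR g"
    by (rule nsq_cong_AE) (simp add: AE_measure_LamR eq)
  also have "\<dots> = (\<integral>\<^sup>+l. ennreal \<bar>l\<bar> * nsq lborel (\<lambda>t. g (l, t)) \<partial>lborel)"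
    unfolding nsq_def by (rule nn_integral_measure_LamR) (use g in measurable)
  also have "\<dots> = (\<integral>\<^sup>+l. ennreal \<bar>l\<bar> * nsq lborel (\<lambda>t. f (l, t)) \<partial>lborel)"
  proof (rule nn_integral_cong_AE)
    show "AE l in lborel. ennreal \<bar>l\<bar> * nsq lborel (\<lambda>t. g (l, t)) = ennreal \<bar>l\<bar> * nsq lborel (\<lambda>t. f (l, t))"
      using AE_lborel_pair[OF eq]
    proof eventually_elim
      case (elim l)
      have "nsq lborel (\<lambda>t. g (l, t)) = nsq lborel (\<lambda>t. f (l, t))"
        by (rule nsq_cong_AE) (use elim in eventually_elim, simp)
      then show ?case by simp
    qed
  qed
  finally show ?thesis .
qed

text \<open>Equality on almost every fibre gives equality almost everywhere by Tonelli's theorem, which needs the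
  set of exceptions to be measurable; hence the detour through Borel representatives.\<close>

lemma AE_AE_measure_LamR:
  fixes f g :: "real \<times> real \<Rightarrow> complex"
  assumes f: "f \<in> borel_measurable lebesgue" and g: "g \<in> borel_measurable lebesgue"
    and eq: "AE l in lborel. AE t in lborel. f (l, t) = g (l, t)"
  shows "AE z in measure_LamR. f z = g z"
proof -
  obtain f' where f': "f' \<in> borel_measurable borel" and ef: "AE z in lborel. f z = f' z"
    using borel_representative[OF f] by blast
  obtain g' where g': "g' \<in> borel_measurable borel" and eg: "AE z in lborel. g z = g' z"
    using borel_representative[OF g] by blast
  have [measurable]: "f' \<in> borel_measurable (borel \<Otimes>\<^sub>M borel)" "g' \<in> borel_measurable (borel \<Otimes>\<^sub>M borel)"
    using f' g' by (simp_all add: borel_prod)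
  have "AE l in lborel. AE t in lborel. f' (l, t) = g' (l, t)"
    using eq AE_lborel_pair[OF ef] AE_lborel_pair[OF eg]
  proof eventually_elim
    case (elim l)
    from elim show ?case by eventually_elim simp
  qed
  then have "AE z in (lborel \<Otimes>\<^sub>M lborel). f' z = g' z"
    by (intro lborel_pair.AE_pair_measure) measurable
  then have "AE z in lborel. f' z = g' z" by (simp only: lborel_prod)
  with ef eg have "AE z in lborel. f z = g z" by eventually_elim simp
  then show ?thesis by (simp add: AE_measure_LamR)
qed

section \<open>Left translations and dilations of the Heisenberg group\<close>

lemma nn_integral_heis:
  fixes F :: "heis \<Rightarrow> ennreal"
  assumes F: "F \<in> borel_measurable (borel \<Otimes>\<^sub>M (borel \<Otimes>\<^sub>M borel))"
  shows "(\<integral>\<^sup>+x. F x \<partial>lborel) = (\<integral>\<^sup>+x1. (\<integral>\<^sup>+x2. (\<integral>\<^sup>+x3. F (x1, x2, x3) \<partial>lborel) \<partial>lborel) \<partial>lborel)"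
proof -
  note [measurable] = F
  have [measurable]: "F \<in> borel_measurable (lborel \<Otimes>\<^sub>M lborel)" using F by (simp add: borel_prod lborel_prod)
  have "(\<integral>\<^sup>+x. F x \<partial>lborel) = (\<integral>\<^sup>+x1. (\<integral>\<^sup>+y. F (x1, y) \<partial>lborel) \<partial>lborel)"
    unfolding lborel_heis by (rule lborel.nn_integral_fst[symmetric]) simp
  also have "\<dots> = (\<integral>\<^sup>+x1. (\<integral>\<^sup>+x2. (\<integral>\<^sup>+x3. F (x1, x2, x3) \<partial>lborel) \<partial>lborel) \<partial>lborel)"
  proof (rule nn_integral_cong)
    fix x1
    have "(\<lambda>y. F (x1, y)) \<in> borel_measurable (borel \<Otimes>\<^sub>M borel)" by measurable
    then have "(\<lambda>y. F (x1, y)) \<in> borel_measurable (lborel \<Otimes>\<^sub>M lborel)" by (simp add: borel_prod lborel_prod)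
    from lborel.nn_integral_fst[OF this]
    show "(\<integral>\<^sup>+y. F (x1, y) \<partial>lborel) = (\<integral>\<^sup>+x2. (\<integral>\<^sup>+x3. F (x1, x2, x3) \<partial>lborel) \<partial>lborel)"
      by (simp add: lborel_prod)
  qed
  finally show ?thesis .
qed

lemma nn_integral_shift:
  "F \<in> borel_measurable borel \<Longrightarrow> (\<integral>\<^sup>+x. F (c + x) \<partial>lborel) = (\<integral>\<^sup>+x. F x \<partial>(lborel :: real measure))"
  by (subst (2) nn_integral_real_affine[where c=1 and t=c]) auto

lemma nn_integral_stretch:
  assumes "F \<in> borel_measurable borel" "c > 0"
  shows "(\<integral>\<^sup>+x. F (c * x) \<partial>lborel) = ennreal (1 / c) * (\<integral>\<^sup>+x. F x \<partial>(lborel :: real measure))"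
  using scales_measure_nn_integral[OF scales_measure_real_affine[of c 0] assms(1)] assms(2) by simp

lemma heis_measurableI:
  fixes T :: "heis \<Rightarrow> heis"
  assumes "T \<in> (borel \<Otimes>\<^sub>M (borel \<Otimes>\<^sub>M borel)) \<rightarrow>\<^sub>M (borel \<Otimes>\<^sub>M (borel \<Otimes>\<^sub>M borel))"
  shows "T \<in> borel \<rightarrow>\<^sub>M borel"
  using assms by (simp add: borel_prod)

text \<open>A shear composed with a translation in each variable; the variables are integrated from the last
  to the first.\<close>

lemma scales_measure_heis_mult: "scales_measure (heis_mult a) 1"
proof -
  obtain a1 a2 a3 where a: "a = (a1, a2, a3)" by (cases a)
  have eq: "heis_mult a = (\<lambda>y. (a1 + fst y, a2 + fst (snd y), a3 + snd (snd y) + a1 * fst (snd y)))"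
    by (auto simp: a fun_eq_iff)
  have T: "heis_mult a \<in> (borel \<Otimes>\<^sub>M (borel \<Otimes>\<^sub>M borel)) \<rightarrow>\<^sub>M (borel \<Otimes>\<^sub>M (borel \<Otimes>\<^sub>M borel))"
    unfolding eq by measurable
  show ?thesis
    unfolding scales_measure_def
  proof (intro conjI allI impI)
    show "heis_mult a \<in> borel_measurable borel" by (rule heis_measurableI[OF T])
    fix F :: "heis \<Rightarrow> ennreal" assume "F \<in> borel_measurable borel"
    then have F [measurable]: "F \<in> borel_measurable (borel \<Otimes>\<^sub>M (borel \<Otimes>\<^sub>M borel))" by (simp add: borel_prod)
    have "(\<integral>\<^sup>+x. F (heis_mult a x) \<partial>lborel) = (\<integral>\<^sup>+x1. (\<integral>\<^sup>+x2. (\<integral>\<^sup>+x3. F (heis_mult a (x1, x2, x3)) \<partial>lborel) \<partial>lborel) \<partial>lborel)"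
      by (rule nn_integral_heis) (rule measurable_compose[OF T F])
    also have "\<dots> = (\<integral>\<^sup>+x1. (\<integral>\<^sup>+x2. (\<integral>\<^sup>+x3. F (a1 + x1, a2 + x2, (a3 + a1 * x2) + x3) \<partial>lborel) \<partial>lborel) \<partial>lborel)"
      by (simp add: a add_ac)
    also have "\<dots> = (\<integral>\<^sup>+x1. (\<integral>\<^sup>+x2. (\<integral>\<^sup>+x3. F (a1 + x1, a2 + x2, x3) \<partial>lborel) \<partial>lborel) \<partial>lborel)"
      by (intro nn_integral_cong nn_integral_shift) measurable
    also have "\<dots> = (\<integral>\<^sup>+x1. (\<integral>\<^sup>+x2. (\<integral>\<^sup>+x3. F (a1 + x1, x2, x3) \<partial>lborel) \<partial>lborel) \<partial>lborel)"
      by (rule nn_integral_cong, rule nn_integral_shift[of "\<lambda>y. \<integral>\<^sup>+x3. F (a1 + _, y, x3) \<partial>lborel"]) measurable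
    also have "\<dots> = (\<integral>\<^sup>+x1. (\<integral>\<^sup>+x2. (\<integral>\<^sup>+x3. F (x1, x2, x3) \<partial>lborel) \<partial>lborel) \<partial>lborel)"
      by (rule nn_integral_shift[of "\<lambda>y. \<integral>\<^sup>+x2. \<integral>\<^sup>+x3. F (y, x2, x3) \<partial>lborel \<partial>lborel"]) measurable
    also have "\<dots> = (\<integral>\<^sup>+x. F x \<partial>lborel)" by (rule nn_integral_heis[OF F, symmetric])
    finally show "(\<integral>\<^sup>+x. F (heis_mult a x) \<partial>lborel) = ennreal 1 * (\<integral>\<^sup>+x. F x \<partial>lborel)" by simp
  qed simp
qed

lemma scales_measure_heis_dil:
  assumes a: "a > 0"
  shows "scales_measure (heis_dil a) (1 / a\<^sup>2)"
proof -
  define s where "s = a powr (1/2)"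
  have s: "s > 0" "s * s = a" using a by (simp_all add: s_def powr_add[symmetric])
  have eq: "heis_dil a = (\<lambda>y. (s * fst y, s * fst (snd y), a * snd (snd y)))"
    by (auto simp: s_def fun_eq_iff)
  have T: "heis_dil a \<in> (borel \<Otimes>\<^sub>M (borel \<Otimes>\<^sub>M borel)) \<rightarrow>\<^sub>M (borel \<Otimes>\<^sub>M (borel \<Otimes>\<^sub>M borel))"
    unfolding eq by measurable
  show ?thesis
    unfolding scales_measure_def
  proof (intro conjI allI impI)
    show "heis_dil a \<in> borel_measurable borel" by (rule heis_measurableI[OF T])
    fix F :: "heis \<Rightarrow> ennreal" assume "F \<in> borel_measurable borel"
    then have F [measurable]: "F \<in> borel_measurable (borel \<Otimes>\<^sub>M (borel \<Otimes>\<^sub>M borel))" by (simp add: borel_prod)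
    have "(\<integral>\<^sup>+x. F (heis_dil a x) \<partial>lborel) = (\<integral>\<^sup>+x1. (\<integral>\<^sup>+x2. (\<integral>\<^sup>+x3. F (s * x1, s * x2, a * x3) \<partial>lborel) \<partial>lborel) \<partial>lborel)"
      by (subst nn_integral_heis) (use measurable_compose[OF T F] in \<open>auto simp: s_def\<close>)
    also have "\<dots> = (\<integral>\<^sup>+x1. (\<integral>\<^sup>+x2. ennreal (1 / a) * (\<integral>\<^sup>+x3. F (s * x1, s * x2, x3) \<partial>lborel) \<partial>lborel) \<partial>lborel)"
      by (intro nn_integral_cong nn_integral_stretch a) measurable
    also have "\<dots> = (\<integral>\<^sup>+x1. ennreal (1 / a) * (\<integral>\<^sup>+x2. (\<integral>\<^sup>+x3. F (s * x1, s * x2, x3) \<partial>lborel) \<partial>lborel) \<partial>lborel)"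
      by (intro nn_integral_cong nn_integral_cmult) measurable
    also have "\<dots> = (\<integral>\<^sup>+x1. ennreal (1 / a) * (ennreal (1 / s) * (\<integral>\<^sup>+x2. (\<integral>\<^sup>+x3. F (s * x1, x2, x3) \<partial>lborel) \<partial>lborel)) \<partial>lborel)"
    proof (rule nn_integral_cong)
      fix x1
      have "(\<lambda>y. \<integral>\<^sup>+x3. F (s * x1, y, x3) \<partial>lborel) \<in> borel_measurable borel" by measurable
      from nn_integral_stretch[OF this s(1)]
      show "ennreal (1 / a) * (\<integral>\<^sup>+x2. (\<integral>\<^sup>+x3. F (s * x1, s * x2, x3) \<partial>lborel) \<partial>lborel) =
        ennreal (1 / a) * (ennreal (1 / s) * (\<integral>\<^sup>+x2. (\<integral>\<^sup>+x3. F (s * x1, x2, x3) \<partial>lborel) \<partial>lborel))" by simp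
    qed
    also have "\<dots> = ennreal (1 / a) * (ennreal (1 / s) * (\<integral>\<^sup>+x1. (\<integral>\<^sup>+x2. (\<integral>\<^sup>+x3. F (s * x1, x2, x3) \<partial>lborel) \<partial>lborel) \<partial>lborel))"
      by (simp add: nn_integral_cmult)
    also have "(\<integral>\<^sup>+x1. (\<integral>\<^sup>+x2. (\<integral>\<^sup>+x3. F (s * x1, x2, x3) \<partial>lborel) \<partial>lborel) \<partial>lborel) = ennreal (1 / s) * (\<integral>\<^sup>+x1. (\<integral>\<^sup>+x2. (\<integral>\<^sup>+x3. F (x1, x2, x3) \<partial>lborel) \<partial>lborel) \<partial>lborel)"
      by (rule nn_integral_stretch[of "\<lambda>y. \<integral>\<^sup>+x2. \<integral>\<^sup>+x3. F (y, x2, x3) \<partial>lborel \<partial>lborel", OF _ s(1)]) measurable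
    also have "(\<integral>\<^sup>+x1. (\<integral>\<^sup>+x2. (\<integral>\<^sup>+x3. F (x1, x2, x3) \<partial>lborel) \<partial>lborel) \<partial>lborel) = (\<integral>\<^sup>+x. F x \<partial>lborel)"
      by (rule nn_integral_heis[OF F, symmetric])
    also have "ennreal (1 / a) * (ennreal (1 / s) * (ennreal (1 / s) * (\<integral>\<^sup>+x. F x \<partial>lborel))) = ennreal (1 / a * (1 / s * (1 / s))) * (\<integral>\<^sup>+x. F x \<partial>lborel)"
      using a s by (simp add: ennreal_mult[symmetric] mult.assoc[symmetric])
    also have "1 / a * (1 / s * (1 / s)) = 1 / a\<^sup>2" using s by (simp add: power2_eq_square field_simps)
    finally show "(\<integral>\<^sup>+x. F (heis_dil a x) \<partial>lborel) = ennreal (1 / a\<^sup>2) * (\<integral>\<^sup>+x. F x \<partial>lborel)" .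
  qed (use a in auto)
qed

lemma scales_measure_comp_L2:
  assumes T: "scales_measure T c" and f: "f \<in> L2 lebesgue"
  shows "(\<lambda>x. f (T x)) \<in> L2 lebesgue"
  using scales_measure_borel_measurable[OF T L2_measurable[OF f]] scales_measure_nsq[OF T L2_measurable[OF f]] f
  by (simp add: L2_iff_nsq ennreal_mult_less_top)

lemma scales_measure_comp_L1_L2:
  assumes T: "scales_measure T c" and \<Phi>: "L1_L2 \<Phi>"
  shows "L1_L2 (\<lambda>x. \<Phi> (T x))"
proof -
  have L: "\<Phi> \<in> L2 lebesgue" and i: "integrable lebesgue \<Phi>" using \<Phi> by (simp_all add: L1_L2_def)
  show ?thesis
    unfolding L1_L2_def
    using scales_measure_comp_L2[OF T L] scales_measure_integral(1)[OF T L2_measurable[OF L] i] by simp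
qed

lemma L1_L2_scale: "L1_L2 \<Phi> \<Longrightarrow> L1_L2 (\<lambda>x. c * \<Phi> x)"
  unfolding L1_L2_def by (intro conjI L2_scale integrable_mult_right) auto

lemma heis_mult_inv_cancel: "heis_mult x (heis_mult (heis_inv x) y) = y"
  by (cases x; cases y) (simp add: algebra_simps)

text \<open>Left invariance of Haar measure moves the translation onto the representation, and
  \<open>\<pi>\<^sub>l(xz) = \<pi>\<^sub>l(x) \<pi>\<^sub>l(z)\<close>.\<close>

lemma fourier_L1_transl:
  assumes \<Phi>: "\<Phi> \<in> borel_measurable lebesgue" and f: "f \<in> borel_measurable lebesgue"
  shows "fourier_L1 (transl x \<Phi>) l f t = schroedinger l x (fourier_L1 \<Phi> l f) t"
proof -
  obtain x1 x2 x3 where x: "x = (x1, x2, x3)" by (cases x)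
  define G where "G z = \<Phi> z * schroedinger l (heis_mult x z) f t" for z
  have c: "schroedinger l (heis_mult x z) f t = ef (l * x3) * ef (- (l * t) * x2) * schroedinger l z f (t - x1)" for z
  proof (cases z)
    case (fields z1 z2 z3)
    have "ef (l * (x3 + z3 + x1 * z2)) * ef (- (l * t) * (x2 + z2)) = ef (l * x3) * ef (- (l * t) * x2) * (ef (l * z3) * ef (- (l * (t - x1)) * z2))"
      unfolding ef_add[symmetric] by (simp add: algebra_simps)
    then show ?thesis by (simp add: fields x schroedinger_ef diff_diff_eq del: schroedinger.simps)
  qed
  have Gc: "G z = (ef (l * x3) * ef (- (l * t) * x2)) * (\<Phi> z * schroedinger l z f (t - x1))" for z
    unfolding G_def c by simp
  have Gm: "G \<in> borel_measurable lebesgue"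
    unfolding Gc[abs_def] by (intro borel_measurable_times borel_measurable_const fourier_integrand_measurable \<Phi> f)
  have "fourier_L1 (transl x \<Phi>) l f t = (\<integral>y. G (heis_mult (heis_inv x) y) \<partial>lebesgue)"
    by (simp add: fourier_L1_def transl_def G_def heis_mult_inv_cancel)
  also have "\<dots> = (\<integral>z. G z \<partial>lebesgue)"
    using scales_measure_integral(2)[OF scales_measure_heis_mult Gm] by simp
  also have "\<dots> = (ef (l * x3) * ef (- (l * t) * x2)) * fourier_L1 \<Phi> l f (t - x1)"
    unfolding Gc fourier_L1_def by (rule Bochner_Integration.integral_mult_right_zero)
  finally show ?thesis by (simp add: x schroedinger_ef del: schroedinger.simps)
qed

text \<open>The representation at \<open>l\<close> evaluated at a dilated group element is the representation at \<open>a l\<close>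
  conjugated by the dilation of the line.\<close>

lemma fourier_L1_dilat:
  assumes a: "a > 0" and \<Phi>: "\<Phi> \<in> borel_measurable lebesgue" and f: "f \<in> borel_measurable lebesgue"
  shows "fourier_L1 (dilat a \<Phi>) l f t = of_real a * fourier_L1 \<Phi> (a * l) (\<lambda>s. f (a powr (1/2) * s)) (a powr (-1/2) * t)"
proof -
  define s where "s = a powr (1/2)"
  have s: "s > 0" "s * s = a" "a powr (-1/2) = 1 / s" "(1 / a) powr (1/2) = 1 / s"
    using a by (simp_all add: s_def powr_add[symmetric] powr_minus_divide powr_divide)
  define G where "G z = of_real (1 / a) * (\<Phi> z * schroedinger (a * l) z (\<lambda>u. f (s * u)) (t / s))" for z
  have f': "(\<lambda>u. f (s * u)) \<in> borel_measurable lebesgue"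
    using scales_measure_borel_measurable[OF scales_measure_real_affine[of s 0] f] s by simp
  have Gm: "G \<in> borel_measurable lebesgue"
    unfolding G_def by (intro borel_measurable_times borel_measurable_const fourier_integrand_measurable \<Phi> f')
  have "schroedinger l y f t = schroedinger (a * l) (heis_dil (1 / a) y) (\<lambda>u. f (s * u)) (t / s)" for y
  proof (cases y)
    case (fields y1 y2 y3)
    have "s * (t / s - y1 / s) = t - y1" using s by (simp add: field_simps)
    moreover have "a * l * (y3 / a) = l * y3" using a by simp
    moreover have "- (a * l * (t / s)) * (y2 / s) = - (l * t) * y2" using s(1) s(2)[symmetric] by (simp add: field_simps)
    ultimately show ?thesis using s by (simp add: fields schroedinger_ef del: schroedinger.simps)
  qed
  then have "fourier_L1 (dilat a \<Phi>) l f t = (\<integral>y. G (heis_dil (1 / a) y) \<partial>lebesgue)"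
    by (simp add: fourier_L1_def dilat_def G_def mult.assoc)
  also have "\<dots> = of_real (1 / (1 / a)\<^sup>2) * (\<integral>z. G z \<partial>lebesgue)"
    by (rule scales_measure_integral(2)[OF scales_measure_heis_dil Gm]) (use a in simp)
  also have "(\<integral>z. G z \<partial>lebesgue) = of_real (1 / a) * fourier_L1 \<Phi> (a * l) (\<lambda>u. f (s * u)) (t / s)"
    unfolding G_def fourier_L1_def by (rule Bochner_Integration.integral_mult_right_zero)
  finally show ?thesis using a s by (simp add: s_def power2_eq_square)
qed

section \<open>Intertwining relations for the Fourier transform\<close>

lemma nsq_limit_unique:
  assumes m: "\<And>n. X n \<in> borel_measurable lebesgue" "P \<in> borel_measurable lebesgue" "Q \<in> borel_measurable lebesgue"
    and P: "(\<lambda>n. nsq lebesgue (\<lambda>t. X n t - P t)) \<longlonglongrightarrow> 0" and Q: "(\<lambda>n. nsq lebesgue (\<lambda>t. X n t - Q t)) \<longlonglongrightarrow> 0"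
  shows "AE t in lborel. P t = Q t"
proof -
  have "nsq lebesgue (\<lambda>t. P t - Q t) \<le> 2 * nsq lebesgue (\<lambda>t. X n t - P t) + 2 * nsq lebesgue (\<lambda>t. X n t - Q t)" for n
    using nsq_diff_triangle[of P lebesgue "X n" Q] m unfolding nsq_minus_commute[of _ "X n" P] by blast
  moreover have "(\<lambda>n. 2 * nsq lebesgue (\<lambda>t. X n t - P t) + 2 * nsq lebesgue (\<lambda>t. X n t - Q t)) \<longlonglongrightarrow> 0 + 0"
    by (intro tendsto_add ennreal_tendsto_cmult_0 P Q) auto
  ultimately have "nsq lebesgue (\<lambda>t. P t - Q t) \<le> 0 + 0"
    by (intro LIMSEQ_le_const) auto
  then have "nsq lebesgue (\<lambda>t. P t - Q t) = 0" by simp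
  then have "AE t in lebesgue. P t - Q t = 0" by (rule nsq_eq_0_AE[rotated]) (use m in auto)
  then have "AE t in lborel. P t - Q t = 0" by (simp add: AE_completion_iff)
  then show ?thesis by eventually_elim simp
qed

lemma has_fourier_transform_bounded: "has_fourier_transform \<phi> A \<Longrightarrow> AE l in lborel. bounded_operator (A l)"
  by (rule has_fourier_transform_approx)

lemma has_fourier_transform_L2: "has_fourier_transform \<phi> A \<Longrightarrow> \<phi> \<in> L2 lebesgue"
  by (simp add: has_fourier_transform_def)

lemma bounded_operator_measurable: "bounded_operator B \<Longrightarrow> f \<in> L2R \<Longrightarrow> B f \<in> borel_measurable lebesgue"
  by (rule L2_measurable[OF bounded_operator_L2])

lemma AE_all_bounded: "(\<And>n. L1_L2 (\<Phi> n)) \<Longrightarrow> AE l in lborel. \<forall>n::nat. bounded_operator (fourier_L1 (\<Phi> n) l)"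
  by (simp add: AE_all_countable fourier_L1_bounded)

lemma schroedinger_eq_scaled:
  "schroedinger l (k, m, n) h t = ef (l * n) * ef (- (l * t) * m) * h (- k + 1 * t)"
  by (simp add: schroedinger_ef del: schroedinger.simps)

lemma schroedinger_measurable:
  assumes h: "h \<in> borel_measurable lebesgue"
  shows "schroedinger l x h \<in> borel_measurable lebesgue"
proof -
  obtain k m n where x: "x = (k, m, n)" by (cases x)
  have "(\<lambda>t. h (- k + 1 * t)) \<in> borel_measurable lebesgue"
    by (rule scales_measure_borel_measurable[OF scales_measure_real_affine h]) simp
  moreover have "(\<lambda>t. ef (l * n) * ef (- (l * t) * m)) \<in> borel_measurable lebesgue"
    by (intro measurable_completion) measurable
  ultimately have "(\<lambda>t. ef (l * n) * ef (- (l * t) * m) * h (- k + 1 * t)) \<in> borel_measurable lebesgue"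
    by (rule borel_measurable_times[rotated])
  then show ?thesis unfolding x schroedinger_eq_scaled[abs_def] .
qed

lemma schroedinger_nsq:
  assumes h: "h \<in> borel_measurable lebesgue"
  shows "nsq lebesgue (schroedinger l x h) = nsq lebesgue h"
proof -
  obtain k m n where x: "x = (k, m, n)" by (cases x)
  have "nsq lebesgue (schroedinger l x h) = nsq lebesgue (\<lambda>t. h (- k + 1 * t))"
    unfolding x schroedinger_eq_scaled[abs_def] by (simp add: nsq_def norm_mult)
  also have "\<dots> = nsq lebesgue h"
    using scales_measure_nsq[OF scales_measure_real_affine[of 1 "- k"] h] by simp
  finally show ?thesis .
qed

lemma schroedinger_diff: "schroedinger l x (\<lambda>t. f t - g t) t = schroedinger l x f t - schroedinger l x g t"
  by (cases x) (simp add: algebra_simps)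

text \<open>A relation between the transforms of \<open>\<Phi>\<close> and \<open>T \<Phi>\<close> that holds for integrable functions survives the
  passage to square-integrable ones.  Approximations \<open>\<Phi>\<^sub>n\<close> of \<open>\<phi>\<close> yield approximations \<open>T \<Phi>\<^sub>n\<close> of
  \<open>\<phi>'\<close>, and along a common subsequence both sides of the relation are strong limits of the same
  sequence.  The maps \<open>u\<close>, \<open>R\<close> and \<open>S\<close> allow a change of the frequency, of the argument, and of the
  value.\<close>

theorem fourier_intertwining:
  assumes A: "has_fourier_transform \<phi> A" and A': "has_fourier_transform \<phi>' A'"
    and T: "\<And>\<Phi>. L1_L2 \<Phi> \<Longrightarrow> L1_L2 (T \<Phi>)"
      "\<And>\<Phi>. L1_L2 \<Phi> \<Longrightarrow> nsq lebesgue (\<lambda>x. T \<Phi> x - \<phi>' x) = ennreal C * nsq lebesgue (\<lambda>x. \<Phi> x - \<phi> x)"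
    and u: "\<And>P. AE l in lborel. P l \<Longrightarrow> AE l in lborel. P (u l)"
    and R: "\<And>f. f \<in> L2R \<Longrightarrow> R f \<in> L2R"
    and S: "\<And>l h. h \<in> borel_measurable lebesgue \<Longrightarrow> S l h \<in> borel_measurable lebesgue"
      "\<And>l h. h \<in> borel_measurable lebesgue \<Longrightarrow> nsq lebesgue (S l h) = ennreal K * nsq lebesgue h"
      "\<And>l h k t. S l (\<lambda>s. h s - k s) t = S l h t - S l k t"
    and eq: "\<And>\<Phi> l f. L1_L2 \<Phi> \<Longrightarrow> f \<in> L2R \<Longrightarrow> fourier_L1 (T \<Phi>) l f = S l (fourier_L1 \<Phi> (u l) (R f))"
  shows "AE l in lborel. \<forall>f\<in>L2R. AE t in lborel. A' l f t = S l (A (u l) (R f)) t"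
proof -
  obtain \<Phi> where \<Phi>: "\<And>n. L1_L2 (\<Phi> n)" and conv: "(\<lambda>n. nsq lebesgue (\<lambda>x. \<Phi> n x - \<phi> x)) \<longlonglongrightarrow> 0"
    by (rule has_fourier_transform_approx[OF A]) blast
  obtain r :: "nat \<Rightarrow> nat" where r: "strict_mono r"
    and lim: "AE l in lborel. \<forall>f\<in>L2R. (\<lambda>n. nsq lebesgue (\<lambda>t. fourier_L1 (\<Phi> (r n)) l f t - A l f t)) \<longlonglongrightarrow> 0"
    by (rule fourier_strong_limit[OF A \<Phi> conv])
  have "(\<lambda>n. nsq lebesgue (\<lambda>x. \<Phi> (r n) x - \<phi> x)) \<longlonglongrightarrow> 0"
    using LIMSEQ_subseq_LIMSEQ[OF conv r] by (simp add: o_def)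
  then have conv': "(\<lambda>n. nsq lebesgue (\<lambda>x. T (\<Phi> (r n)) x - \<phi>' x)) \<longlonglongrightarrow> 0"
    unfolding T(2)[OF \<Phi>] by (intro ennreal_tendsto_cmult_0) auto
  obtain r' :: "nat \<Rightarrow> nat" where r': "strict_mono r'"
    and lim': "AE l in lborel. \<forall>f\<in>L2R. (\<lambda>n. nsq lebesgue (\<lambda>t. fourier_L1 (T (\<Phi> (r (r' n)))) l f t - A' l f t)) \<longlonglongrightarrow> 0"
    by (rule fourier_strong_limit[OF A' T(1)[OF \<Phi>] conv'])
  show ?thesis
    using u[OF lim] lim' u[OF AE_all_bounded[of \<Phi>, OF \<Phi>]] u[OF has_fourier_transform_bounded[OF A]]
      has_fourier_transform_bounded[OF A']
  proof eventually_elim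
    case (elim l)
    show ?case
    proof
      fix f :: "real \<Rightarrow> complex" assume f: "f \<in> L2R"
      let ?X = "\<lambda>n. fourier_L1 (\<Phi> (r (r' n))) (u l) (R f)"
      have Fm: "fourier_L1 (\<Phi> n) (u l) (R f) \<in> borel_measurable lebesgue" for n
        by (rule bounded_operator_measurable[OF _ R[OF f]]) (use elim in blast)
      have Am: "A (u l) (R f) \<in> borel_measurable lebesgue" "A' l f \<in> borel_measurable lebesgue"
        by (rule bounded_operator_measurable[OF elim(4) R[OF f]], rule bounded_operator_measurable[OF elim(5) f])
      show "AE t in lborel. A' l f t = S l (A (u l) (R f)) t"
      proof (rule nsq_limit_unique[where X = "\<lambda>n. S l (?X n)"])
        show "(\<lambda>n. nsq lebesgue (\<lambda>t. S l (?X n) t - A' l f t)) \<longlonglongrightarrow> 0"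
          using elim(2) f by (simp add: eq[OF \<Phi>])
        have "(\<lambda>n. nsq lebesgue (\<lambda>t. ?X n t - A (u l) (R f) t)) \<longlonglongrightarrow> 0"
          using LIMSEQ_subseq_LIMSEQ[OF elim(1)[rule_format, OF R[OF f]] r'] by (simp add: o_def)
        then have "(\<lambda>n. ennreal K * nsq lebesgue (\<lambda>t. ?X n t - A (u l) (R f) t)) \<longlonglongrightarrow> 0"
          by (intro ennreal_tendsto_cmult_0) auto
        then show "(\<lambda>n. nsq lebesgue (\<lambda>t. S l (?X n) t - S l (A (u l) (R f)) t)) \<longlonglongrightarrow> 0"
          by (simp only: S(3)[symmetric] S(2)[OF borel_measurable_diff[OF Fm Am(1)]])
      qed (use Fm Am S(1) in auto)
    qed
  qed
qed

theorem fourier_transl: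
  assumes A: "has_fourier_transform \<phi> A" and A': "has_fourier_transform (transl x \<phi>) A'"
  shows "AE l in lborel. \<forall>f\<in>L2R. AE t in lborel. A' l f t = schroedinger l x (A l f) t"
proof (rule fourier_intertwining[OF A A', where T = "transl x" and u = "\<lambda>l. l" and R = "\<lambda>f. f" and C = 1 and K = 1])
  note T = scales_measure_heis_mult[of "heis_inv x"]
  fix \<Phi> assume \<Phi>: "L1_L2 \<Phi>"
  show "L1_L2 (transl x \<Phi>)"
    unfolding transl_def by (rule scales_measure_comp_L1_L2[OF T \<Phi>])
  have m: "\<phi> \<in> borel_measurable lebesgue" "\<Phi> \<in> borel_measurable lebesgue"
    using has_fourier_transform_L2[OF A] \<Phi> by (auto simp: L1_L2_def L2_measurable)
  show "nsq lebesgue (\<lambda>y. transl x \<Phi> y - transl x \<phi> y) = ennreal 1 * nsq lebesgue (\<lambda>y. \<Phi> y - \<phi> y)"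
    using scales_measure_nsq[OF T borel_measurable_diff[OF m(2,1)]] unfolding transl_def by simp
  show "fourier_L1 (transl x \<Phi>) l f = schroedinger l x (fourier_L1 \<Phi> l f)" if "f \<in> L2R" for l f
    by (rule ext) (rule fourier_L1_transl[OF m(2) L2_measurable[OF that]])
qed (auto simp: schroedinger_measurable schroedinger_nsq schroedinger_diff)

lemma stretch_L2:
  assumes "s > 0" "f \<in> L2R"
  shows "(\<lambda>t. f (s * t)) \<in> L2R"
  using scales_measure_comp_L2[OF scales_measure_real_affine[of s 0] assms(2)] assms(1) by simp

theorem fourier_dilat:
  assumes a: "a > 0" and A: "has_fourier_transform \<phi> A" and A': "has_fourier_transform (dilat a \<phi>) A'"
  shows "AE l in lborel. \<forall>f\<in>L2R. AE t in lborel.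
    A' l f t = of_real a * A (a * l) (\<lambda>s. f (a powr (1/2) * s)) (a powr (-1/2) * t)"
proof -
  define w where "w = a powr (-1/2)"
  have w: "w > 0" using a by (simp add: w_def)
  have a': "a powr (1/2) > 0" "1 / a > 0" using a by auto
  define S where "S h = (\<lambda>t. of_real a * h (w * t) :: complex)" for h
  define R where "R f = (\<lambda>s. f (a powr (1/2) * s))" for f :: "real \<Rightarrow> complex"
  have st: "scales_measure (\<lambda>t::real. w * t) (1 / w)"
    using scales_measure_real_affine[of w 0] w by simp
  note T = scales_measure_heis_dil[OF a'(2)]
  have "AE l in lborel. \<forall>f\<in>L2R. AE t in lborel. A' l f t = S (A (a * l) (R f)) t"
  proof (rule fourier_intertwining[OF A A', where T = "dilat a" and C = "(1 / a)\<^sup>2 * (1 / (1 / a)\<^sup>2)" and K = "a\<^sup>2 * (1 / w)"])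
    show "AE l in lborel. P (a * l)" if "AE l in lborel. P l" for P
      using scales_measure_AE[OF scales_measure_real_affine[of a 0] that] a by simp
    show "R f \<in> L2R" if "f \<in> L2R" for f unfolding R_def by (rule stretch_L2[OF a'(1) that])
    fix h :: "real \<Rightarrow> complex" assume h: "h \<in> borel_measurable lebesgue"
    show "S h \<in> borel_measurable lebesgue"
      unfolding S_def by (intro borel_measurable_times borel_measurable_const scales_measure_borel_measurable[OF st h])
    show "nsq lebesgue (S h) = ennreal (a\<^sup>2 * (1 / w)) * nsq lebesgue h"
      unfolding S_def using w
      by (subst nsq_scale) (simp_all add: scales_measure_borel_measurable[OF st h] scales_measure_nsq[OF st h]
          ennreal_mult[symmetric] mult.assoc[symmetric])
  next
    fix \<Phi> assume \<Phi>: "L1_L2 \<Phi>"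
    show "L1_L2 (dilat a \<Phi>)"
      unfolding dilat_def by (rule L1_L2_scale[OF scales_measure_comp_L1_L2[OF T \<Phi>]])
    have m: "\<phi> \<in> borel_measurable lebesgue" "\<Phi> \<in> borel_measurable lebesgue"
      using has_fourier_transform_L2[OF A] \<Phi> by (auto simp: L1_L2_def L2_measurable)
    let ?d = "\<lambda>y. \<Phi> (heis_dil (1 / a) y) - \<phi> (heis_dil (1 / a) y)"
    have "nsq lebesgue (\<lambda>y. dilat a \<Phi> y - dilat a \<phi> y) = nsq lebesgue (\<lambda>y. of_real (1 / a) * ?d y)"
      unfolding dilat_def by (simp add: right_diff_distrib)
    also have "\<dots> = csq (of_real (1 / a)) * nsq lebesgue ?d"
      by (rule nsq_scale) (intro borel_measurable_diff scales_measure_borel_measurable[OF T] m)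
    also have "nsq lebesgue ?d = ennreal (1 / (1 / a)\<^sup>2) * nsq lebesgue (\<lambda>y. \<Phi> y - \<phi> y)"
      using scales_measure_nsq[OF T borel_measurable_diff[OF m(2,1)]] by simp
    also have "cmod (of_real (1 / a)) = 1 / a" using a by (simp only: norm_of_real) simp
    finally show "nsq lebesgue (\<lambda>y. dilat a \<Phi> y - dilat a \<phi> y) =
        ennreal ((1 / a)\<^sup>2 * (1 / (1 / a)\<^sup>2)) * nsq lebesgue (\<lambda>y. \<Phi> y - \<phi> y)"
      by (simp only: ennreal_mult zero_le_power2 zero_le_divide_1_iff mult.assoc)
    show "fourier_L1 (dilat a \<Phi>) l f = S (fourier_L1 \<Phi> (a * l) (R f))" if "f \<in> L2R" for l f
      unfolding S_def R_def w_def by (rule ext) (rule fourier_L1_dilat[OF a m(2) L2_measurable[OF that]])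
  qed (simp add: S_def right_diff_distrib)
  then show ?thesis unfolding S_def R_def w_def .
qed

text \<open>The common subsequence is chosen in three stages, for the two summands and for the combination.\<close>

theorem fourier_add_scale:
  assumes A: "has_fourier_transform \<phi> A" and B: "has_fourier_transform \<eta> B"
    and C: "has_fourier_transform (\<lambda>x. \<phi> x + c * \<eta> x) C"
  shows "AE l in lborel. \<forall>f\<in>L2R. AE t in lborel. C l f t = A l f t + c * B l f t"
proof -
  obtain \<Phi> where \<Phi>: "\<And>n. L1_L2 (\<Phi> n)" and conv: "(\<lambda>n. nsq lebesgue (\<lambda>x. \<Phi> n x - \<phi> x)) \<longlonglongrightarrow> 0"
    by (rule has_fourier_transform_approx[OF A]) blast
  obtain \<Psi> where \<Psi>: "\<And>n. L1_L2 (\<Psi> n)" and conv2: "(\<lambda>n. nsq lebesgue (\<lambda>x. \<Psi> n x - \<eta> x)) \<longlonglongrightarrow> 0"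
    by (rule has_fourier_transform_approx[OF B]) blast
  obtain r :: "nat \<Rightarrow> nat" where r: "strict_mono r" and lim1: "AE l in lborel. \<forall>f\<in>L2R. (\<lambda>n. nsq lebesgue (\<lambda>t. fourier_L1 (\<Phi> (r n)) l f t - A l f t)) \<longlonglongrightarrow> 0"
    by (rule fourier_strong_limit[OF A \<Phi> conv])
  have c2: "(\<lambda>n. nsq lebesgue (\<lambda>x. \<Psi> (r n) x - \<eta> x)) \<longlonglongrightarrow> 0"
    using LIMSEQ_subseq_LIMSEQ[OF conv2 r] by (simp add: o_def)
  obtain s :: "nat \<Rightarrow> nat" where s: "strict_mono s" and lim2: "AE l in lborel. \<forall>f\<in>L2R. (\<lambda>n. nsq lebesgue (\<lambda>t. fourier_L1 (\<Psi> (r (s n))) l f t - B l f t)) \<longlonglongrightarrow> 0"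
    by (rule fourier_strong_limit[OF B \<Psi> c2])
  define q where "q n = r (s n)" for n
  have q: "strict_mono q" using strict_mono_o[OF r s] by (simp add: q_def[abs_def] o_def)
  have cq: "(\<lambda>n. nsq lebesgue (\<lambda>x. \<Phi> (q n) x - \<phi> x)) \<longlonglongrightarrow> 0" "(\<lambda>n. nsq lebesgue (\<lambda>x. \<Psi> (q n) x - \<eta> x)) \<longlonglongrightarrow> 0"
    using LIMSEQ_subseq_LIMSEQ[OF conv q] LIMSEQ_subseq_LIMSEQ[OF conv2 q] by (simp_all add: o_def)
  have m: "\<phi> \<in> borel_measurable lebesgue" "\<eta> \<in> borel_measurable lebesgue" "\<Phi> n \<in> borel_measurable lebesgue" "\<Psi> n \<in> borel_measurable lebesgue" for n
    using has_fourier_transform_L2[OF A] has_fourier_transform_L2[OF B] \<Phi>[of n] \<Psi>[of n] by (auto simp: L1_L2_def L2_measurable)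
  \<comment> \<open>Used twice: for functions on the group and for the values of the operators.\<close>
  have comb: "(\<lambda>n. nsq lebesgue (\<lambda>x. (U n x + c * W n x) - (u x + c * w x))) \<longlonglongrightarrow> 0"
    if mm: "\<And>n. U n \<in> borel_measurable lebesgue" "\<And>n. W n \<in> borel_measurable lebesgue" "u \<in> borel_measurable lebesgue" "w \<in> borel_measurable lebesgue"
     and "(\<lambda>n. nsq lebesgue (\<lambda>x. U n x - u x)) \<longlonglongrightarrow> 0" "(\<lambda>n. nsq lebesgue (\<lambda>x. W n x - w x)) \<longlonglongrightarrow> 0"
    for U W :: "nat \<Rightarrow> 'b::euclidean_space \<Rightarrow> complex" and u w
  proof (rule tendsto_sandwich[OF _ _ tendsto_const])
    have "(\<lambda>n. 2 * nsq lebesgue (\<lambda>x. U n x - u x) + 2 * (csq c * nsq lebesgue (\<lambda>x. W n x - w x))) \<longlonglongrightarrow> 0 + 0"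
      by (intro tendsto_add ennreal_tendsto_cmult_0 that) auto
    then show "(\<lambda>n. 2 * nsq lebesgue (\<lambda>x. U n x - u x) + 2 * (csq c * nsq lebesgue (\<lambda>x. W n x - w x))) \<longlonglongrightarrow> 0" by simp
    show "\<forall>\<^sub>F n in sequentially. nsq lebesgue (\<lambda>x. (U n x + c * W n x) - (u x + c * w x)) \<le> 2 * nsq lebesgue (\<lambda>x. U n x - u x) + 2 * (csq c * nsq lebesgue (\<lambda>x. W n x - w x))"
    proof (intro always_eventually allI)
      fix n
      have "(\<lambda>x. (U n x + c * W n x) - (u x + c * w x)) = (\<lambda>x. (U n x - u x) + c * (W n x - w x))" by (simp add: fun_eq_iff algebra_simps)
      then show "nsq lebesgue (\<lambda>x. (U n x + c * W n x) - (u x + c * w x)) \<le> 2 * nsq lebesgue (\<lambda>x. U n x - u x) + 2 * (csq c * nsq lebesgue (\<lambda>x. W n x - w x))"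
        using nsq_add_le2[of "\<lambda>x. U n x - u x" lebesgue "\<lambda>x. c * (W n x - w x)"] nsq_scale[of "\<lambda>x. W n x - w x" lebesgue c] mm(1,2)[of n] mm(3,4) by simp
    qed
  qed auto
  define X where "X n x = \<Phi> (q n) x + c * \<Psi> (q n) x" for n x
  have X: "L1_L2 (X n)" for n unfolding X_def by (rule L1_L2_add_scale[OF \<Phi> \<Psi>])
  have convX: "(\<lambda>n. nsq lebesgue (\<lambda>x. X n x - (\<phi> x + c * \<eta> x))) \<longlonglongrightarrow> 0"
    unfolding X_def by (rule comb) (fact m cq)+
  obtain p :: "nat \<Rightarrow> nat" where p: "strict_mono p" and lim3: "AE l in lborel. \<forall>f\<in>L2R. (\<lambda>n. nsq lebesgue (\<lambda>t. fourier_L1 (X (p n)) l f t - C l f t)) \<longlonglongrightarrow> 0"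
    by (rule fourier_strong_limit[OF C X convX])
  have sp: "strict_mono (\<lambda>n. s (p n))" using strict_mono_o[OF s p] by (simp add: o_def)
  show ?thesis
    using lim1 lim2 lim3 AE_all_bounded[of \<Phi>, OF \<Phi>] AE_all_bounded[of \<Psi>, OF \<Psi>] AE_all_bounded[of X, OF X]
      has_fourier_transform_bounded[OF A] has_fourier_transform_bounded[OF B] has_fourier_transform_bounded[OF C]
  proof eventually_elim
    case (elim l)
    show ?case
    proof
      fix f :: "real \<Rightarrow> complex" assume f: "f \<in> L2R"
      have mm: "fourier_L1 (\<Phi> n) l f \<in> borel_measurable lebesgue" "fourier_L1 (\<Psi> n) l f \<in> borel_measurable lebesgue" "fourier_L1 (X n) l f \<in> borel_measurable lebesgue"
        "A l f \<in> borel_measurable lebesgue" "B l f \<in> borel_measurable lebesgue" "C l f \<in> borel_measurable lebesgue" for n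
        by (rule bounded_operator_measurable[OF _ f], use elim in blast)+
      show "AE t in lborel. C l f t = A l f t + c * B l f t"
      proof (rule nsq_limit_unique[where X = "\<lambda>n. fourier_L1 (X (p n)) l f"])
        show "(\<lambda>n. nsq lebesgue (\<lambda>t. fourier_L1 (X (p n)) l f t - C l f t)) \<longlonglongrightarrow> 0" using elim f by blast
        have "nsq lebesgue (\<lambda>t. fourier_L1 (X (p n)) l f t - (A l f t + c * B l f t)) =
          nsq lebesgue (\<lambda>t. (fourier_L1 (\<Phi> (q (p n))) l f t + c * fourier_L1 (\<Psi> (q (p n))) l f t) - (A l f t + c * B l f t))" for n
          unfolding nsq_lebesgue
        proof (rule nsq_cong_AE)
          show "AE t in lborel. fourier_L1 (X (p n)) l f t - (A l f t + c * B l f t) = (fourier_L1 (\<Phi> (q (p n))) l f t + c * fourier_L1 (\<Psi> (q (p n))) l f t) - (A l f t + c * B l f t)"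
            using fourier_L1_add_scale[OF \<Phi>[of "q (p n)"] \<Psi>[of "q (p n)"] f, of c] by eventually_elim (simp add: X_def[abs_def])
        qed
        moreover have "(\<lambda>n. nsq lebesgue (\<lambda>t. (fourier_L1 (\<Phi> (q (p n))) l f t + c * fourier_L1 (\<Psi> (q (p n))) l f t) - (A l f t + c * B l f t))) \<longlonglongrightarrow> 0"
        proof (rule comb)
          show "(\<lambda>n. nsq lebesgue (\<lambda>x. fourier_L1 (\<Phi> (q (p n))) l f x - A l f x)) \<longlonglongrightarrow> 0"
            using LIMSEQ_subseq_LIMSEQ[OF elim(1)[rule_format, OF f] sp] by (simp add: o_def q_def)
          show "(\<lambda>n. nsq lebesgue (\<lambda>x. fourier_L1 (\<Psi> (q (p n))) l f x - B l f x)) \<longlonglongrightarrow> 0"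
            using LIMSEQ_subseq_LIMSEQ[OF elim(2)[rule_format, OF f] p] by (simp add: o_def q_def)
        qed (fact mm)+
        ultimately show "(\<lambda>n. nsq lebesgue (\<lambda>t. fourier_L1 (X (p n)) l f t - (A l f t + c * B l f t))) \<longlonglongrightarrow> 0" by simp
      qed (use mm in auto)
    qed
  qed
qed

section \<open>The reducing isomorphism\<close>

lemma reducing_isomorphism_obtain:
  assumes "reducing_isomorphism H e V" "\<eta> \<in> H"
  obtains A where "has_fourier_transform \<eta> A" "AE l in lborel. AE t in lborel. V \<eta> (l, t) = A l (e l) t"
  using assms unfolding reducing_isomorphism_def AE_lebesgue_on_Lam AE_completion_iff by blast

lemma reducing_isomorphism_L2: "reducing_isomorphism H e V \<Longrightarrow> \<eta> \<in> H \<Longrightarrow> V \<eta> \<in> L2 measure_LamR"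
  by (simp add: reducing_isomorphism_def)

lemma spanning_unit_field_unit:
  assumes "spanning_unit_field H e" "l \<noteq> 0"
  shows "e l \<in> L2R" "L2_norm lebesgue (e l) = 1"
  using assms by (auto simp: spanning_unit_field_def unit_vector_field_def Lam_def)

text \<open>The projection fixes \<open>v\<close>, which lies in its range, and it is self-adjoint; this determines the scalar.\<close>

lemma rank_one_projection_formula:
  assumes P: "orthogonal_projection P" and span: "range_is_span P v" and v: "v \<in> L2R" "L2_norm lebesgue v = 1"
    and f: "f \<in> L2R"
  shows "AE t in lborel. P f t = L2_inner lebesgue f v * v t"
proof -
  have B: "bounded_operator P" using P by (simp add: orthogonal_projection_def)
  note PL = bounded_operator_L2[OF B]
  obtain c where c: "AE t in lebesgue. P f t = c * v t" using span f unfolding range_is_span_def by blast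
  have "\<exists>h\<in>L2R. AE t in lebesgue. P h t = 1 * v t" using span unfolding range_is_span_def by blast
  then obtain h where h: "h \<in> L2R" "AE t in lebesgue. P h t = 1 * v t" by blast
  have Ph: "AE t in lborel. v t = P h t" using h(2) unfolding AE_completion_iff by eventually_elim simp
  have PP: "AE t in lborel. P (P h) t = P h t" using P h(1) unfolding orthogonal_projection_def AE_completion_iff by blast
  have Pv: "AE t in lborel. P v t = v t"
    using bounded_operator_cong_AE[OF B v(1) PL[OF h(1)] Ph] PP Ph by eventually_elim simp
  have "c = c * L2_inner lebesgue v v" using v(2) by (simp add: L2_inner_self)
  also have "\<dots> = L2_inner lebesgue (\<lambda>t. c * v t) v" by (simp add: L2_inner_scale_left)
  also have "\<dots> = L2_inner lebesgue (P f) v"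
  proof (rule L2_inner_cong_AE)
    show "AE t in lebesgue. c * v t = P f t" using c by eventually_elim simp
  qed (use L2_measurable[OF v(1)] L2_measurable[OF PL[OF f]] in auto)
  also have "\<dots> = L2_inner lebesgue f (P v)" using P f v(1) by (simp add: orthogonal_projection_def)
  also have "\<dots> = L2_inner lebesgue f v"
    using L2_measurable[OF f] L2_measurable[OF PL[OF v(1)]] L2_measurable[OF v(1)] Pv
    by (intro L2_inner_cong_AE) (auto simp: AE_completion_iff)
  finally have "c = L2_inner lebesgue f v" .
  then show ?thesis using c by (simp add: AE_completion_iff)
qed

text \<open>Expanding \<open>v\<close> in the basis: the image of the basis vector \<open>onb j\<close> is \<open>\<langle>onb j, v\<rangle> A v\<close>, and the squares of the
  coefficients of the unit vector \<open>v\<close> add up to 1.\<close>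

lemma hs_sq_rank_one:
  assumes A: "bounded_operator A" and P: "orthogonal_projection P" and span: "range_is_span P v"
    and v: "v \<in> L2R" "L2_norm lebesgue v = 1"
  shows "hs_sq (\<lambda>f. A (P f)) = nsq lebesgue (A v)"
proof -
  have B: "bounded_operator P" using P by (simp add: orthogonal_projection_def)
  have Av: "A v \<in> borel_measurable lebesgue" by (rule bounded_operator_measurable[OF A v(1)])
  have "nsq lebesgue (A (P (onb j))) = csq (L2_inner lebesgue v (onb j)) * nsq lebesgue (A v)" for j
  proof -
    let ?c = "L2_inner lebesgue (onb j) v"
    have "AE t in lborel. A (P (onb j)) t = A (\<lambda>t. ?c * v t) t"
      by (rule bounded_operator_cong_AE[OF A bounded_operator_L2[OF B onb_L2] L2_scale[OF v(1)] rank_one_projection_formula[OF P span v onb_L2]])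
    with bounded_operator_scale[OF A v(1), of ?c] have "AE t in lborel. A (P (onb j)) t = ?c * A v t"
      by eventually_elim simp
    then have "nsq lebesgue (A (P (onb j))) = nsq lebesgue (\<lambda>t. ?c * A v t)"
      unfolding nsq_lebesgue by (rule nsq_cong_AE)
    also have "\<dots> = csq ?c * nsq lebesgue (A v)" by (rule nsq_scale[OF Av])
    also have "cmod ?c = cmod (L2_inner lebesgue v (onb j))" by (subst L2_inner_commute) simp
    finally show ?thesis .
  qed
  then have "hs_sq (\<lambda>f. A (P f)) = (\<Sum>\<^sup>+j. csq (L2_inner lebesgue v (onb j)) * nsq lebesgue (A v))"
    by (subst hs_sq_eq) (simp_all add: bounded_operator_L2[OF A bounded_operator_L2[OF B onb_L2]])
  also have "\<dots> = (\<Sum>\<^sup>+j. csq (L2_inner lebesgue v (onb j))) * nsq lebesgue (A v)"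
    by (rule nn_integral_multc) auto
  also have "\<dots> = nsq lebesgue (A v)" using v by (simp add: onb_parseval nsq_eq_L2_norm)
  finally show ?thesis .
qed

text \<open>An element of \<open>H\<close> is its own projection, so composing its transform with the fibre projections yields
  another transform of the same function; the Plancherel formula applies to the second one.\<close>

theorem reducing_isomorphism_isometry:
  assumes e: "spanning_unit_field H e" and V: "reducing_isomorphism H e V" and \<eta>: "\<eta> \<in> H"
  shows "nsq measure_LamR (V \<eta>) = nsq lebesgue \<eta>"
proof -
  obtain A where A: "has_fourier_transform \<eta> A" and VA: "AE l in lborel. AE t in lborel. V \<eta> (l, t) = A l (e l) t"
    by (rule reducing_isomorphism_obtain[OF V \<eta>])
  obtain P where P: "fibre_projections H P" and "AE l in lebesgue_on Lam. range_is_span (P l) (e l)"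
    using e unfolding spanning_unit_field_def by blast
  then have span: "AE l in lborel. range_is_span (P l) (e l)" by (simp add: AE_lebesgue_on_Lam)
  have "orthogonal_projection_of lebesgue H \<eta> \<eta>"
    using \<eta> by (simp add: orthogonal_projection_of_def L2_inner_def)
  then have B: "has_fourier_transform \<eta> (\<lambda>l f. A l (P l f))"
    using P A has_fourier_transform_L2[OF A] unfolding fibre_projections_def by blast
  have "nsq measure_LamR (V \<eta>) = (\<integral>\<^sup>+l. ennreal \<bar>l\<bar> * nsq lborel (\<lambda>t. V \<eta> (l, t)) \<partial>lborel)"
    by (rule nsq_measure_LamR) (rule L2_measurable[OF reducing_isomorphism_L2[OF V \<eta>]])
  also have "\<dots> = (\<integral>\<^sup>+l. ennreal \<bar>l\<bar> * hs_sq (\<lambda>f. A l (P l f)) \<partial>lborel)"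
  proof (rule nn_integral_cong_AE)
    show "AE l in lborel. ennreal \<bar>l\<bar> * nsq lborel (\<lambda>t. V \<eta> (l, t)) = ennreal \<bar>l\<bar> * hs_sq (\<lambda>f. A l (P l f))"
      using VA span AE_neq_0 has_fourier_transform_bounded[OF A]
    proof eventually_elim
      case (elim l)
      have "orthogonal_projection (P l)" using P elim(3) by (simp add: fibre_projections_def Lam_def)
      then have "hs_sq (\<lambda>f. A l (P l f)) = nsq lebesgue (A l (e l))"
        by (rule hs_sq_rank_one[OF elim(4) _ elim(2) spanning_unit_field_unit[OF e elim(3)]])
      also have "\<dots> = nsq lborel (\<lambda>t. V \<eta> (l, t))"
        unfolding nsq_lebesgue by (rule nsq_cong_AE) (use elim(1) in eventually_elim, simp)
      finally show ?case by simp
    qed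
  qed
  also have "\<dots> = nsq lebesgue \<eta>" by (rule fourier_hs_norm[OF B])
  finally show ?thesis .
qed

lemma reducing_isomorphism_measurable: "reducing_isomorphism H e V \<Longrightarrow> \<eta> \<in> H \<Longrightarrow> V \<eta> \<in> borel_measurable lebesgue"
  by (rule measure_LamR_lebesgue[OF L2_measurable[OF reducing_isomorphism_L2]])

theorem reducing_isomorphism_add_scale:
  assumes e: "spanning_unit_field H e" and V: "reducing_isomorphism H e V"
    and H: "\<phi> \<in> H" "\<eta> \<in> H" "(\<lambda>x. \<phi> x + c * \<eta> x) \<in> H"
  shows "AE z in measure_LamR. V (\<lambda>x. \<phi> x + c * \<eta> x) z = V \<phi> z + c * V \<eta> z"
proof (rule AE_AE_measure_LamR)
  obtain A where A: "has_fourier_transform \<phi> A" and VA: "AE l in lborel. AE t in lborel. V \<phi> (l, t) = A l (e l) t"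
    by (rule reducing_isomorphism_obtain[OF V H(1)])
  obtain B where B: "has_fourier_transform \<eta> B" and VB: "AE l in lborel. AE t in lborel. V \<eta> (l, t) = B l (e l) t"
    by (rule reducing_isomorphism_obtain[OF V H(2)])
  obtain C where C: "has_fourier_transform (\<lambda>x. \<phi> x + c * \<eta> x) C"
    and VC: "AE l in lborel. AE t in lborel. V (\<lambda>x. \<phi> x + c * \<eta> x) (l, t) = C l (e l) t"
    by (rule reducing_isomorphism_obtain[OF V H(3)])
  show "AE l in lborel. AE t in lborel. V (\<lambda>x. \<phi> x + c * \<eta> x) (l, t) = V \<phi> (l, t) + c * V \<eta> (l, t)"
    using VA VB VC fourier_add_scale[OF A B C] AE_neq_0
  proof eventually_elim
    case (elim l)
    from elim(1-3) elim(4)[rule_format, OF spanning_unit_field_unit(1)[OF e elim(5)]] show ?case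
      by eventually_elim simp
  qed
qed (use reducing_isomorphism_measurable[OF V] H in auto)

lemma scales_measure_plane:
  assumes p: "p > 0" and r: "r > 0"
  shows "scales_measure (\<lambda>z::real \<times> real. (p * fst z, q + r * snd z)) (1 / p * (1 / r))"
  unfolding scales_measure_def
proof (intro conjI allI impI)
  have T: "(\<lambda>z::real \<times> real. (p * fst z, q + r * snd z)) \<in> (borel \<Otimes>\<^sub>M borel) \<rightarrow>\<^sub>M (borel \<Otimes>\<^sub>M borel)" by measurable
  then show "(\<lambda>z::real \<times> real. (p * fst z, q + r * snd z)) \<in> borel \<rightarrow>\<^sub>M borel" by (simp add: borel_prod)
  fix F :: "real \<times> real \<Rightarrow> ennreal" assume "F \<in> borel_measurable borel"
  then have F [measurable]: "F \<in> borel_measurable (borel \<Otimes>\<^sub>M borel)" by (simp add: borel_prod)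
  have pair: "(\<integral>\<^sup>+z. G z \<partial>lborel) = (\<integral>\<^sup>+x. (\<integral>\<^sup>+y. G (x, y) \<partial>lborel) \<partial>lborel)" if "G \<in> borel_measurable (borel \<Otimes>\<^sub>M borel)" for G :: "real \<times> real \<Rightarrow> ennreal"
    using lborel.nn_integral_fst[of G lborel] that by (simp add: lborel_prod borel_prod)
  have st: "(\<integral>\<^sup>+y. G (q + r * y) \<partial>lborel) = ennreal (1 / r) * (\<integral>\<^sup>+y. G y \<partial>lborel)" if "G \<in> borel_measurable borel" for G :: "real \<Rightarrow> ennreal"
    using scales_measure_nn_integral[OF scales_measure_real_affine[of r q] that] r by simp
  have "(\<integral>\<^sup>+z. F (p * fst z, q + r * snd z) \<partial>lborel) = (\<integral>\<^sup>+x. (\<integral>\<^sup>+y. F (p * x, q + r * y) \<partial>lborel) \<partial>lborel)"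
    by (subst pair) (use measurable_compose[OF T F] in auto)
  also have "\<dots> = (\<integral>\<^sup>+x. ennreal (1 / r) * (\<integral>\<^sup>+y. F (p * x, y) \<partial>lborel) \<partial>lborel)"
    by (intro nn_integral_cong st) measurable
  also have "\<dots> = ennreal (1 / r) * (\<integral>\<^sup>+x. (\<integral>\<^sup>+y. F (p * x, y) \<partial>lborel) \<partial>lborel)"
    by (rule nn_integral_cmult) measurable
  also have "(\<integral>\<^sup>+x. (\<integral>\<^sup>+y. F (p * x, y) \<partial>lborel) \<partial>lborel) = ennreal (1 / p) * (\<integral>\<^sup>+x. (\<integral>\<^sup>+y. F (x, y) \<partial>lborel) \<partial>lborel)"
    by (rule nn_integral_stretch[of "\<lambda>x. \<integral>\<^sup>+y. F (x, y) \<partial>lborel", OF _ p]) measurable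
  also have "(\<integral>\<^sup>+x. (\<integral>\<^sup>+y. F (x, y) \<partial>lborel) \<partial>lborel) = (\<integral>\<^sup>+z. F z \<partial>lborel)" by (rule pair[OF F, symmetric])
  finally show "(\<integral>\<^sup>+z. F (p * fst z, q + r * snd z) \<partial>lborel) = ennreal (1 / p * (1 / r)) * (\<integral>\<^sup>+z. F z \<partial>lborel)"
    using p r by (subst ennreal_mult) (simp_all add: mult_ac)
qed (use p r in auto)

lemma transl_hat_eq:
  "transl_hat (k, l, m) f = (\<lambda>z. ef (fst z * m) * ef (- (fst z * snd z) * l) * f (1 * fst z, - k + 1 * snd z))"
  by (auto simp: transl_hat_def ef_def fun_eq_iff mult_ac)

lemma dilat_hat_eq:
  "dilat_hat chi a f = (\<lambda>z. chi a (fst z) * of_real (a powr (3/4)) * f (a * fst z, 0 + a powr (-1/2) * snd z))"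
  by (auto simp: dilat_hat_def fun_eq_iff)

lemma lebesgue_measurable_fst:
  fixes f :: "real \<Rightarrow> complex"
  assumes f: "f \<in> borel_measurable lebesgue"
  shows "(\<lambda>z::real \<times> real. f (fst z)) \<in> borel_measurable lebesgue"
proof -
  obtain g where g: "g \<in> borel_measurable borel" and eq: "AE x in lborel. f x = g x"
    using borel_representative[OF f] by blast
  have "(\<lambda>z::real \<times> real. g (fst z)) \<in> borel_measurable (borel \<Otimes>\<^sub>M borel)" using g by measurable
  then have "(\<lambda>z::real \<times> real. g (fst z)) \<in> borel_measurable borel" by (simp add: borel_prod)
  then show ?thesis by (rule lebesgue_measurableI_AE[OF _ AE_lborel_fst[OF eq]])
qed

lemma transl_hat_measurable:
  assumes "f \<in> borel_measurable lebesgue"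
  shows "transl_hat x f \<in> borel_measurable lebesgue"
proof -
  obtain k l m where x: "x = (k, l, m)" by (cases x)
  have "(\<lambda>z::real \<times> real. ef (fst z * m) * ef (- (fst z * snd z) * l)) \<in> borel_measurable (borel \<Otimes>\<^sub>M borel)" by measurable
  then have "(\<lambda>z::real \<times> real. ef (fst z * m) * ef (- (fst z * snd z) * l)) \<in> borel_measurable lebesgue"
    by (intro measurable_completion) (simp add: borel_prod)
  moreover have "(\<lambda>z. f (1 * fst z, - k + 1 * snd z)) \<in> borel_measurable lebesgue"
    by (rule scales_measure_borel_measurable[OF scales_measure_plane assms]) auto
  ultimately show ?thesis unfolding x transl_hat_eq by (rule borel_measurable_times)
qed

lemma dilat_hat_measurable:
  assumes a: "a > 0" and f: "f \<in> borel_measurable lebesgue" and chi: "chi a \<in> borel_measurable (lebesgue_on Lam)"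
  shows "dilat_hat chi a f \<in> borel_measurable lebesgue"
  unfolding dilat_hat_eq
  by (intro borel_measurable_times borel_measurable_const lebesgue_measurable_fst measurable_lebesgue_on_Lam chi
      scales_measure_borel_measurable[OF scales_measure_plane f] a) (use a in simp)

lemma transl_hat_cong_AE:
  assumes "AE z in lborel. f z = g z"
  shows "AE z in lborel. transl_hat x f z = transl_hat x g z"
proof -
  obtain k l m where x: "x = (k, l, m)" by (cases x)
  have "AE z in lborel. f (1 * fst z, - k + 1 * snd z) = g (1 * fst z, - k + 1 * snd z)"
    by (rule scales_measure_AE[OF scales_measure_plane assms]) auto
  then show ?thesis unfolding x transl_hat_eq by eventually_elim simp
qed

lemma dilat_hat_cong_AE:
  assumes a: "a > 0" and eq: "AE z in lborel. f z = g z"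
  shows "AE z in lborel. dilat_hat chi a f z = dilat_hat chi a g z"
proof -
  have "AE z in lborel. f (a * fst z, 0 + a powr (-1/2) * snd z) = g (a * fst z, 0 + a powr (-1/2) * snd z)"
    by (rule scales_measure_AE[OF scales_measure_plane eq]) (use a in auto)
  then show ?thesis unfolding dilat_hat_eq by eventually_elim simp
qed

lemma AE_shift: "AE t in lborel. P (t::real) \<Longrightarrow> AE t in lborel. P (t - k)"
  using scales_measure_AE[OF scales_measure_real_affine[of 1 "- k"], of P] by simp

lemma AE_stretch: "c > 0 \<Longrightarrow> AE t in lborel. P (t::real) \<Longrightarrow> AE t in lborel. P (c * t)"
  using scales_measure_AE[OF scales_measure_real_affine[of c 0], of P] by simp

theorem reducing_isomorphism_transl:
  assumes e: "spanning_unit_field H e" and V: "reducing_isomorphism H e V"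
    and H: "\<psi> \<in> H" "transl x \<psi> \<in> H"
  shows "AE z in measure_LamR. V (transl x \<psi>) z = transl_hat x (V \<psi>) z"
proof (rule AE_AE_measure_LamR)
  obtain k lb m where x: "x = (k, lb, m)" by (cases x)
  obtain A where A: "has_fourier_transform \<psi> A" and VA: "AE l in lborel. AE t in lborel. V \<psi> (l, t) = A l (e l) t"
    by (rule reducing_isomorphism_obtain[OF V H(1)])
  obtain A' where A': "has_fourier_transform (transl x \<psi>) A'" and VA': "AE l in lborel. AE t in lborel. V (transl x \<psi>) (l, t) = A' l (e l) t"
    by (rule reducing_isomorphism_obtain[OF V H(2)])
  show "AE l in lborel. AE t in lborel. V (transl x \<psi>) (l, t) = transl_hat x (V \<psi>) (l, t)"
    using VA VA' fourier_transl[OF A A'] AE_neq_0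
  proof eventually_elim
    case (elim l)
    from AE_shift[OF elim(1), of k] elim(2) elim(3)[rule_format, OF spanning_unit_field_unit(1)[OF e elim(4)]] show ?case
      by eventually_elim (simp add: x transl_hat_def)
  qed
qed (use reducing_isomorphism_measurable[OF V] H transl_hat_measurable in auto)

text \<open>The dilated unit vector \<open>e l\<close> is a multiple of \<open>e (a l)\<close> by the definition of the multiplier, with the
  normalization \<open>a\<^sup>1\<^sup>/\<^sup>4\<close> of \<open>C\<^sub>a\<close>; combined with the factor \<open>a\<close> of the dilated transform this gives the
  exponent \<open>3/4\<close>.\<close>

theorem reducing_isomorphism_dilat:
  assumes e: "spanning_unit_field H e" and V: "reducing_isomorphism H e V" and chi: "associated_multiplier e chi"
    and H: "\<psi> \<in> H" "dilat a \<psi> \<in> H" and a: "a > 0"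
  shows "AE z in measure_LamR. V (dilat a \<psi>) z = dilat_hat chi a (V \<psi>) z"
proof (rule AE_AE_measure_LamR)
  have chim: "chi a \<in> borel_measurable (lebesgue_on Lam)"
    and chie: "AE l in lborel. AE t in lborel. C_op a (e l) t = chi a l * e (a * l) t"
    using chi a unfolding associated_multiplier_def AE_lebesgue_on_Lam AE_completion_iff by auto
  obtain A where A: "has_fourier_transform \<psi> A" and VA: "AE l in lborel. AE t in lborel. V \<psi> (l, t) = A l (e l) t"
    by (rule reducing_isomorphism_obtain[OF V H(1)])
  obtain A' where A': "has_fourier_transform (dilat a \<psi>) A'" and VA': "AE l in lborel. AE t in lborel. V (dilat a \<psi>) (l, t) = A' l (e l) t"
    by (rule reducing_isomorphism_obtain[OF V H(2)])
  define q where "q = a powr (1/4)"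
  have q: "q > 0" using a by (simp add: q_def)
  have aq: "a powr (3/4) = a / q"
    using a powr_diff[of a 1 "1/4"] by (simp add: q_def)
  define w where "w = a powr (-1/2)"
  have w: "w > 0" "a powr - (1/2) = w" using a by (simp_all add: w_def)
  define s where "s = a powr (1/2)"
  have s: "s > 0" using a by (simp add: s_def)
  show "AE l in lborel. AE t in lborel. V (dilat a \<psi>) (l, t) = dilat_hat chi a (V \<psi>) (l, t)"
    using AE_stretch[OF a VA] VA' fourier_dilat[OF a A A'] AE_neq_0 chie AE_stretch[OF a has_fourier_transform_bounded[OF A]]
  proof eventually_elim
    case (elim l)
    have el: "e l \<in> L2R" "e (a * l) \<in> L2R" using spanning_unit_field_unit(1)[OF e] elim(4) a by auto
    let ?f = "\<lambda>u. e l (s * u)" and ?c = "chi a l / of_real q"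
    have "AE t in lborel. ?f t = ?c * e (a * l) t"
      using elim(5) by eventually_elim (use q in \<open>simp add: C_op_def q_def[symmetric] s_def[symmetric] field_simps\<close>)
    then have "AE t in lborel. A (a * l) ?f t = A (a * l) (\<lambda>t. ?c * e (a * l) t) t"
      by (rule bounded_operator_cong_AE[OF elim(6) stretch_L2[OF s el(1)] L2_scale[OF el(2)]])
    with bounded_operator_scale[OF elim(6) el(2), of ?c] have "AE t in lborel. A (a * l) ?f t = ?c * A (a * l) (e (a * l)) t"
      by eventually_elim simp
    from AE_stretch[OF w(1) this] AE_stretch[OF w(1) elim(1)] elim(2) elim(3)[rule_format, OF el(1)]
    show ?case
      unfolding s_def[symmetric] w_def[symmetric]
      by eventually_elim (simp add: dilat_hat_def w(2) aq)
  qed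
  show "V (dilat a \<psi>) \<in> borel_measurable lebesgue" by (rule reducing_isomorphism_measurable[OF V H(2)])
  show "dilat_hat chi a (V \<psi>) \<in> borel_measurable lebesgue"
    by (rule dilat_hat_measurable[OF a reducing_isomorphism_measurable[OF V H(1)], of chi, OF chim])
qed

section \<open>Congruent sets\<close>

lemma AE_lborel_of_null_set:
  assumes "N \<in> null_sets lebesgue"
  shows "AE x in lborel. x \<notin> N"
  using AE_not_in[OF assms] by (simp add: AE_completion_iff)

lemma eq_mod_null_AE: "eq_mod_null A B \<Longrightarrow> AE x in lborel. x \<in> A \<longleftrightarrow> x \<in> B"
  unfolding eq_mod_null_def by (drule AE_lborel_of_null_set, erule eventually_mono) auto

lemma AE_all_translates:
  assumes "AE x in lborel. P (x::real)"
  shows "AE x in lborel. \<forall>n::int. P (x + of_int n)"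
proof (subst AE_all_countable, intro allI)
  fix n :: int
  show "AE x in lborel. P (x + of_int n)"
    using AE_shift[OF assms, of "- of_int n"] by simp
qed

lemma AE_all_dyadic_dilates:
  assumes "AE x in lborel. P (x::real)"
  shows "AE x in lborel. \<forall>j::int. P (2 powi j * x)"
proof (subst AE_all_countable, intro allI)
  fix j :: int
  show "AE x in lborel. P (2 powi j * x)"
    by (rule AE_stretch[OF _ assms]) simp
qed

text \<open>If \<open>x + m\<close> and \<open>x + n\<close> both lie in \<open>I\<close>, their images under the congruence differ from \<open>x\<close> by integers and lie in
  the unit interval, and away from a null set even in the half-open one, so they coincide; injectivity gives \<open>m = n\<close>.\<close>

lemma translation_congruent_packing:
  assumes I: "translation_congruent I J" and J: "J \<subseteq> {0..1}"
  shows "AE x in lborel. \<forall>m n::int. x + of_int m \<in> I \<longrightarrow> x + of_int n \<in> I \<longrightarrow> m = n"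
proof -
  obtain I' J' \<tau> and k :: "real \<Rightarrow> int" where I': "eq_mod_null I I'" and J': "eq_mod_null J J'"
    and bij: "bij_betw \<tau> I' J'" and \<tau>: "\<And>l. l \<in> I' \<Longrightarrow> \<tau> l = l + of_int (k l)"
    using I unfolding translation_congruent_def by blast
  have "AE x in lborel. x \<noteq> (1::real)" by (rule AE_lborel_singleton)
  from AE_all_translates[OF eq_mod_null_AE[OF I']] AE_all_translates[OF eq_mod_null_AE[OF J']] AE_all_translates[OF this]
  show ?thesis
  proof eventually_elim
    case (elim x)
    show ?case
    proof (intro allI impI)
      fix m n :: int assume mn: "x + of_int m \<in> I" "x + of_int n \<in> I"
      have m: "x + of_int m \<in> I'" and n: "x + of_int n \<in> I'" using mn elim(1) by blast+
      have unit: "\<tau> (x + of_int p) \<in> {0..<1} \<and> \<tau> (x + of_int p) = x + of_int (p + k (x + of_int p))" if p: "x + of_int p \<in> I'" for p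
      proof -
        have eq: "\<tau> (x + of_int p) = x + of_int (p + k (x + of_int p))" using \<tau>[OF p] by simp
        have "\<tau> (x + of_int p) \<in> J'" using bij p by (auto simp: bij_betw_def)
        then have "x + of_int (p + k (x + of_int p)) \<in> J" using elim(2) unfolding eq by blast
        then have "x + of_int (p + k (x + of_int p)) \<in> {0..1}" using J by blast
        moreover have "x + of_int (p + k (x + of_int p)) \<noteq> 1" using elim(3) by blast
        ultimately show ?thesis unfolding eq by auto
      qed
      define a where "a = m + k (x + of_int m)"
      define b where "b = n + k (x + of_int n)"
      have "x + of_int a \<in> {0..<1}" "x + of_int b \<in> {0..<1}" using unit[OF m] unit[OF n] by (auto simp: a_def b_def)
      then have "\<bar>real_of_int (a - b)\<bar> < 1" by auto
      then have "a = b" by linarith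
      then have "\<tau> (x + of_int m) = \<tau> (x + of_int n)" using unit[OF m] unit[OF n] by (simp add: a_def b_def)
      then have "x + of_int m = x + of_int n" by (rule inj_onD[OF bij_betw_imp_inj_on[OF bij] _ m n])
      then show "m = n" by simp
    qed
  qed
qed

text \<open>In terms of \<open>j + log\<^sub>2 |x|\<close> each half of the Shannon set is a half-open interval of length 1.\<close>

lemma shannon_set_tiling: "x \<noteq> 0 \<Longrightarrow> \<exists>!j::int. 2 powi j * x \<in> shannon_set"
proof -
  assume x: "x \<noteq> 0"
  have iff: "2 powi j * x \<in> shannon_set \<longleftrightarrow> (x > 0 \<and> 1/2 \<le> 2 powi j * x \<and> 2 powi j * x < 1) \<or> (x < 0 \<and> 1/2 < 2 powi j * \<bar>x\<bar> \<and> 2 powi j * \<bar>x\<bar> \<le> 1)" for j :: int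
  proof -
    define y where "y = 2 powi j * x"
    have p: "(2::real) powi j > 0" by simp
    have ay: "2 powi j * \<bar>x\<bar> = \<bar>y\<bar>" by (simp add: y_def abs_mult)
    have "(x > 0 \<and> y > 0) \<or> (x < 0 \<and> y < 0)"
      using p x by (cases "x > 0") (auto simp: y_def mult_pos_neg)
    then show ?thesis unfolding ay y_def[symmetric] by (auto simp: shannon_set_def)
  qed
  have powi: "(2::real) powi j = 2 powr of_int j" for j by (simp add: powr_real_of_int')
  have lg: "2 powi j * \<bar>x\<bar> = 2 powr (of_int j + log 2 \<bar>x\<bar>)" for j
    using x by (simp add: powi powr_add)
  have half: "(1/2::real) = 2 powr (-1)" by (simp add: powr_minus)
  show ?thesis
  proof (cases "x > 0")
    case True
    have "2 powi j * x \<in> shannon_set \<longleftrightarrow> j = - \<lfloor>log 2 \<bar>x\<bar>\<rfloor> - 1" for j :: int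
    proof -
      have "2 powi j * x \<in> shannon_set \<longleftrightarrow> 2 powr (-1) \<le> 2 powr (of_int j + log 2 \<bar>x\<bar>) \<and> 2 powr (of_int j + log 2 \<bar>x\<bar>) < 2 powr 0"
        using True lg[of j] unfolding iff half by simp
      also have "\<dots> \<longleftrightarrow> - 1 - of_int j \<le> log 2 \<bar>x\<bar> \<and> log 2 \<bar>x\<bar> < - of_int j"
        using powr_le_cancel_iff[of 2 "-1" "of_int j + log 2 \<bar>x\<bar>"] powr_less_cancel_iff[of 2 "of_int j + log 2 \<bar>x\<bar>" 0]
          powr_less_cancel_iff[of 2 "-1" "of_int j + log 2 \<bar>x\<bar>"] powr_le_cancel_iff[of 2 "of_int j + log 2 \<bar>x\<bar>" 0] by auto
      also have "\<dots> \<longleftrightarrow> j = - \<lfloor>log 2 \<bar>x\<bar>\<rfloor> - 1" by linarith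
      finally show ?thesis .
    qed
    then show ?thesis by auto
  next
    case False
    have "2 powi j * x \<in> shannon_set \<longleftrightarrow> j = - \<lceil>log 2 \<bar>x\<bar>\<rceil>" for j :: int
    proof -
      have "2 powi j * x \<in> shannon_set \<longleftrightarrow> 2 powr (-1) < 2 powr (of_int j + log 2 \<bar>x\<bar>) \<and> 2 powr (of_int j + log 2 \<bar>x\<bar>) \<le> 2 powr 0"
        using False x lg[of j] unfolding iff half by simp
      also have "\<dots> \<longleftrightarrow> - 1 - of_int j < log 2 \<bar>x\<bar> \<and> log 2 \<bar>x\<bar> \<le> - of_int j"
        using powr_le_cancel_iff[of 2 "-1" "of_int j + log 2 \<bar>x\<bar>"] powr_less_cancel_iff[of 2 "of_int j + log 2 \<bar>x\<bar>" 0]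
          powr_less_cancel_iff[of 2 "-1" "of_int j + log 2 \<bar>x\<bar>"] powr_le_cancel_iff[of 2 "of_int j + log 2 \<bar>x\<bar>" 0] by auto
      also have "\<dots> \<longleftrightarrow> j = - \<lceil>log 2 \<bar>x\<bar>\<rceil>" by linarith
      finally show ?thesis .
    qed
    then show ?thesis by auto
  qed
qed

text \<open>A dilation congruence preserves dyadic orbits, so the property that almost every orbit meets the set
  exactly once passes from the Shannon set to \<open>I\<close>.\<close>

lemma dilation_congruent_tiling:
  assumes I: "dilation_congruent I shannon_set"
  shows "AE x in lborel. \<exists>!j::int. 2 powi j * x \<in> I"
proof -
  obtain I' J' \<delta> and k :: "real \<Rightarrow> int" where I': "eq_mod_null I I'" and J': "eq_mod_null shannon_set J'"
    and bij: "bij_betw \<delta> I' J'" and \<delta>: "\<And>l. l \<in> I' \<Longrightarrow> \<delta> l = 2 powi (k l) * l"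
    using I unfolding dilation_congruent_def by blast
  from AE_all_dyadic_dilates[OF eq_mod_null_AE[OF I']] AE_all_dyadic_dilates[OF eq_mod_null_AE[OF J']] AE_neq_0
  show ?thesis
  proof eventually_elim
    case (elim x)
    have dx: "\<delta> (2 powi j * x) = 2 powi (k (2 powi j * x) + j) * x" if "2 powi j * x \<in> I'" for j
      using \<delta>[OF that] by (simp add: power_int_add)
    from shannon_set_tiling[OF elim(3)] elim(2) have "\<exists>!j::int. 2 powi j * x \<in> J'" by simp
    then obtain i :: int where i: "2 powi i * x \<in> J'" and iu: "\<And>j. 2 powi j * x \<in> J' \<Longrightarrow> j = i" by blast
    have "2 powi i * x \<in> \<delta> ` I'" using bij i by (simp add: bij_betw_def)
    then obtain y where y: "y \<in> I'" "\<delta> y = 2 powi i * x" by auto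
    have "2 powi (i - k y) * x = y"
    proof -
      have "2 powi (k y) * y = 2 powi i * x" using \<delta>[OF y(1)] y(2) by simp
      then show ?thesis by (simp add: power_int_diff field_simps)
    qed
    then have ex: "2 powi (i - k y) * x \<in> I'" using y by simp
    have "j = i - k y" if j: "2 powi j * x \<in> I'" for j
    proof -
      have "\<delta> (2 powi j * x) \<in> J'" using bij j by (auto simp: bij_betw_def)
      then have "\<delta> (2 powi j * x) = 2 powi i * x" unfolding dx[OF j] using iu by metis
      then have "\<delta> (2 powi j * x) = \<delta> y" using y by simp
      then have "2 powi j * x = y" by (rule inj_onD[OF bij_betw_imp_inj_on[OF bij] _ j y(1)])
      then have "2 powi j * x = 2 powi (i - k y) * x" using \<open>2 powi (i - k y) * x = y\<close> by simp
      then have "(2::real) powi j = 2 powi (i - k y)" using elim(3) by simp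
      then have "2 powr (real_of_int j) = 2 powr (real_of_int (i - k y))"
        using powr_real_of_int'[of 2 j] powr_real_of_int'[of 2 "i - k y"] by simp
      then have "real_of_int j = real_of_int (i - k y)" using powr_inj[of 2 "real_of_int j" "real_of_int (i - k y)"] by simp
      then show ?thesis by linarith
    qed
    then have "\<exists>!j::int. 2 powi j * x \<in> I'" using ex by blast
    then show ?case using elim(1) by simp
  qed
qed

section \<open>The Gabor part of the frame\<close>

lemma nn_integral_int_measurable:
  assumes "\<And>n::int. f n \<in> borel_measurable M"
  shows "(\<lambda>x. \<Sum>\<^sup>+n. f n x) \<in> borel_measurable M"
proof -
  note [measurable] = assms
  have "(\<lambda>x. \<Sum>\<^sup>+n. f n x) = (\<lambda>x. \<Sum>k. f (int_decode k) x)"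
    by (subst nn_integral_bij_count_space[OF bij_int_decode, symmetric]) (simp add: nn_integral_count_space_nat)
  then show ?thesis by simp
qed

text \<open>After rescaling by \<open>c\<close> the support has length at most 1 and the frequencies are the integers, so the
  integer translates of the support are disjoint.\<close>

lemma parseval_scaled_interval:
  fixes \<phi> :: "real \<Rightarrow> complex"
  assumes \<phi>: "\<phi> \<in> borel_measurable borel" and fin: "nsq lborel \<phi> < \<infinity>"
    and supp: "\<And>t. \<phi> t \<noteq> 0 \<Longrightarrow> b \<le> t \<and> t < b + \<alpha>" and c: "c \<noteq> 0" "\<bar>c\<bar> * \<alpha> \<le> 1"
  shows "ennreal \<bar>c\<bar> * (\<Sum>\<^sup>+n. csq (\<integral>t. \<phi> t * ef (c * of_int n * t) \<partial>lborel)) = nsq lborel \<phi>"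
proof -
  define y where "y s = \<phi> (0 + (1 / c) * s)" for s
  note [measurable] = \<phi>
  have ym [measurable]: "y \<in> borel_measurable borel" unfolding y_def by measurable
  have nsqy: "nsq lborel y = ennreal \<bar>c\<bar> * nsq lborel \<phi>"
  proof -
    have "nsq lborel y = ennreal (1 / \<bar>1 / c\<bar>) * nsq lborel \<phi>"
      unfolding nsq_def y_def by (rule scales_measure_nn_integral[OF scales_measure_real_affine]) (use c in auto)
    then show ?thesis using c by simp
  qed
  have pack: "\<forall>m n::int. y (x + of_int m) \<noteq> 0 \<longrightarrow> y (x + of_int n) \<noteq> 0 \<longrightarrow> m = n" for x
  proof (intro allI impI)
    fix m n :: int assume "y (x + of_int m) \<noteq> 0" "y (x + of_int n) \<noteq> 0"
    then have *: "b \<le> (x + of_int m) / c" "(x + of_int m) / c < b + \<alpha>" "b \<le> (x + of_int n) / c" "(x + of_int n) / c < b + \<alpha>"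
      using supp[of "(x + of_int m) / c"] supp[of "(x + of_int n) / c"] by (auto simp: y_def)
    have "\<bar>(x + of_int m) / c - (x + of_int n) / c\<bar> < \<alpha>" using * by linarith
    also have "(x + of_int m) / c - (x + of_int n) / c = (of_int (m - n)) / c" by (simp add: diff_divide_distrib[symmetric])
    finally have "\<bar>of_int (m - n)\<bar> / \<bar>c\<bar> < \<alpha>" by (simp add: abs_divide)
    then have "\<bar>real_of_int (m - n)\<bar> < \<alpha> * \<bar>c\<bar>" using c by (simp add: divide_less_eq)
    then have "\<bar>real_of_int (m - n)\<bar> < 1" using c(2) by (simp add: mult.commute)
    then show "m = n" by linarith
  qed
  have coeff: "(\<integral>t. \<phi> t * ef (c * of_int n * t) \<partial>lborel) = of_real \<bar>1 / c\<bar> * (\<integral>s. y s * ef (of_int n * s) \<partial>lborel)" for n :: int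
  proof -
    have "(\<integral>t. \<phi> t * ef (c * of_int n * t) \<partial>lborel) = \<bar>1 / c\<bar> *\<^sub>R (\<integral>s. \<phi> (0 + (1 / c) * s) * ef (c * of_int n * (0 + (1 / c) * s)) \<partial>lborel)"
      by (rule lborel_integral_real_affine) (use c in simp)
    also have "(\<integral>s. \<phi> (0 + (1 / c) * s) * ef (c * of_int n * (0 + (1 / c) * s)) \<partial>lborel) = (\<integral>s. y s * ef (of_int n * s) \<partial>lborel)"
      using c by (intro Bochner_Integration.integral_cong) (auto simp: y_def)
    finally show ?thesis by (simp add: scaleR_conv_of_real)
  qed
  have "(\<Sum>\<^sup>+n. csq (\<integral>t. \<phi> t * ef (c * of_int n * t) \<partial>lborel)) =
    (\<Sum>\<^sup>+n. ennreal (\<bar>1 / c\<bar>\<^sup>2) * csq (\<integral>s. y s * ef (of_int n * s) \<partial>lborel))"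
    unfolding coeff by (simp only: norm_mult norm_of_real power_mult_distrib abs_abs) (simp add: ennreal_mult)
  also have "\<dots> = ennreal (\<bar>1 / c\<bar>\<^sup>2) * (\<Sum>\<^sup>+n. csq (\<integral>s. y s * ef (of_int n * s) \<partial>lborel))"
    by (rule nn_integral_cmult) auto
  also have "(\<Sum>\<^sup>+n. csq (\<integral>s. y s * ef (of_int n * s) \<partial>lborel)) = nsq lborel y"
    by (rule parseval_packing(2)[OF ym]) (use fin nsqy pack in \<open>auto simp: ennreal_mult_less_top\<close>)
  finally have "ennreal \<bar>c\<bar> * (\<Sum>\<^sup>+n. csq (\<integral>t. \<phi> t * ef (c * of_int n * t) \<partial>lborel)) =
    (ennreal \<bar>c\<bar> * (ennreal (\<bar>1 / c\<bar>\<^sup>2) * ennreal \<bar>c\<bar>)) * nsq lborel \<phi>"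
    unfolding nsqy by (simp add: mult.assoc)
  also have "ennreal \<bar>c\<bar> * (ennreal (\<bar>1 / c\<bar>\<^sup>2) * ennreal \<bar>c\<bar>) = ennreal (\<bar>c\<bar> * (\<bar>1 / c\<bar>\<^sup>2 * \<bar>c\<bar>))"
    by (subst ennreal_mult, simp, simp, subst ennreal_mult, simp_all)
  also have "\<bar>c\<bar> * (\<bar>1 / c\<bar>\<^sup>2 * \<bar>c\<bar>) = 1" using c by (simp add: power2_eq_square)
  finally show ?thesis by simp
qed

text \<open>The inner product of a function \<open>F\<close> on the dual side with a translated window at scale 1.  The weight of the
  measure is written out, and the coefficient is an iterated integral so that it can be computed one
  variable at a time.\<close>

definition gabor_coeff :: "real \<Rightarrow> real \<Rightarrow> real set \<Rightarrow> (real \<times> real \<Rightarrow> complex) \<Rightarrow> int \<Rightarrow> int \<Rightarrow> int \<Rightarrow> complex" where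
  "gabor_coeff \<alpha> \<beta> I F p n m =
     (\<integral>l. (\<integral>t. of_real (sqrt \<beta> * \<bar>l\<bar> * indicator I l) * (F (l, t) * indicator {\<alpha> * of_int p..<\<alpha> * of_int p + \<alpha>} t) *
        ef (\<beta> * l * of_int n * t) * ef (- (of_int m * l)) \<partial>lborel) \<partial>lborel)"

text \<open>For each \<open>p\<close> and \<open>n\<close> the sum over \<open>m\<close> is the norm of a function \<open>h p n\<close> supported in \<open>I\<close>, by packing.  The sum over
  \<open>n\<close> of \<open>|h p n l|\<^sup>2\<close> is computed at each \<open>l\<close> by the tight frame property on the interval number \<open>p\<close>: the
  square of the factor \<open>\<surd>\<beta> |l|\<close> is \<open>|l|\<close> times the spacing \<open>\<beta>|l|\<close>.  The sum over \<open>p\<close> tiles the line.\<close>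

theorem gabor_coeff_parseval:
  fixes F :: "real \<times> real \<Rightarrow> complex"
  assumes \<alpha>: "\<alpha> > 0" and \<beta>: "\<beta> > 0" and I: "I \<in> sets borel"
    and bd: "\<And>l. l \<in> I \<Longrightarrow> l \<noteq> 0 \<and> \<bar>l\<bar> \<le> 1 / (\<alpha> * \<beta>)"
    and pack: "AE x in lborel. \<forall>m n::int. x + of_int m \<in> I \<longrightarrow> x + of_int n \<in> I \<longrightarrow> m = n"
    and F: "F \<in> borel_measurable (borel \<Otimes>\<^sub>M borel)"
    and fin: "(\<integral>\<^sup>+l. indicator I l * (ennreal \<bar>l\<bar> * nsq lborel (\<lambda>t. F (l, t))) \<partial>lborel) < \<infinity>"
  shows "(\<Sum>\<^sup>+p. (\<Sum>\<^sup>+n. (\<Sum>\<^sup>+m. csq (gabor_coeff \<alpha> \<beta> I F p n m)))) =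
    (\<integral>\<^sup>+l. indicator I l * (ennreal \<bar>l\<bar> * nsq lborel (\<lambda>t. F (l, t))) \<partial>lborel)"
proof -
  note [measurable] = I F
  define Fp where "Fp p l t = F (l, t) * indicator {\<alpha> * of_int p..<\<alpha> * of_int p + \<alpha>} t" for p :: int and l t
  have [measurable]: "(\<lambda>t. Fp p l t) \<in> borel_measurable borel" for p l unfolding Fp_def by measurable
  define G where "G p n l = (\<integral>t. Fp p l t * ef (\<beta> * l * of_int n * t) \<partial>lborel)" for p n :: int and l
  have [measurable]: "G p n \<in> borel_measurable borel" for p n unfolding G_def Fp_def by measurable
  define h where "h p n l = of_real (sqrt \<beta> * \<bar>l\<bar> * indicator I l) * G p n l" for p n :: int and l
  have hm [measurable]: "h p n \<in> borel_measurable borel" for p n unfolding h_def by measurable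
  have coeff: "gabor_coeff \<alpha> \<beta> I F p n m = (\<integral>l. h p n l * ef (of_int (- m) * l) \<partial>lborel)" for p n m
    unfolding gabor_coeff_def h_def G_def Fp_def[symmetric]
    by (intro Bochner_Integration.integral_cong refl) (simp add: mult.assoc flip: Bochner_Integration.integral_mult_left_zero Bochner_Integration.integral_mult_right_zero)
  have slice: "(\<Sum>\<^sup>+p. (\<Sum>\<^sup>+n. csq (h p n l))) = indicator I l * (ennreal \<bar>l\<bar> * nsq lborel (\<lambda>t. F (l, t)))"
    if "l \<in> I \<Longrightarrow> nsq lborel (\<lambda>t. F (l, t)) < \<infinity>" for l
  proof (cases "l \<in> I")
    case False
    then show ?thesis by (simp add: h_def)
  next
    case True
    have l: "l \<noteq> 0" "\<bar>l\<bar> \<le> 1 / (\<alpha> * \<beta>)" using bd[OF True] by auto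
    have c: "\<beta> * l \<noteq> 0" "\<bar>\<beta> * l\<bar> * \<alpha> \<le> 1" using l \<alpha> \<beta> by (auto simp: abs_mult field_simps)
    have sq: "csq (h p n l) = ennreal \<bar>l\<bar> * (ennreal \<bar>\<beta> * l\<bar> * csq (G p n l))" for p n
    proof -
      have "(cmod (h p n l))\<^sup>2 = \<bar>l\<bar> * (\<bar>\<beta> * l\<bar> * (cmod (G p n l))\<^sup>2)"
        using True \<beta> by (simp add: h_def norm_mult power_mult_distrib abs_mult power2_eq_square[of l])
      then show ?thesis by (simp add: ennreal_mult)
    qed
    have Gn: "(\<Sum>\<^sup>+n. ennreal \<bar>\<beta> * l\<bar> * csq (G p n l)) = nsq lborel (Fp p l)" for p
    proof -
      have "nsq lborel (Fp p l) \<le> nsq lborel (\<lambda>t. F (l, t))"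
        unfolding nsq_def Fp_def by (intro nn_integral_mono) (auto simp: indicator_def)
      then have "nsq lborel (Fp p l) < \<infinity>" using that[OF True] le_less_trans by blast
      moreover have "\<alpha> * of_int p \<le> t \<and> t < \<alpha> * of_int p + \<alpha>" if "Fp p l t \<noteq> 0" for t
        using that by (auto simp: Fp_def indicator_def split: if_splits)
      ultimately have "ennreal \<bar>\<beta> * l\<bar> * (\<Sum>\<^sup>+n. csq (\<integral>t. Fp p l t * ef (\<beta> * l * of_int n * t) \<partial>lborel)) = nsq lborel (Fp p l)"
        by (intro parseval_scaled_interval[OF _ _ _ c]) auto
      then show ?thesis unfolding G_def by (subst nn_integral_cmult) auto
    qed
    have "(\<Sum>\<^sup>+p. (\<Sum>\<^sup>+n. csq (h p n l))) = (\<Sum>\<^sup>+p. ennreal \<bar>l\<bar> * nsq lborel (Fp p l))"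
      unfolding sq by (subst nn_integral_cmult) (auto simp: Gn)
    also have "\<dots> = ennreal \<bar>l\<bar> * (\<Sum>\<^sup>+p. nsq lborel (Fp p l))"
      by (rule nn_integral_cmult) auto
    also have "(\<Sum>\<^sup>+p. nsq lborel (Fp p l)) = nsq lborel (\<lambda>t. F (l, t))"
      unfolding Fp_def by (rule interval_tiling_nsq[OF _ \<alpha>]) measurable
    finally show ?thesis using True by simp
  qed
  have m: "(\<lambda>l. indicator I l * (ennreal \<bar>l\<bar> * nsq lborel (\<lambda>t. F (l, t)))) \<in> borel_measurable lborel"
    unfolding nsq_def by measurable
  have "AE l in lborel. indicator I l * (ennreal \<bar>l\<bar> * nsq lborel (\<lambda>t. F (l, t))) \<noteq> \<infinity>"
    by (rule nn_integral_PInf_AE[OF m]) (use fin in auto)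
  then have AEs: "AE l in lborel. (\<Sum>\<^sup>+p. (\<Sum>\<^sup>+n. csq (h p n l))) = indicator I l * (ennreal \<bar>l\<bar> * nsq lborel (\<lambda>t. F (l, t)))"
  proof eventually_elim
    case (elim l)
    show ?case
    proof (rule slice)
      assume "l \<in> I"
      then show "nsq lborel (\<lambda>t. F (l, t)) < \<infinity>" using elim bd[of l] by (auto simp: ennreal_mult_eq_top_iff less_top)
    qed
  qed
  have total: "(\<Sum>\<^sup>+p. (\<Sum>\<^sup>+n. nsq lborel (h p n))) =
    (\<integral>\<^sup>+l. indicator I l * (ennreal \<bar>l\<bar> * nsq lborel (\<lambda>t. F (l, t))) \<partial>lborel)"
  proof -
    have "(\<Sum>\<^sup>+p. (\<Sum>\<^sup>+n. nsq lborel (h p n))) =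
      (\<Sum>\<^sup>+p. (\<integral>\<^sup>+l. (\<Sum>\<^sup>+n. csq (h p n l)) \<partial>lborel))"
      unfolding nsq_def by (intro nn_integral_cong nn_integral_count_space_nn_integral[symmetric]) auto
    also have "\<dots> = (\<integral>\<^sup>+l. (\<Sum>\<^sup>+p. (\<Sum>\<^sup>+n. csq (h p n l))) \<partial>lborel)"
      by (rule nn_integral_count_space_nn_integral[symmetric]) (auto intro!: nn_integral_int_measurable)
    also have "\<dots> = (\<integral>\<^sup>+l. indicator I l * (ennreal \<bar>l\<bar> * nsq lborel (\<lambda>t. F (l, t))) \<partial>lborel)"
      by (rule nn_integral_cong_AE[OF AEs])
    finally show ?thesis .
  qed
  \<comment> \<open>Packing asks for finite norms; each norm is one term of a double sum whose value is finite.\<close>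
  have fin_h: "nsq lborel (h p n) < \<infinity>" for p n
  proof -
    have "nsq lborel (h p n) \<le> (\<Sum>\<^sup>+n. nsq lborel (h p n))"
      using nn_integral_ge_point[of n UNIV "\<lambda>n. nsq lborel (h p n)"] by simp
    also have "\<dots> \<le> (\<Sum>\<^sup>+p. (\<Sum>\<^sup>+n. nsq lborel (h p n)))"
      using nn_integral_ge_point[of p UNIV "\<lambda>p. \<Sum>\<^sup>+n. nsq lborel (h p n)"] by simp
    also have "\<dots> < \<infinity>" unfolding total by (rule fin)
    finally show ?thesis .
  qed
  have "(\<Sum>\<^sup>+m. csq (gabor_coeff \<alpha> \<beta> I F p n m)) = nsq lborel (h p n)" for p n
  proof -
    have "AE x in lborel. \<forall>i j::int. h p n (x + of_int i) \<noteq> 0 \<longrightarrow> h p n (x + of_int j) \<noteq> 0 \<longrightarrow> i = j"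
      using pack by eventually_elim (auto simp: h_def indicator_def split: if_splits)
    from parseval_packing(2)[OF hm fin_h this]
    show ?thesis unfolding coeff
      using nn_sum_int_uminus[of "\<lambda>m. csq (\<integral>l. h p n l * ef (of_int m * l) \<partial>lborel)"] by simp
  qed
  then show ?thesis using total by simp
qed

section \<open>The wavelet frame on the dual side\<close>

lemma lebesgue_set_borel_representative:
  assumes "I \<in> sets lebesgue"
  obtains B where "B \<in> sets borel" "AE x in lborel. x \<in> I \<longleftrightarrow> x \<in> (B :: 'a::euclidean_space set)"
proof -
  have "(\<lambda>x. indicator I x :: complex) \<in> borel_measurable lebesgue" using assms by simp
  then obtain b where b [measurable]: "b \<in> borel_measurable borel" and eq: "AE x in lborel. (indicator I x :: complex) = b x"
    using borel_representative by blast
  have "{x \<in> space borel. b x = 1} \<in> sets borel" by measurable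
  moreover have "AE x in lborel. x \<in> I \<longleftrightarrow> x \<in> {x \<in> space borel. b x = 1}"
    using eq by eventually_elim (auto simp: indicator_def split: if_splits)
  ultimately show ?thesis by (rule that)
qed

lemma nsq_measure_LamR_weighted:
  assumes f: "f \<in> borel_measurable lebesgue"
  shows "nsq measure_LamR f = nsq lebesgue (\<lambda>z. of_real (sqrt \<bar>fst z\<bar>) * f z)"
proof -
  have fr: "(\<lambda>z. csq (f z)) \<in> borel_measurable (lebesgue_on (Lam \<times> UNIV))"
    using f by (intro measurable_restrict_space1) measurable
  have "nsq measure_LamR f = (\<integral>\<^sup>+z. ennreal \<bar>fst z\<bar> * csq (f z) \<partial>lebesgue_on (Lam \<times> UNIV))"
    unfolding measure_LamR_eq nsq_def by (rule nn_integral_density[OF abs_fst_measurable_on fr])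
  also have "\<dots> = (\<integral>\<^sup>+z. ennreal \<bar>fst z\<bar> * csq (f z) * indicator (Lam \<times> UNIV) z \<partial>lebesgue)"
    by (rule nn_integral_restrict_space) (use Lam_UNIV_sets in auto)
  also have "\<dots> = nsq lebesgue (\<lambda>z. of_real (sqrt \<bar>fst z\<bar>) * f z)"
    unfolding nsq_def
    by (intro nn_integral_cong) (auto simp: Lam_def indicator_def norm_mult power_mult_distrib ennreal_mult)
  finally show ?thesis .
qed

lemma sqrt_fst_measurable: "(\<lambda>z::real \<times> real. complex_of_real (sqrt \<bar>fst z\<bar>)) \<in> borel_measurable lebesgue"
proof -
  have "(\<lambda>z::real \<times> real. complex_of_real (sqrt \<bar>fst z\<bar>)) \<in> borel_measurable borel"
    by (intro borel_measurable_continuous_onI continuous_intros)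
  then show ?thesis by (simp add: measurable_completion)
qed

lemma nsq_transl_hat:
  assumes f: "f \<in> borel_measurable lebesgue"
  shows "nsq measure_LamR (transl_hat x f) = nsq measure_LamR f"
proof -
  obtain k l m where x: "x = (k, l, m)" by (cases x)
  define T where "T z = (1 * fst z, - k + 1 * snd z)" for z :: "real \<times> real"
  have T: "scales_measure T 1" using scales_measure_plane[of 1 1 "- k"] by (simp add: T_def[abs_def])
  define F where "F z = of_real (sqrt \<bar>fst z\<bar>) * f z" for z
  have Fm: "F \<in> borel_measurable lebesgue" unfolding F_def by (intro borel_measurable_times sqrt_fst_measurable f)
  have "nsq measure_LamR (transl_hat x f) = nsq lebesgue (\<lambda>z. F (T z))"
    unfolding nsq_measure_LamR_weighted[OF transl_hat_measurable[OF f]] unfolding nsq_def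
    by (simp add: x transl_hat_eq F_def T_def norm_mult)
  also have "\<dots> = nsq lebesgue F" using scales_measure_nsq[OF T Fm] by simp
  finally show ?thesis unfolding F_def nsq_measure_LamR_weighted[OF f] .
qed

lemma nsq_dilat_hat:
  assumes a: "a > 0" and f: "f \<in> borel_measurable lebesgue" and chi: "chi a \<in> borel_measurable (lebesgue_on Lam)"
    and unimod: "\<And>l. l \<noteq> 0 \<Longrightarrow> cmod (chi a l) = 1"
  shows "nsq measure_LamR (dilat_hat chi a f) = nsq measure_LamR f"
proof -
  define w where "w = a powr (-1/2)"
  have w: "w > 0" using a by (simp add: w_def)
  define T where "T z = (a * fst z, 0 + w * snd z)" for z :: "real \<times> real"
  have T: "scales_measure T (1 / a * (1 / w))" unfolding T_def[abs_def] by (rule scales_measure_plane[OF a w])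
  define F where "F z = of_real (sqrt \<bar>fst z\<bar>) * f z" for z
  have Fm: "F \<in> borel_measurable lebesgue" unfolding F_def by (intro borel_measurable_times sqrt_fst_measurable f)
  have FTm: "(\<lambda>z. F (T z)) \<in> borel_measurable lebesgue" by (rule scales_measure_borel_measurable[OF T Fm])
  define c where "c = a powr (3/4) / sqrt a"
  have c: "c \<ge> 0" "c\<^sup>2 * (1 / a * (1 / w)) = 1"
  proof -
    show "c \<ge> 0" using a by (simp add: c_def)
    have "c\<^sup>2 = a powr (3/2) / a" using a by (simp add: c_def power_divide power2_eq_square powr_add[symmetric])
    moreover have "1 / w = a powr (1/2)" using a by (simp add: w_def powr_minus_divide)
    ultimately have "c\<^sup>2 * (1 / a * (1 / w)) = (a powr (3/2) * a powr (1/2)) / (a * a)" by simp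
    also have "a powr (3/2) * a powr (1/2) = a * a" using a by (simp add: powr_add[symmetric] power2_eq_square)
    also have "(a * a) / (a * a) = 1" using a by simp
    finally show "c\<^sup>2 * (1 / a * (1 / w)) = 1" .
  qed
  have "nsq measure_LamR (dilat_hat chi a f) = nsq lebesgue (\<lambda>z. of_real c * F (T z))"
    unfolding nsq_measure_LamR_weighted[OF dilat_hat_measurable[OF a f, of chi, OF chi]] unfolding nsq_def
  proof (rule nn_integral_cong)
    fix z :: "real \<times> real"
    have "cmod (of_real (sqrt \<bar>fst z\<bar>) * dilat_hat chi a f z) = cmod (of_real c * F (T z))"
    proof (cases "fst z = 0")
      case True
      then show ?thesis by (simp add: F_def T_def)
    next
      case False
      have "c * sqrt \<bar>a * fst z\<bar> = sqrt \<bar>fst z\<bar> * a powr (3/4)"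
        using a by (simp add: c_def abs_mult real_sqrt_mult)
      then have "c * (sqrt \<bar>a * fst z\<bar> * cmod (f (T z))) = sqrt \<bar>fst z\<bar> * (a powr (3/4) * cmod (f (T z)))"
        by (simp only: mult.assoc[symmetric])
      moreover have "dilat_hat chi a f z = chi a (fst z) * of_real (a powr (3/4)) * f (T z)"
        by (simp only: dilat_hat_eq T_def w_def)
      moreover have "fst (T z) = a * fst z" by (simp add: T_def)
      ultimately show ?thesis using False unimod[OF False] c(1) a
        unfolding F_def by (auto simp: norm_mult)
    qed
    then show "csq (of_real (sqrt \<bar>fst z\<bar>) * dilat_hat chi a f z) = csq (of_real c * F (T z))" by simp
  qed
  also have "\<dots> = ennreal (c\<^sup>2) * (ennreal (1 / a * (1 / w)) * nsq lebesgue F)"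
    using c(1) by (subst nsq_scale[OF FTm]) (simp only: scales_measure_nsq[OF T Fm] norm_of_real power2_abs)
  also have "\<dots> = ennreal (c\<^sup>2 * (1 / a * (1 / w))) * nsq lebesgue F"
    using a w by (subst (2) ennreal_mult) (auto simp: mult.assoc)
  finally show ?thesis unfolding c(2) F_def nsq_measure_LamR_weighted[OF f] by simp
qed

lemma L2_inner_measure_LamR_iterated:
  fixes f h f' h' :: "real \<times> real \<Rightarrow> complex"
  assumes f: "f \<in> L2 measure_LamR" and h: "h \<in> L2 measure_LamR"
    and f': "f' \<in> borel_measurable (borel \<Otimes>\<^sub>M borel)" "AE z in lborel. f z = f' z"
    and h': "h' \<in> borel_measurable (borel \<Otimes>\<^sub>M borel)" "AE z in lborel. h z = h' z"
  shows "L2_inner measure_LamR f h = (\<integral>l. (\<integral>t. of_real \<bar>l\<bar> * (f' (l, t) * cnj (h' (l, t))) \<partial>lborel) \<partial>lborel)"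
proof -
  define G where "G z = f' z * cnj (h' z)" for z
  have fb: "f' \<in> borel_measurable lebesgue" "h' \<in> borel_measurable lebesgue"
    using f'(1) h'(1) by (simp_all add: borel_prod measurable_completion)
  have Gm [measurable]: "G \<in> borel_measurable (borel \<Otimes>\<^sub>M borel)" using f'(1) h'(1) unfolding G_def by measurable
  have Gl: "G \<in> borel_measurable lebesgue" using Gm by (simp add: borel_prod measurable_completion)
  have Gr: "G \<in> borel_measurable (lebesgue_on (Lam \<times> UNIV))" using Gl by (rule measurable_restrict_space1)
  have wr: "(\<lambda>z::real \<times> real. \<bar>fst z\<bar>) \<in> borel_measurable (lebesgue_on (Lam \<times> UNIV))"
    by (intro measurable_restrict_space1 measurable_completion) (simp add: borel_measurable_continuous_onI continuous_intros)
  have L: "Lam \<times> UNIV \<inter> space lebesgue \<in> sets (lebesgue :: (real \<times> real) measure)" using Lam_UNIV_sets by simp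
  have aeq: "AE z in measure_LamR. f z * cnj (h z) = G z"
    unfolding AE_measure_LamR using f'(2) h'(2) by eventually_elim (simp add: G_def)
  have G_LamR: "G \<in> borel_measurable measure_LamR" by (rule measure_LamR_borel[OF Gl])
  have fh: "(\<lambda>z. f z * cnj (h z)) \<in> borel_measurable measure_LamR"
    using L2_inner_integrable[OF f h] by auto
  have intG: "integrable measure_LamR G"
    using L2_inner_integrable[OF f h] integrable_cong_AE[OF fh G_LamR aeq] by blast
  have "L2_inner measure_LamR f h = (\<integral>z. G z \<partial>measure_LamR)"
    unfolding L2_inner_def by (rule integral_cong_AE[OF fh G_LamR aeq])
  also have "\<dots> = (\<integral>z. \<bar>fst z\<bar> *\<^sub>R G z \<partial>lebesgue_on (Lam \<times> UNIV))"
    unfolding measure_LamR_eq by (rule integral_density[OF Gr wr]) auto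
  also have "\<dots> = (\<integral>z. indicator (Lam \<times> UNIV) z *\<^sub>R (\<bar>fst z\<bar> *\<^sub>R G z) \<partial>lebesgue)"
    by (rule integral_restrict_space[OF L])
  also have "\<dots> = (\<integral>z. of_real \<bar>fst z\<bar> * G z \<partial>lebesgue)"
    by (intro Bochner_Integration.integral_cong refl) (auto simp: Lam_def indicator_def scaleR_conv_of_real)
  also have "\<dots> = (\<integral>z. of_real \<bar>fst z\<bar> * G z \<partial>lborel)"
  proof (rule integral_completion)
    have "(\<lambda>z. of_real \<bar>fst z\<bar> * G z) \<in> borel_measurable (borel \<Otimes>\<^sub>M borel)" by measurable
    then show "(\<lambda>z. of_real \<bar>fst z\<bar> * G z) \<in> borel_measurable lborel" by (simp add: borel_prod)
  qed
  also have "\<dots> = (\<integral>l. (\<integral>t. of_real \<bar>l\<bar> * G (l, t) \<partial>lborel) \<partial>lborel)"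
  proof -
    have "integrable (lebesgue_on (Lam \<times> UNIV)) (\<lambda>z. \<bar>fst z\<bar> *\<^sub>R G z)"
      using intG unfolding measure_LamR_eq by (subst (asm) integrable_density[OF Gr wr]) auto
    then have "integrable lebesgue (\<lambda>z. indicator (Lam \<times> UNIV) z *\<^sub>R (\<bar>fst z\<bar> *\<^sub>R G z))"
      by (subst (asm) integrable_restrict_space[OF L])
    also have "(\<lambda>z. indicator (Lam \<times> UNIV) z *\<^sub>R (\<bar>fst z\<bar> *\<^sub>R G z)) = (\<lambda>z. of_real \<bar>fst z\<bar> * G z)"
      by (auto simp: fun_eq_iff Lam_def indicator_def scaleR_conv_of_real)
    finally have "integrable lebesgue (\<lambda>z. of_real \<bar>fst z\<bar> * G z)" .
    moreover have "(\<lambda>z. of_real \<bar>fst z\<bar> * G z) \<in> borel_measurable (borel \<Otimes>\<^sub>M borel)" by measurable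
    ultimately have "integrable (lborel \<Otimes>\<^sub>M lborel) (\<lambda>z. of_real \<bar>fst z\<bar> * G z)"
      by (simp add: borel_prod lborel_prod integrable_completion)
    from lborel_pair.integral_fst'[OF this] show ?thesis by (simp add: lborel_prod)
  qed
  finally show ?thesis by (simp add: G_def)
qed

text \<open>The inverse of the dilation at scale \<open>a\<close>, applied to \<open>f\<close>, so that the wavelet coefficients at scale \<open>a\<close>
  become coefficients at scale 1.  A Borel representative \<open>\<xi>\<close> takes the place of the multiplier.\<close>

definition dilated_slice :: "(real \<Rightarrow> complex) \<Rightarrow> real \<Rightarrow> (real \<times> real \<Rightarrow> complex) \<Rightarrow> real \<times> real \<Rightarrow> complex" where
  "dilated_slice \<xi> a f = (\<lambda>(l, t). of_real (a powr (-3/4)) * f (l / a, a powr (1/2) * t) * cnj (\<xi> (l / a)))"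

lemma dilated_slice_measurable:
  assumes [measurable]: "\<xi> \<in> borel_measurable borel" "f \<in> borel_measurable (borel \<Otimes>\<^sub>M borel)"
  shows "dilated_slice \<xi> a f \<in> borel_measurable (borel \<Otimes>\<^sub>M borel)"
  unfolding dilated_slice_def by measurable

text \<open>The substitution \<open>(l, t) \<mapsto> (l/a, a\<^sup>1\<^sup>/\<^sup>2 t)\<close> in the inner product, whose Jacobian \<open>a\<^sup>-\<^sup>1\<^sup>/\<^sup>2\<close> together with
  \<open>1/a\<close> from the weight and \<open>a\<^sup>3\<^sup>/\<^sup>4\<close> from the dilation gives the exponent \<open>-3/4\<close>.\<close>

lemma wavelet_coefficient:
  fixes \<alpha> \<beta> a :: real and f f' :: "real \<times> real \<Rightarrow> complex"
  assumes a: "a > 0" and \<beta>: "\<beta> > 0" and I: "I \<in> sets borel"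
    and f: "f \<in> L2 measure_LamR" and h: "dilat_hat chi a (transl_hat (\<alpha> * of_int p, \<beta> * of_int n, of_int m) g) \<in> L2 measure_LamR"
    and f': "f' \<in> borel_measurable (borel \<Otimes>\<^sub>M borel)" "AE z in lborel. f z = f' z"
    and \<xi>: "\<xi> \<in> borel_measurable borel" "AE l in lborel. chi a l = \<xi> l"
    and g: "AE z in lborel. g z = of_real (sqrt \<beta>) * indicator I (fst z) * indicator {0..<\<alpha>} (snd z)"
  shows "L2_inner measure_LamR f (dilat_hat chi a (transl_hat (\<alpha> * of_int p, \<beta> * of_int n, of_int m) g)) =
    gabor_coeff \<alpha> \<beta> I (dilated_slice \<xi> a f') p n m"
proof -
  note [measurable] = \<xi>(1) f'(1) I
  define w where "w = a powr (-1/2)"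
  define s where "s = a powr (1/2)"
  have ws: "w > 0" "s > 0" "w * s = 1" using a by (simp_all add: w_def s_def powr_add[symmetric])
  let ?x = "(\<alpha> * of_int p, \<beta> * of_int n, of_int m) :: heis"
  define h' where "h' = (\<lambda>z. \<xi> (fst z) * of_real (a powr (3/4)) *
     (ef (a * fst z * of_int m) * ef (- (a * fst z * (w * snd z)) * (\<beta> * of_int n)) *
      (of_real (sqrt \<beta>) * indicator I (a * fst z) * indicator {0..<\<alpha>} (w * snd z - \<alpha> * of_int p))))"
  have h'm: "h' \<in> borel_measurable (borel \<Otimes>\<^sub>M borel)" unfolding h'_def by measurable
  have hh': "AE z in lborel. dilat_hat chi a (transl_hat ?x g) z = h' z"
  proof -
    let ?g = "\<lambda>z. of_real (sqrt \<beta>) * indicator I (fst z) * indicator {0..<\<alpha>} (snd z) :: complex"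
    have "AE z in lborel. dilat_hat chi a (transl_hat ?x g) z = dilat_hat chi a (transl_hat ?x ?g) z"
      by (rule dilat_hat_cong_AE[OF a transl_hat_cong_AE[OF g]])
    moreover have "AE z in (lborel :: (real \<times> real) measure). chi a (fst z) = \<xi> (fst z)" by (rule AE_lborel_fst[OF \<xi>(2)])
    ultimately show ?thesis
    proof eventually_elim
      case (elim z)
      have "dilat_hat chi a (transl_hat ?x ?g) z = chi a (fst z) * of_real (a powr (3/4)) * transl_hat ?x ?g (a * fst z, 0 + w * snd z)"
        by (simp only: dilat_hat_eq w_def)
      also have "\<dots> = h' z" unfolding elim(2) h'_def transl_hat_eq by (simp add: mult_ac)
      finally show ?case using elim(1) by simp
    qed
  qed
  define X where "X l t = of_real \<bar>l\<bar> * (f' (l, t) * cnj (h' (l, t)))" for l t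
  have "L2_inner measure_LamR f (dilat_hat chi a (transl_hat ?x g)) = (\<integral>l. (\<integral>t. X l t \<partial>lborel) \<partial>lborel)"
    unfolding X_def by (rule L2_inner_measure_LamR_iterated[OF f h f' h'm hh'])
  also have "\<dots> = \<bar>1 / a\<bar> *\<^sub>R (\<integral>l. (\<integral>t. X (0 + (1 / a) * l) t \<partial>lborel) \<partial>lborel)"
    by (rule lborel_integral_real_affine) (use a in simp)
  also have "(\<lambda>l. \<integral>t. X (0 + (1 / a) * l) t \<partial>lborel) = (\<lambda>l. \<bar>s\<bar> *\<^sub>R (\<integral>t. X (0 + (1 / a) * l) (0 + s * t) \<partial>lborel))"
    by (rule ext, rule lborel_integral_real_affine) (use ws in simp)
  also have "\<bar>1 / a\<bar> *\<^sub>R (\<integral>l. \<bar>s\<bar> *\<^sub>R (\<integral>t. X (0 + (1 / a) * l) (0 + s * t) \<partial>lborel) \<partial>lborel) =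
     (\<integral>l. (\<integral>t. of_real (s / a) * X (l / a) (s * t) \<partial>lborel) \<partial>lborel)"
    using a ws by (simp add: scaleR_conv_of_real)
  also have "\<dots> = gabor_coeff \<alpha> \<beta> I (dilated_slice \<xi> a f') p n m"
    unfolding gabor_coeff_def
  proof (intro Bochner_Integration.integral_cong refl)
    fix l t :: real
    have e1: "a * (l / a) = l" using a by simp
    have e2: "w * (s * t) = t" using ws(3) by (simp add: mult.assoc[symmetric])
    have ind: "indicator {0..<\<alpha>} (t - \<alpha> * of_int p) = (indicator {\<alpha> * of_int p..<\<alpha> * of_int p + \<alpha>} t :: complex)"
      by (auto simp: indicator_def)
    have h'e: "cnj (h' (l / a, s * t)) = cnj (\<xi> (l / a)) * of_real (a powr (3/4)) * (ef (- (l * of_int m)) * ef (l * t * (\<beta> * of_int n)) *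
        (of_real (sqrt \<beta>) * indicator I l * indicator {\<alpha> * of_int p..<\<alpha> * of_int p + \<alpha>} t))"
      unfolding h'_def fst_conv snd_conv e1 e2 ind by (simp add: cnj_ef cnj_indicator)
    have const: "s / a * (1 / a) * a powr (3/4) = a powr (-3/4)"
    proof -
      have "s / a * (1 / a) * a powr (3/4) = (a powr (1/2) * a powr (3/4)) / (a powr 1 * a powr 1)" using a by (simp add: s_def)
      also have "\<dots> = a powr (1/2 + 3/4 - (1 + 1))" unfolding powr_add[symmetric] powr_diff[symmetric] ..
      finally show ?thesis by simp
    qed
    have "of_real (s / a) * X (l / a) (s * t) = of_real (s / a * (1 / a) * a powr (3/4)) * of_real \<bar>l\<bar> * f' (l / a, s * t) * cnj (\<xi> (l / a)) *
        (ef (- (l * of_int m)) * ef (l * t * (\<beta> * of_int n)) * (of_real (sqrt \<beta>) * indicator I l * indicator {\<alpha> * of_int p..<\<alpha> * of_int p + \<alpha>} t))"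
      unfolding X_def h'e using a by (simp add: abs_divide field_simps)
    also have "\<dots> = of_real (sqrt \<beta> * \<bar>l\<bar> * indicator I l) * (dilated_slice \<xi> a f' (l, t) * indicator {\<alpha> * of_int p..<\<alpha> * of_int p + \<alpha>} t) *
        ef (\<beta> * l * of_int n * t) * ef (- (of_int m * l))"
      unfolding const dilated_slice_def s_def[symmetric] by (simp add: indicator_def mult_ac)
    finally show "of_real (s / a) * X (l / a) (s * t) = of_real (sqrt \<beta> * \<bar>l\<bar> * indicator I l) * (dilated_slice \<xi> a f' (l, t) * indicator {\<alpha> * of_int p..<\<alpha> * of_int p + \<alpha>} t) *
        ef (\<beta> * l * of_int n * t) * ef (- (of_int m * l))" .
  qed
  finally show ?thesis .
qed

lemma ennreal_mult4:
  "a \<ge> 0 \<Longrightarrow> x \<ge> 0 \<Longrightarrow> y \<ge> 0 \<Longrightarrow> z \<ge> 0 \<Longrightarrow>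
    ennreal a * (ennreal x * (ennreal y * ennreal z)) = ennreal (a * (x * (y * z)))"
  by (simp add: ennreal_mult)

text \<open>Undoing the dilation moves the restriction from \<open>I\<close> to \<open>I/a\<close> and otherwise preserves the norm.\<close>

lemma dilated_slice_norm:
  assumes a: "a > 0" and I: "I \<in> sets borel" and \<xi>: "\<xi> \<in> borel_measurable borel" "AE l in lborel. cmod (\<xi> l) = 1"
    and f: "f \<in> borel_measurable (borel \<Otimes>\<^sub>M borel)"
  shows "(\<integral>\<^sup>+l. indicator I l * (ennreal \<bar>l\<bar> * nsq lborel (\<lambda>t. dilated_slice \<xi> a f (l, t))) \<partial>lborel) =
    (\<integral>\<^sup>+l. indicator I (a * l) * (ennreal \<bar>l\<bar> * nsq lborel (\<lambda>t. f (l, t))) \<partial>lborel)"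
proof -
  note [measurable] = I \<xi>(1) f
  note dm [measurable] = dilated_slice_measurable[OF \<xi>(1) f, of a]
  define s where "s = a powr (1/2)"
  have s: "s > 0" using a by (simp add: s_def)
  have "(\<integral>\<^sup>+l. indicator I l * (ennreal \<bar>l\<bar> * nsq lborel (\<lambda>t. dilated_slice \<xi> a f (l, t))) \<partial>lborel) =
    ennreal \<bar>a\<bar> * (\<integral>\<^sup>+l. indicator I (0 + a * l) * (ennreal \<bar>0 + a * l\<bar> * nsq lborel (\<lambda>t. dilated_slice \<xi> a f (0 + a * l, t))) \<partial>lborel)"
    by (rule nn_integral_real_affine) (use a in \<open>auto simp: nsq_def\<close>)
  also have "\<dots> = (\<integral>\<^sup>+l. ennreal \<bar>a\<bar> * (indicator I (0 + a * l) * (ennreal \<bar>0 + a * l\<bar> * nsq lborel (\<lambda>t. dilated_slice \<xi> a f (0 + a * l, t)))) \<partial>lborel)"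
    by (rule nn_integral_cmult[symmetric]) (auto simp: nsq_def)
  also have "\<dots> = (\<integral>\<^sup>+l. indicator I (a * l) * (ennreal \<bar>l\<bar> * nsq lborel (\<lambda>t. f (l, t))) \<partial>lborel)"
  proof (rule nn_integral_cong_AE)
    show "AE l in lborel. ennreal \<bar>a\<bar> * (indicator I (0 + a * l) * (ennreal \<bar>0 + a * l\<bar> * nsq lborel (\<lambda>t. dilated_slice \<xi> a f (0 + a * l, t)))) =
       indicator I (a * l) * (ennreal \<bar>l\<bar> * nsq lborel (\<lambda>t. f (l, t)))"
      using \<xi>(2)
    proof eventually_elim
      case (elim l)
      have "nsq lborel (\<lambda>t. dilated_slice \<xi> a f (0 + a * l, t)) = nsq lborel (\<lambda>t. of_real (a powr (-3/4)) * f (l, 0 + s * t))"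
        using a elim by (simp add: nsq_def dilated_slice_def norm_mult s_def)
      also have "\<dots> = csq (of_real (a powr (-3/4))) * nsq lborel (\<lambda>t. f (l, 0 + s * t))"
        by (rule nsq_scale) measurable
      also have "nsq lborel (\<lambda>t. f (l, 0 + s * t)) = ennreal (1 / \<bar>s\<bar>) * nsq lborel (\<lambda>t. f (l, t))"
        unfolding nsq_def by (rule scales_measure_nn_integral[OF scales_measure_real_affine]) (use s in auto)
      finally have N: "nsq lborel (\<lambda>t. dilated_slice \<xi> a f (0 + a * l, t)) = csq (of_real (a powr (-3/4))) * (ennreal (1 / \<bar>s\<bar>) * nsq lborel (\<lambda>t. f (l, t)))" .
      have r: "a * (a * (a powr (-3/4))\<^sup>2 * (1 / s)) = 1"
      proof -
        have "1 / s = a powr (-1/2)" using a by (simp add: s_def powr_minus_divide)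
        moreover have "(a powr (-3/4))\<^sup>2 = a powr (-3/2)" by (simp add: power2_eq_square powr_add[symmetric])
        ultimately have "a * (a * (a powr (-3/4))\<^sup>2 * (1 / s)) = a * (a * (a powr (-3/2) * a powr (-1/2)))" by (simp only: mult.assoc)
        also have "a powr (-3/2) * a powr (-1/2) = a powr (-2)" by (simp add: powr_add[symmetric])
        also have "a * (a * a powr (-2)) = 1" using a by (simp add: powr_minus_divide power2_eq_square)
        finally show ?thesis .
      qed
      have "ennreal \<bar>a\<bar> * (ennreal \<bar>0 + a * l\<bar> * (csq (of_real (a powr (-3/4))) * ennreal (1 / \<bar>s\<bar>))) = ennreal (a * (\<bar>a * l\<bar> * ((a powr (-3/4))\<^sup>2 * (1 / s))))"
        using a s by (subst ennreal_mult4) auto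
      also have "a * (\<bar>a * l\<bar> * ((a powr (-3/4))\<^sup>2 * (1 / s))) = \<bar>l\<bar> * (a * (a * (a powr (-3/4))\<^sup>2 * (1 / s)))"
        using a by (simp add: abs_mult)
      finally have "ennreal \<bar>a\<bar> * (ennreal \<bar>0 + a * l\<bar> * (csq (of_real (a powr (-3/4))) * ennreal (1 / \<bar>s\<bar>))) = ennreal \<bar>l\<bar>"
        unfolding r by simp
      then have "indicator I (0 + a * l) * (ennreal \<bar>a\<bar> * (ennreal \<bar>0 + a * l\<bar> * (csq (of_real (a powr (-3/4))) * ennreal (1 / \<bar>s\<bar>))) * nsq lborel (\<lambda>t. f (l, t))) =
        indicator I (a * l) * (ennreal \<bar>l\<bar> * nsq lborel (\<lambda>t. f (l, t)))" by simp
      then show ?case unfolding N by (simp only: mult_ac)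
    qed
  qed
  finally show ?thesis .
qed

lemma dyadic_tiling_sum:
  assumes I: "I \<in> sets borel" and tile: "AE x in lborel. \<exists>!j::int. 2 powi j * x \<in> I"
    and w: "w \<in> borel_measurable borel"
  shows "(\<Sum>\<^sup>+j. (\<integral>\<^sup>+l. indicator I (2 powi j * l) * w l \<partial>lborel)) = (\<integral>\<^sup>+l. w l \<partial>(lborel :: real measure))"
proof -
  note [measurable] = I w
  have "(\<Sum>\<^sup>+j. (\<integral>\<^sup>+l. indicator I (2 powi j * l) * w l \<partial>lborel)) =
    (\<integral>\<^sup>+l. (\<Sum>\<^sup>+j. indicator I (2 powi j * l) * w l) \<partial>lborel)"
    by (rule nn_integral_count_space_nn_integral[symmetric]) auto
  also have "\<dots> = (\<integral>\<^sup>+l. w l \<partial>lborel)"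
  proof (rule nn_integral_cong_AE)
    show "AE l in lborel. (\<Sum>\<^sup>+j. indicator I (2 powi j * l) * w l) = w l"
      using tile
    proof eventually_elim
      case (elim l)
      then obtain i :: int where i: "\<And>j. 2 powi j * l \<in> I \<longleftrightarrow> j = i" by metis
      have "indicator I (2 powi j * l) * w l = w l * indicator {i} j" for j :: int
        using i[of j] by (auto simp: indicator_def)
      then show ?case by (simp add: nn_integral_cmult)
    qed
  qed
  finally show ?thesis .
qed

lemma nn_integral_wavelet_index:
  assumes \<alpha>: "\<alpha> \<noteq> 0" and \<beta>: "\<beta> \<noteq> 0"
  shows "(\<integral>\<^sup>+i. \<phi> i \<partial>count_space (wavelet_index \<alpha> \<beta>)) =
    (\<Sum>\<^sup>+j. (\<Sum>\<^sup>+p. (\<Sum>\<^sup>+n. (\<Sum>\<^sup>+m. \<phi> (j, \<alpha> * of_int p, \<beta> * of_int n, of_int m)))))"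
proof -
  define \<iota> :: "int \<times> int \<times> int \<times> int \<Rightarrow> int \<times> heis" where "\<iota> = (\<lambda>(j, p, n, m). (j, \<alpha> * of_int p, \<beta> * of_int n, of_int m))"
  have "bij_betw \<iota> UNIV (wavelet_index \<alpha> \<beta>)"
  proof (rule bij_betwI')
    fix x y :: "int \<times> int \<times> int \<times> int"
    show "\<iota> x = \<iota> y \<longleftrightarrow> x = y" using \<alpha> \<beta> by (cases x; cases y) (auto simp: \<iota>_def)
    show "\<iota> x \<in> wavelet_index \<alpha> \<beta>" by (cases x) (auto simp: \<iota>_def wavelet_index_def)
  next
    fix y assume "y \<in> wavelet_index \<alpha> \<beta>"
    then obtain j p n m where "y = (j, \<alpha> * of_int p, \<beta> * of_int n, of_int m)"
      unfolding wavelet_index_def Ints_def by auto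
    then have "y = \<iota> (j, p, n, m)" by (simp add: \<iota>_def)
    then show "\<exists>x\<in>UNIV. y = \<iota> x" by blast
  qed
  then have "(\<integral>\<^sup>+i. \<phi> i \<partial>count_space (wavelet_index \<alpha> \<beta>)) = (\<Sum>\<^sup>+x. \<phi> (\<iota> x))"
    by (rule nn_integral_bij_count_space[symmetric])
  also have "\<dots> = (\<Sum>\<^sup>+j. (\<Sum>\<^sup>+y. \<phi> (\<iota> (j, y))))"
    by (rule nn_integral_fst_count_space[symmetric])
  also have "\<dots> = (\<Sum>\<^sup>+j. (\<Sum>\<^sup>+p. (\<Sum>\<^sup>+y. \<phi> (\<iota> (j, p, y)))))"
    by (intro nn_integral_cong nn_integral_fst_count_space[symmetric])
  also have "\<dots> = (\<Sum>\<^sup>+j. (\<Sum>\<^sup>+p. (\<Sum>\<^sup>+n. (\<Sum>\<^sup>+m. \<phi> (\<iota> (j, p, n, m))))))"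
    by (intro nn_integral_cong nn_integral_fst_count_space[symmetric])
  finally show ?thesis by (simp add: \<iota>_def)
qed

lemma window_L2:
  assumes K: "K \<in> sets borel" and bd: "\<And>l. l \<in> K \<Longrightarrow> \<bar>l\<bar> \<le> c" and \<alpha>: "\<alpha> > 0"
    and gm: "g \<in> borel_measurable lebesgue"
    and g: "AE z in lborel. g z = complex_of_real b * indicator K (fst z) * indicator {0..<\<alpha>} (snd z)"
  shows "g \<in> L2 measure_LamR"
proof -
  note [measurable] = K
  let ?w = "\<lambda>z. complex_of_real b * indicator K (fst z) * indicator {0..<\<alpha>} (snd z)"
  have "?w \<in> borel_measurable (borel \<Otimes>\<^sub>M borel)" by measurable
  then have wm: "?w \<in> borel_measurable lebesgue" by (simp add: borel_prod measurable_completion)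
  have "nsq measure_LamR g = nsq measure_LamR ?w"
    by (rule nsq_cong_AE) (simp add: AE_measure_LamR g)
  also have "\<dots> = (\<integral>\<^sup>+l. ennreal \<bar>l\<bar> * nsq lborel (\<lambda>t. ?w (l, t)) \<partial>lborel)"
    by (rule nsq_measure_LamR[OF measure_LamR_borel[OF wm]])
  also have "\<dots> \<le> (\<integral>\<^sup>+l. ennreal (c * (b\<^sup>2 * \<alpha>)) * indicator {-c..c} l \<partial>lborel)"
  proof (rule nn_integral_mono)
    fix l :: real
    show "ennreal \<bar>l\<bar> * nsq lborel (\<lambda>t. ?w (l, t)) \<le> ennreal (c * (b\<^sup>2 * \<alpha>)) * indicator {-c..c} l"
    proof (cases "l \<in> K")
      case False
      then show ?thesis by (simp add: nsq_def)
    next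
      case True
      have "nsq lborel (\<lambda>t. ?w (l, t)) = (\<integral>\<^sup>+t. ennreal (b\<^sup>2) * indicator {0..<\<alpha>} t \<partial>lborel)"
        unfolding nsq_def using True by (intro nn_integral_cong) (auto simp: indicator_def norm_mult)
      also have "\<dots> = ennreal (b\<^sup>2 * \<alpha>)" using \<alpha> by (simp add: nn_integral_cmult ennreal_mult)
      finally have "ennreal \<bar>l\<bar> * nsq lborel (\<lambda>t. ?w (l, t)) = ennreal (\<bar>l\<bar> * (b\<^sup>2 * \<alpha>))"
        using \<alpha> by (simp add: ennreal_mult)
      also have "\<dots> \<le> ennreal (c * (b\<^sup>2 * \<alpha>))"
        using bd[OF True] \<alpha> by (intro ennreal_leI mult_right_mono) auto
      finally show ?thesis using bd[OF True] by (auto simp: indicator_def abs_le_iff)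
    qed
  qed
  also have "\<dots> < \<infinity>" by (simp add: nn_integral_cmult ennreal_mult_less_top emeasure_lborel_Icc_eq)
  finally show ?thesis using measure_LamR_borel[OF gm] by (simp add: L2_iff_nsq)
qed

text \<open>At each scale the coefficients add up to the norm of \<open>f\<close> over one dyadic dilate of \<open>I\<close>, and these
  dilates tile the line.\<close>

theorem wavelet_system_hat_parseval_frame:
  assumes chi: "associated_multiplier e chi" and \<alpha>: "\<alpha> > 0" and \<beta>: "\<beta> > 0"
    and I: "I \<in> sets lebesgue" and sub: "subset_mod_null I {- 1 / (\<alpha> * \<beta>) .. 1 / (\<alpha> * \<beta>)}"
    and tr: "translation_congruent I J" and J: "J \<subseteq> {0..1}" and dil: "dilation_congruent I shannon_set"
    and g_def: "g = (\<lambda>z. complex_of_real (\<beta> powr (1/2)) * indicator (I \<times> {0..\<alpha>}) z)"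
  shows "parseval_frame measure_LamR (L2 measure_LamR) (wavelet_index \<alpha> \<beta>) (wavelet_system_hat chi g)"
proof -
  obtain B where B: "B \<in> sets borel" and IB: "AE x in lborel. x \<in> I \<longleftrightarrow> x \<in> B"
    by (rule lebesgue_set_borel_representative[OF I])
  note [measurable] = B
  \<comment> \<open>A Borel set equal to \<open>I\<close> up to a null set, on which the frequency bound holds everywhere.\<close>
  define K where "K = B \<inter> {l. l \<noteq> 0 \<and> \<bar>l\<bar> \<le> 1 / (\<alpha> * \<beta>)}"
  have K: "K \<in> sets borel" unfolding K_def by measurable
  have IK: "AE x in lborel. x \<in> I \<longleftrightarrow> x \<in> K"
    using AE_lborel_of_null_set[OF sub[unfolded subset_mod_null_def]] IB AE_neq_0
    by eventually_elim (auto simp: K_def)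
  have Kbd: "l \<noteq> 0 \<and> \<bar>l\<bar> \<le> 1 / (\<alpha> * \<beta>)" if "l \<in> K" for l using that by (simp add: K_def)
  have pack: "AE x in lborel. \<forall>m n::int. x + of_int m \<in> K \<longrightarrow> x + of_int n \<in> K \<longrightarrow> m = n"
    using translation_congruent_packing[OF tr J] AE_all_translates[OF IK] by eventually_elim blast
  have tile: "AE x in lborel. \<exists>!j::int. 2 powi j * x \<in> K"
    using dilation_congruent_tiling[OF dil] AE_all_dyadic_dilates[OF IK] by eventually_elim simp
  have chim: "chi a \<in> borel_measurable (lebesgue_on Lam)" and unimod: "\<And>l. l \<noteq> 0 \<Longrightarrow> cmod (chi a l) = 1" if "a > 0" for a
    using chi that unfolding associated_multiplier_def by (auto simp: Lam_def)
  have gAE: "AE z in lborel. g z = of_real (sqrt \<beta>) * indicator K (fst z) * indicator {0..<\<alpha>} (snd z)"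
  proof -
    have "AE z in (lborel :: (real \<times> real) measure). fst z \<in> I \<longleftrightarrow> fst z \<in> K" by (rule AE_lborel_fst[OF IK])
    moreover have "AE z in (lborel :: (real \<times> real) measure). snd z \<noteq> \<alpha>"
    proof -
      have "AE x in (lborel :: real measure). AE y in (lborel :: real measure). snd (x, y) \<noteq> \<alpha>"
        using AE_lborel_singleton[of \<alpha>] by simp
      then have "AE z in ((lborel :: real measure) \<Otimes>\<^sub>M (lborel :: real measure)). snd z \<noteq> \<alpha>"
        by (intro lborel_pair.AE_pair_measure) measurable
      then show ?thesis by (simp only: lborel_prod)
    qed
    ultimately show ?thesis
      by eventually_elim (use \<beta> in \<open>auto simp: g_def indicator_def powr_half_sqrt split: if_splits\<close>)
  qed
  have gm: "g \<in> borel_measurable lebesgue"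
  proof (rule lebesgue_measurableI_AE[OF _ gAE])
    have "(\<lambda>z. complex_of_real (sqrt \<beta>) * indicator K (fst z) * indicator {0..<\<alpha>} (snd z)) \<in> borel_measurable (borel \<Otimes>\<^sub>M borel)"
      using K by measurable
    then show "(\<lambda>z. complex_of_real (sqrt \<beta>) * indicator K (fst z) * indicator {0..<\<alpha>} (snd z)) \<in> borel_measurable borel"
      by (simp add: borel_prod)
  qed
  have gL2: "g \<in> L2 measure_LamR"
    by (rule window_L2[OF K _ \<alpha> gm gAE]) (use Kbd in blast)
  have uL2: "dilat_hat chi a (transl_hat x g) \<in> L2 measure_LamR" if a: "a > 0" for a x
  proof -
    have tm: "transl_hat x g \<in> borel_measurable lebesgue" by (rule transl_hat_measurable[OF gm])
    have "nsq measure_LamR (dilat_hat chi a (transl_hat x g)) = nsq measure_LamR g"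
      using nsq_dilat_hat[OF a tm, of chi, OF chim[OF a] unimod[OF a]] nsq_transl_hat[OF gm] by simp
    moreover have "dilat_hat chi a (transl_hat x g) \<in> borel_measurable measure_LamR"
      by (rule measure_LamR_borel[OF dilat_hat_measurable[OF a tm, of chi, OF chim[OF a]]])
    ultimately show ?thesis using gL2 by (simp add: L2_iff_nsq)
  qed
  show ?thesis
    unfolding parseval_frame_def
  proof (intro conjI ballI)
    fix i assume "i \<in> wavelet_index \<alpha> \<beta>"
    show "wavelet_system_hat chi g i \<in> L2 measure_LamR"
      by (cases i) (simp add: wavelet_system_hat_def uL2)
  next
    fix f assume f: "f \<in> L2 measure_LamR"
    obtain f' where f'0: "f' \<in> borel_measurable borel" and ff': "AE z in lborel. f z = f' z"
      using borel_representative[OF measure_LamR_lebesgue[OF L2_measurable[OF f]]] by blast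
    have f' [measurable]: "f' \<in> borel_measurable (borel \<Otimes>\<^sub>M borel)" using f'0 by (simp add: borel_prod)
    have nf: "nsq measure_LamR f = (\<integral>\<^sup>+l. ennreal \<bar>l\<bar> * nsq lborel (\<lambda>t. f' (l, t)) \<partial>lborel)"
    proof -
      have "nsq measure_LamR f = nsq measure_LamR f'" by (rule nsq_cong_AE) (simp add: AE_measure_LamR ff')
      also have "\<dots> = (\<integral>\<^sup>+l. ennreal \<bar>l\<bar> * nsq lborel (\<lambda>t. f' (l, t)) \<partial>lborel)"
        by (rule nsq_measure_LamR[OF measure_LamR_borel]) (use f'0 in \<open>simp add: measurable_completion\<close>)
      finally show ?thesis .
    qed
    have layer: "(\<Sum>\<^sup>+p. (\<Sum>\<^sup>+n. (\<Sum>\<^sup>+m. csq (L2_inner measure_LamR f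
          (dilat_hat chi (2 powi j) (transl_hat (\<alpha> * of_int p, \<beta> * of_int n, of_int m) g)))))) =
        (\<integral>\<^sup>+l. indicator K (2 powi j * l) * (ennreal \<bar>l\<bar> * nsq lborel (\<lambda>t. f' (l, t))) \<partial>lborel)" for j :: int
    proof -
      define a :: real where "a = 2 powi j"
      have a: "a > 0" by (simp add: a_def)
      obtain \<xi> where \<xi>: "\<xi> \<in> borel_measurable borel" "AE l in lborel. chi a l = \<xi> l"
        using borel_representative[OF measurable_lebesgue_on_Lam[OF chim[OF a]]] by blast
      have \<xi>1: "AE l in lborel. cmod (\<xi> l) = 1"
        using \<xi>(2) AE_neq_0 by eventually_elim (use unimod[OF a] in metis)
      have norm: "(\<integral>\<^sup>+l. indicator K l * (ennreal \<bar>l\<bar> * nsq lborel (\<lambda>t. dilated_slice \<xi> a f' (l, t))) \<partial>lborel) =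
          (\<integral>\<^sup>+l. indicator K (a * l) * (ennreal \<bar>l\<bar> * nsq lborel (\<lambda>t. f' (l, t))) \<partial>lborel)"
        by (rule dilated_slice_norm[OF a K \<xi>(1) \<xi>1 f'])
      have "\<dots> \<le> nsq measure_LamR f"
        unfolding nf by (intro nn_integral_mono) (auto simp: indicator_def)
      also have "\<dots> < \<infinity>" using f by (simp add: L2_iff_nsq)
      finally have fin: "(\<integral>\<^sup>+l. indicator K l * (ennreal \<bar>l\<bar> * nsq lborel (\<lambda>t. dilated_slice \<xi> a f' (l, t))) \<partial>lborel) < \<infinity>"
        unfolding norm .
      show ?thesis
        unfolding a_def[symmetric] wavelet_coefficient[OF a \<beta> K f uL2[OF a] f' ff' \<xi> gAE] norm[symmetric]
        by (rule gabor_coeff_parseval[OF \<alpha> \<beta> K Kbd pack dilated_slice_measurable[OF \<xi>(1) f'] fin])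
    qed
    have "(\<integral>\<^sup>+i. csq (L2_inner measure_LamR f (wavelet_system_hat chi g i)) \<partial>count_space (wavelet_index \<alpha> \<beta>)) =
      (\<Sum>\<^sup>+j. (\<integral>\<^sup>+l. indicator K (2 powi j * l) * (ennreal \<bar>l\<bar> * nsq lborel (\<lambda>t. f' (l, t))) \<partial>lborel))"
      using \<alpha> \<beta> by (subst nn_integral_wavelet_index) (simp_all add: wavelet_system_hat_def layer)
    also have "\<dots> = nsq measure_LamR f"
      unfolding nf by (rule dyadic_tiling_sum[OF K tile]) (auto simp: nsq_def)
    also have "\<dots> = ennreal ((L2_norm measure_LamR f)\<^sup>2)" by (rule nsq_eq_L2_norm[OF f])
    finally show "((\<lambda>i. (cmod (L2_inner measure_LamR f (wavelet_system_hat chi g i)))\<^sup>2) has_sum (L2_norm measure_LamR f)\<^sup>2) (wavelet_index \<alpha> \<beta>)"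
      by (subst nn_integral_count_space_has_sum) auto
  qed
qed

section \<open>Transfer to the invariant subspace\<close>

text \<open>The isometry \<open>V\<close> preserves inner products and sends each element of the wavelet system of \<open>\<psi>\<close> to the
  corresponding element of the system of \<open>g\<close>, so the frame identity for \<open>V \<phi>\<close> is the one for \<open>\<phi>\<close>.\<close>

theorem corollary3p10:
  fixes H :: "(heis \<Rightarrow> complex) set"
    and e :: "real \<Rightarrow> real \<Rightarrow> complex"
    and V :: "(heis \<Rightarrow> complex) \<Rightarrow> (real \<times> real \<Rightarrow> complex)"
    and chi :: "real \<Rightarrow> real \<Rightarrow> complex"
    and \<alpha> \<beta> :: real
    and I :: "real set"
    and g :: "real \<times> real \<Rightarrow> complex"
    and \<psi> :: "heis \<Rightarrow> complex"
  assumes "invariant_multiplicity_one H"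
    and "spanning_unit_field H e"
    and "reducing_isomorphism H e V"
    and "associated_multiplier e chi"
    and "\<alpha> > 0" and "\<beta> > 0"
    and "I \<in> sets lebesgue" and "I \<subseteq> Lam"
    and "subset_mod_null I {- 1 / (\<alpha> * \<beta>) .. 1 / (\<alpha> * \<beta>)}"
    and "\<exists>J\<in>sets lebesgue. J \<subseteq> {0..1} \<and> translation_congruent I J"
    and "dilation_congruent I shannon_set"
    and "g = (\<lambda>z. complex_of_real (\<beta> powr (1/2)) * indicator (I \<times> {0..\<alpha>}) z)"
    and "\<psi> \<in> H" and "AE z in measure_LamR. V \<psi> z = g z"
  shows "parseval_frame lebesgue H (wavelet_index \<alpha> \<beta>) (wavelet_system \<psi>) \<and>
         parseval_frame measure_LamR (L2 measure_LamR) (wavelet_index \<alpha> \<beta>) (wavelet_system_hat chi g)"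
proof
  note e = assms(2) and V = assms(3) and chi = assms(4)
  obtain J where J: "J \<subseteq> {0..1}" "translation_congruent I J" using assms(10) by blast
  show hat: "parseval_frame measure_LamR (L2 measure_LamR) (wavelet_index \<alpha> \<beta>) (wavelet_system_hat chi g)"
    by (rule wavelet_system_hat_parseval_frame[OF chi assms(5-7,9) J(2,1) assms(11,12)])
  have clos: "closed_L2_subspace lebesgue H"
    and transl_H: "\<And>x \<phi>. \<phi> \<in> H \<Longrightarrow> transl x \<phi> \<in> H"
    and dilat_H: "\<And>a \<phi>. a > 0 \<Longrightarrow> \<phi> \<in> H \<Longrightarrow> dilat a \<phi> \<in> H"
    using assms(1) unfolding invariant_multiplicity_one_def multiplicity_one_def translation_invariant_subspace_def by auto
  have H_L2: "\<And>\<phi>. \<phi> \<in> H \<Longrightarrow> \<phi> \<in> L2 lebesgue"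
    and H_add: "\<And>\<phi> \<eta> c. \<phi> \<in> H \<Longrightarrow> \<eta> \<in> H \<Longrightarrow> (\<lambda>x. \<phi> x + c * \<eta> x) \<in> H"
    using clos unfolding closed_L2_subspace_def by auto
  have VL2: "V \<eta> \<in> L2 measure_LamR" if "\<eta> \<in> H" for \<eta> by (rule reducing_isomorphism_L2[OF V that])
  have norm_V: "L2_norm measure_LamR (V \<eta>) = L2_norm lebesgue \<eta>" if "\<eta> \<in> H" for \<eta>
    using reducing_isomorphism_isometry[OF e V that] VL2[OF that] H_L2[OF that]
    by (simp add: nsq_eq_L2_norm)
  have inner_V: "L2_inner lebesgue \<phi> \<eta> = L2_inner measure_LamR (V \<phi>) (V \<eta>)" if "\<phi> \<in> H" "\<eta> \<in> H" for \<phi> \<eta>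
  proof (rule L2_polarization)
    fix c
    have "L2_norm lebesgue (\<lambda>x. \<phi> x + c * \<eta> x) = L2_norm measure_LamR (V (\<lambda>x. \<phi> x + c * \<eta> x))"
      by (rule norm_V[symmetric]) (rule H_add[OF that])
    also have "\<dots> = L2_norm measure_LamR (\<lambda>z. V \<phi> z + c * V \<eta> z)"
      by (rule L2_norm_cong_AE[OF L2_measurable[OF VL2[OF H_add[OF that]]] L2_measurable[OF L2_add[OF VL2[OF that(1)] L2_scale[OF VL2[OF that(2)]]]]
          reducing_isomorphism_add_scale[OF e V that H_add[OF that]]])
    finally show "L2_norm lebesgue (\<lambda>x. \<phi> x + c * \<eta> x) = L2_norm measure_LamR (\<lambda>z. V \<phi> z + c * V \<eta> z)" .
  qed (use that norm_V VL2 H_L2 in auto)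
  have wav_H: "wavelet_system \<psi> i \<in> H" for i
    by (cases i) (simp add: wavelet_system_def transl_H dilat_H assms(13))
  have wav_V: "AE z in measure_LamR. V (wavelet_system \<psi> i) z = wavelet_system_hat chi g i z" for i
  proof -
    obtain j x where i: "i = (j, x)" by (cases i)
    have a: "(2::real) powi j > 0" by simp
    have t\<psi>: "transl x \<psi> \<in> H" by (rule transl_H[OF assms(13)])
    have "AE z in lborel. V (transl x \<psi>) z = transl_hat x (V \<psi>) z"
      using reducing_isomorphism_transl[OF e V assms(13) t\<psi>] by (simp add: AE_measure_LamR)
    moreover have "AE z in lborel. transl_hat x (V \<psi>) z = transl_hat x g z"
      using assms(14) by (intro transl_hat_cong_AE) (simp add: AE_measure_LamR)
    ultimately have "AE z in lborel. V (transl x \<psi>) z = transl_hat x g z" by eventually_elim simp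
    from dilat_hat_cong_AE[OF a this, of chi]
    have "AE z in lborel. dilat_hat chi (2 powi j) (V (transl x \<psi>)) z = dilat_hat chi (2 powi j) (transl_hat x g) z" .
    moreover have "AE z in lborel. V (dilat (2 powi j) (transl x \<psi>)) z = dilat_hat chi (2 powi j) (V (transl x \<psi>)) z"
      using reducing_isomorphism_dilat[OF e V chi t\<psi> dilat_H[OF a t\<psi>] a] by (simp add: AE_measure_LamR)
    ultimately have "AE z in lborel. V (dilat (2 powi j) (transl x \<psi>)) z = dilat_hat chi (2 powi j) (transl_hat x g) z"
      by eventually_elim simp
    then show ?thesis by (simp add: i wavelet_system_def wavelet_system_hat_def AE_measure_LamR)
  qed
  show "parseval_frame lebesgue H (wavelet_index \<alpha> \<beta>) (wavelet_system \<psi>)"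
    unfolding parseval_frame_def
  proof (intro conjI ballI)
    fix \<phi> assume \<phi>: "\<phi> \<in> H"
    have "((\<lambda>i. (cmod (L2_inner measure_LamR (V \<phi>) (wavelet_system_hat chi g i)))\<^sup>2) has_sum (L2_norm measure_LamR (V \<phi>))\<^sup>2) (wavelet_index \<alpha> \<beta>)"
      using hat VL2[OF \<phi>] unfolding parseval_frame_def by blast
    moreover have "L2_inner lebesgue \<phi> (wavelet_system \<psi> i) = L2_inner measure_LamR (V \<phi>) (wavelet_system_hat chi g i)"
      if i: "i \<in> wavelet_index \<alpha> \<beta>" for i
    proof -
      have "wavelet_system_hat chi g i \<in> L2 measure_LamR" using hat i unfolding parseval_frame_def by blast
      then show ?thesis
        unfolding inner_V[OF \<phi> wav_H]
        by (intro L2_inner_cong_AE wav_V L2_measurable VL2 \<phi> wav_H) auto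
    qed
    ultimately show "((\<lambda>i. (cmod (L2_inner lebesgue \<phi> (wavelet_system \<psi> i)))\<^sup>2) has_sum (L2_norm lebesgue \<phi>)\<^sup>2) (wavelet_index \<alpha> \<beta>)"
      unfolding norm_V[OF \<phi>] by (simp cong: has_sum_cong)
  qed (rule wav_H)
qed

end
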